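(* Assume that the infinite moving average process $X_n=\sum_{i=-\infty}^\infty a_iZ_{n-i}$, $n\in\mathbb{Z}$ (with the noise $(Z_n)$ and its law $F_Z$ as specified in the context) has short memory, that is, $\sum_{n=-\infty}^\infty|a_n|<\infty$ and $\sum_{n=-\infty}^\infty a_n\neq 0$, and that $A=\sum_{n=-\infty}^\infty a_n>0$. Assume, further, that $\left|\int_{\mathbb{R}}e^{\mathrm{i}tz}\,F_Z(dz)\right|<1$ for every real $t\neq0$, where $\mathrm{i}=\sqrt{-1}$. Let $\varepsilon$ satisfy $0<\varepsilon/A<s_0$. Then, with $E_j(n,\varepsilon)$, $T^*$, $(U_i^-)$, $(U_i^+)$ and $(V_j(\varepsilon))$ as defined in the context, the following hold as $n\to\infty$. (1) The conditional laws $$P\left(\left(\sum_{i=j}^{j+n-1}X_i-n\varepsilon,\ j\in\mathbb{Z}\right)\in\cdot\ \Big|\ E_0(n,\varepsilon)\right)$$ converge weakly in $\mathbb{R}^\infty$ (sequences indexed by $j\in\mathbb{Z}$, with the topology of finite-dimensional convergence) to the law of the sequence whose $j$-th entry is $$T^*+\sum_{i=j}^{-1}U_i^--\sum_{i=j}^{-1}U_i^+\quad\text{for } j=\ldots,-2,-1,$$ $$T^*-\sum_{i=0}^{j-1}U_i^-+\sum_{i=0}^{j-1}U_i^+\quad\text{for } j=0,1,2,\ldots.$$ (2) In particular, $$P\Bigl(\bigl(\mathbf{1}(E_j(n,\varepsilon)),\ j\in\mathbb{Z}\bigr)\in\cdot\ \Big|\ E_0(n,\varepsilon)\Bigr)\Rightarrow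 P\Bigl(\bigl(V_j(\varepsilon),\ j\in\mathbb{Z}\bigr)\in\cdot\Bigr)$$ weakly in $\{0,1\}^\infty$ (sequences indexed by $\mathbb{Z}$, with the topology of finite-dimensional convergence). (3) Furthermore, for every fixed integers $K_-,K_+\ge1$, $$P\left[\left(\sum_{j=-K_-}^{-1}\mathbf{1}(E_j(n,\varepsilon)),\ \sum_{j=1}^{K_+}\mathbf{1}(E_j(n,\varepsilon))\right)\in\cdot\ \Big|\ E_0(n,\varepsilon)\right]\Rightarrow P\left[\left(\sum_{j=-K_-}^{-1}V_j(\varepsilon),\ \sum_{j=1}^{K_+}V_j(\varepsilon)\right)\in\cdot\right].$$
   Context: Setting. $(Z_n:n\in\mathbb{Z})$ are i.i.d. non-degenerate real random variables with law $F_Z$ satisfying $\int_{\mathbb{R}}e^{tz}F_Z(dz)<\infty$ for all $t\in\mathbb{R}$ and $\int_{\mathbb{R}}z\,F_Z(dz)=0$. The coefficients $(a_j)_{j\in\mathbb{Z}}$ are real with $\sum_j a_j^2<\infty$, and $X_n=\sum_{i=-\infty}^\infty a_iZ_{n-i}$, $n\in\mathbb{Z}$ (convergence in $L^2$ and a.s.). For $j\in\mathbb{Z}$, $n\ge1$, $\varepsilon>0$, $$E_j(n,\varepsilon)=\left\{\frac1n\sum_{i=j}^{n+j-1}X_i\ge\varepsilon\right\}.$$ Notation. $A=\sum_{n=-\infty}^\infty a_n$, $A^-=\sum_{n=-\infty}^{-1}a_n$, $A^+=\sum_{n=0}^\infty a_n$; for $n=0,1,2,\ldots$, $A_n^-=\sum_{j=1}^na_{-j}$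 (so $A_0^-=0$) and $A_n^+=\sum_{j=0}^na_j$. $\varphi_Z(t)=\log\int_{\mathbb{R}}e^{tz}F_Z(dz)$. For $\theta\in\mathbb{R}$, $G_\theta$ is the probability measure $G_\theta(dx)=e^{-\varphi_Z(\theta)+\theta x}F_Z(dx)$. $s_0=\sup\{x\in\mathbb{R}:F_Z(x)<1\}\in(0,\infty]$, where $F_Z(x)$ denotes the distribution function, is the right endpoint of the support of the noise. For $0<\varepsilon/A<s_0$, $\tau(\varepsilon)>0$ is the unique solution of $\varphi_Z'(\tau(\varepsilon))=\varepsilon/A$ ($\varphi_Z'$ increases strictly from $0$ at $t=0$ to $s_0$ as $t\to\infty$). Limiting objects. $\{Z_j^u:j\in\mathbb{Z},\,u\in\{+,-\}\}$ is a collection of independent random variables with laws $$Z^-_{-j}\sim G_{\tau(\varepsilon)(A^+-A^+_{j-1})/A}\ (j\ge1),\qquad Z^-_j\sim G_{\tau(\varepsilon)(A^++A^-_j)/A}\ (j\ge0),$$ $$Z^+_{-j}\sim G_{\tau(\varepsilon)(A^+_{j-1}+A^-)/A}\ (j\ge1),\qquad Z^+_j\sim G_{\tau(\varepsilon)(A^--A^-_j)/A}\ (j\ge0).$$ $T^*$ is an exponential random variable with parameter (rate) $\tau(\varepsilon)/A$, independent of this family. $U^\pm_n=\sum_{i=-\infty}^\infty a_iZ^\pm_{n-i}$, $n\in\mathbb{Z}$ (the series converge in $L^1$ and a.s.). Finally $$V_j(\varepsilon)=\mathbf{1}\Bigl(T^*\ge\sum_{i=0}^{j-1}(U_i^--U_i^+)\Bigr)\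 (j\ge1),\qquad V_j(\varepsilon)=\mathbf{1}\Bigl(T^*\ge\sum_{i=j}^{-1}(U_i^+-U_i^-)\Bigr)\ (j<0),$$ and $V_0(\varepsilon)=1$. Empty sums are zero. *)

theory Defs
  imports "HOL-Probability.Probability"
begin

text \<open>
  The library's \<^const>\<open>weak_conv_m\<close> is restricted to measures on the real line. Below, function types
  \<open>int \<Rightarrow> _\<close> carry the product topology (the topology of finite-dimensional convergence),
  and \<open>bool\<close> and \<open>nat\<close> are discrete.
\<close>

definition weak_conv_measure :: "(nat \<Rightarrow> 'a::topological_space measure) \<Rightarrow> 'a measure \<Rightarrow> bool" where
  "weak_conv_measure \<mu> \<nu> \<longleftrightarrow>
     (\<forall>f :: 'a \<Rightarrow> real. continuous_on UNIV f \<longrightarrow> bounded (range f) \<longrightarrow>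
        (\<lambda>n. \<integral>x. f x \<partial>\<mu> n) \<longlonglongrightarrow> (\<integral>x. f x \<partial>\<nu>))"

text \<open>If \<open>E\<close> is null, this is the zero measure rather than a probability measure.\<close>

definition cond_law :: "'w measure \<Rightarrow> 'w set \<Rightarrow> ('w \<Rightarrow> 'a::topological_space) \<Rightarrow> 'a measure" where
  "cond_law M E Y = distr (uniform_measure M E) borel Y"

definition log_mgf :: "real measure \<Rightarrow> real \<Rightarrow> real" where
  "log_mgf F t = ln (\<integral>z. exp (t * z) \<partial>F)"

definition tilted_law :: "real measure \<Rightarrow> real \<Rightarrow> real measure" where
  "tilted_law F \<theta> = density F (\<lambda>x. ennreal (exp (- log_mgf F \<theta> + \<theta> * x)))"

definition right_endpoint :: "real measure \<Rightarrow> ereal" where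
  "right_endpoint F = Sup (ereal ` {x. cdf F x < 1})"

text \<open>
  For a centred non-degenerate law \<open>F\<close> with finite exponential moments, the derivative of
  \<open>log_mgf F\<close> increases strictly from \<open>0\<close> to \<open>right_endpoint F\<close> on the positive half-line, so the
  description is proper whenever \<open>0 < x < right_endpoint F\<close>.
\<close>

definition tilt_param :: "real measure \<Rightarrow> real \<Rightarrow> real" where
  "tilt_param F x = (THE t. t > 0 \<and> (log_mgf F has_real_derivative x) (at t))"

definition coef_sum :: "(int \<Rightarrow> real) \<Rightarrow> real" where
  "coef_sum a = (\<Sum>\<^sub>\<infinity>n. a n)"

definition coef_sum_neg :: "(int \<Rightarrow> real) \<Rightarrow> real" where
  "coef_sum_neg a = (\<Sum>\<^sub>\<infinity>n\<in>{..-1}. a n)"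

definition coef_sum_nonneg :: "(int \<Rightarrow> real) \<Rightarrow> real" where
  "coef_sum_nonneg a = (\<Sum>\<^sub>\<infinity>n\<in>{0..}. a n)"

definition coef_partial_neg :: "(int \<Rightarrow> real) \<Rightarrow> nat \<Rightarrow> real" where
  "coef_partial_neg a n = (\<Sum>j=1..n. a (- int j))"

definition coef_partial_nonneg :: "(int \<Rightarrow> real) \<Rightarrow> nat \<Rightarrow> real" where
  "coef_partial_nonneg a n = (\<Sum>j=0..n. a (int j))"

definition short_memory :: "(int \<Rightarrow> real) \<Rightarrow> bool" where
  "short_memory a \<longleftrightarrow> (\<lambda>n. \<bar>a n\<bar>) summable_on UNIV \<and> coef_sum a \<noteq> 0"

text \<open>
  The summation is unconditional. With absolutely summable coefficients and a noise whose first
  absolute moments are bounded, the series converges absolutely almost surely, so that it agrees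
  almost surely with the limit of the two-sided partial sums.
\<close>

definition moving_average :: "(int \<Rightarrow> real) \<Rightarrow> (int \<Rightarrow> 'w \<Rightarrow> real) \<Rightarrow> int \<Rightarrow> 'w \<Rightarrow> real" where
  "moving_average a Z n \<omega> = (\<Sum>\<^sub>\<infinity>i. a i * Z (n - i) \<omega>)"

definition window_event ::
    "'w measure \<Rightarrow> (int \<Rightarrow> 'w \<Rightarrow> real) \<Rightarrow> nat \<Rightarrow> real \<Rightarrow> int \<Rightarrow> 'w set" where
  "window_event M X n \<epsilon> j =
     {\<omega> \<in> space M. (1 / real n) * (\<Sum>i=j..int n + j - 1. X i \<omega>) \<ge> \<epsilon>}"

text \<open>The superscripts \<open>-\<close> and \<open>+\<close> of the two limiting noise families.\<close>

datatype side = Minus | Plus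

definition limit_seq ::
    "('w \<Rightarrow> real) \<Rightarrow> (side \<Rightarrow> int \<Rightarrow> 'w \<Rightarrow> real) \<Rightarrow> 'w \<Rightarrow> int \<Rightarrow> real" where
  "limit_seq T U \<omega> j =
     (if j < 0
      then T \<omega> + (\<Sum>i=j..-1. U Minus i \<omega>) - (\<Sum>i=j..-1. U Plus i \<omega>)
      else T \<omega> - (\<Sum>i=0..j-1. U Minus i \<omega>) + (\<Sum>i=0..j-1. U Plus i \<omega>))"

definition limit_indicator ::
    "('w \<Rightarrow> real) \<Rightarrow> (side \<Rightarrow> int \<Rightarrow> 'w \<Rightarrow> real) \<Rightarrow> 'w \<Rightarrow> int \<Rightarrow> bool" where
  "limit_indicator T U \<omega> j \<longleftrightarrow>
     (if j \<ge> 1 then T \<omega> \<ge> (\<Sum>i=0..j-1. U Minus i \<omega> - U Plus i \<omega>)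
      else if j < 0 then T \<omega> \<ge> (\<Sum>i=j..-1. U Plus i \<omega> - U Minus i \<omega>)
      else True)"

end

theory Submission
  imports Defs "HOL-Probability.Probability"
begin

text \<open>
  Conditioning on \<open>E_0(n, \<epsilon>)\<close> is analysed after an exponential change of measure: the noise variable
  \<open>Z k\<close> is tilted by \<open>s_n * b_n k\<close>, where \<open>b_n k\<close> is its coefficient in \<open>S_n = X_0 + \<dots> + X_(n-1)\<close> and
  \<open>s_n\<close> is chosen such that \<open>S_n\<close> gets mean \<open>n * \<epsilon>\<close>; then \<open>s_n\<close> tends to \<open>\<theta> = \<tau> / A\<close>. The conditional
  expectation of \<open>f\<close> becomes the quotient of the tilted expectations of \<open>f * h\<close> and \<open>h\<close>, where
  \<open>h = exp (- s_n * (S_n - n * \<epsilon>))\<close> on \<open>S_n \<ge> n * \<epsilon>\<close> and \<open>h = 0\<close> elsewhere. Multiplied by \<open>sqrt n\<close>, these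
  converge by a local limit theorem for \<open>S_n\<close>, which holds jointly with the noise in finite blocks
  around \<open>0\<close> and \<open>n\<close>: in the limit the blocks are independent of the overshoot \<open>S_n - n * \<epsilon>\<close>, whose
  Lebesgue measure is weighted by \<open>exp (- \<theta> * y)\<close> and thus turned into the exponential law of \<open>T\<close>.
  The blocks have the tilts \<open>\<theta> * lim b_n k\<close> and \<open>\<theta> * lim b_n (n + k)\<close>, which are those of \<open>W Minus\<close> and
  \<open>W Plus\<close>; shifting the window by \<open>j\<close> only exchanges summands near its two ends. The noise outside the
  blocks is negligible in \<open>L^1\<close>, uniformly in \<open>n\<close>, so Lipschitz functions of finitely many coordinates
  suffice. The indicators are almost surely continuous functions of the limit because
  \<open>T\<close> has a density and is independent of the drift.
\<close>

section \<open>Weak convergence on sequence spaces\<close>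

text \<open>Under the tilted measure the conditioning event still costs a factor of order
  \<open>1 / sqrt n\<close>, so an error that is merely small in L^1 is not good enough: it must
  stay small after multiplication by \<open>sqrt n\<close>. Errors are therefore bounded under the
  weight \<open>sqrt n * kernel (S_n - n * \<epsilon>)\<close>. Removing one noise variable
  \<open>Z k\<close> from \<open>S_n\<close> leaves a sum whose kernel integral is
  \<open>O(1 / sqrt n)\<close> uniformly over translations; integrating over \<open>Z k\<close>
  afterwards bounds the weighted first moments uniformly in \<open>k\<close> and in large
  \<open>n\<close>, and absolute summability of the coefficients does the rest.

  The noise only has \<open>|char| < 1\<close> off the origin, with no bound near infinity. The
  local limit theorem is therefore proved first against a function with compactly supported Fourier
  transform, for which only bounded intervals of the characteristic function matter. Since this
  function is positive, the laws can be reweighted by it into probability measures, and Levy's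
  continuity theorem extends the limit to almost everywhere continuous functions that it
  dominates.\<close>

definition window_dist :: "nat \<Rightarrow> (int \<Rightarrow> real) \<Rightarrow> (int \<Rightarrow> real) \<Rightarrow> real" where
  "window_dist m x y = real m * (\<Sum>j\<in>{-int m..int m}. \<bar>x j - y j\<bar>)"

text \<open>The Pasch-Hausdorff envelope: for bounded \<open>f\<close>, the largest minorant that is
  1-Lipschitz for \<open>window_dist m\<close>. The single index \<open>m\<close> raises the
  Lipschitz constant and widens the window of coordinates at the same time.\<close>

definition lower_env :: "((int \<Rightarrow> real) \<Rightarrow> real) \<Rightarrow> nat \<Rightarrow> (int \<Rightarrow> real) \<Rightarrow> real" where
  "lower_env f m x = (INF y. f y + window_dist m x y)"

lemma window_dist_nonneg: "0 \<le> window_dist m x y"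
  by (auto simp: window_dist_def intro!: mult_nonneg_nonneg sum_nonneg)

lemma window_dist_refl: "window_dist m x x = 0"
  by (simp add: window_dist_def)

lemma window_dist_commute: "window_dist m x y = window_dist m y x"
  by (simp add: window_dist_def abs_minus_commute)

lemma window_dist_triangle: "window_dist m x z \<le> window_dist m x y + window_dist m y z"
  unfolding window_dist_def distrib_left[symmetric] sum.distrib[symmetric]
  by (intro mult_left_mono sum_mono) auto

text \<open>Only finitely many coordinates enter \<open>window_dist\<close>, so it is continuous in
  the product topology, and a function whose increments it dominates is continuous there
  too.\<close>

lemma borel_measurable_window_lipschitz:
  fixes g :: "(int \<Rightarrow> real) \<Rightarrow> real"
  assumes g: "\<And>x y. \<bar>g x - g y\<bar> \<le> window_dist m x y"
  shows "g \<in> borel_measurable borel"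
proof (rule borel_measurable_continuous_onI, rule continuous_at_imp_continuous_on, rule ballI)
  fix x :: "int \<Rightarrow> real"
  have c: "continuous_on UNIV (\<lambda>y. window_dist m x y)"
    unfolding window_dist_def by (intro continuous_intros continuous_on_product_coordinates)
  then have "((\<lambda>y. window_dist m x y) \<longlongrightarrow> window_dist m x x) (at x)"
    by (auto simp: continuous_on_def)
  then have "((\<lambda>y. window_dist m x y) \<longlongrightarrow> 0) (at x)"
    by (simp add: window_dist_refl)
  then have "((\<lambda>y. g y - g x) \<longlongrightarrow> 0) (at x)"
    by (rule Lim_null_comparison[rotated]) (metis (mono_tags, lifting) always_eventually g real_norm_def window_dist_commute)
  then show "isCont g x"
    by (simp add: isCont_def LIM_zero_iff)
qed

context
  fixes f :: "(int \<Rightarrow> real) \<Rightarrow> real" and C :: real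
  assumes bound: "\<And>x. \<bar>f x\<bar> \<le> C"
begin

lemma lower_env_bdd: "bdd_below (range (\<lambda>y. f y + window_dist m x y))"
proof (rule bdd_belowI2)
  show "- C \<le> f y + window_dist m x y" for y
    using bound[of y] window_dist_nonneg[of m x y] by (auto simp: abs_le_iff)
qed

lemma lower_env_le: "lower_env f m x \<le> f y + window_dist m x y"
  unfolding lower_env_def by (rule cINF_lower[OF lower_env_bdd]) simp

lemma lower_env_ge: "(\<And>y. c \<le> f y + window_dist m x y) \<Longrightarrow> c \<le> lower_env f m x"
  unfolding lower_env_def by (rule cINF_greatest) auto

lemma lower_env_le_self: "lower_env f m x \<le> f x"
  using lower_env_le[of m x x] by (simp add: window_dist_refl)

lemma lower_env_abs_le: "\<bar>lower_env f m x\<bar> \<le> C"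
proof -
  have "- C \<le> lower_env f m x"
    by (rule lower_env_ge) (use bound window_dist_nonneg[of m x] in \<open>auto simp: abs_le_iff intro: add_increasing2 minus_le_iff[THEN iffD1]\<close>)
  moreover have "lower_env f m x \<le> C"
    using lower_env_le_self[of m x] bound[of x] by (auto simp: abs_le_iff)
  ultimately show ?thesis by auto
qed

lemma lower_env_lipschitz: "\<bar>lower_env f m x - lower_env f m y\<bar> \<le> window_dist m x y"
proof -
  have *: "lower_env f m x - window_dist m x y \<le> lower_env f m y" for x y
  proof (rule lower_env_ge)
    fix z
    show "lower_env f m x - window_dist m x y \<le> f z + window_dist m y z"
      using lower_env_le[of m x z] window_dist_triangle[of m x z y] by linarith
  qed
  show ?thesis
    using *[of x y] *[of y x] by (simp add: window_dist_commute abs_le_iff)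
qed

text \<open>A basic neighbourhood of \<open>x\<close> restricts finitely many coordinates. Inside it
  \<open>f\<close> is almost \<open>f x\<close>; outside it the penalty
  \<open>window_dist m x y\<close> eventually exceeds the oscillation of \<open>f\<close>. So no
  \<open>y\<close> can push the infimum much below \<open>f x\<close>.\<close>

lemma lower_env_tendsto:
  assumes cont: "isCont f x"
  shows "(\<lambda>m. lower_env f m x) \<longlonglongrightarrow> f x"
proof (rule LIMSEQ_I)
  fix r :: real assume r: "0 < r"
  have C0: "C \<ge> 0" using bound[of undefined] by linarith
  have "eventually (\<lambda>y. dist (f y) (f x) < r/2) (nhds x)"
    using cont r unfolding isCont_def tendsto_iff eventually_at_filter
    by (auto simp: eventually_at_filter elim!: allE[of _ "r/2"] eventually_mono)
  then obtain S where S: "open S" "x \<in> S" "\<And>y. y \<in> S \<Longrightarrow> \<bar>f y - f x\<bar> < r/2"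
    unfolding eventually_nhds dist_real_def by auto
  obtain X where X: "x \<in> (\<Pi>\<^sub>E i\<in>UNIV. X i)" "\<And>i. open (X i)" "finite {i. X i \<noteq> UNIV}"
      "(\<Pi>\<^sub>E i\<in>UNIV. X i) \<subseteq> S"
    using product_topology_open_contains_basis[of "\<lambda>_. euclidean" UNIV S x] S
    by (auto simp: open_fun_def)
  define J where "J = {i. X i \<noteq> UNIV}"
  have J: "finite J" using X(3) by (simp add: J_def)
  have "\<exists>d>0. ball (x i) d \<subseteq> X i" for i
    using X(1) X(2)[of i] by (auto simp: open_contains_ball PiE_def Pi_def)
  then obtain d where d: "\<And>i. d i > 0" "\<And>i. ball (x i) (d i) \<subseteq> X i" by metis
  define \<delta> where "\<delta> = Min (insert 1 (d ` J))"
  have \<delta>: "\<delta> > 0" "\<And>i. i \<in> J \<Longrightarrow> \<delta> \<le> d i"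
    using J d(1) by (auto simp: \<delta>_def)
  \<comment> \<open>From \<open>N\<close> on, the window contains \<open>J\<close>, and leaving the
    box of radius \<open>\<delta>\<close> in a coordinate of \<open>J\<close> costs at least
    \<open>2 * C\<close>, a bound for the oscillation of \<open>f\<close>.\<close>
  define N where "N = max (nat (Max (insert 0 (abs ` J)))) (nat \<lceil>2 * C / \<delta>\<rceil>)"
  have NJ: "i \<in> {-int m..int m}" if "i \<in> J" "m \<ge> N" for i m
  proof -
    have "\<bar>i\<bar> \<le> Max (insert 0 (abs ` J))" using J that by auto
    also have "\<dots> \<le> int m" using that(2) by (auto simp: N_def)
    finally show ?thesis by auto
  qed
  have NC: "real m * \<delta> \<ge> 2 * C" if "m \<ge> N" for m
  proof -
    have "2 * C / \<delta> \<le> real (nat \<lceil>2 * C / \<delta>\<rceil>)" by linarith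
    also have "\<dots> \<le> real m" using that by (auto simp: N_def)
    finally show ?thesis using \<delta> by (simp add: field_simps)
  qed
  have low: "f x - r/2 \<le> lower_env f m x" if m: "m \<ge> N" for m
  proof (rule lower_env_ge)
    fix y
    show "f x - r/2 \<le> f y + window_dist m x y"
    proof (cases "\<forall>i\<in>J. \<bar>x i - y i\<bar> < \<delta>")
      case True
      have "y i \<in> X i" for i
      proof (cases "i \<in> J")
        case True
        then have "y i \<in> ball (x i) (d i)"
          using \<open>\<forall>i\<in>J. \<bar>x i - y i\<bar> < \<delta>\<close> \<delta>(2)[of i] by (force simp: dist_real_def)
        then show ?thesis using d(2)[of i] by blast
      qed (auto simp: J_def)
      then have "y \<in> S" using X(4) by auto
      from S(3)[OF this] show ?thesis using window_dist_nonneg[of m x y] by linarith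
    next
      case False
      then obtain i where i: "i \<in> J" "\<bar>x i - y i\<bar> \<ge> \<delta>" by force
      have "\<bar>x i - y i\<bar> \<le> (\<Sum>j\<in>{-int m..int m}. \<bar>x j - y j\<bar>)"
        by (rule member_le_sum) (use NJ[OF i(1) m] in auto)
      then have "real m * \<delta> \<le> window_dist m x y"
        unfolding window_dist_def using i(2) by (intro mult_left_mono) auto
      then show ?thesis
        using NC[OF m] bound[of x] bound[of y] r by linarith
    qed
  qed
  have "norm (lower_env f m x - f x) < r" if "m \<ge> N" for m
    unfolding real_norm_def using low[OF that] lower_env_le_self[of m x] r by linarith
  then show "\<exists>no. \<forall>m\<ge>no. norm (lower_env f m x - f x) < r"
    by blast
qed

end

text \<open>A portmanteau theorem. The lower envelopes increase the integral up to that of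
  \<open>f\<close> because \<open>f\<close> is continuous almost everywhere under
  \<open>\<nu>\<close>; this bounds the limit inferior, and the same bound for \<open>- f\<close>
  gives the limit superior. Finiteness is asked of \<open>\<mu> n\<close> only eventually, as
  conditional laws are known to be probability measures only for large \<open>n\<close>.\<close>

lemma integral_tendsto_if_window_lipschitz:
  fixes \<mu> :: "nat \<Rightarrow> (int \<Rightarrow> real) measure" and f :: "(int \<Rightarrow> real) \<Rightarrow> real"
  assumes \<mu>: "\<forall>\<^sub>F n in sequentially. finite_measure (\<mu> n)" "\<And>n. sets (\<mu> n) = sets borel"
    and \<nu>: "prob_space \<nu>" "sets \<nu> = sets borel"
    and lip: "\<And>g m C. (\<And>x. \<bar>g x\<bar> \<le> C) \<Longrightarrow> (\<And>x y. \<bar>g x - g y\<bar> \<le> window_dist m x y) \<Longrightarrow>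
        (\<lambda>n. \<integral>x. g x \<partial>\<mu> n) \<longlonglongrightarrow> (\<integral>x. g x \<partial>\<nu>)"
    and f: "f \<in> borel_measurable borel" "\<And>x. \<bar>f x\<bar> \<le> C"
    and cont: "AE x in \<nu>. isCont f x"
  shows "(\<lambda>n. \<integral>x. f x \<partial>\<mu> n) \<longlonglongrightarrow> (\<integral>x. f x \<partial>\<nu>)"
proof -
  interpret \<nu>: prob_space \<nu> by fact
  have lower: "\<forall>\<^sub>F n in sequentially. (\<integral>x. f x \<partial>\<nu>) - e < (\<integral>x. f x \<partial>\<mu> n)"
    if e: "e > 0" and f: "f \<in> borel_measurable borel" "\<And>x. \<bar>f x\<bar> \<le> C"
      and cont: "AE x in \<nu>. isCont f x" for f e
  proof -
    note b = lower_env_abs_le[OF f(2)] and l = lower_env_lipschitz[OF f(2)]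
    have meas: "lower_env f m \<in> borel_measurable borel" for m
      by (rule borel_measurable_window_lipschitz[OF l])
    have "(\<lambda>m. \<integral>x. lower_env f m x \<partial>\<nu>) \<longlonglongrightarrow> (\<integral>x. f x \<partial>\<nu>)"
    proof (rule integral_dominated_convergence[where w="\<lambda>_. C"])
      show "AE x in \<nu>. (\<lambda>m. lower_env f m x) \<longlonglongrightarrow> f x"
        using cont by eventually_elim (rule lower_env_tendsto[OF f(2)])
      show "lower_env f i \<in> borel_measurable \<nu>" for i
        using meas[of i] \<nu>(2) by (simp cong: measurable_cong_sets)
      show "f \<in> borel_measurable \<nu>"
        using f(1) \<nu>(2) by (simp cong: measurable_cong_sets)
    qed (auto intro!: b)
    then have "\<forall>\<^sub>F m in sequentially. (\<integral>x. f x \<partial>\<nu>) - e < (\<integral>x. lower_env f m x \<partial>\<nu>)"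
      by (rule order_tendstoD) (use e in auto)
    then obtain m where m: "(\<integral>x. f x \<partial>\<nu>) - e < (\<integral>x. lower_env f m x \<partial>\<nu>)"
      using eventually_happens'[OF sequentially_bot] by blast
    have "\<forall>\<^sub>F n in sequentially. (\<integral>x. f x \<partial>\<nu>) - e < (\<integral>x. lower_env f m x \<partial>\<mu> n)"
      by (rule order_tendstoD(1)[OF lip[of "lower_env f m", OF b l] m])
    with \<mu>(1) show ?thesis
    proof eventually_elim
      case (elim n)
      interpret finite_measure "\<mu> n" by (rule elim)
      have "(\<integral>x. lower_env f m x \<partial>\<mu> n) \<le> (\<integral>x. f x \<partial>\<mu> n)"
      proof (rule integral_mono)
        show "integrable (\<mu> n) (lower_env f m)"
          by (rule integrable_const_bound[where B=C])
            (use meas b \<mu>(2)[of n] in \<open>auto cong: measurable_cong_sets\<close>)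
        show "integrable (\<mu> n) f"
          by (rule integrable_const_bound[where B=C])
            (use f \<mu>(2)[of n] in \<open>auto cong: measurable_cong_sets\<close>)
      qed (rule lower_env_le_self[OF f(2)])
      with elim show ?case by linarith
    qed
  qed
  show ?thesis
  proof (rule order_tendstoI)
    fix a assume "a < (\<integral>x. f x \<partial>\<nu>)"
    then show "\<forall>\<^sub>F n in sequentially. a < (\<integral>x. f x \<partial>\<mu> n)"
      using lower[OF _ f cont, of "(\<integral>x. f x \<partial>\<nu>) - a"] by simp
  next
    fix a assume a: "(\<integral>x. f x \<partial>\<nu>) < a"
    have "AE x in \<nu>. isCont (\<lambda>x. - f x) x"
      using cont by eventually_elim (rule isCont_minus)
    then show "\<forall>\<^sub>F n in sequentially. (\<integral>x. f x \<partial>\<mu> n) < a"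
      using lower[of "a - (\<integral>x. f x \<partial>\<nu>)" "\<lambda>x. - f x"] a f by simp
  qed
qed

section \<open>A local limit theorem on the real line\<close>

definition tri :: "real \<Rightarrow> real" where
  "tri s = max 0 (1 - \<bar>s\<bar>)"

text \<open>The Fejer kernel \<open>(sin (y/2) / (y/2))^2\<close>, which is the Fourier transform of
  \<open>tri\<close>; the value at \<open>0\<close> is its continuous extension.\<close>

definition fejer :: "real \<Rightarrow> real" where
  "fejer y = (if y = 0 then 1 else 2 * (1 - cos y) / y\<^sup>2)"

lemma tri_measurable [measurable]: "tri \<in> borel_measurable borel"
  unfolding tri_def by measurable

lemma fejer_measurable [measurable]: "fejer \<in> borel_measurable borel"
  unfolding fejer_def by measurable

lemma tri_nonneg: "0 \<le> tri s" and tri_le_indicator: "tri s \<le> indicator {-1..1} s"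
  by (auto simp: tri_def indicator_def)

lemma integrable_tri: "integrable lborel tri"
  by (rule Bochner_Integration.integrable_bound[where f="indicator {-1..1::real}"])
    (use tri_nonneg tri_le_indicator in \<open>auto intro!: AE_I2\<close>)

lemma fourier_tri: "(CLINT s|lborel. tri s * iexp (s * y)) = fejer y"
proof -
  define f g :: "real \<Rightarrow> complex" where "f = (\<lambda>s. (1 - s) * iexp (s * y))"
    and "g = (\<lambda>s. (1 + s) * iexp (s * y))"
  \<comment> \<open>Antiderivatives of \<open>f\<close> and \<open>g\<close>, found by integration
    by parts; at \<open>y = 0\<close> the general formula would divide by zero.\<close>
  define P Q :: "real \<Rightarrow> complex" where
    "P = (\<lambda>s. if y = 0 then s - s\<^sup>2 / 2 else (1 - s) * iexp (s * y) / (\<i> * y) + iexp (s * y) / (\<i> * y)\<^sup>2)" and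
    "Q = (\<lambda>s. if y = 0 then s + s\<^sup>2 / 2 else (1 + s) * iexp (s * y) / (\<i> * y) - iexp (s * y) / (\<i> * y)\<^sup>2)"
  have f: "continuous_on S f" and g: "continuous_on S g" for S
    unfolding f_def g_def by (intro continuous_intros)+
  have P: "(P has_vector_derivative f s) (at s within S)" and Q: "(Q has_vector_derivative g s) (at s within S)" for s S
  proof -
    define p q :: "complex \<Rightarrow> complex" where
      "p = (\<lambda>z::complex. if y = 0 then z - z\<^sup>2 / 2 else (1 - z) * exp (\<i> * (z * y)) / (\<i> * y) + exp (\<i> * (z * y)) / (\<i> * y)\<^sup>2)" and
      "q = (\<lambda>z::complex. if y = 0 then z + z\<^sup>2 / 2 else (1 + z) * exp (\<i> * (z * y)) / (\<i> * y) - exp (\<i> * (z * y)) / (\<i> * y)\<^sup>2)"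
    have p: "(p has_field_derivative (1 - z) * exp (\<i> * (z * y))) (at z)" 
      and q: "(q has_field_derivative (1 + z) * exp (\<i> * (z * y))) (at z)" for z :: complex
      unfolding p_def q_def
      by (cases "y = 0"; simp; (rule derivative_eq_intros refl | simp)+; simp add: field_simps power2_eq_square power4_eq_xxxx)+
    have "P = (\<lambda>s. p (of_real s))" "Q = (\<lambda>s. q (of_real s))"
      by (auto simp: P_def Q_def p_def q_def)
    then show "(P has_vector_derivative f s) (at s within S)" "(Q has_vector_derivative g s) (at s within S)"
      using has_vector_derivative_real_field[OF p[of "of_real s"], of S]
        has_vector_derivative_real_field[OF q[of "of_real s"], of S] by (simp_all add: f_def g_def)
  qed
  have "(CLINT s|lborel. tri s * iexp (s * y)) =
      (CLINT s|lborel. indicator {0..1} s *\<^sub>R f s + indicator {-1..0} s *\<^sub>R g s)"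
  proof (rule integral_cong_AE)
    \<comment> \<open>Both closed intervals contain \<open>0\<close>, where the right-hand side
      counts twice; hence equality only almost everywhere.\<close>
    show "AE s in lborel. tri s * iexp (s * y) = indicator {0..1} s *\<^sub>R f s + indicator {-1..0} s *\<^sub>R g s"
      using AE_lborel_singleton[of 0]
      by eventually_elim (auto simp: tri_def f_def g_def indicator_def max_def)
  qed (auto simp: f_def g_def)
  also have "\<dots> = (P 1 - P 0) + (Q 0 - Q (-1))"
    using has_bochner_integral_FTC_Icc[of 0 1 P f, OF _ P f] has_bochner_integral_FTC_Icc[of "-1" 0 Q g, OF _ Q g]
    by (intro has_bochner_integral_integral_eq has_bochner_integral_add) auto
  also have "\<dots> = fejer y"
    unfolding P_def Q_def fejer_def
    by (cases "y = 0"; auto simp: field_simps power2_eq_square complex_eq_iff Re_exp Im_exp)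
  finally show ?thesis .
qed

text \<open>
  The Fejer kernel vanishes at the nonzero multiples of \<open>2 * pi\<close>; adding its translate by \<open>pi\<close>
  removes the zeros, so that every function decaying quadratically is dominated by a multiple of
  \<open>kernel\<close>, while the Fourier transform keeps its compact support.
\<close>

definition kernel :: "real \<Rightarrow> real" where
  "kernel y = fejer y + fejer (y - pi)"

text \<open>Translating \<open>fejer\<close> by \<open>pi\<close> multiplies \<open>tri\<close> by
  the phase \<open>exp (- i * pi * s)\<close>; this is the second summand of the factor.\<close>

definition khat :: "real \<Rightarrow> complex" where
  "khat s = tri s * (1 + iexp (- (pi * s)))"

lemma kernel_measurable [measurable]: "kernel \<in> borel_measurable borel"
  unfolding kernel_def by measurable

lemma khat_measurable [measurable]: "khat \<in> borel_measurable borel"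
  unfolding khat_def by measurable

lemma isCont_khat: "isCont khat s"
  unfolding khat_def tri_def by (intro continuous_intros)

lemma khat_0: "khat 0 = 2"
  by (simp add: khat_def tri_def)

lemma cmod_khat_le: "cmod (khat s) \<le> 2 * tri s"
proof -
  have *: "cmod (1 + iexp (- (pi * s))) \<le> 1 + 1"
    by (rule order.trans[OF norm_triangle_ineq]) simp
  then show ?thesis
    using mult_left_mono[OF * tri_nonneg[of s]] tri_nonneg[of s] by (simp add: khat_def norm_mult mult.commute)
qed

lemma cmod_khat_le_indicator: "cmod (khat s) \<le> 2 * indicator {-1..1} s"
  using cmod_khat_le[of s] tri_le_indicator[of s] by linarith

lemma integrable_khat: "integrable lborel khat"
  by (rule Bochner_Integration.integrable_bound[where f="\<lambda>s. 2 * tri s"])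
    (use integrable_tri cmod_khat_le tri_nonneg in auto)

lemma fourier_khat: "(CLINT s|lborel. khat s * iexp (s * y)) = kernel y"
proof -
  have i: "integrable lborel (\<lambda>s. tri s * iexp (s * z))" for z
    by (rule Bochner_Integration.integrable_bound[OF integrable_tri]) (auto simp: norm_mult)
  have "khat s * iexp (s * y) = tri s * iexp (s * y) + tri s * iexp (s * (y - pi))" for s
    by (simp add: khat_def ring_distribs exp_add[symmetric] algebra_simps)
  then have "(CLINT s|lborel. khat s * iexp (s * y)) =
      (CLINT s|lborel. tri s * iexp (s * y)) + (CLINT s|lborel. tri s * iexp (s * (y - pi)))"
    using Bochner_Integration.integral_add[OF i i] by presburger
  then show ?thesis
    by (simp only: fourier_tri kernel_def of_real_add)
qed

lemma fejer_ge: "2 * (1 - cos y) / (\<bar>y\<bar> + a)\<^sup>2 \<le> fejer y" if "a \<ge> 0"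
proof (cases "y = 0")
  case False
  have "\<bar>y\<bar>\<^sup>2 \<le> (\<bar>y\<bar> + a)\<^sup>2" using that by (intro power_mono) auto
  then show ?thesis using False by (auto simp: fejer_def intro!: divide_left_mono mult_pos_pos add_pos_nonneg that)
qed (simp add: fejer_def)

text \<open>The numerators \<open>1 - cos y\<close> and \<open>1 - cos (y - pi) = 1 + cos y\<close>
  add up to \<open>2\<close>, so the two Fejer terms are never small together. Both denominators are
  at most \<open>(|y| + pi)^2\<close>.\<close>

lemma kernel_ge: "4 / (\<bar>y\<bar> + pi)\<^sup>2 \<le> kernel y"
proof -
  have "2 * (1 - cos (y - pi)) / (\<bar>y\<bar> + pi)\<^sup>2 \<le> 2 * (1 - cos (y - pi)) / (\<bar>y - pi\<bar> + 0)\<^sup>2" if "y \<noteq> pi"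
  proof -
    have "\<bar>y - pi\<bar> + 0 \<le> \<bar>y\<bar> + pi" "0 < \<bar>y\<bar> + pi" "0 < \<bar>y - pi\<bar> + 0" using pi_gt_zero that by linarith+
    then show ?thesis
      by (intro divide_left_mono power_mono mult_pos_pos zero_less_power mult_nonneg_nonneg) (auto simp: cos_diff real_0_le_add_iff)
  qed
  then have "2 * (1 - cos (y - pi)) / (\<bar>y\<bar> + pi)\<^sup>2 \<le> fejer (y - pi)"
    by (cases "y = pi") (auto simp: fejer_def)
  moreover have "2 * (1 - cos y) / (\<bar>y\<bar> + pi)\<^sup>2 \<le> fejer y"
    by (rule fejer_ge) simp
  moreover have "2 * (1 - cos y) / (\<bar>y\<bar> + pi)\<^sup>2 + 2 * (1 - cos (y - pi)) / (\<bar>y\<bar> + pi)\<^sup>2 = 4 / (\<bar>y\<bar> + pi)\<^sup>2"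
    by (simp add: add_divide_distrib[symmetric] cos_diff)
  ultimately show ?thesis unfolding kernel_def by linarith
qed

lemma kernel_pos: "0 < kernel y"
proof (rule less_le_trans[OF _ kernel_ge])
  have "\<bar>y\<bar> + pi > 0" using pi_gt_zero by linarith
  then show "0 < 4 / (\<bar>y\<bar> + pi)\<^sup>2" by simp
qed

text \<open>A Fourier transform is bounded by the L^1 norm of its source:
  \<open>|khat| <= 2 * tri\<close>, and \<open>tri\<close> has integral
  \<open>fejer 0 = 1\<close>.\<close>

lemma kernel_le: "kernel y \<le> 2"
proof -
  have "cmod (kernel y) \<le> (\<integral>s. 2 * tri s \<partial>lborel)"
    unfolding fourier_khat[symmetric]
    by (rule order.trans[OF integral_norm_bound], rule integral_mono)
       (use integrable_tri cmod_khat_le integrable_khat in \<open>auto simp: norm_mult intro!: integrable_norm 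
         Bochner_Integration.integrable_bound[OF integrable_khat]\<close>)
  also have "\<dots> = 2"
    using fourier_tri[of 0] integral_complex_of_real[of lborel tri] by (simp add: fejer_def of_real_eq_iff[symmetric] del: of_real_eq_iff)
  finally show ?thesis by simp
qed

text \<open>The two excluded points are those where one of the Fejer terms switches to its special
  value. They form a null set, which is enough for continuity almost everywhere.\<close>

lemma isCont_kernel: "isCont kernel y" if "y \<noteq> 0" "y \<noteq> pi"
proof -
  have 1: "isCont (\<lambda>y. 2 * (1 - cos y) / y\<^sup>2 + 2 * (1 - cos (y - pi)) / (y - pi)\<^sup>2) y"
    using that by (intro continuous_intros) auto
  have "eventually (\<lambda>y. y \<in> - {0, pi}) (nhds y)"
    using that by (intro eventually_nhds_in_open) (auto intro: open_Compl)
  then have 2: "\<forall>\<^sub>F y in nhds y. kernel y = 2 * (1 - cos y) / y\<^sup>2 + 2 * (1 - cos (y - pi)) / (y - pi)\<^sup>2"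
    by eventually_elim (auto simp: kernel_def fejer_def)
  show ?thesis
    using 1 isCont_cong[OF 2] by simp
qed

lemma (in real_distribution) integrable_kernel: "integrable M kernel"
  by (rule integrable_const_bound[where B=2]) (use kernel_le kernel_pos in \<open>auto simp: abs_of_pos\<close>)

text \<open>Parseval's relation, by Fubini. As \<open>khat\<close> vanishes outside
  \<open>[-1, 1]\<close>, only values of the characteristic function on a bounded interval around
  \<open>t\<close> enter.\<close>

lemma (in real_distribution) fourier_kernel:
  "(CLINT y|M. kernel y * iexp (t * y)) = (CLINT s|lborel. khat s * char M (s + t))"
proof -
  interpret pair_sigma_finite lborel M ..
  have int: "integrable (lborel \<Otimes>\<^sub>M M) (\<lambda>(s, y). khat s * iexp ((s + t) * y))"
  proof (rule Fubini_integrable)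
    show "integrable lborel (\<lambda>s. \<integral>y. norm (case (s, y) of (s, y) \<Rightarrow> khat s * iexp ((s + t) * y)) \<partial>M)"
      using integrable_norm[OF integrable_khat] by (simp add: norm_mult prob_space)
    show "AE s in lborel. integrable M (\<lambda>y. case (s, y) of (s, y) \<Rightarrow> khat s * iexp ((s + t) * y))"
      by (intro AE_I2) (auto intro!: integrable_const_bound[where B="cmod (khat _)"] simp: norm_mult)
  qed simp
  have "(CLINT y|M. kernel y * iexp (t * y)) = (CLINT y|M. CLINT s|lborel. khat s * iexp ((s + t) * y))"
    unfolding fourier_khat[symmetric] integral_mult_left_zero[symmetric]
    by (intro Bochner_Integration.integral_cong refl) (simp add: exp_add[symmetric] algebra_simps)
  also have "\<dots> = (CLINT s|lborel. CLINT y|M. khat s * iexp ((s + t) * y))"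
    using Fubini_integral[OF int] by simp
  also have "\<dots> = (CLINT s|lborel. khat s * char M (s + t))"
    by (simp add: char_def)
  finally show ?thesis .
qed

section \<open>Kernel integrals of laws with approximately Gaussian characteristic functions\<close>

lemma gaussian_integral:
  assumes "c > 0"
  shows "has_bochner_integral lborel (\<lambda>u::real. exp (- (c * u\<^sup>2))) (sqrt (pi / c))"
proof -
  define s where "s = sqrt (1 / (2 * c))"
  have s: "s > 0" "s\<^sup>2 = 1 / (2 * c)" using assms by (auto simp: s_def)
  have eq: "exp (- (c * u\<^sup>2)) = sqrt (pi / c) * normal_density 0 s u" for u
    unfolding normal_density_def s(2) using assms by (simp add: real_sqrt_divide field_simps)
  show ?thesis
    unfolding eq has_bochner_integral_iff
    using integrable_normal_density[OF s(1)] integral_normal_density[OF s(1)] by auto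
qed

text \<open>By Parseval the kernel integral is at most twice the integral of \<open>|char|\<close>
  over \<open>[-1, 1]\<close>, which the Gaussian bound makes \<open>O(1 / r)\<close>. Only the
  modulus of the characteristic function enters, so the bound is the same for all translates of the
  law.\<close>

lemma (in real_distribution) kernel_integral_bound:
  assumes c: "c > 0" and r: "r > 0"
    and bound: "\<And>s. \<bar>s\<bar> \<le> 1 \<Longrightarrow> cmod (char M s) \<le> exp (- (c * r\<^sup>2 * s\<^sup>2))"
  shows "r * (\<integral>y. kernel y \<partial>M) \<le> 2 * sqrt (pi / c)"
proof -
  have p: "c * r\<^sup>2 > 0" using c r by simp
  have "(\<integral>y. kernel y \<partial>M) \<le> cmod (CLINT y|M. kernel y)"
    unfolding integral_complex_of_real norm_of_real by simp
  also have "\<dots> = cmod (CLINT s|lborel. khat s * char M s)"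
    using fourier_kernel[of 0] by simp
  also have "\<dots> \<le> (\<integral>s. 2 * exp (- (c * r\<^sup>2 * s\<^sup>2)) \<partial>lborel)"
  proof (rule order.trans[OF integral_norm_bound], rule integral_mono)
    have "cmod (khat s * char M s) \<le> cmod (khat s)" for s
      using mult_left_mono[OF cmod_char_le_1[of s], of "cmod (khat s)"] by (simp add: norm_mult)
    then show "integrable lborel (\<lambda>s. norm (khat s * char M s))"
      by (intro integrable_norm Bochner_Integration.integrable_bound[OF integrable_khat]) auto
    show "integrable lborel (\<lambda>s. 2 * exp (- (c * r\<^sup>2 * s\<^sup>2)))"
      using gaussian_integral[OF p] by (auto simp: has_bochner_integral_iff)
    show "norm (khat s * char M s) \<le> 2 * exp (- (c * r\<^sup>2 * s\<^sup>2))" for s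
      unfolding norm_mult using cmod_khat_le_indicator[of s] bound[of s]
      by (cases "s \<in> {-1..1}") (auto intro!: mult_mono)
  qed
  also have "\<dots> = 2 * sqrt (pi / c) / r"
    using gaussian_integral[OF p] r by (simp add: has_bochner_integral_iff real_sqrt_divide real_sqrt_mult)
  finally show ?thesis using r by (simp add: field_simps)
qed

text \<open>Parseval followed by the substitution \<open>s = u / r n - t\<close>, whose Jacobian
  cancels the factor \<open>r n\<close>. Pointwise, \<open>khat\<close> tends to
  \<open>khat (- t)\<close> and the characteristic function to the Gaussian one; the decay
  hypothesis dominates, since \<open>khat\<close> confines \<open>u / r n\<close> to
  \<open>|u / r n| <= 1 + |t|\<close>.\<close>

lemma kernel_limit:
  fixes \<nu> :: "nat \<Rightarrow> real measure" and r :: "nat \<Rightarrow> real"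
  assumes \<nu>: "\<And>n. real_distribution (\<nu> n)"
    and r: "\<And>n. r n > 0" "filterlim r at_top sequentially" and \<sigma>: "\<sigma> > 0"
    and clt: "\<And>u. (\<lambda>n. char (\<nu> n) (u / r n)) \<longlonglongrightarrow> complex_of_real (exp (- (\<sigma>\<^sup>2 * u\<^sup>2 / 2)))"
    and bound: "\<And>S. \<exists>c>0. \<forall>\<^sub>F n in sequentially. \<forall>s. \<bar>s\<bar> \<le> S \<longrightarrow>
        cmod (char (\<nu> n) s) \<le> exp (- (c * (r n)\<^sup>2 * s\<^sup>2))"
  shows "(\<lambda>n. r n * (CLINT y|\<nu> n. kernel y * iexp (t * y))) \<longlonglongrightarrow> khat (- t) * (sqrt (2 * pi) / \<sigma>)"
proof -
  obtain c where c: "c > 0" and ev: "\<forall>\<^sub>F n in sequentially. \<forall>s. \<bar>s\<bar> \<le> 1 + \<bar>t\<bar> \<longrightarrow>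
        cmod (char (\<nu> n) s) \<le> exp (- (c * (r n)\<^sup>2 * s\<^sup>2))"
    using bound[of "1 + \<bar>t\<bar>"] by blast
  obtain N where N: "\<And>n s. n \<ge> N \<Longrightarrow> \<bar>s\<bar> \<le> 1 + \<bar>t\<bar> \<Longrightarrow> cmod (char (\<nu> n) s) \<le> exp (- (c * (r n)\<^sup>2 * s\<^sup>2))"
    using ev unfolding eventually_sequentially by blast
  define h where "h n u = khat (u / r n - t) * char (\<nu> n) (u / r n)" for n u
  have hm: "h n \<in> borel_measurable lborel" for n
  proof -
    interpret real_distribution "\<nu> n" by (rule \<nu>)
    show ?thesis unfolding h_def by measurable
  qed
  have eq: "r n * (CLINT y|\<nu> n. kernel y * iexp (t * y)) = (CLINT u|lborel. h n u)" for n
  proof -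
    interpret real_distribution "\<nu> n" by (rule \<nu>)
    show ?thesis
      unfolding fourier_kernel h_def
      by (subst lborel_integral_real_affine[of "1 / r n" _ "- t"])
        (use r(1)[of n] in \<open>auto simp: scaleR_conv_of_real algebra_simps\<close>)
  qed
  have inv: "(\<lambda>n. u / r n) \<longlonglongrightarrow> 0" for u
    using tendsto_mult[OF tendsto_const[of u] tendsto_inverse_0_at_top[OF r(2)]] by (simp add: divide_inverse)
  have g: "has_bochner_integral lborel (\<lambda>u. exp (- (\<sigma>\<^sup>2 * u\<^sup>2 / 2))) (sqrt (2 * pi) / \<sigma>)"
    using gaussian_integral[of "\<sigma>\<^sup>2 / 2"] \<sigma> by (simp add: real_sqrt_divide real_sqrt_mult mult.commute)
  \<comment> \<open>The domination holds from \<open>N\<close> on only, hence the shifted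
    index.\<close>
  have "(\<lambda>n. CLINT u|lborel. h (n + N) u) \<longlonglongrightarrow>
      (CLINT u|lborel. khat (- t) * complex_of_real (exp (- (\<sigma>\<^sup>2 * u\<^sup>2 / 2))))"
  proof (rule integral_dominated_convergence[where w="\<lambda>u. 2 * exp (- (c * u\<^sup>2))"])
    show "integrable lborel (\<lambda>u. 2 * exp (- (c * u\<^sup>2)))"
      using gaussian_integral[OF c] by (auto simp: has_bochner_integral_iff)
    show "AE u in lborel. norm (h (n + N) u) \<le> 2 * exp (- (c * u\<^sup>2))" for n
    proof (rule AE_I2)
      fix u
      have r0: "r (n + N) > 0" by (rule r)
      show "norm (h (n + N) u) \<le> 2 * exp (- (c * u\<^sup>2))"
      proof (cases "u / r (n + N) - t \<in> {-1..1}")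
        case True
        then have "\<bar>u / r (n + N)\<bar> \<le> 1 + \<bar>t\<bar>" by (auto simp: abs_real_def)
        from N[of "n + N", OF le_add2 this] r0 have "cmod (char (\<nu> (n + N)) (u / r (n + N))) \<le> exp (- (c * u\<^sup>2))"
          by (simp add: power_divide)
        then show ?thesis
          unfolding h_def norm_mult using cmod_khat_le_indicator[of "u / r (n + N) - t"] True
          by (intro mult_mono) auto
      next
        case False
        then show ?thesis
          unfolding h_def norm_mult using cmod_khat_le_indicator[of "u / r (n + N) - t"] by simp
      qed
    qed
    have "(\<lambda>n. h n u) \<longlonglongrightarrow> khat (- t) * complex_of_real (exp (- (\<sigma>\<^sup>2 * u\<^sup>2 / 2)))" for u
      unfolding h_def using tendsto_diff[OF inv[of u] tendsto_const[of t]]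
      by (intro tendsto_mult clt isCont_tendsto_compose[OF isCont_khat]) simp
    then show "AE u in lborel. (\<lambda>n. h (n + N) u) \<longlonglongrightarrow> khat (- t) * complex_of_real (exp (- (\<sigma>\<^sup>2 * u\<^sup>2 / 2)))"
      by (intro AE_I2 LIMSEQ_ignore_initial_segment)
  qed (use hm in auto)
  also have "(CLINT u|lborel. khat (- t) * complex_of_real (exp (- (\<sigma>\<^sup>2 * u\<^sup>2 / 2)))) = khat (- t) * (sqrt (2 * pi) / \<sigma>)"
    using g by (simp add: has_bochner_integral_iff integral_complex_of_real del: of_real_exp)
  finally show ?thesis
    unfolding eq by (rule LIMSEQ_offset)
qed


text \<open>Fourier inversion for \<open>kernel\<close>, obtained by applying
  \<open>kernel_limit\<close> to centred normal laws with standard deviation \<open>r n\<close>.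
  Multiplied by \<open>r n\<close>, their densities increase to the constant
  \<open>1 / sqrt (2 * pi)\<close>: monotone convergence gives integrability, and dominated
  convergence then identifies the transform.\<close>

lemma lborel_kernel:
  shows integrable_lborel_kernel: "integrable lborel kernel"
    and fourier_lborel_kernel: "(CLINT y|lborel. kernel y * iexp (t * y)) = 2 * pi * khat (- t)"
proof -
  define r where "r n = real (Suc n)" for n
  define \<nu> where "\<nu> n = distr std_normal_distribution borel (\<lambda>x. r n * x)" for n
  have r: "r n > 0" "filterlim r at_top sequentially" for n
    unfolding r_def by (simp, rule filterlim_compose[OF filterlim_real_sequentially filterlim_Suc])
  interpret N: real_distribution std_normal_distribution by (rule real_dist_normal_dist)
  have char: "char (\<nu> n) s = complex_of_real (exp (- ((r n)\<^sup>2 * s\<^sup>2 / 2)))" for n s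
    using fun_cong[OF char_std_normal_distribution, of "r n * s"]
    by (simp add: \<nu>_def char_def integral_distr power_mult_distrib algebra_simps)
  have lim: "(\<lambda>n. r n * (CLINT y|\<nu> n. kernel y * iexp (t * y))) \<longlonglongrightarrow> khat (- t) * (sqrt (2 * pi) / 1)" for t
  proof (rule kernel_limit)
    show "(\<lambda>n. char (\<nu> n) (u / r n)) \<longlonglongrightarrow> complex_of_real (exp (- (1\<^sup>2 * u\<^sup>2 / 2)))" for u
      using r(1) by (simp add: char power_divide less_imp_neq[symmetric])
    show "\<exists>c>0. \<forall>\<^sub>F n in sequentially. \<forall>s. \<bar>s\<bar> \<le> S \<longrightarrow> cmod (char (\<nu> n) s) \<le> exp (- (c * (r n)\<^sup>2 * s\<^sup>2))" for S
      by (intro exI[of _ "1/2"]) (simp add: char)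
    show "real_distribution (\<nu> n)" for n
      unfolding \<nu>_def by (rule N.real_distribution_distr) simp
  qed (use r in auto)
  define w where "w n y = std_normal_density (y / r n)" for n y
  have w: "w n y \<ge> 0" "w n y \<le> 1 / sqrt (2 * pi)" "(\<lambda>n. w n y) \<longlonglongrightarrow> 1 / sqrt (2 * pi)" "w n y \<le> w (Suc n) y" for n y
  proof -
    have "(\<lambda>n. y / r n) \<longlonglongrightarrow> 0"
      using tendsto_mult[OF tendsto_const[of y] tendsto_inverse_0_at_top[OF r(2)]] by (simp add: divide_inverse)
    then have "(\<lambda>n. exp (- ((y / r n)\<^sup>2 / 2))) \<longlonglongrightarrow> exp (- (0\<^sup>2 / 2))"
      by (intro tendsto_exp tendsto_minus tendsto_divide tendsto_power tendsto_const) auto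
    from tendsto_mult[OF tendsto_const[of "1 / sqrt (2 * pi)"] this]
    show "(\<lambda>n. w n y) \<longlonglongrightarrow> 1 / sqrt (2 * pi)" by (simp add: w_def std_normal_density_def)
    have "(y / r (Suc n))\<^sup>2 \<le> (y / r n)\<^sup>2"
      unfolding power_divide by (intro divide_left_mono power_mono mult_pos_pos zero_less_power) (auto simp: r_def)
    then show "w n y \<le> w (Suc n) y" by (auto simp: w_def std_normal_density_def intro!: divide_right_mono)
  qed (auto simp: w_def std_normal_density_def intro!: divide_right_mono)
  have wm [measurable]: "w n \<in> borel_measurable borel" for n
    unfolding w_def by measurable
  have eq: "r n * (CLINT y|\<nu> n. kernel y * iexp (t * y)) = (CLINT y|lborel. w n y * (kernel y * iexp (t * y)))" for n t
  proof -
    have "(CLINT y|\<nu> n. kernel y * iexp (t * y)) =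
        (CLINT x|lborel. std_normal_density x *\<^sub>R (kernel (r n * x) * iexp (t * (r n * x))))"
      unfolding \<nu>_def by (subst integral_distr) (auto simp: integral_density)
    then show ?thesis
      using r(1)[of n] unfolding w_def
      by (subst lborel_integral_real_affine[of "r n" _ 0]) (auto simp: scaleR_conv_of_real)
  qed
  have wk: "integrable lborel (\<lambda>y. w n y * kernel y)" for n
  proof (rule Bochner_Integration.integrable_bound)
    show "integrable lborel (\<lambda>y. 2 * w n y)"
      using lborel_integrable_real_affine[OF integrable_normal_density[of 1 0, OF zero_less_one], of "1 / r n" 0] r(1)[of n]
      by (simp add: w_def)
    show "AE y in lborel. norm (w n y * kernel y) \<le> norm (2 * w n y)"
      using w(1) kernel_le kernel_pos by (auto simp: abs_mult abs_of_pos mult.commute intro!: mult_right_mono)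
  qed simp
  have "(\<lambda>n. \<integral>y. w n y * kernel y \<partial>lborel) \<longlonglongrightarrow> 2 * sqrt (2 * pi)"
  proof -
    have "complex_of_real (\<integral>y. w n y * kernel y \<partial>lborel) = r n * (CLINT y|\<nu> n. kernel y * iexp (0 * y))" for n
      unfolding eq integral_complex_of_real[symmetric] by simp
    then have "(\<lambda>n. complex_of_real (\<integral>y. w n y * kernel y \<partial>lborel)) \<longlonglongrightarrow> complex_of_real (2 * sqrt (2 * pi))"
      using lim[of 0] by (simp add: khat_0)
    then show ?thesis by (simp only: tendsto_of_real_iff)
  qed
  moreover have "(\<lambda>n. w n y * kernel y) \<longlonglongrightarrow> 1 / sqrt (2 * pi) * kernel y" for y
    by (intro tendsto_mult w tendsto_const)
  then have "AE y in lborel. (\<lambda>n. w n y * kernel y) \<longlonglongrightarrow> 1 / sqrt (2 * pi) * kernel y"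
    by (rule AE_I2)
  ultimately have "integrable lborel (\<lambda>y. 1 / sqrt (2 * pi) * kernel y)"
    by (intro integral_monotone_convergence_nonneg(1)[OF wk])
      (use w kernel_pos in \<open>auto intro!: incseq_SucI mult_right_mono simp: less_imp_le\<close>)
  from integrable_mult_right[OF this, of "sqrt (2 * pi)"]
  show int: "integrable lborel kernel"
    by simp
  have "(\<lambda>n. CLINT y|lborel. w n y * (kernel y * iexp (t * y))) \<longlonglongrightarrow>
      (CLINT y|lborel. complex_of_real (1 / sqrt (2 * pi)) * (kernel y * iexp (t * y)))"
  proof (rule integral_dominated_convergence[where w="\<lambda>y. 1 / sqrt (2 * pi) * kernel y"])
    fix n
    have "w n y * kernel y \<le> 1 / sqrt (2 * pi) * kernel y" for y
      using w(2) kernel_pos by (intro mult_right_mono) (auto simp: less_imp_le)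
    then show "AE y in lborel. norm (w n y * (kernel y * iexp (t * y))) \<le> 1 / sqrt (2 * pi) * kernel y"
      using w(1)[of n] kernel_pos by (intro AE_I2) (simp add: norm_mult abs_of_pos)
  qed (use w(3) int in \<open>auto intro!: AE_I2 tendsto_mult tendsto_of_real simp del: of_real_divide\<close>)
  then have "complex_of_real (1 / sqrt (2 * pi)) * (CLINT y|lborel. kernel y * iexp (t * y)) = khat (- t) * sqrt (2 * pi)"
    using LIMSEQ_unique[OF lim[of t]] unfolding eq integral_mult_right_zero by simp
  then have "complex_of_real (sqrt (2 * pi)) * (complex_of_real (1 / sqrt (2 * pi)) * (CLINT y|lborel. kernel y * iexp (t * y)))
      = complex_of_real (sqrt (2 * pi)) * (khat (- t) * sqrt (2 * pi))"
    by simp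
  moreover have "complex_of_real (sqrt (2 * pi)) * complex_of_real (1 / sqrt (2 * pi)) = 1"
    "complex_of_real (sqrt (2 * pi)) * complex_of_real (sqrt (2 * pi)) = 2 * pi"
    unfolding of_real_mult[symmetric] by auto
  moreover have "X = p * k" if "a * (b * X) = a * (k * a)" "a * b = 1" "a * a = p" for a b k p X :: complex
    using that by algebra
  ultimately show "(CLINT y|lborel. kernel y * iexp (t * y)) = 2 * pi * khat (- t)"
    by blast
qed

text \<open>Reweighted by \<open>kernel\<close> and normalised, the laws \<open>\<nu> n\<close>
  become probability measures whose characteristic functions are governed by
  \<open>kernel_limit\<close>, so they converge weakly to normalised \<open>kernel\<close> times
  Lebesgue measure. The quotient \<open>g / kernel\<close> is bounded and almost everywhere
  continuous, hence an admissible test function, and undoing the normalisation gives the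
  claim.\<close>

theorem local_limit:
  fixes \<nu> :: "nat \<Rightarrow> real measure" and r :: "nat \<Rightarrow> real" and g :: "real \<Rightarrow> real"
  assumes \<nu>: "\<And>n. real_distribution (\<nu> n)"
    and r: "\<And>n. r n > 0" "filterlim r at_top sequentially" and \<sigma>: "\<sigma> > 0"
    and clt: "\<And>u. (\<lambda>n. char (\<nu> n) (u / r n)) \<longlonglongrightarrow> complex_of_real (exp (- (\<sigma>\<^sup>2 * u\<^sup>2 / 2)))"
    and bound: "\<And>S. \<exists>c>0. \<forall>\<^sub>F n in sequentially. \<forall>s. \<bar>s\<bar> \<le> S \<longrightarrow>
        cmod (char (\<nu> n) s) \<le> exp (- (c * (r n)\<^sup>2 * s\<^sup>2))"
    and g [measurable]: "g \<in> borel_measurable borel" and gC: "\<And>y. \<bar>g y\<bar> \<le> C * kernel y"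
    and cont: "AE y in lborel. isCont g y"
  shows "(\<lambda>n. r n * (\<integral>y. g y \<partial>\<nu> n)) \<longlonglongrightarrow> (\<integral>y. g y \<partial>lborel) / (\<sigma> * sqrt (2 * pi))"
proof -
  note lim = kernel_limit[OF \<nu> r \<sigma> clt bound]
  define m where "m n = r n * (\<integral>y. kernel y \<partial>\<nu> n)" for n
  have ikn: "integrable (\<nu> n) kernel" for n
    by (rule real_distribution.integrable_kernel[OF \<nu>])
  have sets [measurable_cong, simp]: "sets (\<nu> n) = sets borel" for n
    using \<nu>[of n] by (rule real_distribution.events_eq_borel)
  have m: "m n > 0" for n
  proof -
    interpret real_distribution "\<nu> n" by (rule \<nu>)
    have "(\<integral>y. kernel y \<partial>\<nu> n) \<noteq> 0"
    proof
      assume "(\<integral>y. kernel y \<partial>\<nu> n) = 0"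
      then have "AE y in \<nu> n. kernel y = 0"
        using ikn[of n] kernel_pos by (subst (asm) integral_nonneg_eq_0_iff_AE) (auto simp: less_imp_le)
      then show False
        using kernel_pos by (auto simp: less_imp_neq[symmetric])
    qed
    moreover have "(\<integral>y. kernel y \<partial>\<nu> n) \<ge> 0"
      using kernel_pos by (auto intro!: integral_nonneg simp: less_imp_le)
    ultimately have "(\<integral>y. kernel y \<partial>\<nu> n) > 0" by linarith
    then show ?thesis using r(1) by (simp add: m_def)
  qed
  have mlim: "m \<longlonglongrightarrow> 2 * (sqrt (2 * pi) / \<sigma>)"
  proof -
    have "complex_of_real (m n) = r n * (CLINT y|\<nu> n. kernel y * iexp (0 * y))" for n
      unfolding m_def of_real_mult integral_complex_of_real[symmetric] by simp
    then have "(\<lambda>n. complex_of_real (m n)) \<longlonglongrightarrow> complex_of_real (2 * (sqrt (2 * pi) / \<sigma>))"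
      using lim[of 0] by (simp add: khat_0)
    then show ?thesis by (simp only: tendsto_of_real_iff)
  qed
  have kint: "(\<integral>y. kernel y \<partial>lborel) = 4 * pi"
  proof -
    have "complex_of_real (\<integral>y. kernel y \<partial>lborel) = complex_of_real (4 * pi)"
      unfolding integral_complex_of_real[symmetric] using fourier_lborel_kernel[of 0] by (simp add: khat_0)
    then show ?thesis by (simp only: of_real_eq_iff)
  qed
  \<comment> \<open>The normalisations are the total masses: \<open>m n / r n\<close> is the
    integral of \<open>kernel\<close> under \<open>\<nu> n\<close>, and
    \<open>4 * pi = 2 * pi * khat 0\<close> is its Lebesgue integral.\<close>
  define \<kappa> where "\<kappa> n = density (\<nu> n) (\<lambda>y. ennreal (r n / m n * kernel y))" for n
  define \<kappa>' where "\<kappa>' = density lborel (\<lambda>y. ennreal (kernel y / (4 * pi)))"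
  have \<kappa>_int: "integral\<^sup>L (\<kappa> n) f = (\<integral>y. (r n / m n * kernel y) *\<^sub>R f y \<partial>\<nu> n)"
    if "f \<in> borel_measurable borel" for f :: "real \<Rightarrow> 'b :: {banach, second_countable_topology}" and n
    unfolding \<kappa>_def using that m r(1)[of n] kernel_pos by (intro integral_density) (auto simp: less_imp_le)
  have \<kappa>'_int: "integral\<^sup>L \<kappa>' f = (\<integral>y. (kernel y / (4 * pi)) *\<^sub>R f y \<partial>lborel)"
    if "f \<in> borel_measurable borel" for f :: "real \<Rightarrow> 'b :: {banach, second_countable_topology}"
    unfolding \<kappa>'_def using that kernel_pos by (intro integral_density) (auto simp: less_imp_le)
  have \<kappa>: "real_distribution (\<kappa> n)" for n
  proof (intro real_distribution.intro real_distribution_axioms.intro prob_spaceI)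
    have "space (\<nu> n) = UNIV"
      using sets_eq_imp_space_eq[OF sets[of n]] by simp
    then have "emeasure (\<kappa> n) (space (\<kappa> n)) = (\<integral>\<^sup>+y. ennreal (r n / m n * kernel y) \<partial>\<nu> n)"
      unfolding \<kappa>_def by (subst emeasure_density) (auto intro!: nn_integral_cong)
    also have "\<dots> = ennreal (\<integral>y. r n / m n * kernel y \<partial>\<nu> n)"
      using ikn[of n] m[of n] r(1)[of n] kernel_pos by (intro nn_integral_eq_integral) (auto simp: less_imp_le)
    also have "(\<integral>y. r n / m n * kernel y \<partial>\<nu> n) = 1"
      using m[of n] by (auto simp: m_def)
    finally show "emeasure (\<kappa> n) (space (\<kappa> n)) = 1" by simp
  qed (simp add: \<kappa>_def)
  have \<kappa>': "real_distribution \<kappa>'"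
  proof (intro real_distribution.intro real_distribution_axioms.intro prob_spaceI)
    have "emeasure \<kappa>' (space \<kappa>') = (\<integral>\<^sup>+y. ennreal (kernel y / (4 * pi)) \<partial>lborel)"
      by (simp add: \<kappa>'_def emeasure_density)
    also have "\<dots> = ennreal (\<integral>y. kernel y / (4 * pi) \<partial>lborel)"
      using integrable_lborel_kernel kernel_pos by (intro nn_integral_eq_integral) (auto simp: less_imp_le)
    also have "(\<integral>y. kernel y / (4 * pi) \<partial>lborel) = 1"
      by (simp add: kint)
    finally show "emeasure \<kappa>' (space \<kappa>') = 1" by simp
  qed (simp add: \<kappa>'_def)
  have "weak_conv_m \<kappa> \<kappa>'"
  proof (rule levy_continuity[OF \<kappa> \<kappa>'])
    fix t
    have 1: "char (\<kappa> n) t = (r n * (CLINT y|\<nu> n. kernel y * iexp (t * y))) / m n" for n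
    proof -
      have "char (\<kappa> n) t = (CLINT y|\<nu> n. complex_of_real (r n / m n) * (kernel y * iexp (t * y)))"
        unfolding char_def by (subst \<kappa>_int) (simp_all add: scaleR_conv_of_real mult.assoc)
      then show ?thesis unfolding integral_mult_right_zero by simp
    qed
    have 2: "char \<kappa>' t = khat (- t) / 2"
    proof -
      have "char \<kappa>' t = (CLINT y|lborel. complex_of_real (1 / (4 * pi)) * (kernel y * iexp (t * y)))"
        unfolding char_def by (subst \<kappa>'_int) (simp_all add: scaleR_conv_of_real mult.assoc)
      then show ?thesis unfolding integral_mult_right_zero fourier_lborel_kernel by simp
    qed
    have "(\<lambda>n. char (\<kappa> n) t) \<longlonglongrightarrow> khat (- t) * (sqrt (2 * pi) / \<sigma>) / complex_of_real (2 * (sqrt (2 * pi) / \<sigma>))"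
      unfolding 1 using \<sigma> by (intro tendsto_divide lim tendsto_of_real mlim) auto
    then show "(\<lambda>n. char (\<kappa> n) t) \<longlonglongrightarrow> char \<kappa>' t"
      using \<sigma> by (simp add: 2)
  qed
  define f where "f y = g y / kernel y" for y
  have fm [measurable]: "f \<in> borel_measurable borel" unfolding f_def by measurable
  have fk: "kernel y * f y = g y" for y
    using kernel_pos[of y] by (simp add: f_def)
  have "(\<lambda>n. integral\<^sup>L (\<kappa> n) f) \<longlonglongrightarrow> integral\<^sup>L \<kappa>' f"
  proof (rule weak_conv_imp_bdd_ae_continuous_conv[OF \<kappa> \<kappa>' \<open>weak_conv_m \<kappa> \<kappa>'\<close>])
    show "norm (f y) \<le> C" for y
      using gC[of y] kernel_pos[of y] by (simp add: f_def abs_of_pos field_simps)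
    show "f \<in> borel_measurable borel" by (rule fm)
    have "AE y in lborel. isCont f y"
      using cont AE_lborel_singleton[of 0] AE_lborel_singleton[of pi]
      by eventually_elim
        (auto simp: f_def[abs_def] kernel_pos less_imp_neq[symmetric] intro!: continuous_divide isCont_kernel)
    then have "AE y in \<kappa>'. isCont f y"
      unfolding \<kappa>'_def by (subst AE_density) auto
    then obtain N where N: "{y \<in> space \<kappa>'. \<not> isCont f y} \<subseteq> N" "emeasure \<kappa>' N = 0" "N \<in> sets \<kappa>'"
      by (rule AE_E)
    have "emeasure \<kappa>' {y. \<not> isCont f y} \<le> emeasure \<kappa>' N"
      using N by (intro emeasure_mono) (auto simp: \<kappa>'_def)
    then show "emeasure \<kappa>' {y. \<not> isCont f y} = 0"
      using N(2) by simp
  qed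
  moreover have "integral\<^sup>L (\<kappa> n) f = r n * (\<integral>y. g y \<partial>\<nu> n) / m n" for n
    by (subst \<kappa>_int) (simp_all add: mult.assoc fk)
  moreover have "integral\<^sup>L \<kappa>' f = (\<integral>y. g y \<partial>lborel) / (4 * pi)"
    by (subst \<kappa>'_int) (simp_all add: fk)
  ultimately have "(\<lambda>n. r n * (\<integral>y. g y \<partial>\<nu> n) / m n * m n) \<longlonglongrightarrow>
      (\<integral>y. g y \<partial>lborel) / (4 * pi) * (2 * (sqrt (2 * pi) / \<sigma>))"
    using mlim by (intro tendsto_mult) simp_all
  moreover have "r n * (\<integral>y. g y \<partial>\<nu> n) / m n * m n = r n * (\<integral>y. g y \<partial>\<nu> n)" for n
    using m[of n] by simp
  moreover have "(\<integral>y. g y \<partial>lborel) / (4 * pi) * (2 * (sqrt (2 * pi) / \<sigma>)) = (\<integral>y. g y \<partial>lborel) / (\<sigma> * sqrt (2 * pi))"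
  proof -
    define q where "q = sqrt (2 * pi)"
    have q: "q > 0" "4 * pi = 2 * (q * q)" by (auto simp: q_def)
    show ?thesis
      unfolding q_def[symmetric] q(2) using q(1) \<sigma> by (simp add: field_simps)
  qed
  ultimately show ?thesis by simp
qed

section \<open>Exponential tilting of a single law\<close>

lemma power_le_fact_exp: "0 \<le> x \<Longrightarrow> x ^ k \<le> fact k * exp x" for x :: real
proof -
  assume x: "0 \<le> x"
  have "x ^ k / fact k \<le> (\<Sum>n. x ^ n / fact n)"
    using sum_le_suminf[OF summable_exp_generic[of x], of "{k}"] x by (simp add: scaleR_conv_of_real divide_inverse mult.commute)
  also have "\<dots> = exp x"
    by (simp add: exp_def scaleR_conv_of_real divide_inverse mult.commute)
  finally show ?thesis by (simp add: field_simps)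
qed

lemma exp_taylor2: "\<bar>exp x - 1 - x\<bar> \<le> x\<^sup>2 * exp \<bar>x\<bar>" for x :: real
proof -
  obtain t where t: "\<bar>t\<bar> \<le> \<bar>x\<bar>" "exp x = (\<Sum>m<2. (x ^ m) / fact m) + (exp t / fact 2) * x\<^sup>2"
    using Maclaurin_exp_le by blast
  then have "\<bar>exp x - 1 - x\<bar> = exp t / 2 * x\<^sup>2"
    by (simp add: eval_nat_numeral)
  also have "\<dots> \<le> exp \<bar>x\<bar> * x\<^sup>2"
  proof (rule mult_right_mono)
    have "exp t \<le> exp \<bar>x\<bar>" using t(1) by simp
    then show "exp t / 2 \<le> exp \<bar>x\<bar>" using exp_gt_zero[of t] by linarith
  qed simp
  finally show ?thesis by (simp add: mult.commute)
qed

text \<open>The Taylor expansion to order four leaves at least \<open>u^2 / 2 - u^4 / 24\<close>,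
  and \<open>u^4 <= u^2\<close> for \<open>|u| <= 1\<close>.\<close>

lemma one_minus_cos_ge: "\<bar>u\<bar> \<le> 1 \<Longrightarrow> u\<^sup>2 / 4 \<le> 1 - cos u" for u :: real
proof -
  assume u: "\<bar>u\<bar> \<le> 1"
  have lessThan_4: "{..<4::nat} = {0, 1, 2, 3}" by auto
  obtain t where t: "cos u = (\<Sum>m<4. cos_coeff m * u ^ m) + (cos (t + 1/2 * real 4 * pi) / fact 4) * u ^ 4"
    using Maclaurin_cos_expansion[of u 4] by blast
  have "cos (t + 1/2 * real 4 * pi) / fact 4 * u ^ 4 \<le> 1 / fact 4 * u ^ 4"
    by (intro mult_right_mono divide_right_mono) auto
  then have "cos u \<le> 1 - u\<^sup>2 / 2 + u ^ 4 / 24"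
    unfolding t by (simp add: lessThan_4 cos_coeff_def fact_numeral)
  moreover have "u ^ 4 \<le> u\<^sup>2"
    using u power_decreasing[of 2 4 "\<bar>u\<bar>"] by simp
  ultimately show ?thesis using zero_le_power2[of u] by linarith
qed

lemma lipschitz_of_continuous_deriv:
  fixes f f' :: "real \<Rightarrow> real"
  assumes d: "\<And>x. (f has_real_derivative f' x) (at x)" and c: "\<And>x. isCont f' x"
  shows "\<exists>C\<ge>0. \<forall>x y. \<bar>x\<bar> \<le> B \<longrightarrow> \<bar>y\<bar> \<le> B \<longrightarrow> \<bar>f x - f y\<bar> \<le> C * \<bar>x - y\<bar>"
proof -
  have "compact (f' ` {-B..B})"
    by (intro compact_continuous_image continuous_at_imp_continuous_on ballI c compact_Icc)
  then have "bounded (f' ` {-B..B})" by (rule compact_imp_bounded)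
  then obtain C where "\<forall>y\<in>f' ` {-B..B}. norm y \<le> C" unfolding bounded_iff ..
  then have C: "norm (f' x) \<le> C" if "x \<in> {-B..B}" for x using that by auto
  have "\<bar>f x - f y\<bar> \<le> max C 0 * \<bar>x - y\<bar>" if "\<bar>x\<bar> \<le> B" "\<bar>y\<bar> \<le> B" for x y
  proof -
    have "norm (f x - f y) \<le> max C 0 * norm (x - y)"
    proof (rule field_differentiable_bound[of "{-B..B}" f f'])
      show "(f has_field_derivative f' z) (at z within {-B..B})" for z
        by (rule has_field_derivative_at_within[OF d])
      show "norm (f' z) \<le> max C 0" if "z \<in> {-B..B}" for z
        using C[OF that] by simp
    qed (use that in auto)
    then show ?thesis by simp
  qed
  then show ?thesis by (intro exI[of _ "max C 0"]) auto
qed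

locale tiltable = real_distribution F for F :: "real measure" +
  assumes exp_moments: "\<And>t. integrable F (\<lambda>z. exp (t * z))"
    and centred: "(\<integral>z. z \<partial>F) = 0"
    and nondegenerate: "\<not> (\<exists>c. AE z in F. z = c)"
    and nonlattice: "\<And>t. t \<noteq> 0 \<Longrightarrow> cmod (char F t) < 1"
begin

lemma prob_UNIV [simp]: "measure F UNIV = 1"
  using prob_space by simp

text \<open>The power is absorbed by raising the exponential rate by one, and
  \<open>exp (c * |z|)\<close> is at most the sum of the two one-sided exponentials, which are
  integrable by assumption.\<close>

lemma integrable_abs_power_exp: "integrable F (\<lambda>z. \<bar>z\<bar> ^ k * exp (B * \<bar>z\<bar>))"
proof (rule Bochner_Integration.integrable_bound)
  show "integrable F (\<lambda>z. fact k * (exp ((B + 1) * z) + exp (- (B + 1) * z)))"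
    by (intro integrable_mult_right Bochner_Integration.integrable_add exp_moments)
  have *: "exp (c * \<bar>z\<bar>) \<le> exp (c * z) + exp (- c * z)" for c z :: real
    by (cases "z \<ge> 0") auto
  show "AE z in F. norm (\<bar>z\<bar> ^ k * exp (B * \<bar>z\<bar>)) \<le> norm (fact k * (exp ((B + 1) * z) + exp (- (B + 1) * z)))"
  proof (rule AE_I2)
    fix z :: real
    have "\<bar>z\<bar> ^ k * exp (B * \<bar>z\<bar>) \<le> fact k * exp \<bar>z\<bar> * exp (B * \<bar>z\<bar>)"
      by (intro mult_right_mono power_le_fact_exp) auto
    also have "\<dots> = fact k * exp ((B + 1) * \<bar>z\<bar>)" by (simp add: exp_add[symmetric] ring_distribs)
    also have "\<dots> \<le> fact k * (exp ((B + 1) * z) + exp (- (B + 1) * z))"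
      by (intro mult_left_mono *) auto
    finally show "norm (\<bar>z\<bar> ^ k * exp (B * \<bar>z\<bar>)) \<le> norm (fact k * (exp ((B + 1) * z) + exp (- (B + 1) * z)))"
      by (simp add: abs_mult abs_of_nonneg add_nonneg_nonneg)
  qed
qed simp

lemma exp_le_exp_abs: "\<bar>t\<bar> \<le> B \<Longrightarrow> exp (t * z) \<le> exp (B * \<bar>z\<bar>)" for t z :: real
proof -
  assume "\<bar>t\<bar> \<le> B"
  have "t * z \<le> \<bar>t\<bar> * \<bar>z\<bar>" by (simp add: abs_mult[symmetric])
  also have "\<dots> \<le> B * \<bar>z\<bar>" using \<open>\<bar>t\<bar> \<le> B\<close> by (intro mult_right_mono) auto
  finally show ?thesis by simp
qed

lemma integrable_power_exp: "integrable F (\<lambda>z. z ^ k * exp (t * z))"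
proof (rule Bochner_Integration.integrable_bound[OF integrable_abs_power_exp[of k "\<bar>t\<bar>"]])
  have "\<bar>z\<bar> ^ k * exp (t * z) \<le> \<bar>z\<bar> ^ k * exp (\<bar>t\<bar> * \<bar>z\<bar>)" for z
    by (intro mult_left_mono exp_le_exp_abs) auto
  then show "AE z in F. norm (z ^ k * exp (t * z)) \<le> norm (\<bar>z\<bar> ^ k * exp (\<bar>t\<bar> * \<bar>z\<bar>))"
    by (intro AE_I2) (simp add: abs_mult power_abs)
qed simp

text \<open>The \<open>k\<close>-th derivative of the moment generating function, kept unnormalised
  so that one lemma, \<open>deriv_mom\<close>, provides all derivatives.\<close>

definition mom :: "nat \<Rightarrow> real \<Rightarrow> real" where
  "mom k t = (\<integral>z. z ^ k * exp (t * z) \<partial>F)"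

text \<open>Differentiation under the integral with an explicit error: the second-order Taylor
  remainder of the exponential makes the difference quotient miss its limit by at most
  \<open>D * |h|\<close>. The rate \<open>|t| + 1\<close> in \<open>D\<close> leaves room for all
  \<open>|h| <= 1\<close>.\<close>

lemma deriv_mom: "(mom k has_real_derivative mom (Suc k) t) (at t)"
proof -
  define D where "D = (\<integral>z. \<bar>z\<bar> ^ (k + 2) * exp ((\<bar>t\<bar> + 1) * \<bar>z\<bar>) \<partial>F)"
  have bound: "\<bar>(mom k (t + h) - mom k t) / h - mom (Suc k) t\<bar> \<le> D * \<bar>h\<bar>" if h: "\<bar>h\<bar> \<le> 1" "h \<noteq> 0" for h
  proof -
    have "\<bar>(mom k (t + h) - mom k t) / h - mom (Suc k) t\<bar> =
        \<bar>\<integral>z. (z ^ k * exp ((t + h) * z) - z ^ k * exp (t * z)) / h - z ^ Suc k * exp (t * z) \<partial>F\<bar>"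
      unfolding mom_def using integrable_power_exp[of k] integrable_power_exp[of "Suc k"] by simp
    also have "\<bar>\<integral>z. (z ^ k * exp ((t + h) * z) - z ^ k * exp (t * z)) / h - z ^ Suc k * exp (t * z) \<partial>F\<bar> \<le> (\<integral>z. \<bar>h\<bar> * (\<bar>z\<bar> ^ (k + 2) * exp ((\<bar>t\<bar> + 1) * \<bar>z\<bar>)) \<partial>F)"
    proof (rule order.trans[OF integral_abs_bound], rule integral_mono)
      fix z :: real
      have "(z ^ k * exp ((t + h) * z) - z ^ k * exp (t * z)) / h - z ^ Suc k * exp (t * z) =
          z ^ k * exp (t * z) * ((exp (h * z) - 1 - h * z) / h)"
        using h(2) by (simp add: exp_add distrib_right) (simp add: field_simps)
      then have "\<bar>(z ^ k * exp ((t + h) * z) - z ^ k * exp (t * z)) / h - z ^ Suc k * exp (t * z)\<bar> =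
          \<bar>z\<bar> ^ k * exp (t * z) * (\<bar>exp (h * z) - 1 - h * z\<bar> / \<bar>h\<bar>)"
        by (simp add: abs_mult power_abs)
      also have "\<dots> \<le> \<bar>z\<bar> ^ k * exp (t * z) * ((h * z)\<^sup>2 * exp \<bar>h * z\<bar> / \<bar>h\<bar>)"
        by (intro mult_left_mono divide_right_mono exp_taylor2) auto
      also have "\<dots> = \<bar>h\<bar> * (\<bar>z\<bar> ^ (k + 2) * (exp (t * z) * exp (\<bar>h\<bar> * \<bar>z\<bar>)))"
      proof -
        have "(h * z)\<^sup>2 = \<bar>h\<bar> * \<bar>h\<bar> * \<bar>z\<bar>\<^sup>2" by (simp add: power_mult_distrib power2_eq_square)
        then show ?thesis using h(2) by (simp only: abs_mult power_add) (simp add: field_simps)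
      qed
      also have "\<dots> \<le> \<bar>h\<bar> * (\<bar>z\<bar> ^ (k + 2) * (exp (\<bar>t\<bar> * \<bar>z\<bar>) * exp (1 * \<bar>z\<bar>)))"
        using h(1) by (intro mult_left_mono mult_mono exp_le_exp_abs) (auto intro!: mult_left_le_one_le)
      finally show "\<bar>(z ^ k * exp ((t + h) * z) - z ^ k * exp (t * z)) / h - z ^ Suc k * exp (t * z)\<bar>
          \<le> \<bar>h\<bar> * (\<bar>z\<bar> ^ (k + 2) * exp ((\<bar>t\<bar> + 1) * \<bar>z\<bar>))"
        by (simp add: exp_add[symmetric] ring_distribs)
      show "integrable F (\<lambda>z. \<bar>h\<bar> * (\<bar>z\<bar> ^ (k + 2) * exp ((\<bar>t\<bar> + 1) * \<bar>z\<bar>)))"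
        by (intro integrable_mult_right integrable_abs_power_exp)
      show "integrable F (\<lambda>z. \<bar>(z ^ k * exp ((t + h) * z) - z ^ k * exp (t * z)) / h - z ^ Suc k * exp (t * z)\<bar>)"
        by (intro integrable_abs Bochner_Integration.integrable_diff integrable_divide integrable_power_exp)
    qed
    finally show ?thesis by (simp add: D_def mult.commute)
  qed
  have "((\<lambda>h. D * \<bar>h\<bar>) \<longlongrightarrow> D * \<bar>0\<bar>) (at 0)"
    by (intro tendsto_intros)
  then have lim: "((\<lambda>h. D * \<bar>h\<bar>) \<longlongrightarrow> 0) (at 0)" by simp
  have "\<forall>\<^sub>F h in at 0. \<bar>h::real\<bar> \<le> 1 \<and> h \<noteq> 0"
    unfolding eventually_at by (intro exI[of _ 1]) (auto simp: dist_real_def)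
  then have "\<forall>\<^sub>F h in at 0. norm ((mom k (t + h) - mom k t) / h - mom (Suc k) t) \<le> D * \<bar>h\<bar>"
    by eventually_elim (use bound in auto)
  then have "((\<lambda>h. (mom k (t + h) - mom k t) / h - mom (Suc k) t) \<longlongrightarrow> 0) (at 0)"
    by (rule Lim_null_comparison[OF _ lim])
  then show ?thesis
    unfolding DERIV_def by (rule LIM_zero_cancel)
qed

lemma isCont_mom: "isCont (mom k) t"
  by (rule DERIV_isCont[OF deriv_mom])

definition mgf :: "real \<Rightarrow> real" where "mgf = mom 0"
text \<open>Here and in \<open>var\<close>: the first and second derivatives of
  \<open>log_mgf F\<close>, which are at the same time the mean and the variance of
  \<open>tilted_law F t\<close>.\<close>

definition mean :: "real \<Rightarrow> real" where "mean t = mom 1 t / mgf t"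
definition var :: "real \<Rightarrow> real" where "var t = mom 2 t / mgf t - (mean t)\<^sup>2"

lemma mgf_eq: "mgf t = (\<integral>z. exp (t * z) \<partial>F)"
  by (simp add: mgf_def mom_def)

text \<open>Jensen's inequality for a centred law, through \<open>1 + t * z <= exp (t * z)\<close>.
  It lets upper bounds on tilted densities drop the normalisation.\<close>

lemma mgf_ge_1: "1 \<le> mgf t"
proof -
  have i: "integrable F (\<lambda>z. z)" using integrable_power_exp[of 1 0] by simp
  then have "(\<integral>z. 1 + t * z \<partial>F) \<le> mgf t"
    unfolding mgf_eq by (intro integral_mono exp_moments) (auto simp: exp_ge_add_one_self)
  then show ?thesis using i using prob_space by (simp add: centred)
qed

lemma mgf_pos: "0 < mgf t" using mgf_ge_1[of t] by linarith

lemma mgf_le: "\<bar>t\<bar> \<le> B \<Longrightarrow> mgf t \<le> (\<integral>z. exp (B * \<bar>z\<bar>) \<partial>F)"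
  unfolding mgf_eq using integrable_abs_power_exp[of 0] by (intro integral_mono exp_moments exp_le_exp_abs) auto

lemma log_mgf_eq: "log_mgf F t = ln (mgf t)"
  by (simp add: log_mgf_def mgf_eq)

lemma deriv_log_mgf: "(log_mgf F has_real_derivative mean t) (at t)"
  unfolding log_mgf_eq[abs_def] mean_def using deriv_mom[of 0 t] mgf_pos[of t]
  by (auto intro!: derivative_eq_intros simp: mgf_def)

lemma deriv_mean: "(mean has_real_derivative var t) (at t)"
  unfolding mean_def[abs_def] var_def mgf_def using mgf_pos[of t]
  by (intro DERIV_cong[OF DERIV_divide[OF deriv_mom deriv_mom]])
    (auto simp: mgf_def mean_def numeral_2_eq_2 power2_eq_square field_simps)

lemma isCont_mgf: "isCont mgf t" unfolding mgf_def by (rule isCont_mom)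

lemma isCont_mean: "isCont mean t" by (rule DERIV_isCont[OF deriv_mean])

lemma isCont_var: "isCont var t"
  unfolding var_def[abs_def] using mgf_pos[of t]
  by (intro continuous_intros isCont_mom isCont_mgf isCont_mean) auto

lemma mean_lipschitz:
  "\<exists>C\<ge>0. \<forall>x y. \<bar>x\<bar> \<le> B \<longrightarrow> \<bar>y\<bar> \<le> B \<longrightarrow> \<bar>mean x - mean y\<bar> \<le> C * \<bar>x - y\<bar>"
  by (rule lipschitz_of_continuous_deriv[OF deriv_mean isCont_var])

lemma var_lipschitz:
  "\<exists>C\<ge>0. \<forall>x y. \<bar>x\<bar> \<le> B \<longrightarrow> \<bar>y\<bar> \<le> B \<longrightarrow> \<bar>var x - var y\<bar> \<le> C * \<bar>x - y\<bar>"
proof (rule lipschitz_of_continuous_deriv)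
  define D where "D t = (mom (Suc 2) t * mom 0 t - mom 2 t * mom (Suc 0) t) / (mom 0 t * mom 0 t) - 
    real 2 * (var t * mean t ^ (2 - Suc 0))" for t
  show "(var has_real_derivative D t) (at t)" for t
  proof -
    have "((\<lambda>t. mom 2 t / mom 0 t - (mean t)\<^sup>2) has_real_derivative D t) (at t)"
      unfolding D_def using mgf_pos[of t]
      by (intro DERIV_diff DERIV_divide deriv_mom DERIV_power deriv_mean) (auto simp: mgf_def)
    then show ?thesis by (simp add: var_def[abs_def] mgf_def)
  qed
  show "isCont D t" for t
    unfolding D_def using mgf_pos[of t] by (intro continuous_intros isCont_mom isCont_mean isCont_var) (auto simp: mgf_def)
qed

abbreviation G :: "real \<Rightarrow> real measure" where "G \<equiv> tilted_law F"

lemma tilted_density: "exp (- log_mgf F t + t * x) = exp (t * x) / mgf t"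
  using mgf_pos[of t] by (simp add: log_mgf_eq exp_diff)

lemma sets_tilted [simp, measurable_cong]: "sets (G t) = sets borel"
  by (simp add: tilted_law_def)

lemma integral_tilted:
  fixes f :: "real \<Rightarrow> 'b :: {banach, second_countable_topology}"
  assumes [measurable]: "f \<in> borel_measurable borel"
  shows "(\<integral>z. f z \<partial>G t) = (\<integral>z. (exp (t * z) / mgf t) *\<^sub>R f z \<partial>F)"
  unfolding tilted_law_def tilted_density using mgf_pos[of t] by (intro integral_density) auto

lemma integrable_tilted_iff:
  fixes f :: "real \<Rightarrow> 'b :: {banach, second_countable_topology}"
  assumes [measurable]: "f \<in> borel_measurable borel"
  shows "integrable (G t) f \<longleftrightarrow> integrable F (\<lambda>z. (exp (t * z) / mgf t) *\<^sub>R f z)"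
  unfolding tilted_law_def tilted_density using mgf_pos[of t] by (intro integrable_density) auto

lemma real_distribution_tilted: "real_distribution (G t)"
proof (intro real_distribution.intro real_distribution_axioms.intro prob_spaceI)
  have "emeasure (G t) (space (G t)) = (\<integral>\<^sup>+z. ennreal (exp (t * z) / mgf t) \<partial>F)"
    unfolding tilted_law_def tilted_density by (subst emeasure_density) auto
  also have "\<dots> = ennreal (\<integral>z. exp (t * z) / mgf t \<partial>F)"
    using exp_moments[of t] mgf_pos[of t] by (intro nn_integral_eq_integral) auto
  also have "(\<integral>z. exp (t * z) / mgf t \<partial>F) = 1"
    using mgf_pos[of t] by (simp add: mgf_eq[symmetric])
  finally show "emeasure (G t) (space (G t)) = 1" by simp
qed simp

lemma AE_tilted_iff: "(AE z in G t. P z) \<longleftrightarrow> (AE z in F. P z)" if [measurable]: "Measurable.pred borel P"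
  unfolding tilted_law_def by (subst AE_density) (auto simp: exp_gt_zero)

lemma integrable_tilted_abs_power: "integrable (G t) (\<lambda>z. \<bar>z\<bar> ^ k)"
proof (subst integrable_tilted_iff)
  have "integrable F (\<lambda>z. \<bar>z ^ k * exp (t * z)\<bar> / mgf t)"
    using integrable_power_exp[of k t] by auto
  then show "integrable F (\<lambda>z. (exp (t * z) / mgf t) *\<^sub>R \<bar>z\<bar> ^ k)"
    by (simp add: abs_mult power_abs mult.commute)
qed simp

lemma integrable_tilted_power: "integrable (G t) (\<lambda>z. z ^ k)"
  using integrable_tilted_abs_power[of t k] by (rule Bochner_Integration.integrable_bound) (auto simp: power_abs)

lemma tilted_power: "(\<integral>z. z ^ k \<partial>G t) = mom k t / mgf t"
  by (subst integral_tilted) (simp_all add: mom_def mult.commute)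

text \<open>Since \<open>mgf t >= 1\<close>, the tilted density is at most
  \<open>exp (B * |z|)\<close>, a bound that does not depend on the tilt.\<close>

lemma mgf_bound_abs_power:
  assumes "\<bar>t\<bar> \<le> B"
  shows "(\<integral>z. \<bar>z\<bar> ^ k \<partial>G t) \<le> (\<integral>z. \<bar>z\<bar> ^ k * exp (B * \<bar>z\<bar>) \<partial>F)"
proof (subst integral_tilted)
  show "(\<integral>z. (exp (t * z) / mgf t) *\<^sub>R \<bar>z\<bar> ^ k \<partial>F) \<le> (\<integral>z. \<bar>z\<bar> ^ k * exp (B * \<bar>z\<bar>) \<partial>F)"
  proof (rule integral_mono)
    show "integrable F (\<lambda>z. (exp (t * z) / mgf t) *\<^sub>R \<bar>z\<bar> ^ k)"
      using integrable_tilted_abs_power[of t k] by (subst (asm) integrable_tilted_iff) auto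
    show "integrable F (\<lambda>z. \<bar>z\<bar> ^ k * exp (B * \<bar>z\<bar>))" by (rule integrable_abs_power_exp)
    fix z
    have "exp (t * z) / mgf t \<le> exp (t * z)"
      using mgf_ge_1[of t] by (simp add: field_simps)
    also have "\<dots> \<le> exp (B * \<bar>z\<bar>)" using assms by (rule exp_le_exp_abs)
    finally have "(exp (t * z) / mgf t) * \<bar>z\<bar> ^ k \<le> exp (B * \<bar>z\<bar>) * \<bar>z\<bar> ^ k"
      by (rule mult_right_mono) simp
    then show "(exp (t * z) / mgf t) *\<^sub>R \<bar>z\<bar> ^ k \<le> \<bar>z\<bar> ^ k * exp (B * \<bar>z\<bar>)"
      by (simp add: mult.commute)
  qed
qed simp

lemma variance_tilted: "(\<integral>z. (z - mean t)\<^sup>2 \<partial>G t) = var t"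
proof -
  interpret G: real_distribution "G t" by (rule real_distribution_tilted)
  have "(\<integral>z. (z - mean t)\<^sup>2 \<partial>G t) = (\<integral>z. z\<^sup>2 - 2 * mean t * z ^ 1 + (mean t)\<^sup>2 \<partial>G t)"
    by (simp add: power2_diff algebra_simps)
  also have "\<dots> = mom 2 t / mgf t - 2 * mean t * (mom 1 t / mgf t) + (mean t)\<^sup>2"
    using integrable_tilted_power[of t 1] integrable_tilted_power[of t 2] tilted_power[of t 1] tilted_power[of t 2]
    using G.prob_space by simp
  finally show ?thesis by (simp add: var_def mean_def power2_eq_square)
qed

text \<open>The tilted density is positive, so \<open>G t\<close> and \<open>F\<close> have the same
  null sets; zero variance would make \<open>F\<close> itself degenerate.\<close>

lemma var_pos: "0 < var t"
proof -
  have i: "integrable (G t) (\<lambda>z. (z - mean t)\<^sup>2)"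
  proof -
    interpret G: real_distribution "G t" by (rule real_distribution_tilted)
    show ?thesis
      using integrable_tilted_power[of t 1] integrable_tilted_power[of t 2] by (simp add: power2_diff)
  qed
  have "var t \<noteq> 0"
  proof
    assume "var t = 0"
    then have "AE z in G t. (z - mean t)\<^sup>2 = 0"
      using i unfolding variance_tilted[symmetric] by (subst (asm) integral_nonneg_eq_0_iff_AE) auto
    then have "AE z in F. (z - mean t)\<^sup>2 = 0" by (subst (asm) AE_tilted_iff) auto
    then have "AE z in F. z = mean t" by eventually_elim simp
    then show False using nondegenerate by blast
  qed
  moreover have "var t \<ge> 0" unfolding variance_tilted[symmetric] by (intro Bochner_Integration.integral_nonneg) simp
  ultimately show ?thesis by linarith
qed

lemma mean_strict_mono: "s < t \<Longrightarrow> mean s < mean t"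
  by (rule DERIV_pos_imp_increasing) (use deriv_mean var_pos in auto)

lemma mean_0: "mean 0 = 0"
  by (simp add: mean_def mom_def centred)

text \<open>Pick \<open>y\<close> strictly between \<open>x\<close> and the right endpoint. The mass
  \<open>p\<close> beyond \<open>y\<close> forces \<open>log_mgf F t >= t * y + ln p\<close>, so for
  large \<open>t\<close> the average slope of \<open>log_mgf F\<close> on \<open>[0, t]\<close>
  exceeds \<open>x\<close>. The mean value theorem yields a point where \<open>mean\<close> exceeds
  \<open>x\<close>, the intermediate value theorem one where it equals \<open>x\<close>; strict
  monotonicity makes it unique, as the definite description requires.\<close>

lemma tilt_param:
  assumes x: "0 < x" "ereal x < right_endpoint F"
  shows "0 < tilt_param F x" "mean (tilt_param F x) = x"
proof -
  obtain y where y: "x < y" "cdf F y < 1"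
    using x(2) unfolding right_endpoint_def less_Sup_iff by auto
  define p where "p = 1 - cdf F y"
  have p: "p > 0" using y by (simp add: p_def)
  have low: "log_mgf F t \<ge> t * y + ln p" if "t > 0" for t
  proof -
    have "measure F {y<..} = p"
    proof -
      have "measure F {y<..} = measure F (space F - {..y})" by (rule arg_cong[where f="measure F"]) auto
      then show ?thesis using prob_compl[of "{..y}"] by (simp add: p_def cdf_def)
    qed
    then have "exp (t * y) * p = (\<integral>z. exp (t * y) * indicator {y<..} z \<partial>F)" by simp
    also have "\<dots> \<le> mgf t"
      unfolding mgf_eq using that
      by (intro integral_mono exp_moments integrable_mult_right integrable_real_indicator)
        (auto simp: indicator_def emeasure_eq_measure)
    finally have "ln (exp (t * y) * p) \<le> ln (mgf t)"
      using p by (intro ln_mono) auto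
    then show ?thesis using p by (simp add: log_mgf_eq ln_mult)
  qed
  \<comment> \<open>Large enough that \<open>t * (y - x)\<close> outweighs \<open>- ln p\<close> by
    at least \<open>1\<close>.\<close>
  define t where "t = max 1 ((1 - ln p) / (y - x))"
  have t: "t > 0" by (simp add: t_def)
  have "t * (y - x) \<ge> 1 - ln p"
  proof -
    have "(1 - ln p) / (y - x) \<le> t" by (simp add: t_def)
    then show ?thesis using y(1) by (simp add: field_simps)
  qed
  then have pos: "log_mgf F t - t * x > 0"
    using low[OF t] by (simp add: algebra_simps)
  obtain s where s: "0 < s" "s < t" "log_mgf F t - log_mgf F 0 = (t - 0) * mean s"
    using MVT2[of 0 t "log_mgf F" mean] t deriv_log_mgf by blast
  have "mean s > x"
  proof -
    have "log_mgf F 0 = 0" by (simp add: log_mgf_eq mgf_eq prob_space)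
    then have "t * x < t * mean s" using s(3) pos by simp
    then show ?thesis using t by simp
  qed
  then obtain r where r: "0 \<le> r" "r \<le> s" "mean r = x"
    using IVT[of mean 0 x s] x(1) s(1) isCont_mean by (auto simp: mean_0)
  then have r0: "r > 0" using x(1) mean_0 by (cases "r = 0") auto
  have "tilt_param F x = r"
    unfolding tilt_param_def
  proof (rule the_equality)
    show "0 < r \<and> (log_mgf F has_real_derivative x) (at r)" using r0 r(3) deriv_log_mgf[of r] by simp
    fix u assume "0 < u \<and> (log_mgf F has_real_derivative x) (at u)"
    then have "mean u = x" using DERIV_unique[OF deriv_log_mgf[of u]] by simp
    then show "u = r" using r(3) mean_strict_mono[of u r] mean_strict_mono[of r u] by (cases u r rule: linorder_cases) auto
  qed
  then show "0 < tilt_param F x" "mean (tilt_param F x) = x" using r0 r(3) by auto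
qed

end

section \<open>Gaussian approximation of the characteristic functions of the tilted laws\<close>

lemma exp_neg_approx: "0 \<le> x \<Longrightarrow> \<bar>exp (- x) - (1 - x)\<bar> \<le> x\<^sup>2 / 2" for x :: real
proof -
  assume x: "0 \<le> x"
  have "exp (-x) \<ge> 1 - x" using exp_ge_add_one_self[of "-x"] by simp
  moreover have "exp (-x) \<le> 1 - x + x\<^sup>2 / 2"
  proof -
    have "((\<lambda>x. 1 - x + x\<^sup>2 / 2 - exp (-x)) has_real_derivative (- 1 + y + exp (-y))) (at y)" for y :: real
      by (auto intro!: derivative_eq_intros)
    then have "1 - 0 + 0\<^sup>2 / 2 - exp (-0) \<le> 1 - x + x\<^sup>2 / 2 - exp (-x)"
    proof (intro DERIV_nonneg_imp_nondecreasing[OF x] exI conjI)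
      show "0 \<le> - 1 + y + exp (- y)" for y :: real using exp_ge_add_one_self[of "-y"] by linarith
    qed
    then show ?thesis by simp
  qed
  ultimately show ?thesis by simp
qed

context tiltable
begin

lemma mean_bounded: "\<exists>C. \<forall>t. \<bar>t\<bar> \<le> B \<longrightarrow> \<bar>mean t\<bar> \<le> C"
proof -
  obtain C where C: "\<And>x y. \<bar>x\<bar> \<le> B \<Longrightarrow> \<bar>y\<bar> \<le> B \<Longrightarrow> \<bar>mean x - mean y\<bar> \<le> C * \<bar>x - y\<bar>" "C \<ge> 0"
    using mean_lipschitz[of B] by blast
  have "\<bar>mean t\<bar> \<le> C * B" if "\<bar>t\<bar> \<le> B" for t
    using C(1)[of t 0] that mult_left_mono[OF that C(2)] abs_ge_zero[of t] by (simp add: mean_0)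
  then show ?thesis by blast
qed

lemma third_moment_bounded: "\<exists>C\<ge>0. \<forall>t. \<bar>t\<bar> \<le> B \<longrightarrow> (\<integral>z. \<bar>z - mean t\<bar> ^ 3 \<partial>G t) \<le> C"
proof -
  obtain C where C: "\<And>t. \<bar>t\<bar> \<le> B \<Longrightarrow> \<bar>mean t\<bar> \<le> C" using mean_bounded by blast
  define D where "D = 4 * (\<integral>z. \<bar>z\<bar> ^ 3 * exp (B * \<bar>z\<bar>) \<partial>F) + 4 * \<bar>C\<bar> ^ 3"
  have "(\<integral>z. \<bar>z - mean t\<bar> ^ 3 \<partial>G t) \<le> D" if t: "\<bar>t\<bar> \<le> B" for t
  proof -
    interpret G: real_distribution "G t" by (rule real_distribution_tilted)
    have *: "\<bar>z - mean t\<bar> ^ 3 \<le> 4 * \<bar>z\<bar> ^ 3 + 4 * \<bar>C\<bar> ^ 3" for z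
    proof -
      have "\<bar>z - mean t\<bar> ^ 3 \<le> (\<bar>z\<bar> + \<bar>C\<bar>) ^ 3"
        using C[OF t] by (intro power_mono) auto
      also have "\<dots> \<le> 4 * \<bar>z\<bar> ^ 3 + 4 * \<bar>C\<bar> ^ 3"
      proof -
        \<comment> \<open>Convexity of the cube on nonnegative reals, as an explicit
          identity.\<close>
        have "4 * x ^ 3 + 4 * y ^ 3 - (x + y) ^ 3 = 3 * ((x - y)\<^sup>2 * (x + y))" for x y :: real
          by (simp add: eval_nat_numeral algebra_simps)
        moreover have "0 \<le> 3 * ((\<bar>z\<bar> - \<bar>C\<bar>)\<^sup>2 * (\<bar>z\<bar> + \<bar>C\<bar>))" by simp
        ultimately show ?thesis by (metis diff_ge_0_iff_ge)
      qed
      finally show ?thesis .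
    qed
    have "(\<integral>z. \<bar>z - mean t\<bar> ^ 3 \<partial>G t) \<le> (\<integral>z. 4 * \<bar>z\<bar> ^ 3 + 4 * \<bar>C\<bar> ^ 3 \<partial>G t)"
    proof (rule integral_mono[OF _ _ *])
      show i: "integrable (G t) (\<lambda>z. 4 * \<bar>z\<bar> ^ 3 + 4 * \<bar>C\<bar> ^ 3)"
        using integrable_tilted_abs_power by (intro Bochner_Integration.integrable_add integrable_mult_right) auto
      show "integrable (G t) (\<lambda>z. \<bar>z - mean t\<bar> ^ 3)"
        by (rule Bochner_Integration.integrable_bound[OF i]) (use * in \<open>auto intro!: AE_I2 order.trans[OF _ abs_ge_self]\<close>)
    qed
    also have "\<dots> = 4 * (\<integral>z. \<bar>z\<bar> ^ 3 \<partial>G t) + 4 * \<bar>C\<bar> ^ 3"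
      using integrable_tilted_abs_power[of t 3] G.prob_space by simp
    also have "\<dots> \<le> D" unfolding D_def using mgf_bound_abs_power[OF t, of 3] by simp
    finally show ?thesis .
  qed
  then show ?thesis by (intro exI[of _ "\<bar>D\<bar>"]) force
qed

text \<open>The centred characteristic function and the Gaussian both agree with
  \<open>1 - s^2 * var t / 2\<close>: the former up to a cubic error controlled by third moments,
  the latter up to a quartic error, which \<open>|s| <= S\<close> turns into a cubic one. Third
  moments and variances are bounded uniformly over \<open>|t| <= B\<close>.\<close>

lemma char_tilted_approx:
  "\<exists>C\<ge>0. \<forall>t s. \<bar>t\<bar> \<le> B \<longrightarrow> \<bar>s\<bar> \<le> S \<longrightarrow>
     cmod (char (G t) s * iexp (- (s * mean t)) - exp (- (s\<^sup>2 * var t / 2))) \<le> C * \<bar>s\<bar> ^ 3"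
proof -
  obtain C where C: "C \<ge> 0" "\<And>t. \<bar>t\<bar> \<le> B \<Longrightarrow> (\<integral>z. \<bar>z - mean t\<bar> ^ 3 \<partial>G t) \<le> C"
    using third_moment_bounded[of B] by blast
  have "\<exists>V. \<forall>t. \<bar>t\<bar> \<le> B \<longrightarrow> var t \<le> V"
  proof -
    have "compact (var ` {-B..B})"
      by (intro compact_continuous_image continuous_at_imp_continuous_on ballI isCont_var compact_Icc)
    then have "bounded (var ` {-B..B})" by (rule compact_imp_bounded)
    then obtain V where "\<forall>y\<in>var ` {-B..B}. norm y \<le> V" unfolding bounded_iff ..
    then have "var t \<le> V" if "\<bar>t\<bar> \<le> B" for t using that by (auto simp: abs_le_iff)
    then show ?thesis by blast
  qed
  then obtain V where V: "\<And>t. \<bar>t\<bar> \<le> B \<Longrightarrow> var t \<le> V" by blast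
  define D where "D = C / 6 + \<bar>S\<bar> * V\<^sup>2 / 8"
  have "cmod (char (G t) s * iexp (- (s * mean t)) - exp (- (s\<^sup>2 * var t / 2))) \<le> D * \<bar>s\<bar> ^ 3"
    if t: "\<bar>t\<bar> \<le> B" and s: "\<bar>s\<bar> \<le> S" for t s
  proof -
    interpret G: real_distribution "G t" by (rule real_distribution_tilted)
    define X where "X z = z - mean t" for z
    have i1: "integrable (G t) X"
      using integrable_tilted_power[of t 1] by (simp add: X_def[abs_def])
    have i2: "integrable (G t) (\<lambda>z. (X z)\<^sup>2)"
      using integrable_tilted_power[of t 1] integrable_tilted_power[of t 2] by (simp add: X_def power2_diff)
    have i3: "integrable (G t) (\<lambda>z. \<bar>X z\<bar> ^ 3)"
    proof -
      have "integrable (G t) (\<lambda>z. \<bar>z ^ 3 - 3 * mean t * z ^ 2 + 3 * (mean t)\<^sup>2 * z ^ 1 - mean t ^ 3\<bar>)"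
        by (intro integrable_abs Bochner_Integration.integrable_diff Bochner_Integration.integrable_add
            integrable_mult_right integrable_tilted_power G.integrable_const)
      also have "(\<lambda>z. \<bar>z ^ 3 - 3 * mean t * z ^ 2 + 3 * (mean t)\<^sup>2 * z ^ 1 - mean t ^ 3\<bar>) = (\<lambda>z. \<bar>X z\<bar> ^ 3)"
        by (simp add: power_abs[symmetric] X_def) (simp add: eval_nat_numeral algebra_simps)
      finally show ?thesis .
    qed
    have e1: "G.expectation X = 0"
      using integrable_tilted_power[of t 1] tilted_power[of t 1] G.prob_space by (simp add: X_def[abs_def] mean_def)
    have ch: "char (distr (G t) borel X) s = char (G t) s * iexp (- (s * mean t))"
    proof -
      have "char (distr (G t) borel X) s = (CLINT z|G t. iexp (s * z) * iexp (- (s * mean t)))"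
        unfolding char_def X_def by (subst integral_distr) (auto simp: exp_add[symmetric] algebra_simps)
      then show ?thesis unfolding char_def by simp
    qed
    have "cmod (char (distr (G t) borel X) s - (1 - s^2 * var t / 2)) \<le>
        (s^2 / 6) * G.expectation (\<lambda>x. min (6 * (X x)^2) (\<bar>s\<bar> * \<bar>X x\<bar>^3))"
      by (rule G.char_approx3'[OF _ i1 i2 e1]) (use e1 variance_tilted[of t] in \<open>auto simp: X_def[abs_def]\<close>)
    also have "\<dots> \<le> (s^2 / 6) * (\<bar>s\<bar> * C)"
    proof (rule mult_left_mono)
      have "G.expectation (\<lambda>x. min (6 * (X x)^2) (\<bar>s\<bar> * \<bar>X x\<bar>^3)) \<le> G.expectation (\<lambda>x. \<bar>s\<bar> * \<bar>X x\<bar>^3)"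
        by (rule integral_mono) (use i2 i3 in auto)
      also have "\<dots> \<le> \<bar>s\<bar> * C" using C(2)[OF t] by (simp add: X_def mult_left_mono)
      finally show "G.expectation (\<lambda>x. min (6 * (X x)^2) (\<bar>s\<bar> * \<bar>X x\<bar>^3)) \<le> \<bar>s\<bar> * C" .
    qed simp
    also have "\<dots> = C / 6 * \<bar>s\<bar> ^ 3" by (simp add: power3_eq_cube power2_eq_square)
    finally have 1: "cmod (char (G t) s * iexp (- (s * mean t)) - (1 - s^2 * var t / 2)) \<le> C / 6 * \<bar>s\<bar> ^ 3"
      unfolding ch .
    have "\<bar>exp (- (s\<^sup>2 * var t / 2)) - (1 - s\<^sup>2 * var t / 2)\<bar> \<le> (s\<^sup>2 * var t / 2)\<^sup>2 / 2"
      by (rule exp_neg_approx) (use var_pos[of t] in \<open>auto simp: less_imp_le\<close>)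
    also have "\<dots> = \<bar>s\<bar> * \<bar>s\<bar> ^ 3 * (var t)\<^sup>2 / 8"
      by (simp add: power2_eq_square power3_eq_cube)
    also have "\<dots> \<le> \<bar>S\<bar> * \<bar>s\<bar> ^ 3 * V\<^sup>2 / 8"
      using s V[OF t] var_pos[of t] by (intro divide_right_mono mult_mono power_mono) auto
    also have "\<dots> = \<bar>S\<bar> * V\<^sup>2 / 8 * \<bar>s\<bar> ^ 3" by simp
    finally have 2: "\<bar>exp (- (s\<^sup>2 * var t / 2)) - (1 - s\<^sup>2 * var t / 2)\<bar> \<le> \<bar>S\<bar> * V\<^sup>2 / 8 * \<bar>s\<bar> ^ 3" .
    have "cmod (complex_of_real (exp (- (s\<^sup>2 * var t / 2))) - (1 - s\<^sup>2 * var t / 2)) \<le> \<bar>S\<bar> * V\<^sup>2 / 8 * \<bar>s\<bar> ^ 3"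
      using 2 by (metis (no_types, lifting) norm_of_real of_real_1 of_real_diff)
    then show ?thesis
      using 1 norm_triangle_ineq4[of "char (G t) s * iexp (- (s * mean t)) - (1 - s^2 * var t / 2)"
          "complex_of_real (exp (- (s\<^sup>2 * var t / 2))) - (1 - s\<^sup>2 * var t / 2)"]
      by (simp add: D_def distrib_right)
  qed
  moreover have "D \<ge> 0" using C by (simp add: D_def)
  ultimately show ?thesis by blast
qed

subsection \<open>Uniform decay of the characteristic functions of the tilted laws\<close>

text \<open>An unnormalised expectation over a bounded interval. On such an interval the tilted
  densities are bounded away from zero, uniformly over bounded tilts, so truncated quantities of
  \<open>F\<close> can bound those of \<open>G t\<close> from below.\<close>

definition trunc :: "nat \<Rightarrow> (real \<Rightarrow> real) \<Rightarrow> real" where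
  "trunc R f = (\<integral>z. indicator {- real R..real R} z * f z \<partial>F)"

lemma integrable_trunc:
  fixes f :: "real \<Rightarrow> real"
  assumes [measurable]: "f \<in> borel_measurable borel" and "\<And>z. \<bar>z\<bar> \<le> real R \<Longrightarrow> \<bar>f z\<bar> \<le> c"
  shows "integrable F (\<lambda>z. indicator {- real R..real R} z * f z)"
  by (rule integrable_const_bound[where B="max 0 c"]) (use assms in \<open>force simp: indicator_def abs_le_iff\<close>)+

lemma trunc_tendsto: "integrable F f \<Longrightarrow> (\<lambda>R. trunc R f) \<longlonglongrightarrow> (\<integral>z. f z \<partial>F)"
  unfolding trunc_def
proof (rule integral_dominated_convergence[where w="\<lambda>z. \<bar>f z\<bar>"])
  assume f: "integrable F f"
  then show "f \<in> borel_measurable F" by simp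
  show "(\<lambda>z. indicator {- real R..real R} z * f z) \<in> borel_measurable F" for R
    using f by simp
  show "integrable F (\<lambda>z. \<bar>f z\<bar>)" using f by simp
  show "AE z in F. norm (indicator {- real R..real R} z * f z) \<le> \<bar>f z\<bar>" for R
    by (auto simp: indicator_def)
  have "(\<lambda>R. indicator {- real R..real R} z * f z) \<longlonglongrightarrow> f z" for z
  proof (rule tendsto_eventually)
    show "\<forall>\<^sub>F R in sequentially. indicator {- real R..real R} z * f z = f z"
      using eventually_ge_at_top[of "nat \<lceil>\<bar>z\<bar>\<rceil>"] by eventually_elim (auto simp: indicator_def)
  qed
  then show "AE z in F. (\<lambda>R. indicator {- real R..real R} z * f z) \<longlonglongrightarrow> f z" by simp
qed

text \<open>
  Up to normalisation, \<open>sym_gap\<close> is \<open>1 - |char|^2\<close> for the restriction of \<open>F\<close> to \<open>[-R, R]\<close>. It is the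
  double integral of \<open>1 - cos (s * (z - z'))\<close>, hence monotone in \<open>R\<close> and, unlike \<open>|char|\<close> itself,
  easily compared with the corresponding quantity of a tilted law.
\<close>

definition sym_gap :: "nat \<Rightarrow> real \<Rightarrow> real" where
  "sym_gap R s = (trunc R (\<lambda>_. 1))\<^sup>2 - (trunc R (\<lambda>z. cos (s * z)))\<^sup>2 - (trunc R (\<lambda>z. sin (s * z)))\<^sup>2"

lemma trunc_cos_diff: "trunc R (\<lambda>z'. 1 - cos (s * (z - z'))) =
    trunc R (\<lambda>_. 1) - cos (s * z) * trunc R (\<lambda>z. cos (s * z)) - sin (s * z) * trunc R (\<lambda>z. sin (s * z))"
proof -
  have i: "integrable F (\<lambda>z. indicator {- real R..real R} z * cos (s * z))"
    "integrable F (\<lambda>z. indicator {- real R..real R} z * sin (s * z))"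
    "integrable F (\<lambda>z. indicator {- real R..real R} z :: real)"
    using integrable_trunc[of "\<lambda>z. cos (s * z)" R 1] integrable_trunc[of "\<lambda>z. sin (s * z)" R 1]
      integrable_trunc[of "\<lambda>z. 1::real" R 1] by auto
  have "trunc R (\<lambda>z'. 1 - cos (s * (z - z'))) = (\<integral>z'. indicator {- real R..real R} z' -
    cos (s * z) * (indicator {- real R..real R} z' * cos (s * z')) -
    sin (s * z) * (indicator {- real R..real R} z' * sin (s * z')) \<partial>F)"
    unfolding trunc_def by (intro Bochner_Integration.integral_cong) (auto simp: cos_diff right_diff_distrib indicator_def)
  also have "\<dots> = trunc R (\<lambda>_. 1) - cos (s * z) * trunc R (\<lambda>z. cos (s * z)) - sin (s * z) * trunc R (\<lambda>z. sin (s * z))"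
    unfolding trunc_def using i by (simp del: integral_indicator)
  finally show ?thesis .
qed

lemma sym_gap_eq: "sym_gap R s = trunc R (\<lambda>z. trunc R (\<lambda>z'. 1 - cos (s * (z - z'))))"
proof -
  have i: "integrable F (\<lambda>z. indicator {- real R..real R} z * cos (s * z))"
    "integrable F (\<lambda>z. indicator {- real R..real R} z * sin (s * z))"
    "integrable F (\<lambda>z. indicator {- real R..real R} z :: real)"
    using integrable_trunc[of "\<lambda>z. cos (s * z)" R 1] integrable_trunc[of "\<lambda>z. sin (s * z)" R 1]
      integrable_trunc[of "\<lambda>z. 1::real" R 1] by auto
  have "trunc R (\<lambda>z. trunc R (\<lambda>z'. 1 - cos (s * (z - z')))) = (\<integral>z.
      trunc R (\<lambda>_. 1) * indicator {- real R..real R} z -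
      trunc R (\<lambda>z. cos (s * z)) * (indicator {- real R..real R} z * cos (s * z)) -
      trunc R (\<lambda>z. sin (s * z)) * (indicator {- real R..real R} z * sin (s * z)) \<partial>F)"
    unfolding trunc_cos_diff by (subst trunc_def, intro Bochner_Integration.integral_cong) (auto simp: indicator_def)
  also have "\<dots> = sym_gap R s"
    unfolding sym_gap_def using i by (simp del: integral_indicator) (simp add: trunc_def power2_eq_square del: integral_indicator)
  finally show ?thesis by simp
qed

lemma trunc_mono:
  assumes "f \<in> borel_measurable borel" "g \<in> borel_measurable borel"
    and "\<And>z. \<bar>z\<bar> \<le> real R \<Longrightarrow> \<bar>f z\<bar> \<le> c" "\<And>z. \<bar>z\<bar> \<le> real R \<Longrightarrow> \<bar>g z\<bar> \<le> d"
    and "\<And>z. \<bar>z\<bar> \<le> real R \<Longrightarrow> f z \<le> g z"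
  shows "trunc R f \<le> trunc R g"
  unfolding trunc_def
  by (intro integral_mono integrable_trunc[OF assms(1) assms(3)] integrable_trunc[OF assms(2) assms(4)])
    (use assms(5) in \<open>auto simp: indicator_def abs_le_iff\<close>)

lemma trunc_mono_radius:
  assumes R: "R \<le> R'" and f: "f \<in> borel_measurable borel" and b: "\<And>z. \<bar>z\<bar> \<le> real R' \<Longrightarrow> 0 \<le> f z \<and> f z \<le> c"
  shows "trunc R f \<le> trunc R' f"
  unfolding trunc_def
proof (intro integral_mono)
  show "integrable F (\<lambda>z. indicator {- real R..real R} z * f z)"
    using R by (intro integrable_trunc[OF f, of _ c]) (use b in force)
  show "integrable F (\<lambda>z. indicator {- real R'..real R'} z * f z)"
    by (intro integrable_trunc[OF f, of _ c]) (use b in force)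
  show "indicator {- real R..real R} z * f z \<le> indicator {- real R'..real R'} z * f z" for z
    using R b[of z] by (auto simp: indicator_def abs_le_iff)
qed

lemma trunc_cmult: "trunc R (\<lambda>z. c * f z) = c * trunc R f"
  unfolding trunc_def by (subst integral_mult_right_zero[symmetric]) (simp add: ac_simps)

lemma sym_gap_mono: "R \<le> R' \<Longrightarrow> sym_gap R s \<le> sym_gap R' s"
proof -
  assume R: "R \<le> R'"
  have [measurable]: "(\<lambda>z. trunc R (\<lambda>z'. 1 - cos (s * (z - z')))) \<in> borel_measurable borel" for R
    unfolding trunc_cos_diff by measurable
  have p: "0 \<le> trunc R (\<lambda>z'. 1 - cos (s * (z - z')))" for z R
    unfolding trunc_def by (intro Bochner_Integration.integral_nonneg) (auto simp: indicator_def)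
  have q: "trunc R (\<lambda>z'. 1 - cos (s * (z - z'))) \<le> 2 * trunc R (\<lambda>z. 1)" for z R
    unfolding trunc_cmult[symmetric] using cos_ge_minus_one
    by (intro trunc_mono[of _ _ _ 2 2]) (auto simp: abs_le_iff intro: order.trans[OF _ cos_ge_minus_one])
  have "sym_gap R s \<le> trunc R (\<lambda>z. trunc R' (\<lambda>z'. 1 - cos (s * (z - z'))))"
    unfolding sym_gap_eq
  proof (rule trunc_mono)
    show "trunc R (\<lambda>z'. 1 - cos (s * (z - z'))) \<le> trunc R' (\<lambda>z'. 1 - cos (s * (z - z')))" for z
      by (rule trunc_mono_radius[OF R, of _ 2]) (auto intro: order.trans[OF _ cos_ge_minus_one] simp: diff_le_eq add_increasing2 real_0_le_add_iff)
    show "\<bar>trunc R (\<lambda>z'. 1 - cos (s * (z - z')))\<bar> \<le> 2 * trunc R (\<lambda>z. 1)"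
      "\<bar>trunc R' (\<lambda>z'. 1 - cos (s * (z - z')))\<bar> \<le> 2 * trunc R' (\<lambda>z. 1)" for z
      using p q by (simp_all add: abs_of_nonneg)
  qed measurable
  also have "\<dots> \<le> sym_gap R' s"
    unfolding sym_gap_eq using p q by (intro trunc_mono_radius[OF R, where c="2 * trunc R' (\<lambda>z. 1)"]) auto
  finally show ?thesis .
qed

text \<open>For \<open>|s| * 2 * R <= 1\<close> the cosine has an argument of size at most
  \<open>1\<close>, so \<open>1 - cos\<close> dominates a quarter of its square. The double integral
  of \<open>(z - z')^2\<close> over the square is \<open>D R\<close>, which tends to twice the
  variance of \<open>F\<close> and is hence positive for some \<open>R\<close>.\<close>

lemma sym_gap_near_0: "\<exists>R c. c > 0 \<and> R \<ge> 1 \<and> (\<forall>s. \<bar>s\<bar> * (2 * real R) \<le> 1 \<longrightarrow> c * s\<^sup>2 \<le> sym_gap R s)"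
proof -
  define D where "D R = 2 * (trunc R (\<lambda>_. 1) * trunc R (\<lambda>z. z\<^sup>2) - (trunc R (\<lambda>z. z))\<^sup>2)" for R
  have i: "integrable F (\<lambda>z. z)" "integrable F (\<lambda>z. z\<^sup>2)"
    using integrable_power_exp[of 1 0] integrable_power_exp[of 2 0] by simp_all
  have "D \<longlonglongrightarrow> 2 * ((\<integral>z. 1 \<partial>F) * (\<integral>z. z\<^sup>2 \<partial>F) - (\<integral>z. z \<partial>F)\<^sup>2)"
    unfolding D_def using i by (intro tendsto_intros trunc_tendsto) auto
  moreover have "2 * ((\<integral>z. 1 \<partial>F) * (\<integral>z. z\<^sup>2 \<partial>F) - (\<integral>z. z \<partial>F)\<^sup>2) > 0"
    using var_pos[of 0] by (simp add: var_def mean_0 centred mom_def mgf_def)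
  ultimately have "\<forall>\<^sub>F R in sequentially. D R > 0 \<and> R \<ge> 1"
    by (intro eventually_conj order_tendstoD(1) eventually_ge_at_top)
  then obtain R where R: "D R > 0" "R \<ge> 1"
    using eventually_happens'[OF sequentially_bot] by blast
  have j: "integrable F (\<lambda>z. indicator {- real R..real R} z * z ^ k)" for k
    by (rule integrable_trunc[where c="real R ^ k"]) (auto simp: power_abs intro!: power_mono)
  have inner: "trunc R (\<lambda>z'. (z - z')\<^sup>2) = z\<^sup>2 * trunc R (\<lambda>_. 1) - 2 * z * trunc R (\<lambda>z. z) + trunc R (\<lambda>z. z\<^sup>2)" for z
  proof -
    have "trunc R (\<lambda>z'. (z - z')\<^sup>2) = (\<integral>z'. z\<^sup>2 * (indicator {- real R..real R} z' * z' ^ 0)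
        - 2 * z * (indicator {- real R..real R} z' * z' ^ 1) + (indicator {- real R..real R} z' * z' ^ 2) \<partial>F)"
      unfolding trunc_def by (intro Bochner_Integration.integral_cong) (auto simp: indicator_def power2_diff)
    also have "\<dots> = z\<^sup>2 * (\<integral>z'. indicator {- real R..real R} z' * z' ^ 0 \<partial>F)
        - 2 * z * (\<integral>z'. indicator {- real R..real R} z' * z' ^ 1 \<partial>F) + (\<integral>z'. indicator {- real R..real R} z' * z' ^ 2 \<partial>F)"
      using j[of 0] j[of 1] j[of 2] by (simp del: integral_indicator)
    finally show ?thesis by (simp add: trunc_def del: integral_indicator)
  qed
  have outer: "trunc R (\<lambda>z. trunc R (\<lambda>z'. (z - z')\<^sup>2)) = D R"
  proof -
    have "trunc R (\<lambda>z. trunc R (\<lambda>z'. (z - z')\<^sup>2)) = (\<integral>z. trunc R (\<lambda>_. 1) * (indicator {- real R..real R} z * z ^ 2)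
        - 2 * trunc R (\<lambda>z. z) * (indicator {- real R..real R} z * z ^ 1) + trunc R (\<lambda>z. z\<^sup>2) * (indicator {- real R..real R} z * z ^ 0) \<partial>F)"
      unfolding inner by (subst trunc_def, intro Bochner_Integration.integral_cong) (auto simp: indicator_def)
    also have "\<dots> = trunc R (\<lambda>_. 1) * (\<integral>z'. indicator {- real R..real R} z' * z' ^ 2 \<partial>F)
        - 2 * trunc R (\<lambda>z. z) * (\<integral>z'. indicator {- real R..real R} z' * z' ^ 1 \<partial>F) + trunc R (\<lambda>z. z\<^sup>2) * (\<integral>z'. indicator {- real R..real R} z' * z' ^ 0 \<partial>F)"
      using j[of 0] j[of 1] j[of 2] by (simp del: integral_indicator)
    finally show ?thesis by (simp add: trunc_def D_def power2_eq_square del: integral_indicator)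
  qed
  have "D R / 4 * s\<^sup>2 \<le> sym_gap R s" if s: "\<bar>s\<bar> * (2 * real R) \<le> 1" for s
  proof -
    have b: "s\<^sup>2 / 4 * (z - z')\<^sup>2 \<le> 1 - cos (s * (z - z'))" if "\<bar>z\<bar> \<le> real R" "\<bar>z'\<bar> \<le> real R" for z z'
    proof -
      have "\<bar>s * (z - z')\<bar> \<le> \<bar>s\<bar> * (2 * real R)"
        unfolding abs_mult using that by (intro mult_left_mono) auto
      with s have "\<bar>s * (z - z')\<bar> \<le> 1" by linarith
      from one_minus_cos_ge[OF this] show ?thesis by (simp add: power_mult_distrib)
    qed
    have sq: "\<bar>s\<^sup>2 / 4 * (z - z')\<^sup>2\<bar> \<le> 2" if "\<bar>z\<bar> \<le> real R" "\<bar>z'\<bar> \<le> real R" for z z'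
    proof -
      have "0 \<le> s\<^sup>2 / 4 * (z - z')\<^sup>2" by simp
      then show ?thesis using b[OF that] cos_ge_minus_one[of "s * (z - z')"] by linarith
    qed
    have c2: "\<bar>1 - cos x\<bar> \<le> 2" for x :: real
      using cos_ge_minus_one[of x] cos_le_one[of x] by (simp only: abs_le_iff) linarith
    have in1: "\<bar>trunc R (\<lambda>z'. s\<^sup>2 / 4 * (z - z')\<^sup>2)\<bar> \<le> 2" if "\<bar>z\<bar> \<le> real R" for z
    proof -
      have "norm (trunc R (\<lambda>z'. s\<^sup>2 / 4 * (z - z')\<^sup>2)) \<le> (\<integral>z. 2 \<partial>F)"
        unfolding trunc_def
        by (rule Bochner_Integration.integral_norm_bound_integral, rule integrable_trunc[where c=2]) (use sq[OF that] in \<open>auto simp: indicator_def abs_le_iff\<close>)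
      then show ?thesis by simp
    qed
    have in2: "\<bar>trunc R (\<lambda>z'. 1 - cos (s * (z - z')))\<bar> \<le> 2" for z
    proof -
      have "norm (trunc R (\<lambda>z'. 1 - cos (s * (z - z')))) \<le> (\<integral>z. 2 \<partial>F)"
        unfolding trunc_def
        by (rule Bochner_Integration.integral_norm_bound_integral, rule integrable_trunc[where c=2]) (use c2 in \<open>auto simp: indicator_def\<close>)
      then show ?thesis by simp
    qed
    have "trunc R (\<lambda>z. trunc R (\<lambda>z'. s\<^sup>2 / 4 * (z - z')\<^sup>2)) \<le> sym_gap R s"
      unfolding sym_gap_eq
    proof (rule trunc_mono[where c=2 and d=2])
      show "(\<lambda>z. trunc R (\<lambda>z'. s\<^sup>2 / 4 * (z - z')\<^sup>2)) \<in> borel_measurable borel"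
        unfolding trunc_cmult inner by measurable
      show "(\<lambda>z. trunc R (\<lambda>z'. 1 - cos (s * (z - z')))) \<in> borel_measurable borel"
        unfolding trunc_cos_diff by measurable
      show "trunc R (\<lambda>z'. s\<^sup>2 / 4 * (z - z')\<^sup>2) \<le> trunc R (\<lambda>z'. 1 - cos (s * (z - z')))" if "\<bar>z\<bar> \<le> real R" for z
        by (rule trunc_mono[where c=2 and d=2]) (use b[OF that] sq[OF that] c2 in auto)
    qed (use in1 in2 in auto)
    then show ?thesis unfolding trunc_cmult outer by (simp add: mult.commute)
  qed
  then show ?thesis using R by (intro exI[of _ R] exI[of _ "D R / 4"]) auto
qed

lemma char_sq: "real_distribution M \<Longrightarrow> (cmod (char M s))\<^sup>2 = (\<integral>z. cos (s * z) \<partial>M)\<^sup>2 + (\<integral>z. sin (s * z) \<partial>M)\<^sup>2"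
proof -
  assume "real_distribution M"
  then interpret M: real_distribution M .
  have "complex_integrable M (\<lambda>z. iexp (s * z))" by (rule M.integrable_iexp) auto
  then have "Re (char M s) = (\<integral>z. cos (s * z) \<partial>M)" "Im (char M s) = (\<integral>z. sin (s * z) \<partial>M)"
    unfolding char_def by (simp_all add: integral_Re[symmetric] integral_Im[symmetric] Re_exp Im_exp del: of_real_mult)
  then show ?thesis by (simp add: cmod_power2)
qed

text \<open>Let \<open>p\<close> be the mass of \<open>[-R, R]\<close>. Restricting \<open>F\<close>
  to this interval changes each of the three squares in \<open>sym_gap\<close> unfavourably by at
  most \<open>2 * (1 - p)\<close>; this is where the factor \<open>6\<close> comes from.\<close>

lemma sym_gap_away: "sym_gap R s \<ge> 1 - (cmod (char F s))\<^sup>2 - 6 * (1 - trunc R (\<lambda>_. 1))"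
proof -
  define p where "p = trunc R (\<lambda>_. 1)"
  have p: "p = prob {- real R..real R}" by (simp add: p_def trunc_def)
  have p01: "0 \<le> p" "p \<le> 1" by (simp_all add: p)
  have *: "(trunc R f)\<^sup>2 \<le> (\<integral>z. f z \<partial>F)\<^sup>2 + 2 * (1 - p)"
    if f: "f \<in> borel_measurable borel" "\<And>z. \<bar>f z\<bar> \<le> 1" for f :: "real \<Rightarrow> real"
  proof -
    have if': "integrable F f" by (rule integrable_const_bound[where B=1]) (use f in auto)
    have it: "integrable F (\<lambda>z. indicator {- real R..real R} z * f z)" by (rule integrable_trunc[OF f])
    have "\<bar>trunc R f - (\<integral>z. f z \<partial>F)\<bar> = \<bar>\<integral>z. indicator {- real R..real R} z * f z - f z \<partial>F\<bar>"
      unfolding trunc_def using if' it by simp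
    also have "\<dots> \<le> (\<integral>z. 1 - indicator {- real R..real R} z \<partial>F)"
    proof -
      have "norm (\<integral>z. indicator {- real R..real R} z * f z - f z \<partial>F) \<le> (\<integral>z. 1 - indicator {- real R..real R} z \<partial>F)"
      proof (rule Bochner_Integration.integral_norm_bound_integral)
        show "integrable F (\<lambda>z. 1 - indicat_real {- real R..real R} z)"
          by (simp add: emeasure_eq_measure)
        show "norm (indicator {- real R..real R} z * f z - f z) \<le> 1 - indicator {- real R..real R} z" for z
          using f(2)[of z] by (auto simp: indicator_def)
      qed (use if' it in simp)
      then show ?thesis by simp
    qed
    also have "\<dots> = 1 - p" by (simp add: p emeasure_eq_measure)
    finally have d: "\<bar>trunc R f - (\<integral>z. f z \<partial>F)\<bar> \<le> 1 - p" .
    have "norm (\<integral>z. f z \<partial>F) \<le> (\<integral>z. 1 \<partial>F)"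
      by (rule Bochner_Integration.integral_norm_bound_integral) (use if' f(2) in auto)
    moreover have "norm (trunc R f) \<le> (\<integral>z. 1 \<partial>F)"
      unfolding trunc_def by (rule Bochner_Integration.integral_norm_bound_integral) (use it f(2) in \<open>auto simp: indicator_def\<close>)
    ultimately have s: "\<bar>trunc R f + (\<integral>z. f z \<partial>F)\<bar> \<le> 2" by simp
    have "(trunc R f)\<^sup>2 - (\<integral>z. f z \<partial>F)\<^sup>2 \<le> \<bar>trunc R f - (\<integral>z. f z \<partial>F)\<bar> * \<bar>trunc R f + (\<integral>z. f z \<partial>F)\<bar>"
      unfolding abs_mult[symmetric] by (simp add: power2_eq_square algebra_simps)
    also have "\<dots> \<le> (1 - p) * 2" by (rule mult_mono[OF d s]) (use p01 in auto)
    finally show ?thesis by simp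
  qed
  have "1 - 2 * (1 - p) \<le> p\<^sup>2"
    using zero_le_power2[of "p - 1"] by (simp add: power2_diff)
  then show ?thesis
    unfolding sym_gap_def p_def[symmetric] char_sq[OF real_distribution_axioms]
    using *[of "\<lambda>z. cos (s * z)"] *[of "\<lambda>z. sin (s * z)"] by simp
qed

text \<open>Near the origin the quadratic bound applies. Away from it, on a compact set,
  \<open>|char F|\<close> stays below \<open>1\<close> by continuity, and truncation loses only half
  of this gap once \<open>R\<close> is large. Monotonicity of \<open>sym_gap\<close> in
  \<open>R\<close> reconciles the two choices of \<open>R\<close>.\<close>

lemma sym_gap_lower: "\<exists>R c. c > 0 \<and> (\<forall>s. \<bar>s\<bar> \<le> S \<longrightarrow> c * s\<^sup>2 \<le> sym_gap R s)"
proof -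
  obtain R1 c1 where c1: "c1 > 0" "R1 \<ge> 1" "\<And>s. \<bar>s\<bar> * (2 * real R1) \<le> 1 \<Longrightarrow> c1 * s\<^sup>2 \<le> sym_gap R1 s"
    using sym_gap_near_0 by blast
  define s1 where "s1 = 1 / (2 * real R1)"
  have s1: "s1 > 0" using c1(2) by (simp add: s1_def)
  define K where "K = {-\<bar>S\<bar>..-s1} \<union> {s1..\<bar>S\<bar>}"
  have "\<exists>\<eta>>0. \<forall>s\<in>K. \<eta> \<le> 1 - (cmod (char F s))\<^sup>2"
  proof (cases "K = {}")
    case False
    have "continuous_on K (\<lambda>s. 1 - (cmod (char F s))\<^sup>2)"
      by (intro continuous_intros continuous_at_imp_continuous_on ballI isCont_char)
    moreover have "compact K" unfolding K_def by (intro compact_Un compact_Icc)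
    ultimately obtain x where x: "x \<in> K"
      "\<forall>s\<in>K. 1 - (cmod (char F x))\<^sup>2 \<le> 1 - (cmod (char F s))\<^sup>2"
      using continuous_attains_inf[of K "\<lambda>s. 1 - (cmod (char F s))\<^sup>2"] False by blast
    have "x \<noteq> 0" using x(1) s1 by (auto simp: K_def)
    then have "(cmod (char F x))\<^sup>2 < 1\<^sup>2" by (intro power_strict_mono nonlattice) auto
    then show ?thesis using x(2) by (intro exI[of _ "1 - (cmod (char F x))\<^sup>2"]) auto
  qed (auto intro: exI[of _ 1])
  then obtain \<eta> where \<eta>: "\<eta> > 0" "\<And>s. s \<in> K \<Longrightarrow> \<eta> \<le> 1 - (cmod (char F s))\<^sup>2" by blast
  have "(\<lambda>R. 6 * (1 - trunc R (\<lambda>_. 1))) \<longlonglongrightarrow> 6 * (1 - (\<integral>z. 1 \<partial>F))"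
    by (intro tendsto_intros trunc_tendsto) simp
  then have "\<forall>\<^sub>F R in sequentially. 6 * (1 - trunc R (\<lambda>_. 1)) < \<eta> / 2 \<and> R \<ge> R1"
    using \<eta>(1) by (intro eventually_conj order_tendstoD(2) eventually_ge_at_top) auto
  then obtain R where R: "6 * (1 - trunc R (\<lambda>_. 1)) < \<eta> / 2" "R \<ge> R1"
    using eventually_happens'[OF sequentially_bot] by blast
  \<comment> \<open>The second entry turns the constant gap \<open>\<eta> / 2\<close> into a
    quadratic bound, as \<open>s^2 <= S^2 + 1\<close>.\<close>
  define c where "c = min c1 (\<eta> / 2 / (S\<^sup>2 + 1))"
  have c: "c > 0" using c1(1) \<eta>(1) by (simp add: c_def add_nonneg_pos)
  have "c * s\<^sup>2 \<le> sym_gap R s" if s: "\<bar>s\<bar> \<le> S" for s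
  proof (cases "\<bar>s\<bar> * (2 * real R1) \<le> 1")
    case True
    have "c * s\<^sup>2 \<le> c1 * s\<^sup>2" by (intro mult_right_mono) (auto simp: c_def)
    with c1(3)[OF True] sym_gap_mono[OF R(2), of s] show ?thesis by linarith
  next
    case False
    then have "s1 \<le> \<bar>s\<bar>" using c1(2) by (simp add: s1_def field_simps)
    then have "s \<in> K" using s by (auto simp: K_def abs_if split: if_splits)
    then have "\<eta> / 2 \<le> sym_gap R s" using \<eta>(2)[of s] sym_gap_away[of s R] R(1) by linarith
    moreover have "c * s\<^sup>2 \<le> \<eta> / 2"
    proof -
      have "c * s\<^sup>2 \<le> \<eta> / 2 / (S\<^sup>2 + 1) * (S\<^sup>2 + 1)"
        using s \<eta>(1) c abs_le_square_iff[of s S] by (intro mult_mono) (auto simp: c_def add_nonneg_nonneg)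
      also have "\<dots> = \<eta> / 2"
      proof -
        have "S\<^sup>2 + 1 \<noteq> 0" using zero_le_power2[of S] by linarith
        then show ?thesis by (rule nonzero_eq_divide_eq[THEN iffD1, OF _ refl, symmetric, THEN sym])
      qed
      finally show ?thesis .
    qed
    ultimately show ?thesis by linarith
  qed
  with c show ?thesis by blast
qed

text \<open>\<open>1 - |char (G t) s|^2\<close> is the double integral of
  \<open>1 - cos (s * (z - z'))\<close> under \<open>G t\<close>. Bounding the density below by
  \<open>w\<close> in each variable leaves \<open>w^2 * sym_gap R s\<close>, which is at least
  quadratic in \<open>s\<close>. Then \<open>1 - x <= exp (- x)\<close>, and the square root halves
  the exponent.\<close>

lemma char_tilted_decay:
  "\<exists>c>0. \<forall>t s. \<bar>t\<bar> \<le> B \<longrightarrow> \<bar>s\<bar> \<le> S \<longrightarrow> cmod (char (G t) s) \<le> exp (- (c * s\<^sup>2))"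
proof -
  obtain R c where c: "c > 0" "\<And>s. \<bar>s\<bar> \<le> S \<Longrightarrow> c * s\<^sup>2 \<le> sym_gap R s"
    using sym_gap_lower by blast
  define m where "m = (\<integral>z. exp (\<bar>B\<bar> * \<bar>z\<bar>) \<partial>F)"
  have m: "m \<ge> 1" using mgf_le[of 0 "\<bar>B\<bar>"] mgf_ge_1[of 0] by (simp add: m_def)
  \<comment> \<open>A lower bound, common to all \<open>|t| <= B\<close>, for the density of
    \<open>G t\<close> on \<open>[-R, R]\<close>: the exponential is at least the numerator there,
    and \<open>m\<close> bounds \<open>mgf t\<close>.\<close>
  define w where "w = exp (- (\<bar>B\<bar> * real R)) / m"
  have w: "w > 0" using m by (simp add: w_def)
  have "cmod (char (G t) s) \<le> exp (- (w\<^sup>2 * c / 2 * s\<^sup>2))" if t: "\<bar>t\<bar> \<le> B" and s: "\<bar>s\<bar> \<le> S" for t s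
  proof -
    interpret G: real_distribution "G t" by (rule real_distribution_tilted)
    have lower: "w * trunc R f \<le> (\<integral>z. f z \<partial>G t)"
      if f: "f \<in> borel_measurable borel" "\<And>z. 0 \<le> f z" "\<And>z. f z \<le> C" for f :: "real \<Rightarrow> real" and C
    proof -
      have C: "\<And>z. \<bar>f z\<bar> \<le> C" using f by (simp add: abs_of_nonneg)
      have "w * trunc R f = (\<integral>z. w * (indicator {- real R..real R} z * f z) \<partial>F)"
        by (simp add: trunc_def)
      also have "\<dots> \<le> (\<integral>z. (exp (t * z) / mgf t) *\<^sub>R f z \<partial>F)"
      proof (rule integral_mono)
        show "integrable F (\<lambda>z. w * (indicator {- real R..real R} z * f z))"
          by (intro integrable_mult_right integrable_trunc[OF f(1), where c=C] C)
        have "integrable (G t) f" by (rule G.integrable_const_bound[where B=C]) (use C f in auto)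
        then show "integrable F (\<lambda>z. (exp (t * z) / mgf t) *\<^sub>R f z)" using f(1) by (simp add: integrable_tilted_iff)
        fix z
        show "w * (indicator {- real R..real R} z * f z) \<le> (exp (t * z) / mgf t) *\<^sub>R f z"
        proof (cases "z \<in> {- real R..real R}")
          case True
          have "- (t * z) \<le> \<bar>B\<bar> * real R"
          proof -
            have "- (t * z) \<le> \<bar>t\<bar> * \<bar>z\<bar>" by (simp add: abs_mult[symmetric])
            also have "\<dots> \<le> \<bar>B\<bar> * real R" using t True by (intro mult_mono) auto
            finally show ?thesis .
          qed
          then have *: "w \<le> exp (t * z) / mgf t"
            unfolding w_def using m mgf_le[of t "\<bar>B\<bar>"] t mgf_pos[of t]
            by (intro frac_le) (auto simp: m_def)
          show ?thesis using mult_right_mono[OF * f(2)[of z]] True by simp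
        qed (use f(2)[of z] mgf_pos[of t] in auto)
      qed
      also have "\<dots> = (\<integral>z. f z \<partial>G t)" by (rule integral_tilted[symmetric, OF f(1)])
      finally show ?thesis .
    qed
    define C D where "C = (\<integral>z. cos (s * z) \<partial>G t)" and "D = (\<integral>z. sin (s * z) \<partial>G t)"
    have ic: "integrable (G t) (\<lambda>z. cos (s * z))" "integrable (G t) (\<lambda>z. sin (s * z))"
      by (rule G.integrable_const_bound[where B=1]; simp)+
    \<comment> \<open>The inner integral of the double integral. The lower bound is applied to it
      first and to the outer integral afterwards.\<close>
    define h where "h z = 1 - cos (s * z) * C - sin (s * z) * D" for z
    have h: "h z = (\<integral>z'. 1 - cos (s * (z - z')) \<partial>G t)" for z
      unfolding right_diff_distrib cos_diff using ic G.prob_space by (simp add: h_def C_def D_def)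
    have k: "(\<lambda>z. trunc R (\<lambda>z'. 1 - cos (s * (z - z')))) \<in> borel_measurable borel"
      unfolding trunc_cos_diff by measurable
    have hk: "w * trunc R (\<lambda>z'. 1 - cos (s * (z - z'))) \<le> h z" for z
      unfolding h
    proof (rule lower)
      show "1 - cos (s * (z - z')) \<le> 2" for z' using cos_ge_minus_one[of "s * (z - z')"] by linarith
    qed auto
    have kpos: "0 \<le> trunc R (\<lambda>z'. 1 - cos (s * (z - z')))" for z
      unfolding trunc_def by (intro Bochner_Integration.integral_nonneg) (auto simp: indicator_def)
    have h0: "0 \<le> h z" for z using hk[of z] kpos[of z] w by (smt (verit) mult_nonneg_nonneg)
    have h2: "h z \<le> 2" for z
    proof -
      have "h z \<le> (\<integral>z'. 2 \<partial>G t)"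
        unfolding h right_diff_distrib cos_diff
      proof (rule integral_mono)
        show "1 - (cos (s * z) * cos (s * z') + sin (s * z) * sin (s * z')) \<le> 2" for z'
          using cos_ge_minus_one[of "s * z - s * z'"] unfolding cos_diff by linarith
      qed (use ic in auto)
      then show ?thesis using G.prob_space by simp
    qed
    have "w\<^sup>2 * sym_gap R s = w * trunc R (\<lambda>z. w * trunc R (\<lambda>z'. 1 - cos (s * (z - z'))))"
      unfolding sym_gap_eq trunc_cmult by (simp add: power2_eq_square)
    also have "\<dots> \<le> w * trunc R h"
    proof (intro mult_left_mono trunc_mono)
      show "\<bar>w * trunc R (\<lambda>z'. 1 - cos (s * (z - z')))\<bar> \<le> 2" "\<bar>h z\<bar> \<le> 2" for z
        using hk[of z] h2[of z] h0[of z] kpos[of z] w by simp_all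
    qed (use k hk w in \<open>auto simp: h_def[abs_def]\<close>)
    also have "\<dots> \<le> (\<integral>z. h z \<partial>G t)"
      by (rule lower[OF _ h0 h2]) (use h0 h2 in \<open>auto simp: h_def[abs_def]\<close>)
    also have "\<dots> = 1 - (cmod (char (G t) s))\<^sup>2"
      unfolding char_sq[OF G.real_distribution_axioms] h_def[abs_def] using ic G.prob_space
      by (simp add: C_def D_def power2_eq_square)
    finally have "(cmod (char (G t) s))\<^sup>2 \<le> 1 - w\<^sup>2 * sym_gap R s" by linarith
    also have "\<dots> \<le> 1 - w\<^sup>2 * (c * s\<^sup>2)"
      using mult_left_mono[OF c(2)[OF s], of "w\<^sup>2"] by simp
    also have "\<dots> \<le> exp (- (w\<^sup>2 * (c * s\<^sup>2)))"
      using exp_ge_add_one_self[of "- (w\<^sup>2 * (c * s\<^sup>2))"] by simp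
    also have "\<dots> = (exp (- (w\<^sup>2 * c / 2 * s\<^sup>2)))\<^sup>2"
      by (simp add: power2_eq_square exp_add[symmetric])
    finally show ?thesis by (rule power2_le_imp_le) simp
  qed
  then show ?thesis using w c(1) by (intro exI[of _ "w\<^sup>2 * c / 2"]) auto
qed

end

section \<open>Products of tilted laws\<close>

context tiltable
begin

text \<open>Product measures are determined by rectangles, on which both the density and the
  indicator factorise.\<close>

lemma PiM_tilted_density:
  fixes I :: "'i set" and \<gamma> :: "'i \<Rightarrow> real"
  assumes I: "finite I"
  shows "PiM I (\<lambda>p. G (\<gamma> p)) = density (PiM I (\<lambda>_. F)) (\<lambda>z. \<Prod>p\<in>I. ennreal (exp (\<gamma> p * z p) / mgf (\<gamma> p)))"
proof -
  interpret P: product_sigma_finite "\<lambda>p. G (\<gamma> p)"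
    using real_distribution_tilted
    by (intro product_sigma_finite.intro prob_space_imp_sigma_finite) (auto simp: real_distribution_def)
  interpret P': product_sigma_finite "\<lambda>_::'i. F"
    by (intro product_sigma_finite.intro prob_space_imp_sigma_finite) (rule prob_space_axioms)
  show ?thesis
  proof (rule P.PiM_eqI[OF I, symmetric])
    show "sets (density (PiM I (\<lambda>_. F)) (\<lambda>z. \<Prod>p\<in>I. ennreal (exp (\<gamma> p * z p) / mgf (\<gamma> p)))) = sets (PiM I (\<lambda>p. G (\<gamma> p)))"
      by (simp cong: sets_PiM_cong)
    fix A :: "'i \<Rightarrow> real set" assume "\<And>i. i \<in> I \<Longrightarrow> A i \<in> sets (G (\<gamma> i))"
    then have A [measurable]: "\<And>i. i \<in> I \<Longrightarrow> A i \<in> sets borel" by simp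
    have "emeasure (density (PiM I (\<lambda>_. F)) (\<lambda>z. \<Prod>p\<in>I. ennreal (exp (\<gamma> p * z p) / mgf (\<gamma> p)))) (Pi\<^sub>E I A) =
        (\<integral>\<^sup>+z. (\<Prod>p\<in>I. ennreal (exp (\<gamma> p * z p) / mgf (\<gamma> p))) * indicator (Pi\<^sub>E I A) z \<partial>PiM I (\<lambda>_. F))"
      using I A by (subst emeasure_density) (auto intro!: sets_PiM_I_finite)
    also have "\<dots> = (\<integral>\<^sup>+z. (\<Prod>p\<in>I. ennreal (exp (\<gamma> p * z p) / mgf (\<gamma> p)) * indicator (A p) (z p)) \<partial>PiM I (\<lambda>_. F))"
    proof (rule nn_integral_cong)
      fix z assume "z \<in> space (PiM I (\<lambda>_. F))"
      then have "indicator (Pi\<^sub>E I A) z = (\<Prod>p\<in>I. indicator (A p) (z p) :: ennreal)"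
      proof (cases "z \<in> Pi\<^sub>E I A")
        case False
        then obtain p where "p \<in> I" "z p \<notin> A p"
          using \<open>z \<in> space (PiM I (\<lambda>_. F))\<close> by (auto simp: space_PiM PiE_def Pi_def)
        then have "\<exists>p\<in>I. (indicator (A p) (z p) :: ennreal) = 0" by (intro bexI[of _ p]) auto
        from prod_zero[OF I this] False show ?thesis by simp
      qed (auto simp: PiE_mem)
      then show "(\<Prod>p\<in>I. ennreal (exp (\<gamma> p * z p) / mgf (\<gamma> p))) * indicator (Pi\<^sub>E I A) z =
          (\<Prod>p\<in>I. ennreal (exp (\<gamma> p * z p) / mgf (\<gamma> p)) * indicator (A p) (z p))"
        by (simp add: prod.distrib)
    qed
    also have "\<dots> = (\<Prod>p\<in>I. \<integral>\<^sup>+x. ennreal (exp (\<gamma> p * x) / mgf (\<gamma> p)) * indicator (A p) x \<partial>F)"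
      using I A by (intro P'.product_nn_integral_prod) auto
    also have "\<dots> = (\<Prod>p\<in>I. emeasure (G (\<gamma> p)) (A p))"
      unfolding tilted_law_def tilted_density using A by (intro prod.cong refl emeasure_density[symmetric]) auto
    finally show "emeasure (density (PiM I (\<lambda>_. F)) (\<lambda>z. \<Prod>p\<in>I. ennreal (exp (\<gamma> p * z p) / mgf (\<gamma> p)))) (Pi\<^sub>E I A) =
        (\<Prod>p\<in>I. emeasure (G (\<gamma> p)) (A p))" .
  qed
qed

text \<open>Measures and integrands vary simultaneously. All the measures have densities with
  respect to the same product of copies of \<open>F\<close>; these converge pointwise and are
  bounded by products of \<open>exp (B * |z p|)\<close>, so one dominated convergence treats both
  variations.\<close>

lemma PiM_tilted_tendsto:
  fixes I :: "'i set" and \<beta> :: "nat \<Rightarrow> 'i \<Rightarrow> real" and H :: "nat \<Rightarrow> ('i \<Rightarrow> real) \<Rightarrow> real"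
  assumes I: "finite I" and \<beta>: "\<And>p. p \<in> I \<Longrightarrow> (\<lambda>n. \<beta> n p) \<longlonglongrightarrow> \<gamma> p" "\<And>n p. p \<in> I \<Longrightarrow> \<bar>\<beta> n p\<bar> \<le> B"
    and H [measurable]: "\<And>n. H n \<in> borel_measurable (PiM I (\<lambda>_. borel))" "H' \<in> borel_measurable (PiM I (\<lambda>_. borel))"
    and bound: "\<forall>\<^sub>F n in sequentially. \<forall>z\<in>space (PiM I (\<lambda>_. borel)). \<bar>H n z\<bar> \<le> C"
    and lim: "\<And>z. z \<in> space (PiM I (\<lambda>_. borel)) \<Longrightarrow> (\<lambda>n. H n z) \<longlonglongrightarrow> H' z"
  shows "(\<lambda>n. \<integral>z. H n z \<partial>PiM I (\<lambda>p. G (\<beta> n p))) \<longlonglongrightarrow> (\<integral>z. H' z \<partial>PiM I (\<lambda>p. G (\<gamma> p)))"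
proof -
  interpret P': product_sigma_finite "\<lambda>_::'i. F"
    by (intro product_sigma_finite.intro prob_space_imp_sigma_finite) (rule prob_space_axioms)
  have sets: "sets (PiM I (\<lambda>_. F)) = sets (PiM I (\<lambda>_. borel :: real measure))"
    by (intro sets_PiM_cong) auto
  have sp: "space (PiM I (\<lambda>_. F)) = space (PiM I (\<lambda>_. borel :: real measure))"
    by (rule sets_eq_imp_space_eq[OF sets])
  note [measurable_cong] = sets
  obtain N where N: "\<And>n z. n \<ge> N \<Longrightarrow> z \<in> space (PiM I (\<lambda>_. borel)) \<Longrightarrow> \<bar>H n z\<bar> \<le> C"
    using bound unfolding eventually_sequentially by blast
  define d where "d \<gamma> z = (\<Prod>p\<in>I. exp (\<gamma> p * z p) / mgf (\<gamma> p))" for \<gamma> :: "'i \<Rightarrow> real" and z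
  have d0: "d \<gamma> z \<ge> 0" for \<gamma> z
    unfolding d_def using mgf_pos by (intro prod_nonneg) (auto simp: less_imp_le)
  have dm [measurable]: "d \<gamma> \<in> borel_measurable (PiM I (\<lambda>_. borel))" for \<gamma>
    unfolding d_def[abs_def] by measurable
  have int_eq: "(\<integral>z. h z \<partial>PiM I (\<lambda>p. G (\<gamma> p))) = (\<integral>z. d \<gamma> z * h z \<partial>PiM I (\<lambda>_. F))"
    if [measurable]: "h \<in> borel_measurable (PiM I (\<lambda>_. borel))" for h :: "('i \<Rightarrow> real) \<Rightarrow> real" and \<gamma>
  proof -
    have "PiM I (\<lambda>p. G (\<gamma> p)) = density (PiM I (\<lambda>_. F)) (\<lambda>z. ennreal (d \<gamma> z))"
      unfolding PiM_tilted_density[OF I] d_def using mgf_pos by (subst prod_ennreal) (auto simp: less_imp_le)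
    then show ?thesis
      by (simp add: integral_density d0)
  qed
  have C0: "\<exists>z. z \<in> space (PiM I (\<lambda>_. borel :: real measure))"
    by (intro exI[of _ "\<lambda>i\<in>I. 0"]) (auto simp: space_PiM)
  have "(\<lambda>n. \<integral>z. d (\<beta> (n + N)) z * H (n + N) z \<partial>PiM I (\<lambda>_. F)) \<longlonglongrightarrow> (\<integral>z. d \<gamma> z * H' z \<partial>PiM I (\<lambda>_. F))"
  proof (rule integral_dominated_convergence[where w="\<lambda>z. (\<Prod>p\<in>I. exp (B * \<bar>z p\<bar>)) * \<bar>C\<bar>"])
    have "integrable F (\<lambda>z. exp (B * \<bar>z\<bar>))" using integrable_abs_power_exp[of 0 B] by simp
    then show "integrable (PiM I (\<lambda>_. F)) (\<lambda>z. (\<Prod>p\<in>I. exp (B * \<bar>z p\<bar>)) * \<bar>C\<bar>)"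
      by (intro integrable_mult_left P'.product_integrable_prod I)
    show "AE z in PiM I (\<lambda>_. F). norm (d (\<beta> (n + N)) z * H (n + N) z) \<le> (\<Prod>p\<in>I. exp (B * \<bar>z p\<bar>)) * \<bar>C\<bar>" for n
    proof (rule AE_I2)
      fix z assume z: "z \<in> space (PiM I (\<lambda>_. F))"
      have "d (\<beta> (n + N)) z \<le> (\<Prod>p\<in>I. exp (B * \<bar>z p\<bar>))"
        unfolding d_def
      proof (rule prod_mono, safe)
        fix p assume p: "p \<in> I"
        show "0 \<le> exp (\<beta> (n + N) p * z p) / mgf (\<beta> (n + N) p)" using mgf_pos by (simp add: less_imp_le)
        have "exp (\<beta> (n + N) p * z p) / mgf (\<beta> (n + N) p) \<le> exp (\<beta> (n + N) p * z p)"
          using mgf_ge_1[of "\<beta> (n + N) p"] by (simp add: field_simps)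
        also have "\<dots> \<le> exp (B * \<bar>z p\<bar>)" by (rule exp_le_exp_abs[OF \<beta>(2)[OF p]])
        finally show "exp (\<beta> (n + N) p * z p) / mgf (\<beta> (n + N) p) \<le> exp (B * \<bar>z p\<bar>)" .
      qed
      moreover have "\<bar>H (n + N) z\<bar> \<le> \<bar>C\<bar>" using N[of "n + N" z] z sp by simp
      ultimately show "norm (d (\<beta> (n + N)) z * H (n + N) z) \<le> (\<Prod>p\<in>I. exp (B * \<bar>z p\<bar>)) * \<bar>C\<bar>"
        using d0[of "\<beta> (n + N)" z] by (auto simp: abs_mult intro!: mult_mono prod_nonneg)
    qed
    show "AE z in PiM I (\<lambda>_. F). (\<lambda>n. d (\<beta> (n + N)) z * H (n + N) z) \<longlonglongrightarrow> d \<gamma> z * H' z"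
    proof (rule AE_I2)
      fix z assume z: "z \<in> space (PiM I (\<lambda>_. F))"
      have "(\<lambda>n. d (\<beta> n) z) \<longlonglongrightarrow> d \<gamma> z"
        unfolding d_def using mgf_pos
        by (intro tendsto_prod tendsto_divide tendsto_exp tendsto_mult tendsto_const \<beta>(1)
            isCont_tendsto_compose[OF isCont_mgf]) (auto simp: less_imp_neq[symmetric])
      then have "(\<lambda>n. d (\<beta> n) z * H n z) \<longlonglongrightarrow> d \<gamma> z * H' z"
        using z sp by (intro tendsto_mult lim) auto
      then show "(\<lambda>n. d (\<beta> (n + N)) z * H (n + N) z) \<longlonglongrightarrow> d \<gamma> z * H' z"
        by (rule LIMSEQ_ignore_initial_segment)
    qed
  qed measurable
  then have "(\<lambda>n. \<integral>z. H (n + N) z \<partial>PiM I (\<lambda>p. G (\<beta> (n + N) p))) \<longlonglongrightarrow> (\<integral>z. H' z \<partial>PiM I (\<lambda>p. G (\<gamma> p)))"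
    by (simp add: int_eq)
  then show ?thesis by (rule LIMSEQ_offset)
qed

end

section \<open>Coefficients\<close>

lemma infsum_tendsto_finite_sets:
  fixes f :: "'a \<Rightarrow> 'b :: {comm_monoid_add, t2_space}"
  assumes "f summable_on A" and "\<And>n. finite (S n)" "\<And>n. S n \<subseteq> A" and ev: "\<And>x. x \<in> A \<Longrightarrow> \<forall>\<^sub>F n in sequentially. x \<in> S n"
  shows "(\<lambda>n. sum f (S n)) \<longlonglongrightarrow> infsum f A"
proof -
  have "(sum f \<longlongrightarrow> infsum f A) (finite_subsets_at_top A)"
    using assms(1) by (simp add: has_sum_infsum flip: has_sum_def)
  moreover have "filterlim S (finite_subsets_at_top A) sequentially"
    unfolding filterlim_finite_subsets_at_top
  proof safe
    fix X assume X: "finite X" "X \<subseteq> A"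
    have "\<forall>\<^sub>F n in sequentially. \<forall>x\<in>X. x \<in> S n"
      using X ev by (intro eventually_ball_finite) auto
    then show "\<forall>\<^sub>F n in sequentially. finite (S n) \<and> X \<subseteq> S n \<and> S n \<subseteq> A"
      by eventually_elim (use assms(2,3) in auto)
  qed
  ultimately show ?thesis by (rule filterlim_compose)
qed

lemma infsum_tendsto_int:
  fixes f :: "int \<Rightarrow> 'b :: {comm_monoid_add, t2_space}"
  assumes "f summable_on UNIV"
  shows "(\<lambda>m. \<Sum>k\<in>{-int m..int m}. f k) \<longlonglongrightarrow> infsum f UNIV"
proof (rule infsum_tendsto_finite_sets[OF assms])
  show "\<forall>\<^sub>F n in sequentially. x \<in> {-int n..int n}" for x
    using eventually_ge_at_top[of "nat \<bar>x\<bar>"] by eventually_elim auto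
qed auto

lemma
  fixes f :: "'i \<Rightarrow> 'a \<Rightarrow> real"
  assumes "\<And>i. i \<in> I \<Longrightarrow> f i summable_on A"
  shows summable_on_finite_sum: "(\<lambda>x. \<Sum>i\<in>I. f i x) summable_on A"
    and infsum_finite_sum: "(\<Sum>\<^sub>\<infinity>x\<in>A. \<Sum>i\<in>I. f i x) = (\<Sum>i\<in>I. infsum (f i) A)"
proof -
  have "((\<lambda>x. \<Sum>i\<in>I. f i x) has_sum (\<Sum>i\<in>I. infsum (f i) A)) A"
    using assms
  proof (induction I rule: infinite_finite_induct)
    case (insert i I)
    then show ?case by (simp add: has_sum_add)
  qed (simp_all add: has_sum_0)
  then show "(\<lambda>x. \<Sum>i\<in>I. f i x) summable_on A" "(\<Sum>\<^sub>\<infinity>x\<in>A. \<Sum>i\<in>I. f i x) = (\<Sum>i\<in>I. infsum (f i) A)"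
    by (auto simp: has_sum_imp_summable infsumI)
qed

lemma infsum_abs_le:
  fixes f :: "'a \<Rightarrow> real"
  assumes "(\<lambda>x. \<bar>f x\<bar>) summable_on A"
  shows "\<bar>infsum f A\<bar> \<le> (\<Sum>\<^sub>\<infinity>x\<in>A. \<bar>f x\<bar>)"
  using norm_infsum_bound[of f A] assms by simp

text \<open>With \<open>X_i\<close> written as the sum of \<open>a (i - k) * Z k\<close> over
  \<open>k\<close>, this collects the terms belonging to \<open>Z k\<close> over
  \<open>0 <= i < n\<close>.\<close>

definition bcoef :: "(int \<Rightarrow> real) \<Rightarrow> nat \<Rightarrow> int \<Rightarrow> real" where
  "bcoef a n k = (\<Sum>i<n. a (int i - k))"

definition bulk :: "nat \<Rightarrow> int \<Rightarrow> real" where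
  "bulk n k = of_bool (0 \<le> k \<and> k < int n)"

text \<open>The deviation from an idealised profile equal to the total coefficient sum on the window
  \<open>[0, n)\<close> and to \<open>0\<close> elsewhere. As its l^1 norm is \<open>o(n)\<close>,
  sums over the coefficients can be replaced by \<open>n\<close> times the value at the total
  sum.\<close>

definition bdev :: "(int \<Rightarrow> real) \<Rightarrow> nat \<Rightarrow> int \<Rightarrow> real" where
  "bdev a n k = bcoef a n k - bulk n k * infsum a UNIV"

lemma summable_reflect:
  fixes f :: "int \<Rightarrow> 'b :: {comm_monoid_add, t2_space}"
  shows "f summable_on UNIV \<Longrightarrow> (\<lambda>k. f (c - k)) summable_on UNIV"
    and infsum_reflect: "(\<Sum>\<^sub>\<infinity>k. f (c - k)) = infsum f UNIV"
proof -
  have b: "bij_betw (\<lambda>k. c - k) UNIV (UNIV :: int set)"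
    by (rule bij_betwI[of _ _ _ "\<lambda>k. c - k"]) auto
  show "f summable_on UNIV \<Longrightarrow> (\<lambda>k. f (c - k)) summable_on UNIV"
    using summable_on_reindex_bij_betw[OF b, of f] by simp
  show "(\<Sum>\<^sub>\<infinity>k. f (c - k)) = infsum f UNIV"
    using infsum_reindex_bij_betw[OF b, of f] by simp
qed

lemma infsum_bulk: "finite {k. bulk n k \<noteq> 0}" "(\<lambda>k. bulk n k * c) summable_on UNIV" "(\<Sum>\<^sub>\<infinity>k. bulk n k * c) = real n * c"
proof -
  have s: "{k. bulk n k \<noteq> 0} = {0..<int n}" by (auto simp: bulk_def)
  then show "finite {k. bulk n k \<noteq> 0}" by simp
  have "((\<lambda>k. bulk n k * c) has_sum (\<Sum>k\<in>{0..<int n}. bulk n k * c)) UNIV"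
    by (rule has_sum_cong_neutral[THEN iffD1, OF _ _ _ has_sum_finite]) (auto simp: bulk_def)
  moreover have "(\<Sum>k\<in>{0..<int n}. bulk n k * c) = real n * c" by (simp add: bulk_def)
  ultimately show "(\<lambda>k. bulk n k * c) summable_on UNIV" "(\<Sum>\<^sub>\<infinity>k. bulk n k * c) = real n * c"
    by (auto simp: has_sum_imp_summable infsumI)
qed

lemma bcoef_abs_summable:
  assumes a: "(\<lambda>m. \<bar>a m\<bar>) summable_on UNIV"
  shows "(\<lambda>k. \<bar>bcoef a n k\<bar>) summable_on UNIV"
    and bcoef_abs_sum_le: "(\<Sum>\<^sub>\<infinity>k. \<bar>bcoef a n k\<bar>) \<le> real n * (\<Sum>\<^sub>\<infinity>m. \<bar>a m\<bar>)"
    and bcoef_abs_le: "\<bar>bcoef a n k\<bar> \<le> (\<Sum>\<^sub>\<infinity>m. \<bar>a m\<bar>)"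
proof -
  have s: "(\<lambda>k. \<bar>a (int i - k)\<bar>) summable_on UNIV" for i
    by (rule summable_reflect(1)[OF a])
  have S: "(\<lambda>k. \<Sum>i<n. \<bar>a (int i - k)\<bar>) summable_on UNIV"
    by (intro summable_on_finite_sum) (use s in auto)
  have le: "\<bar>bcoef a n k\<bar> \<le> (\<Sum>i<n. \<bar>a (int i - k)\<bar>)" for k
    by (simp add: bcoef_def sum_abs)
  show 1: "(\<lambda>k. \<bar>bcoef a n k\<bar>) summable_on UNIV"
    by (rule summable_on_comparison_test[OF S]) (use le in auto)
  have "(\<Sum>\<^sub>\<infinity>k. \<bar>bcoef a n k\<bar>) \<le> (\<Sum>\<^sub>\<infinity>k. \<Sum>i<n. \<bar>a (int i - k)\<bar>)"
    by (rule infsum_mono[OF 1 S le])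
  also have "\<dots> = (\<Sum>i<n. \<Sum>\<^sub>\<infinity>k. \<bar>a (int i - k)\<bar>)"
    by (rule infsum_finite_sum) (use s in auto)
  also have "\<dots> = real n * (\<Sum>\<^sub>\<infinity>m. \<bar>a m\<bar>)"
    using infsum_reflect[of "\<lambda>m. \<bar>a m\<bar>"] by simp
  finally show "(\<Sum>\<^sub>\<infinity>k. \<bar>bcoef a n k\<bar>) \<le> real n * (\<Sum>\<^sub>\<infinity>m. \<bar>a m\<bar>)" .
  have "(\<Sum>i<n. \<bar>a (int i - k)\<bar>) = (\<Sum>m\<in>(\<lambda>i. int i - k) ` {..<n}. \<bar>a m\<bar>)"
    by (subst sum.reindex) (auto simp: inj_on_def)
  also have "\<dots> \<le> (\<Sum>\<^sub>\<infinity>m. \<bar>a m\<bar>)"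
    by (rule finite_sum_le_infsum[OF a]) auto
  finally show "\<bar>bcoef a n k\<bar> \<le> (\<Sum>\<^sub>\<infinity>m. \<bar>a m\<bar>)"
    using le[of k] by linarith
qed

lemma abs_summable_imp_summable: "(\<lambda>x. \<bar>f x\<bar>) summable_on A \<Longrightarrow> f summable_on A" for f :: "'a \<Rightarrow> real"
  using abs_summable_summable[of f A] by simp

lemma bdev_abs_summable:
  assumes a: "(\<lambda>m. \<bar>a m\<bar>) summable_on UNIV"
  shows "(\<lambda>k. \<bar>bdev a n k\<bar>) summable_on UNIV"
    and bdev_abs_sum_le: "(\<Sum>\<^sub>\<infinity>k. \<bar>bdev a n k\<bar>) \<le> 2 * (real n * (\<Sum>\<^sub>\<infinity>m. \<bar>a m\<bar>))"
proof -
  have s: "(\<lambda>k. \<bar>bcoef a n k\<bar> + bulk n k * \<bar>infsum a UNIV\<bar>) summable_on UNIV"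
    by (intro summable_on_add bcoef_abs_summable a infsum_bulk)
  have le: "\<bar>bdev a n k\<bar> \<le> \<bar>bcoef a n k\<bar> + bulk n k * \<bar>infsum a UNIV\<bar>" for k
    unfolding bdev_def using abs_triangle_ineq4[of "bcoef a n k" "bulk n k * infsum a UNIV"]
    by (simp add: abs_mult bulk_def)
  show 1: "(\<lambda>k. \<bar>bdev a n k\<bar>) summable_on UNIV"
    by (rule summable_on_comparison_test[OF s]) (use le in auto)
  have "(\<Sum>\<^sub>\<infinity>k. \<bar>bdev a n k\<bar>) \<le> (\<Sum>\<^sub>\<infinity>k. \<bar>bcoef a n k\<bar> + bulk n k * \<bar>infsum a UNIV\<bar>)"
    by (rule infsum_mono[OF 1 s le])
  also have "\<dots> = (\<Sum>\<^sub>\<infinity>k. \<bar>bcoef a n k\<bar>) + real n * \<bar>infsum a UNIV\<bar>"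
    by (subst infsum_add[OF bcoef_abs_summable(1)[OF a] infsum_bulk(2)]) (simp add: infsum_bulk)
  also have "\<dots> \<le> real n * (\<Sum>\<^sub>\<infinity>m. \<bar>a m\<bar>) + real n * (\<Sum>\<^sub>\<infinity>m. \<bar>a m\<bar>)"
    by (intro add_mono bcoef_abs_sum_le a mult_left_mono infsum_abs_le) auto
  finally show "(\<Sum>\<^sub>\<infinity>k. \<bar>bdev a n k\<bar>) \<le> 2 * (real n * (\<Sum>\<^sub>\<infinity>m. \<bar>a m\<bar>))" by simp
qed

text \<open>For finitely supported \<open>a\<close>, the profile \<open>bcoef\<close> is a
  combination of shifted windows with weights \<open>a m\<close>. A shift by \<open>m\<close>
  changes the window at no more than \<open>2 * |m|\<close> sites, whatever \<open>n\<close>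
  is.\<close>

lemma bdev_finite_support:
  assumes J: "finite J" and supp: "\<And>m. m \<notin> J \<Longrightarrow> a m = 0"
  shows "(\<Sum>\<^sub>\<infinity>k. \<bar>bdev a n k\<bar>) \<le> (\<Sum>m\<in>J. \<bar>a m\<bar> * (2 * \<bar>real_of_int m\<bar>))"
proof -
  have A: "infsum a UNIV = (\<Sum>m\<in>J. a m)"
  proof -
    have "infsum a UNIV = infsum a J" by (rule infsum_cong_neutral) (auto simp: supp)
    then show ?thesis using J by simp
  qed
  \<comment> \<open>Marks the sites where the window and its shift by \<open>m\<close>
    differ.\<close>
  define e where "e m k = \<bar>bulk n (k + m) - bulk n k\<bar>" for m k
  have b: "bcoef a n k = (\<Sum>m\<in>J. a m * bulk n (k + m))" for k
  proof -
    have "bcoef a n k = (\<Sum>m\<in>(\<lambda>i. int i - k) ` {..<n}. a m)"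
      unfolding bcoef_def by (subst sum.reindex) (auto simp: inj_on_def)
    also have "(\<lambda>i. int i - k) ` {..<n} = {-k..<int n - k}"
    proof safe
      fix x assume "x \<in> {-k..<int n - k}"
      then show "x \<in> (\<lambda>i. int i - k) ` {..<n}" by (intro image_eqI[of _ _ "nat (x + k)"]) auto
    qed auto
    also have "(\<Sum>m\<in>{-k..<int n - k}. a m) = (\<Sum>m\<in>J \<union> {-k..<int n - k}. a m * bulk n (k + m))"
      by (rule sum.mono_neutral_cong_left) (use J in \<open>auto simp: bulk_def\<close>)
    also have "\<dots> = (\<Sum>m\<in>J. a m * bulk n (k + m))"
      by (rule sum.mono_neutral_right) (use J supp in auto)
    finally show ?thesis .
  qed
  have "\<bar>bdev a n k\<bar> \<le> (\<Sum>m\<in>J. \<bar>a m\<bar> * e m k)" for k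
  proof -
    have "bdev a n k = (\<Sum>m\<in>J. a m * (bulk n (k + m) - bulk n k))"
      unfolding bdev_def b A by (simp add: sum_distrib_right sum_subtractf right_diff_distrib mult.commute)
    then show ?thesis unfolding e_def abs_mult[symmetric] by (simp add: sum_abs)
  qed
  moreover have e: "(e m) summable_on UNIV" "infsum (e m) UNIV \<le> 2 * \<bar>real_of_int m\<bar>" for m
  proof -
    define S where "S = {- \<bar>m\<bar>..<\<bar>m\<bar>} \<union> {int n - \<bar>m\<bar>..<int n + \<bar>m\<bar>}"
    have 0: "e m k = 0" if "k \<notin> {- \<bar>m\<bar>..<\<bar>m\<bar>} \<union> {int n - \<bar>m\<bar>..<int n + \<bar>m\<bar>}" for k
      using that by (auto simp: e_def bulk_def)
    define S' where "S' = {k. e m k \<noteq> 0}"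
    have "S' \<subseteq> S" using 0 unfolding S'_def S_def by blast
    then have S': "finite S'" by (rule finite_subset) (simp add: S_def)
    have hs: "(e m has_sum (\<Sum>k\<in>S'. e m k)) UNIV"
      by (rule has_sum_cong_neutral[THEN iffD1, OF _ _ _ has_sum_finite[OF S']]) (auto simp: S'_def)
    have "(\<Sum>k\<in>S'. e m k) \<le> (\<Sum>k\<in>S'. 1)"
      by (intro sum_mono) (auto simp: e_def bulk_def)
    also have "\<dots> = real (card S')" by simp
    also have "card S' \<le> card ({min 0 (-m)..<max 0 (-m)} \<union> {min (int n) (int n - m)..<max (int n) (int n - m)})"
      by (rule card_mono) (auto simp: S'_def e_def bulk_def)
    also have "\<dots> \<le> card {min 0 (-m)..<max 0 (-m)} + card {min (int n) (int n - m)..<max (int n) (int n - m)}"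
      by (rule card_Un_le)
    also have "\<dots> = 2 * nat \<bar>m\<bar>" by (auto simp: min_def max_def)
    finally have "(\<Sum>k\<in>S'. e m k) \<le> 2 * \<bar>real_of_int m\<bar>" by simp
    then show "(e m) summable_on UNIV" "infsum (e m) UNIV \<le> 2 * \<bar>real_of_int m\<bar>"
      using hs by (auto simp: has_sum_imp_summable infsumI)
  qed
  moreover have "(\<lambda>k. \<bar>bdev a n k\<bar>) summable_on UNIV"
  proof (rule bdev_abs_summable)
    have "(\<lambda>m. \<bar>a m\<bar>) summable_on J" using J by simp
    then show "(\<lambda>m. \<bar>a m\<bar>) summable_on UNIV"
      by (rule summable_on_cong_neutral[THEN iffD1, rotated 3]) (auto simp: supp)
  qed
  moreover have es: "(\<lambda>k. \<Sum>m\<in>J. \<bar>a m\<bar> * e m k) summable_on UNIV"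
    by (intro summable_on_finite_sum summable_on_cmult_right e)
  ultimately have "(\<Sum>\<^sub>\<infinity>k. \<bar>bdev a n k\<bar>) \<le> (\<Sum>\<^sub>\<infinity>k. \<Sum>m\<in>J. \<bar>a m\<bar> * e m k)"
    by (intro infsum_mono) auto
  also have "\<dots> = (\<Sum>m\<in>J. \<bar>a m\<bar> * infsum (e m) UNIV)"
    by (subst infsum_finite_sum) (auto intro!: summable_on_cmult_right e simp: infsum_cmult_right')
  also have "\<dots> \<le> (\<Sum>m\<in>J. \<bar>a m\<bar> * (2 * \<bar>real_of_int m\<bar>))"
    by (intro sum_mono mult_left_mono e) auto
  finally show ?thesis .
qed

text \<open>Split \<open>a\<close> into a finitely supported part, whose deviation stays bounded as
  \<open>n\<close> grows, and a remainder of small l^1 norm, whose deviation is at most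
  \<open>2 * n\<close> times that norm.\<close>

lemma bdev_negligible:
  assumes a: "(\<lambda>m. \<bar>a m\<bar>) summable_on UNIV"
  shows "(\<lambda>n. (\<Sum>\<^sub>\<infinity>k. \<bar>bdev a n k\<bar>) / real n) \<longlonglongrightarrow> 0"
proof (rule LIMSEQ_I)
  fix r :: real assume r: "0 < r"
  \<comment> \<open>A remainder below \<open>r / 4\<close> contributes less than
    \<open>2 * n * (r / 4)\<close>, half of the admissible error.\<close>
  have "\<exists>J. finite J \<and> (\<Sum>\<^sub>\<infinity>m. \<bar>if m \<in> J then 0 else a m\<bar>) < r / 4"
  proof -
    have "\<forall>\<^sub>F n in sequentially. dist (\<Sum>m\<in>{-int n..int n}. \<bar>a m\<bar>) (\<Sum>\<^sub>\<infinity>m. \<bar>a m\<bar>) < r / 4"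
      using infsum_tendsto_int[OF a] r by (intro tendstoD) auto
    then obtain n where n: "\<bar>(\<Sum>m\<in>{-int n..int n}. \<bar>a m\<bar>) - (\<Sum>\<^sub>\<infinity>m. \<bar>a m\<bar>)\<bar> < r / 4"
      using eventually_happens'[OF sequentially_bot] by (auto simp: dist_real_def)
    define J where "J = {-int n..int n}"
    have "(\<Sum>\<^sub>\<infinity>m. \<bar>if m \<in> J then 0 else a m\<bar>) = (\<Sum>\<^sub>\<infinity>m\<in>UNIV - J. \<bar>a m\<bar>)"
      by (rule infsum_cong_neutral) auto
    also have "\<dots> = (\<Sum>\<^sub>\<infinity>m. \<bar>a m\<bar>) - (\<Sum>\<^sub>\<infinity>m\<in>J. \<bar>a m\<bar>)"
      by (rule infsum_Diff[OF a]) (auto simp: J_def)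
    finally show ?thesis using n by (intro exI[of _ J]) (auto simp: J_def abs_real_def split: if_splits)
  qed
  then obtain J where J: "finite J" "(\<Sum>\<^sub>\<infinity>m. \<bar>if m \<in> J then 0 else a m\<bar>) < r / 4" by blast
  define a1 a2 where "a1 m = (if m \<in> J then a m else 0)" and "a2 m = (if m \<in> J then 0 else a m)" for m
  have s1: "(\<lambda>m. \<bar>a1 m\<bar>) summable_on UNIV" and s2: "(\<lambda>m. \<bar>a2 m\<bar>) summable_on UNIV"
    by (rule summable_on_comparison_test[OF a]; simp add: a1_def a2_def)+
  have sum: "bdev a n k = bdev a1 n k + bdev a2 n k" for n k
  proof -
    have "a m = a1 m + a2 m" for m by (simp add: a1_def a2_def)
    then have a12: "a = (\<lambda>m. a1 m + a2 m)" by auto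
    have "bcoef a n k = bcoef a1 n k + bcoef a2 n k"
      by (subst a12) (simp add: bcoef_def sum.distrib)
    moreover have "infsum a UNIV = (\<Sum>\<^sub>\<infinity>m. a1 m + a2 m)"
      by (rule arg_cong[OF a12, of "\<lambda>f. infsum f UNIV"])
    then have "infsum a UNIV = infsum a1 UNIV + infsum a2 UNIV"
      by (simp add: infsum_add[OF abs_summable_imp_summable[OF s1] abs_summable_imp_summable[OF s2]])
    ultimately have "bcoef a n k = bcoef a1 n k + bcoef a2 n k" "infsum a UNIV = infsum a1 UNIV + infsum a2 UNIV"
      by auto
    then show ?thesis by (simp add: bdev_def algebra_simps)
  qed
  define D where "D = (\<Sum>m\<in>J. \<bar>a1 m\<bar> * (2 * \<bar>real_of_int m\<bar>))"
  have bound: "(\<Sum>\<^sub>\<infinity>k. \<bar>bdev a n k\<bar>) \<le> D + real n * (r / 2)" for n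
  proof -
    have "(\<Sum>\<^sub>\<infinity>k. \<bar>bdev a n k\<bar>) \<le> (\<Sum>\<^sub>\<infinity>k. \<bar>bdev a1 n k\<bar> + \<bar>bdev a2 n k\<bar>)"
      by (rule infsum_mono[OF bdev_abs_summable(1)[OF a] summable_on_add[OF bdev_abs_summable(1)[OF s1] bdev_abs_summable(1)[OF s2]]])
        (simp add: sum)
    also have "\<dots> = (\<Sum>\<^sub>\<infinity>k. \<bar>bdev a1 n k\<bar>) + (\<Sum>\<^sub>\<infinity>k. \<bar>bdev a2 n k\<bar>)"
      by (rule infsum_add; rule bdev_abs_summable; fact)
    also have "\<dots> \<le> D + 2 * (real n * (\<Sum>\<^sub>\<infinity>m. \<bar>a2 m\<bar>))"
      unfolding D_def by (intro add_mono bdev_finite_support bdev_abs_sum_le s2 J) (auto simp: a1_def)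
    also have "\<dots> \<le> D + 2 * (real n * (r / 4))"
      using J(2) unfolding a2_def[symmetric] by (intro add_left_mono mult_left_mono) auto
    finally show ?thesis by (simp add: mult.commute)
  qed
  define N where "N = nat \<lceil>2 * \<bar>D\<bar> / r\<rceil> + 1"
  have "norm ((\<Sum>\<^sub>\<infinity>k. \<bar>bdev a n k\<bar>) / real n - 0) < r" if n: "n \<ge> N" for n
  proof -
    have n0: "real n > 0" using n by (simp add: N_def)
    have "2 * \<bar>D\<bar> / r \<le> real (nat \<lceil>2 * \<bar>D\<bar> / r\<rceil>)" by linarith
    also have "\<dots> < real n" using n by (simp add: N_def)
    finally have "D < real n * (r / 2)" using r by (simp add: field_simps)
    then have "(\<Sum>\<^sub>\<infinity>k. \<bar>bdev a n k\<bar>) < real n * r" using bound[of n] by linarith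
    moreover have "(\<Sum>\<^sub>\<infinity>k. \<bar>bdev a n k\<bar>) \<ge> 0" by (rule infsum_nonneg) simp
    ultimately show ?thesis using n0 by (simp add: field_simps)
  qed
  then show "\<exists>no. \<forall>n\<ge>no. norm ((\<Sum>\<^sub>\<infinity>k. \<bar>bdev a n k\<bar>) / real n - 0) < r" by blast
qed

text \<open>Because \<open>g 0 = 0\<close>, applying \<open>g\<close> to the idealised profile gives
  \<open>bulk n k * g (infsum a UNIV)\<close>, with sum \<open>n * g (infsum a UNIV)\<close>. The
  Lipschitz condition turns the error into the l^1 norm of \<open>bdev\<close>.\<close>

lemma bcoef_average:
  fixes g :: "real \<Rightarrow> real"
  assumes a: "(\<lambda>m. \<bar>a m\<bar>) summable_on UNIV"
    and g: "g 0 = 0" "\<And>x y. \<bar>x\<bar> \<le> (\<Sum>\<^sub>\<infinity>m. \<bar>a m\<bar>) \<Longrightarrow> \<bar>y\<bar> \<le> (\<Sum>\<^sub>\<infinity>m. \<bar>a m\<bar>) \<Longrightarrow> \<bar>g x - g y\<bar> \<le> C * \<bar>x - y\<bar>"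
  shows bcoef_average_summable: "(\<lambda>k. \<bar>g (bcoef a n k)\<bar>) summable_on UNIV"
    and bcoef_average_bound: "\<bar>(\<Sum>\<^sub>\<infinity>k. g (bcoef a n k)) - real n * g (infsum a UNIV)\<bar> \<le> C * (\<Sum>\<^sub>\<infinity>k. \<bar>bdev a n k\<bar>)"
proof -
  note A = infsum_abs_le[OF a]
  have pos: "0 \<le> (\<Sum>\<^sub>\<infinity>m. \<bar>a m\<bar>)" by (rule infsum_nonneg) simp
  have "\<bar>g (bcoef a n k)\<bar> \<le> C * \<bar>bcoef a n k\<bar>" for k
    using g(2)[of "bcoef a n k" 0] bcoef_abs_le[OF a, of n k] pos by (simp add: g(1))
  then show s: "(\<lambda>k. \<bar>g (bcoef a n k)\<bar>) summable_on UNIV"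
    by (intro summable_on_comparison_test[OF summable_on_cmult_right[OF bcoef_abs_summable(1)[OF a], of C]]) auto
  have le: "\<bar>g (bcoef a n k) - bulk n k * g (infsum a UNIV)\<bar> \<le> C * \<bar>bdev a n k\<bar>" for k
    using g(2)[of "bcoef a n k" "infsum a UNIV"] g(2)[of "bcoef a n k" 0] bcoef_abs_le[OF a, of n k] A pos
    by (auto simp: bdev_def bulk_def g(1))
  have s': "(\<lambda>k. C * \<bar>bdev a n k\<bar>) summable_on UNIV"
    by (intro summable_on_cmult_right bdev_abs_summable a)
  have s'': "(\<lambda>k. \<bar>g (bcoef a n k) - bulk n k * g (infsum a UNIV)\<bar>) summable_on UNIV"
    by (rule summable_on_comparison_test[OF s']) (use le in auto)
  have "(\<Sum>\<^sub>\<infinity>k. (g (bcoef a n k) - bulk n k * g (infsum a UNIV)) + bulk n k * g (infsum a UNIV)) =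
      (\<Sum>\<^sub>\<infinity>k. g (bcoef a n k) - bulk n k * g (infsum a UNIV)) + real n * g (infsum a UNIV)"
    by (subst infsum_add[OF abs_summable_imp_summable[OF s''] infsum_bulk(2)]) (simp add: infsum_bulk)
  then have "(\<Sum>\<^sub>\<infinity>k. g (bcoef a n k)) - real n * g (infsum a UNIV) = (\<Sum>\<^sub>\<infinity>k. g (bcoef a n k) - bulk n k * g (infsum a UNIV))"
    by simp
  also have "\<bar>\<Sum>\<^sub>\<infinity>k. g (bcoef a n k) - bulk n k * g (infsum a UNIV)\<bar> \<le> (\<Sum>\<^sub>\<infinity>k. \<bar>g (bcoef a n k) - bulk n k * g (infsum a UNIV)\<bar>)"
    by (rule infsum_abs_le[OF s''])
  also have "\<dots> \<le> (\<Sum>\<^sub>\<infinity>k. C * \<bar>bdev a n k\<bar>)" by (rule infsum_mono[OF s'' s' le])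
  also have "\<dots> = C * (\<Sum>\<^sub>\<infinity>k. \<bar>bdev a n k\<bar>)" by (simp add: infsum_cmult_right')
  finally show "\<bar>(\<Sum>\<^sub>\<infinity>k. g (bcoef a n k)) - real n * g (infsum a UNIV)\<bar> \<le> C * (\<Sum>\<^sub>\<infinity>k. \<bar>bdev a n k\<bar>)" .
qed

text \<open>\<open>bcoef a n k\<close> sums \<open>a\<close> over the consecutive indices from
  \<open>- k\<close> to \<open>n - k - 1\<close>. For fixed \<open>k\<close> the lower end stays and
  the upper end runs to infinity; at position \<open>n + k\<close> the roles are exchanged, as in
  \<open>bcoef_tendsto_right\<close>.\<close>

lemma bcoef_tendsto_left:
  assumes a: "(\<lambda>m. \<bar>a m\<bar>) summable_on UNIV"
  shows "(\<lambda>n. bcoef a n k) \<longlonglongrightarrow> infsum a {-k..}"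
proof -
  have eq: "bcoef a n k = sum a {-k..<int n - k}" for n
  proof -
    have "bcoef a n k = (\<Sum>m\<in>(\<lambda>i. int i - k) ` {..<n}. a m)"
      unfolding bcoef_def by (subst sum.reindex) (auto simp: inj_on_def)
    also have "(\<lambda>i. int i - k) ` {..<n} = {-k..<int n - k}"
    proof safe
      fix x assume "x \<in> {-k..<int n - k}"
      then show "x \<in> (\<lambda>i. int i - k) ` {..<n}" by (intro image_eqI[of _ _ "nat (x + k)"]) auto
    qed auto
    finally show ?thesis .
  qed
  show ?thesis
    unfolding eq
  proof (rule infsum_tendsto_finite_sets)
    show "a summable_on {-k..}"
      by (rule summable_on_subset_banach[OF abs_summable_imp_summable[OF a]]) simp
    show "\<forall>\<^sub>F n in sequentially. x \<in> {-k..<int n - k}" if "x \<in> {-k..}" for x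
      using eventually_gt_at_top[of "nat \<bar>x + k\<bar>"] by eventually_elim (use that in auto)
  qed auto
qed

lemma bcoef_tendsto_right:
  assumes a: "(\<lambda>m. \<bar>a m\<bar>) summable_on UNIV"
  shows "(\<lambda>n. bcoef a n (int n + k)) \<longlonglongrightarrow> infsum a {..-1-k}"
proof -
  have eq: "bcoef a n (int n + k) = sum a {-int n-k..-1-k}" for n
  proof -
    have "bcoef a n (int n + k) = (\<Sum>m\<in>(\<lambda>i. int i - (int n + k)) ` {..<n}. a m)"
      unfolding bcoef_def by (subst sum.reindex) (auto simp: inj_on_def)
    also have "(\<lambda>i. int i - (int n + k)) ` {..<n} = {-int n-k..-1-k}"
    proof safe
      fix x assume "x \<in> {-int n-k..-1-k}"
      then show "x \<in> (\<lambda>i. int i - (int n + k)) ` {..<n}" by (intro image_eqI[of _ _ "nat (x + int n + k)"]) auto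
    qed auto
    finally show ?thesis .
  qed
  show ?thesis
    unfolding eq
  proof (rule infsum_tendsto_finite_sets)
    show "a summable_on {..-1-k}"
      by (rule summable_on_subset_banach[OF abs_summable_imp_summable[OF a]]) simp
    show "\<forall>\<^sub>F n in sequentially. x \<in> {-int n-k..-1-k}" if "x \<in> {..-1-k}" for x
      using eventually_gt_at_top[of "nat \<bar>x + k\<bar>"] by eventually_elim (use that in auto)
  qed auto
qed

section \<open>Infinite linear forms in independent variables\<close>

text \<open>Where the series is not summable, \<open>infsum\<close> returns \<open>0\<close>. This
  makes \<open>lin\<close> measurable without exceptional sets, whereas splittings of the series
  hold only almost surely.\<close>

definition lin :: "(int \<Rightarrow> real) \<Rightarrow> (int \<Rightarrow> 'w \<Rightarrow> real) \<Rightarrow> 'w \<Rightarrow> real" where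
  "lin c Z \<omega> = (\<Sum>\<^sub>\<infinity>k. c k * Z k \<omega>)"

lemma integrable_count_space_iff: "integrable (count_space A) f \<longleftrightarrow> (\<lambda>x. \<bar>f x\<bar>) summable_on A" for f :: "'a \<Rightarrow> real"
  using abs_summable_equivalent[of f A] by (simp add: abs_summable_on_def)

text \<open>For real families summability and absolute summability coincide, and otherwise both
  sides default to \<open>0\<close>. Measurability of infinite sums is inherited from Lebesgue
  integrals in this way.\<close>

lemma infsum_eq_integral: "infsum f UNIV = (\<integral>k. f k \<partial>count_space UNIV)" for f :: "int \<Rightarrow> real"
proof (cases "(\<lambda>x. \<bar>f x\<bar>) summable_on UNIV")
  case True
  then show ?thesis
    using infsetsum_infsum[of f UNIV] by (simp add: infsetsum_def abs_summable_on_def integrable_count_space_iff)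
next
  case False
  then have "\<not> f summable_on UNIV"
    using summable_on_iff_abs_summable_on_real[of f UNIV] by simp
  then show ?thesis
    using False by (simp add: not_integrable_integral_eq infsum_not_exists integrable_count_space_iff)
qed

lemma borel_measurable_infsum [measurable (raw)]:
  fixes f :: "'w \<Rightarrow> int \<Rightarrow> real"
  assumes [measurable]: "\<And>k. (\<lambda>\<omega>. f \<omega> k) \<in> borel_measurable M"
  shows "(\<lambda>\<omega>. \<Sum>\<^sub>\<infinity>k. f \<omega> k) \<in> borel_measurable M"
proof -
  interpret sigma_finite_measure "count_space (UNIV :: int set)"
    by (rule sigma_finite_measure_count_space)
  have "(\<lambda>p. case p of (\<omega>, k) \<Rightarrow> f \<omega> k) \<in> borel_measurable (M \<Otimes>\<^sub>M count_space UNIV)"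
    unfolding split_beta'
    by (rule measurable_compose_countable'[where f="\<lambda>k p. f (fst p) k" and g=snd and I=UNIV]) auto
  then show ?thesis
    unfolding infsum_eq_integral by (rule borel_measurable_lebesgue_integral)
qed

lemma lin_measurable [measurable]:
  assumes [measurable]: "\<And>k. Z k \<in> borel_measurable M"
  shows "lin c Z \<in> borel_measurable M"
  unfolding lin_def[abs_def] by measurable

lemma lin_moving_average: "moving_average a Z n = lin (\<lambda>k. a (n - k)) Z"
proof
  fix \<omega>
  show "moving_average a Z n \<omega> = lin (\<lambda>k. a (n - k)) Z \<omega>"
    using infsum_reflect[of "\<lambda>k. a (n - k) * Z k \<omega>" n] by (simp add: lin_def moving_average_def)
qed

text \<open>Tonelli. The weight \<open>D\<close> will be either \<open>1\<close> or
  \<open>sqrt n * kernel\<close> of the centred window sum; first moments bounded uniformly in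
  \<open>k\<close> under this weight reduce truncation errors to l^1 norms of coefficients.\<close>

lemma nn_integral_abs_weighted:
  fixes Z :: "int \<Rightarrow> 'w \<Rightarrow> real"
  assumes [measurable]: "\<And>k. Z k \<in> borel_measurable Q" "D \<in> borel_measurable Q"
    and bound: "\<And>k. (\<integral>\<^sup>+\<omega>. D \<omega> * ennreal \<bar>Z k \<omega>\<bar> \<partial>Q) \<le> ennreal C" and C: "C \<ge> 0"
    and c: "(\<lambda>k. \<bar>c k\<bar>) summable_on UNIV"
  shows "(\<integral>\<^sup>+\<omega>. D \<omega> * (\<integral>\<^sup>+k. ennreal \<bar>c k * Z k \<omega>\<bar> \<partial>count_space UNIV) \<partial>Q) \<le> ennreal (C * (\<Sum>\<^sub>\<infinity>k. \<bar>c k\<bar>))"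
proof -
  have "(\<integral>\<^sup>+\<omega>. D \<omega> * (\<integral>\<^sup>+k. ennreal \<bar>c k * Z k \<omega>\<bar> \<partial>count_space UNIV) \<partial>Q) =
      (\<integral>\<^sup>+\<omega>. \<integral>\<^sup>+k. D \<omega> * ennreal \<bar>c k * Z k \<omega>\<bar> \<partial>count_space UNIV \<partial>Q)"
    by (intro nn_integral_cong nn_integral_cmult[symmetric]) simp
  also have "\<dots> = (\<integral>\<^sup>+k. \<integral>\<^sup>+\<omega>. D \<omega> * ennreal \<bar>c k * Z k \<omega>\<bar> \<partial>Q \<partial>count_space UNIV)"
    by (rule nn_integral_count_space_nn_integral) auto
  also have "\<dots> = (\<integral>\<^sup>+k. ennreal \<bar>c k\<bar> * (\<integral>\<^sup>+\<omega>. D \<omega> * ennreal \<bar>Z k \<omega>\<bar> \<partial>Q) \<partial>count_space UNIV)"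
  proof (intro nn_integral_cong)
    fix k
    have "D \<omega> * ennreal \<bar>c k * Z k \<omega>\<bar> = ennreal \<bar>c k\<bar> * (D \<omega> * ennreal \<bar>Z k \<omega>\<bar>)" for \<omega>
      by (simp add: abs_mult ennreal_mult mult.left_commute)
    then show "(\<integral>\<^sup>+\<omega>. D \<omega> * ennreal \<bar>c k * Z k \<omega>\<bar> \<partial>Q) = ennreal \<bar>c k\<bar> * (\<integral>\<^sup>+\<omega>. D \<omega> * ennreal \<bar>Z k \<omega>\<bar> \<partial>Q)"
      by (simp add: nn_integral_cmult)
  qed
  also have "\<dots> \<le> (\<integral>\<^sup>+k. ennreal \<bar>c k\<bar> * ennreal C \<partial>count_space UNIV)"
    by (intro nn_integral_mono mult_left_mono bound) auto
  also have "\<dots> = (\<integral>\<^sup>+k. ennreal (\<bar>c k\<bar>) \<partial>count_space UNIV) * ennreal C"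
    by (rule nn_integral_multc) simp
  also have "(\<integral>\<^sup>+k. ennreal (\<bar>c k\<bar>) \<partial>count_space UNIV) = ennreal (\<Sum>\<^sub>\<infinity>k. \<bar>c k\<bar>)"
    unfolding infsum_eq_integral
    using c by (intro nn_integral_eq_integral) (auto simp: integrable_count_space_iff)
  also have "ennreal (\<Sum>\<^sub>\<infinity>k. \<bar>c k\<bar>) * ennreal C = ennreal (C * (\<Sum>\<^sub>\<infinity>k. \<bar>c k\<bar>))"
    using C by (simp add: ennreal_mult infsum_nonneg mult.commute)
  finally show ?thesis .
qed

lemma (in prob_space) AE_lin_summable:
  fixes Z :: "int \<Rightarrow> 'a \<Rightarrow> real"
  assumes [measurable]: "\<And>k. Z k \<in> borel_measurable M"
    and bound: "\<And>k. (\<integral>\<^sup>+\<omega>. ennreal \<bar>Z k \<omega>\<bar> \<partial>M) \<le> ennreal C" and C: "C \<ge> 0"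
    and c: "(\<lambda>k. \<bar>c k\<bar>) summable_on UNIV"
  shows "AE \<omega> in M. (\<lambda>k. \<bar>c k * Z k \<omega>\<bar>) summable_on UNIV"
proof -
  interpret sigma_finite_measure "count_space (UNIV :: int set)"
    by (rule sigma_finite_measure_count_space)
  have "(\<integral>\<^sup>+\<omega>. (\<integral>\<^sup>+k. ennreal \<bar>c k * Z k \<omega>\<bar> \<partial>count_space UNIV) \<partial>M) \<le> ennreal (C * (\<Sum>\<^sub>\<infinity>k. \<bar>c k\<bar>))"
    using nn_integral_abs_weighted[of Z M "\<lambda>_. 1" C c] bound C c by simp
  then have "(\<integral>\<^sup>+\<omega>. (\<integral>\<^sup>+k. ennreal \<bar>c k * Z k \<omega>\<bar> \<partial>count_space UNIV) \<partial>M) \<noteq> \<infinity>"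
    by (auto simp: top_unique)
  moreover have "(\<lambda>p. case p of (\<omega>, k) \<Rightarrow> ennreal \<bar>c k * Z k \<omega>\<bar>) \<in> borel_measurable (M \<Otimes>\<^sub>M count_space UNIV)"
    unfolding split_beta'
    by (rule measurable_compose_countable'[where f="\<lambda>k p. ennreal \<bar>c k * Z k (fst p)\<bar>" and g=snd and I=UNIV]) auto
  then have "(\<lambda>\<omega>. \<integral>\<^sup>+k. ennreal \<bar>c k * Z k \<omega>\<bar> \<partial>count_space UNIV) \<in> borel_measurable M"
    by (rule borel_measurable_nn_integral)
  ultimately have "AE \<omega> in M. (\<integral>\<^sup>+k. ennreal \<bar>c k * Z k \<omega>\<bar> \<partial>count_space UNIV) \<noteq> \<infinity>"
    by (intro nn_integral_PInf_AE)
  then show ?thesis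
  proof eventually_elim
    case (elim \<omega>)
    then have "integrable (count_space UNIV) (\<lambda>k. c k * Z k \<omega>)"
      by (intro integrableI_bounded) (auto simp: less_top)
    then show ?case by (simp add: integrable_count_space_iff)
  qed
qed

lemma lin_tendsto:
  "(\<lambda>k. \<bar>c k * Z k \<omega>\<bar>) summable_on UNIV \<Longrightarrow> (\<lambda>m. \<Sum>k\<in>{-int m..int m}. c k * Z k \<omega>) \<longlonglongrightarrow> lin c Z \<omega>"
  unfolding lin_def by (rule infsum_tendsto_int[OF abs_summable_imp_summable])

text \<open>Symmetric partial sums converge almost surely and their characteristic functions
  factorise; bounded convergence passes to the limit. Bounds on finite products thus carry over to
  the infinite form.\<close>

lemma (in prob_space) char_lin_tendsto:
  fixes Z :: "int \<Rightarrow> 'a \<Rightarrow> real"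
  assumes ind: "indep_vars (\<lambda>_. borel) Z UNIV"
    and ae: "AE \<omega> in M. (\<lambda>k. \<bar>c k * Z k \<omega>\<bar>) summable_on UNIV"
  shows "(\<lambda>m. \<Prod>k\<in>{-int m..int m}. char (distr M borel (Z k)) (s * c k)) \<longlonglongrightarrow> char (distr M borel (lin c Z)) s"
proof -
  have Z [measurable]: "Z k \<in> borel_measurable M" for k
    using ind unfolding indep_vars_def by auto
  have "(\<Prod>k\<in>{-int m..int m}. char (distr M borel (Z k)) (s * c k)) =
      (CLINT \<omega>|M. iexp (s * (\<Sum>k\<in>{-int m..int m}. c k * Z k \<omega>)))" for m
  proof -
    have ind': "indep_vars (\<lambda>_. borel) (\<lambda>k \<omega>. c k * Z k \<omega>) {-int m..int m}"
      by (rule indep_vars_compose2[where X=Z and M'="\<lambda>_. borel"]) (auto intro: indep_vars_subset[OF ind])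
    have "char (distr M borel (\<lambda>\<omega>. \<Sum>k\<in>{-int m..int m}. c k * Z k \<omega>)) s =
        (\<Prod>k\<in>{-int m..int m}. char (distr M borel (\<lambda>\<omega>. c k * Z k \<omega>)) s)"
      by (rule char_distr_sum[OF ind'])
    moreover have "char (distr M borel (\<lambda>\<omega>. c k * Z k \<omega>)) s = char (distr M borel (Z k)) (s * c k)" for k
      unfolding char_def by (simp add: integral_distr mult.assoc)
    moreover have "char (distr M borel (\<lambda>\<omega>. \<Sum>k\<in>{-int m..int m}. c k * Z k \<omega>)) s =
        (CLINT \<omega>|M. iexp (s * (\<Sum>k\<in>{-int m..int m}. c k * Z k \<omega>)))"
      unfolding char_def by (subst integral_distr) auto
    ultimately show ?thesis by simp
  qed
  moreover have "(\<lambda>m. CLINT \<omega>|M. iexp (s * (\<Sum>k\<in>{-int m..int m}. c k * Z k \<omega>))) \<longlonglongrightarrow> (CLINT \<omega>|M. iexp (s * lin c Z \<omega>))"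
  proof (rule integral_dominated_convergence[where w="\<lambda>_. 1"])
    show "AE \<omega> in M. (\<lambda>m. iexp (s * (\<Sum>k\<in>{-int m..int m}. c k * Z k \<omega>))) \<longlonglongrightarrow> iexp (s * lin c Z \<omega>)"
      using ae
    proof eventually_elim
      case (elim \<omega>)
      have "(\<lambda>m. \<Sum>k\<in>{-int m..int m}. c k * Z k \<omega>) \<longlonglongrightarrow> lin c Z \<omega>"
        using elim by (rule lin_tendsto)
      then show ?case
        by (intro isCont_tendsto_compose[OF isCont_iexp] tendsto_mult tendsto_const)
    qed
  qed auto
  moreover have "(CLINT \<omega>|M. iexp (s * lin c Z \<omega>)) = char (distr M borel (lin c Z)) s"
    unfolding char_def by (subst integral_distr) auto
  ultimately show ?thesis by simp
qed

text \<open>Functions of disjoint groups of independent variables are independent. The map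
  \<open>idx\<close> allows one abstract index set \<open>I\<close>, hence one product space, to
  serve for blocks that move with \<open>n\<close>.\<close>

lemma (in prob_space) distr_block_rest:
  fixes X :: "'k \<Rightarrow> 'a \<Rightarrow> real" and idx :: "'i \<Rightarrow> 'k" and \<phi> :: "('k \<Rightarrow> real) \<Rightarrow> real"
  assumes ind: "indep_vars (\<lambda>_. borel) X UNIV" and inj: "inj_on idx I" and I: "I \<noteq> {}"
    and \<phi>: "\<phi> \<in> borel_measurable (PiM (- idx ` I) (\<lambda>_. borel))"
    and Y: "\<And>\<omega>. Y \<omega> = \<phi> (restrict (\<lambda>k. X k \<omega>) (- idx ` I))"
  shows "distr M (PiM I (\<lambda>_. borel) \<Otimes>\<^sub>M borel) (\<lambda>\<omega>. (\<lambda>p\<in>I. X (idx p) \<omega>, Y \<omega>)) =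
      PiM I (\<lambda>p. distr M borel (X (idx p))) \<Otimes>\<^sub>M distr M borel Y"
proof -
  have X [measurable]: "X k \<in> borel_measurable M" for k
    using ind unfolding indep_vars_def by auto
  define K where "K b = (if b then idx ` I else - idx ` I)" for b
  have "indep_vars (\<lambda>j. PiM (K j) (\<lambda>_. borel)) (\<lambda>j \<omega>. restrict (\<lambda>i. X i \<omega>) (K j)) (UNIV :: bool set)"
    by (rule indep_vars_restrict[OF ind]) (auto simp: K_def disjoint_family_on_def)
  then have "indep_var (PiM (K True) (\<lambda>_. borel)) (\<lambda>\<omega>. restrict (\<lambda>i. X i \<omega>) (K True))
      (PiM (K False) (\<lambda>_. borel)) (\<lambda>\<omega>. restrict (\<lambda>i. X i \<omega>) (K False))"
    unfolding indep_var_def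
    by (rule indep_vars_cong[THEN iffD1, rotated 3]) (auto split: bool.split simp: UNIV_bool)
  then have joint: "distr M (PiM (K True) (\<lambda>_. borel)) (\<lambda>\<omega>. restrict (\<lambda>i. X i \<omega>) (K True)) \<Otimes>\<^sub>M
      distr M (PiM (K False) (\<lambda>_. borel)) (\<lambda>\<omega>. restrict (\<lambda>i. X i \<omega>) (K False)) =
      distr M (PiM (K True) (\<lambda>_. borel) \<Otimes>\<^sub>M PiM (K False) (\<lambda>_. borel))
        (\<lambda>\<omega>. (restrict (\<lambda>i. X i \<omega>) (K True), restrict (\<lambda>i. X i \<omega>) (K False)))"
    (is "?A \<Otimes>\<^sub>M ?B = _")
    by (simp add: indep_var_distribution_eq)
  define f where "f x = (\<lambda>p\<in>I. x (idx p))" for x :: "'k \<Rightarrow> real"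
  have f [measurable]: "f \<in> measurable (PiM (K True) (\<lambda>_. borel)) (PiM I (\<lambda>_. borel))"
    unfolding f_def by (auto simp: K_def intro!: measurable_restrict measurable_component_singleton)
  have \<phi>' [measurable]: "\<phi> \<in> borel_measurable (PiM (K False) (\<lambda>_. borel))"
    using \<phi> by (simp add: K_def)
  have r [measurable]: "(\<lambda>\<omega>. restrict (\<lambda>i. X i \<omega>) (K b)) \<in> measurable M (PiM (K b) (\<lambda>_. borel))" for b
    by measurable
  have fr: "f (restrict (\<lambda>i. X i \<omega>) (K True)) = (\<lambda>p\<in>I. X (idx p) \<omega>)" "\<phi> (restrict (\<lambda>i. X i \<omega>) (K False)) = Y \<omega>" for \<omega>
    by (auto simp: f_def K_def fun_eq_iff Y)
  interpret B: prob_space ?B by (rule prob_space_distr) simp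
  interpret B': prob_space "distr ?B borel \<phi>" by (rule B.prob_space_distr) simp
  have "distr ?A (PiM I (\<lambda>_. borel)) f \<Otimes>\<^sub>M distr ?B borel \<phi> =
      distr (?A \<Otimes>\<^sub>M ?B) (PiM I (\<lambda>_. borel) \<Otimes>\<^sub>M borel) (\<lambda>(x, y). (f x, \<phi> y))"
    by (rule pair_measure_distr) (simp_all add: B'.sigma_finite_measure_axioms)
  also have "\<dots> = distr M (PiM I (\<lambda>_. borel) \<Otimes>\<^sub>M borel) (\<lambda>\<omega>. (\<lambda>p\<in>I. X (idx p) \<omega>, Y \<omega>))"
    unfolding joint by (subst distr_distr) (auto simp: comp_def fr)
  also have "distr ?A (PiM I (\<lambda>_. borel)) f = distr M (PiM I (\<lambda>_. borel)) (\<lambda>\<omega>. \<lambda>p\<in>I. X (idx p) \<omega>)"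
    by (subst distr_distr) (auto simp: comp_def fr)
  also have "distr ?B borel \<phi> = distr M borel Y"
    by (subst distr_distr) (auto simp: comp_def fr)
  finally have "distr M (PiM I (\<lambda>_. borel)) (\<lambda>\<omega>. \<lambda>p\<in>I. X (idx p) \<omega>) \<Otimes>\<^sub>M distr M borel Y =
      distr M (PiM I (\<lambda>_. borel) \<Otimes>\<^sub>M borel) (\<lambda>\<omega>. (\<lambda>p\<in>I. X (idx p) \<omega>, Y \<omega>))" .
  moreover have "indep_vars (\<lambda>_. borel) (\<lambda>p. X (idx p)) I"
  proof -
    have "indep_vars (\<lambda>p. PiM {idx p} (\<lambda>_. borel)) (\<lambda>p \<omega>. restrict (\<lambda>i. X i \<omega>) {idx p}) I"
      by (rule indep_vars_restrict[OF ind]) (use inj in \<open>auto simp: disjoint_family_on_def inj_on_def\<close>)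
    from indep_vars_compose2[OF this, of "\<lambda>p x. x (idx p)" "\<lambda>_. borel"] show ?thesis by simp
  qed
  then have "distr M (PiM I (\<lambda>_. borel)) (\<lambda>\<omega>. \<lambda>p\<in>I. X (idx p) \<omega>) = PiM I (\<lambda>p. distr M borel (X (idx p)))"
    using indep_vars_iff_distr_eq_PiM[OF I, where X="\<lambda>p. X (idx p)" and M'="\<lambda>_. borel"] by simp
  ultimately show ?thesis by simp
qed

text \<open>A linear form with vanishing coefficients on \<open>B\<close> is a measurable function
  of the coordinates outside \<open>B\<close>, in the form that \<open>distr_block_rest\<close> asks
  for.\<close>

lemma lin_restrict:
  assumes "\<And>k. k \<in> B \<Longrightarrow> c k = 0"
  shows "lin c Z \<omega> = lin c (\<lambda>k x. x k) (restrict (\<lambda>k. Z k \<omega>) (- B))"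
    and "lin c (\<lambda>k x. x k) \<in> borel_measurable (PiM (- B) (\<lambda>_. borel))"
proof -
  show "lin c Z \<omega> = lin c (\<lambda>k x. x k) (restrict (\<lambda>k. Z k \<omega>) (- B))"
    unfolding lin_def by (rule infsum_cong) (use assms in \<open>auto simp: restrict_def\<close>)
  have "(\<lambda>x. \<Sum>\<^sub>\<infinity>k. c k * x k) \<in> borel_measurable (PiM (- B) (\<lambda>_. borel))"
  proof (rule borel_measurable_infsum)
    fix k show "(\<lambda>x. c k * x k) \<in> borel_measurable (PiM (- B) (\<lambda>_. borel))"
      by (cases "k \<in> B") (auto simp: assms)
  qed
  then show "lin c (\<lambda>k x. x k) \<in> borel_measurable (PiM (- B) (\<lambda>_. borel))"
    by (simp add: lin_def[abs_def])
qed

section \<open>Tilting the noise sequence\<close>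

text \<open>A density on the original space rather than a new product of tilted laws: expectations
  before and after tilting then concern the same random variables and differ by an explicit
  factor.\<close>

definition tilt_measure :: "'w measure \<Rightarrow> (int \<Rightarrow> 'w \<Rightarrow> real) \<Rightarrow> (int \<Rightarrow> real) \<Rightarrow> 'w measure" where
  "tilt_measure M Z w = density M (\<lambda>\<omega>. ennreal (exp (lin w Z \<omega>) / (\<integral>\<omega>. exp (lin w Z \<omega>) \<partial>M)))"

lemma sets_tilt_measure [simp, measurable_cong]: "sets (tilt_measure M Z w) = sets M"
  and space_tilt_measure [simp]: "space (tilt_measure M Z w) = space M"
  by (simp_all add: tilt_measure_def)

context tiltable
begin

text \<open>The exponent is linear in \<open>v\<close>, so the product of these moments over all
  noise variables is at most the exponential of a multiple of the l^1 norm of the tilts.\<close>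

lemma exp_abs_moment_le:
  assumes v: "0 \<le> v" "v \<le> V"
  shows "(\<integral>z. exp (v * \<bar>z\<bar>) \<partial>F) \<le> exp (v * (\<integral>z. \<bar>z\<bar> * exp (V * \<bar>z\<bar>) \<partial>F))"
proof -
  have "exp (v * \<bar>z\<bar>) \<le> 1 + v * (\<bar>z\<bar> * exp (V * \<bar>z\<bar>))" for z
  proof -
    have "1 - exp (v * \<bar>z\<bar>) \<ge> - (v * \<bar>z\<bar>) * exp (v * \<bar>z\<bar>)"
      using mult_right_mono[OF exp_ge_add_one_self[of "- (v * \<bar>z\<bar>)"], of "exp (v * \<bar>z\<bar>)"]
      by (simp add: exp_add[symmetric] algebra_simps)
    also have "- (v * \<bar>z\<bar>) * exp (v * \<bar>z\<bar>) \<ge> - (v * \<bar>z\<bar>) * exp (V * \<bar>z\<bar>)"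
      using v by (simp add: mult_left_mono mult_right_mono)
    finally show ?thesis by (simp add: mult.assoc)
  qed
  then have "(\<integral>z. exp (v * \<bar>z\<bar>) \<partial>F) \<le> (\<integral>z. 1 + v * (\<bar>z\<bar> * exp (V * \<bar>z\<bar>)) \<partial>F)"
    using integrable_abs_power_exp[of 0 v] integrable_abs_power_exp[of 1 V] by (intro integral_mono) auto
  also have "\<dots> = 1 + v * (\<integral>z. \<bar>z\<bar> * exp (V * \<bar>z\<bar>) \<partial>F)"
    using integrable_abs_power_exp[of 1 V] by simp
  also have "\<dots> \<le> exp (v * (\<integral>z. \<bar>z\<bar> * exp (V * \<bar>z\<bar>) \<partial>F))"
    by (rule exp_ge_add_one_self)
  finally show ?thesis .
qed

lemma nn_integral_abs_tilted_le:
  assumes Z: "Z \<in> borel_measurable Q" "distr Q borel Z = G w" and w: "\<bar>w\<bar> \<le> B"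
  shows "(\<integral>\<^sup>+\<omega>. ennreal \<bar>Z \<omega>\<bar> \<partial>Q) \<le> ennreal (\<integral>z. \<bar>z\<bar> * exp (B * \<bar>z\<bar>) \<partial>F)"
proof -
  have "(\<integral>\<^sup>+\<omega>. ennreal \<bar>Z \<omega>\<bar> \<partial>Q) = (\<integral>\<^sup>+z. ennreal \<bar>z\<bar> \<partial>G w)"
    unfolding Z(2)[symmetric] by (subst nn_integral_distr[OF Z(1)]) auto
  also have "\<dots> = ennreal (\<integral>z. \<bar>z\<bar> \<partial>G w)"
    using integrable_tilted_abs_power[of w 1] by (intro nn_integral_eq_integral) auto
  also have "\<dots> \<le> ennreal (\<integral>z. \<bar>z\<bar> * exp (B * \<bar>z\<bar>) \<partial>F)"
    using mgf_bound_abs_power[OF w, of 1] by (intro ennreal_leI) simp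
  finally show ?thesis .
qed

lemma G_0: "G 0 = F"
proof -
  have "mgf 0 = 1" by (simp add: mgf_eq)
  then show ?thesis unfolding tilted_law_def tilted_density by (simp add: density_1)
qed

lemma tilted_lin_AE_summable:
  fixes Z :: "int \<Rightarrow> 'w \<Rightarrow> real"
  assumes Q: "prob_space Q" and Z: "\<And>k. Z k \<in> borel_measurable Q" "\<And>k. distr Q borel (Z k) = G (w k)"
    and w: "\<And>k. \<bar>w k\<bar> \<le> B" and c: "(\<lambda>k. \<bar>c k\<bar>) summable_on UNIV"
  shows "AE \<omega> in Q. (\<lambda>k. \<bar>c k * Z k \<omega>\<bar>) summable_on UNIV"
proof (rule prob_space.AE_lin_summable[where C="\<integral>z. \<bar>z\<bar> * exp (B * \<bar>z\<bar>) \<partial>F"])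
  show "(\<integral>\<^sup>+\<omega>. ennreal \<bar>Z k \<omega>\<bar> \<partial>Q) \<le> ennreal (\<integral>z. \<bar>z\<bar> * exp (B * \<bar>z\<bar>) \<partial>F)" for k
    by (rule nn_integral_abs_tilted_le[OF Z w])
qed (use Q Z(1) c in \<open>auto intro!: Bochner_Integration.integral_nonneg\<close>)

text \<open>For factors of modulus at most \<open>1\<close>, the difference of two products is at
  most the sum of the differences of the factors. Each of these is cubic in \<open>s * c k\<close>,
  so finite partial products obey the bound, and it survives the passage to the limit.\<close>

lemma lin_char_gauss:
  assumes Q: "prob_space Q" and ind: "prob_space.indep_vars Q (\<lambda>_. borel) Z UNIV"
    and law: "\<And>k. distr Q borel (Z k) = G (w k)"
    and w: "\<And>k. \<bar>w k\<bar> \<le> B" and c: "(\<lambda>k. \<bar>c k\<bar>) summable_on UNIV" and sc: "\<And>k. \<bar>s * c k\<bar> \<le> S"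
    and C: "\<And>t s. \<bar>t\<bar> \<le> B \<Longrightarrow> \<bar>s\<bar> \<le> S \<Longrightarrow>
      cmod (char (G t) s * iexp (- (s * mean t)) - exp (- (s\<^sup>2 * var t / 2))) \<le> C * \<bar>s\<bar> ^ 3"
    and sum1: "(\<lambda>k. c k * mean (w k)) summable_on UNIV"
    and sum2: "(\<lambda>k. (c k)\<^sup>2 * var (w k)) summable_on UNIV"
    and sum3: "(\<lambda>k. \<bar>c k\<bar> ^ 3) summable_on UNIV" and C0: "C \<ge> 0"
  shows "cmod (char (distr Q borel (lin c Z)) s * iexp (- (s * (\<Sum>\<^sub>\<infinity>k. c k * mean (w k)))) -
      exp (- (s\<^sup>2 * (\<Sum>\<^sub>\<infinity>k. (c k)\<^sup>2 * var (w k)) / 2))) \<le> C * \<bar>s\<bar> ^ 3 * (\<Sum>\<^sub>\<infinity>k. \<bar>c k\<bar> ^ 3)"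
proof -
  interpret Q: prob_space Q by (rule Q)
  have Z [measurable]: "Z k \<in> borel_measurable Q" for k
    using ind unfolding Q.indep_vars_def by auto
  have 1: "(\<lambda>m. \<Prod>k\<in>{-int m..int m}. char (G (w k)) (s * c k)) \<longlonglongrightarrow> char (distr Q borel (lin c Z)) s"
    using Q.char_lin_tendsto[OF ind tilted_lin_AE_summable[OF Q Z law w c], of s] by (simp add: law)
  have 2: "(\<lambda>m. iexp (- (s * (\<Sum>k\<in>{-int m..int m}. c k * mean (w k))))) \<longlonglongrightarrow> iexp (- (s * (\<Sum>\<^sub>\<infinity>k. c k * mean (w k))))"
    by (intro isCont_tendsto_compose[OF isCont_iexp] tendsto_minus tendsto_mult tendsto_const infsum_tendsto_int sum1)
  have 3: "(\<lambda>m. complex_of_real (exp (- (s\<^sup>2 * (\<Sum>k\<in>{-int m..int m}. (c k)\<^sup>2 * var (w k)) / 2)))) \<longlonglongrightarrow>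
      complex_of_real (exp (- (s\<^sup>2 * (\<Sum>\<^sub>\<infinity>k. (c k)\<^sup>2 * var (w k)) / 2)))"
    by (intro tendsto_of_real tendsto_exp tendsto_minus tendsto_divide tendsto_mult tendsto_const infsum_tendsto_int sum2) simp
  have fin: "cmod ((\<Prod>k\<in>{-int m..int m}. char (G (w k)) (s * c k)) * iexp (- (s * (\<Sum>k\<in>{-int m..int m}. c k * mean (w k)))) -
      exp (- (s\<^sup>2 * (\<Sum>k\<in>{-int m..int m}. (c k)\<^sup>2 * var (w k)) / 2))) \<le> C * \<bar>s\<bar> ^ 3 * (\<Sum>\<^sub>\<infinity>k. \<bar>c k\<bar> ^ 3)" for m
  proof -
    let ?J = "{-int m..int m}"
    have e1: "iexp (- (s * (\<Sum>k\<in>?J. c k * mean (w k)))) = (\<Prod>k\<in>?J. iexp (- (s * c k * mean (w k))))"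
      by (simp add: exp_sum[symmetric] sum_distrib_left sum_negf mult.assoc)
    have e2: "complex_of_real (exp (- (s\<^sup>2 * (\<Sum>k\<in>?J. (c k)\<^sup>2 * var (w k)) / 2))) =
        (\<Prod>k\<in>?J. complex_of_real (exp (- ((s * c k)\<^sup>2 * var (w k) / 2))))"
      by (simp only: of_real_prod[symmetric] exp_sum[symmetric] finite_atLeastAtMost_int)
        (simp add: sum_negf sum_divide_distrib sum_distrib_left power_mult_distrib mult.assoc)
    have "cmod ((\<Prod>k\<in>?J. char (G (w k)) (s * c k) * iexp (- (s * c k * mean (w k)))) -
        (\<Prod>k\<in>?J. complex_of_real (exp (- ((s * c k)\<^sup>2 * var (w k) / 2))))) \<le>
        (\<Sum>k\<in>?J. cmod (char (G (w k)) (s * c k) * iexp (- (s * c k * mean (w k))) -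
          complex_of_real (exp (- ((s * c k)\<^sup>2 * var (w k) / 2)))))"
    proof (rule norm_prod_diff)
      fix k
      show "cmod (char (G (w k)) (s * c k) * iexp (- (s * c k * mean (w k)))) \<le> 1"
        using real_distribution.cmod_char_le_1[OF real_distribution_tilted] by (simp add: norm_mult)
      show "cmod (complex_of_real (exp (- ((s * c k)\<^sup>2 * var (w k) / 2)))) \<le> 1"
        using var_pos[of "w k"] by (simp add: less_imp_le)
    qed
    also have "\<dots> \<le> (\<Sum>k\<in>?J. C * \<bar>s * c k\<bar> ^ 3)"
      by (intro sum_mono C w sc)
    also have "\<dots> = C * \<bar>s\<bar> ^ 3 * (\<Sum>k\<in>?J. \<bar>c k\<bar> ^ 3)"
      by (simp add: sum_distrib_left abs_mult power_mult_distrib mult.assoc)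
    also have "\<dots> \<le> C * \<bar>s\<bar> ^ 3 * (\<Sum>\<^sub>\<infinity>k. \<bar>c k\<bar> ^ 3)"
      using C0 by (intro mult_left_mono finite_sum_le_infsum sum3) auto
    finally show ?thesis unfolding e1 e2 prod.distrib[symmetric] .
  qed
  show ?thesis
    by (rule Lim_bounded[OF tendsto_norm[OF tendsto_diff[OF tendsto_mult[OF 1 2] 3]]]) (use fin in auto)
qed

context
  fixes M :: "'w measure" and Z :: "int \<Rightarrow> 'w \<Rightarrow> real" and w :: "int \<Rightarrow> real"
  assumes M: "prob_space M" and ind: "prob_space.indep_vars M (\<lambda>_. borel) Z UNIV"
    and law: "\<And>k. distr M borel (Z k) = F" and w: "(\<lambda>k. \<bar>w k\<bar>) summable_on UNIV"
begin

interpretation M: prob_space M by (rule M)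

lemma noise_measurable [measurable]: "Z k \<in> borel_measurable M"
  using ind unfolding M.indep_vars_def by auto

lemma noise_prod_integral:
  assumes J: "finite J" and f: "\<And>k. f k \<in> borel_measurable borel" "\<And>k. k \<in> J \<Longrightarrow> integrable F (f k)"
  shows "integrable M (\<lambda>\<omega>. \<Prod>k\<in>J. f k (Z k \<omega>) :: real)" "(\<integral>\<omega>. (\<Prod>k\<in>J. f k (Z k \<omega>)) \<partial>M) = (\<Prod>k\<in>J. \<integral>z. f k z \<partial>F)"
proof -
  have i: "M.indep_vars (\<lambda>_. borel) (\<lambda>k \<omega>. f k (Z k \<omega>)) J"
    by (rule M.indep_vars_compose2[where X=Z and M'="\<lambda>_. borel"]) (use f M.indep_vars_subset[OF ind] in auto)
  have eq: "integrable M (\<lambda>\<omega>. f k (Z k \<omega>)) \<longleftrightarrow> integrable F (f k)" "(\<integral>\<omega>. f k (Z k \<omega>) \<partial>M) = (\<integral>z. f k z \<partial>F)" for k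
    unfolding law[symmetric, of k] using f(1)[of k] by (simp_all add: integrable_distr_eq integral_distr)
  show "integrable M (\<lambda>\<omega>. \<Prod>k\<in>J. f k (Z k \<omega>))"
    by (rule M.indep_vars_integrable[OF J i]) (simp add: eq f)
  show "(\<integral>\<omega>. (\<Prod>k\<in>J. f k (Z k \<omega>)) \<partial>M) = (\<Prod>k\<in>J. \<integral>z. f k z \<partial>F)"
    using M.indep_vars_lebesgue_integral[OF J i] by (simp add: eq f)
qed

lemma noise_AE_summable: "AE \<omega> in M. (\<lambda>k. \<bar>w k * Z k \<omega>\<bar>) summable_on UNIV"
  by (rule tilted_lin_AE_summable[where w="\<lambda>_. 0" and B=0]) (simp_all add: M law G_0 w)

text \<open>Fatou's lemma along the symmetric partial sums: by independence and
  \<open>exp_abs_moment_le\<close> their exponential moments are at most \<open>exp (C * V)\<close>.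
  The resulting function dominates the exponentials of all partial sums of
  \<open>lin w Z\<close>.\<close>

lemma integrable_exp_abs_lin: "integrable M (\<lambda>\<omega>. exp (lin (\<lambda>k. \<bar>w k\<bar>) (\<lambda>k \<omega>. \<bar>Z k \<omega>\<bar>) \<omega>))"
proof (rule integrableI_bounded)
  define V where "V = (\<Sum>\<^sub>\<infinity>k. \<bar>w k\<bar>)"
  define C where "C = (\<integral>z. \<bar>z\<bar> * exp (V * \<bar>z\<bar>) \<partial>F)"
  have C: "C \<ge> 0" unfolding C_def by (intro Bochner_Integration.integral_nonneg) simp
  have wV: "\<bar>w k\<bar> \<le> V" for k
    using finite_sum_le_infsum[OF w, of "{k}"] by (simp add: V_def)
  define S where "S m \<omega> = (\<Sum>k\<in>{-int m..int m}. \<bar>w k\<bar> * \<bar>Z k \<omega>\<bar>)" for m \<omega>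
  have b: "(\<integral>\<^sup>+\<omega>. ennreal (exp (S m \<omega>)) \<partial>M) \<le> ennreal (exp (C * V))" for m
  proof -
    have e: "exp (S m \<omega>) = (\<Prod>k\<in>{-int m..int m}. exp (\<bar>w k\<bar> * \<bar>Z k \<omega>\<bar>))" for \<omega>
      by (simp add: S_def exp_sum)
    have ie: "integrable F (\<lambda>z. exp (\<bar>w k\<bar> * \<bar>z\<bar>))" for k
      using integrable_abs_power_exp[of 0] by simp
    have i: "integrable M (\<lambda>\<omega>. exp (S m \<omega>))" and
      v: "(\<integral>\<omega>. exp (S m \<omega>) \<partial>M) = (\<Prod>k\<in>{-int m..int m}. \<integral>z. exp (\<bar>w k\<bar> * \<bar>z\<bar>) \<partial>F)"
      unfolding e using noise_prod_integral[of "{-int m..int m}" "\<lambda>k z. exp (\<bar>w k\<bar> * \<bar>z\<bar>)"] ie by auto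
    note v
    also have "(\<Prod>k\<in>{-int m..int m}. \<integral>z. exp (\<bar>w k\<bar> * \<bar>z\<bar>) \<partial>F) \<le> (\<Prod>k\<in>{-int m..int m}. exp (\<bar>w k\<bar> * C))"
      unfolding C_def using exp_abs_moment_le wV by (intro prod_mono conjI Bochner_Integration.integral_nonneg) auto
    also have "\<dots> = exp (C * (\<Sum>k\<in>{-int m..int m}. \<bar>w k\<bar>))"
      by (simp add: exp_sum[symmetric] sum_distrib_left mult.commute)
    also have "\<dots> \<le> exp (C * V)"
      unfolding V_def using C w by (auto intro!: mult_left_mono finite_sum_le_infsum)
    finally show ?thesis
      by (subst nn_integral_eq_integral[OF i]) (auto intro: ennreal_leI)
  qed
  have "(\<integral>\<^sup>+\<omega>. ennreal (norm (exp (lin (\<lambda>k. \<bar>w k\<bar>) (\<lambda>k \<omega>. \<bar>Z k \<omega>\<bar>) \<omega>))) \<partial>M) = (\<integral>\<^sup>+\<omega>. liminf (\<lambda>m. ennreal (exp (S m \<omega>))) \<partial>M)"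
  proof (rule nn_integral_cong_AE)
    show "AE \<omega> in M. ennreal (norm (exp (lin (\<lambda>k. \<bar>w k\<bar>) (\<lambda>k \<omega>. \<bar>Z k \<omega>\<bar>) \<omega>))) = liminf (\<lambda>m. ennreal (exp (S m \<omega>)))"
      using noise_AE_summable
    proof eventually_elim
      case (elim \<omega>)
      then have "(\<lambda>k. \<bar>\<bar>w k\<bar> * \<bar>Z k \<omega>\<bar>\<bar>) summable_on UNIV" by (simp add: abs_mult)
      from lin_tendsto[of "\<lambda>k. \<bar>w k\<bar>" "\<lambda>k \<omega>. \<bar>Z k \<omega>\<bar>", OF this]
      have "(\<lambda>m. ennreal (exp (S m \<omega>))) \<longlonglongrightarrow> ennreal (exp (lin (\<lambda>k. \<bar>w k\<bar>) (\<lambda>k \<omega>. \<bar>Z k \<omega>\<bar>) \<omega>))"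
        unfolding S_def by (intro tendsto_ennrealI tendsto_exp)
      from lim_imp_Liminf[OF _ this] show ?case by simp
    qed
  qed
  also have "\<dots> \<le> liminf (\<lambda>m. \<integral>\<^sup>+\<omega>. ennreal (exp (S m \<omega>)) \<partial>M)"
    by (rule nn_integral_liminf) (simp add: S_def)
  also have "\<dots> \<le> liminf (\<lambda>m. ennreal (exp (C * V)))"
    by (rule Liminf_mono) (use b in auto)
  also have "\<dots> < \<infinity>" by (simp add: Liminf_const)
  finally show "(\<integral>\<^sup>+\<omega>. ennreal (norm (exp (lin (\<lambda>k. \<bar>w k\<bar>) (\<lambda>k \<omega>. \<bar>Z k \<omega>\<bar>) \<omega>))) \<partial>M) < \<infinity>" .
qed measurable

lemma exp_lin_tendsto:
  assumes f [measurable]: "f \<in> borel_measurable M" and b: "\<And>\<omega>. \<bar>f \<omega>\<bar> \<le> 1"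
  shows "integrable M (\<lambda>\<omega>. exp (lin w Z \<omega>) * f \<omega>)"
    "(\<lambda>m. \<integral>\<omega>. exp (\<Sum>k\<in>{-int m..int m}. w k * Z k \<omega>) * f \<omega> \<partial>M) \<longlonglongrightarrow> (\<integral>\<omega>. exp (lin w Z \<omega>) * f \<omega> \<partial>M)"
proof -
  have lim: "AE \<omega> in M. (\<lambda>m. exp (\<Sum>k\<in>{-int m..int m}. w k * Z k \<omega>) * f \<omega>) \<longlonglongrightarrow> exp (lin w Z \<omega>) * f \<omega>"
    using noise_AE_summable
  proof eventually_elim
    case (elim \<omega>)
    then have "(\<lambda>m. \<Sum>k\<in>{-int m..int m}. w k * Z k \<omega>) \<longlonglongrightarrow> lin w Z \<omega>" by (rule lin_tendsto)
    then show ?case by (intro tendsto_mult tendsto_exp tendsto_const)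
  qed
  have dom: "AE \<omega> in M. norm (exp (\<Sum>k\<in>{-int m..int m}. w k * Z k \<omega>) * f \<omega>) \<le> exp (lin (\<lambda>k. \<bar>w k\<bar>) (\<lambda>k \<omega>. \<bar>Z k \<omega>\<bar>) \<omega>)" for m
    using noise_AE_summable
  proof eventually_elim
    case (elim \<omega>)
    have "(\<Sum>k\<in>{-int m..int m}. w k * Z k \<omega>) \<le> (\<Sum>k\<in>{-int m..int m}. \<bar>w k\<bar> * \<bar>Z k \<omega>\<bar>)"
      by (intro sum_mono) (simp add: abs_mult[symmetric])
    also have "\<dots> \<le> lin (\<lambda>k. \<bar>w k\<bar>) (\<lambda>k \<omega>. \<bar>Z k \<omega>\<bar>) \<omega>"
      unfolding lin_def using elim by (intro finite_sum_le_infsum) (auto simp: abs_mult)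
    finally have "exp (\<Sum>k\<in>{-int m..int m}. w k * Z k \<omega>) \<le> exp (lin (\<lambda>k. \<bar>w k\<bar>) (\<lambda>k \<omega>. \<bar>Z k \<omega>\<bar>) \<omega>)" by simp
    then have "exp (\<Sum>k\<in>{-int m..int m}. w k * Z k \<omega>) * \<bar>f \<omega>\<bar> \<le> exp (lin (\<lambda>k. \<bar>w k\<bar>) (\<lambda>k \<omega>. \<bar>Z k \<omega>\<bar>) \<omega>) * 1"
      using b[of \<omega>] by (intro mult_mono) auto
    then show ?case by (simp add: abs_mult)
  qed
  show "integrable M (\<lambda>\<omega>. exp (lin w Z \<omega>) * f \<omega>)"
    by (rule integrable_dominated_convergence[OF _ _ integrable_exp_abs_lin lim dom]) measurable
  show "(\<lambda>m. \<integral>\<omega>. exp (\<Sum>k\<in>{-int m..int m}. w k * Z k \<omega>) * f \<omega> \<partial>M) \<longlonglongrightarrow> (\<integral>\<omega>. exp (lin w Z \<omega>) * f \<omega> \<partial>M)"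
    by (rule integral_dominated_convergence[OF _ _ integrable_exp_abs_lin lim dom]) measurable
qed

definition norming :: real where "norming = (\<integral>\<omega>. exp (lin w Z \<omega>) \<partial>M)"

lemma integrable_exp_lin: "integrable M (\<lambda>\<omega>. exp (lin w Z \<omega>))"
  using exp_lin_tendsto(1)[of "\<lambda>_. 1"] by simp

lemma norming_pos: "norming > 0"
proof -
  have "norming \<noteq> 0"
  proof
    assume "norming = 0"
    then have "AE \<omega> in M. exp (lin w Z \<omega>) = 0"
      unfolding norming_def using integrable_exp_lin by (subst (asm) integral_nonneg_eq_0_iff_AE) auto
    then show False by simp
  qed
  moreover have "norming \<ge> 0" unfolding norming_def by (intro Bochner_Integration.integral_nonneg) simp
  ultimately show ?thesis by linarith
qed

lemma tilt_measure_eq: "tilt_measure M Z w = density M (\<lambda>\<omega>. ennreal (exp (lin w Z \<omega>) / norming))"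
  by (simp add: tilt_measure_def norming_def)

lemma integral_tilt_measure:
  fixes f :: "'w \<Rightarrow> real"
  assumes "f \<in> borel_measurable M"
  shows "(\<integral>\<omega>. f \<omega> \<partial>tilt_measure M Z w) = (\<integral>\<omega>. exp (lin w Z \<omega>) / norming * f \<omega> \<partial>M)"
  unfolding tilt_measure_eq using assms norming_pos by (subst integral_density) auto

lemma prob_space_tilt_measure: "prob_space (tilt_measure M Z w)"
proof (rule prob_spaceI)
  have "emeasure (tilt_measure M Z w) (space (tilt_measure M Z w)) = (\<integral>\<^sup>+\<omega>. ennreal (exp (lin w Z \<omega>) / norming) \<partial>M)"
    unfolding tilt_measure_eq by (subst emeasure_density) (auto intro!: nn_integral_cong)
  also have "\<dots> = ennreal (\<integral>\<omega>. exp (lin w Z \<omega>) / norming \<partial>M)"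
    using integrable_exp_lin norming_pos by (intro nn_integral_eq_integral) auto
  also have "(\<integral>\<omega>. exp (lin w Z \<omega>) / norming \<partial>M) = 1"
    using norming_pos by (simp add: norming_def[symmetric])
  finally show "emeasure (tilt_measure M Z w) (space (tilt_measure M Z w)) = 1" by simp
qed

text \<open>With a finite partial sum in the exponent the expectation of a box indicator factorises
  into moment generating functions and tilted probabilities, the latter not depending on how many
  terms are taken. Letting the partial sums grow gives the product formula, from which both the
  marginal laws and independence follow.\<close>

lemma tilt_measure_box:
  assumes J: "finite J" and A: "\<And>k. k \<in> J \<Longrightarrow> A k \<in> sets borel"
  shows "measure (tilt_measure M Z w) {\<omega> \<in> space M. \<forall>k\<in>J. Z k \<omega> \<in> A k} = (\<Prod>k\<in>J. measure (G (w k)) (A k))"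
proof -
  define f where "f \<omega> = (\<Prod>k\<in>J. indicator (A k) (Z k \<omega>) :: real)" for \<omega>
  have f01: "f \<omega> = (if \<forall>k\<in>J. Z k \<omega> \<in> A k then 1 else 0)" for \<omega>
    using J by (auto simp: f_def indicator_def prod_zero_iff)
  have f [measurable]: "f \<in> borel_measurable M"
    unfolding f_def[abs_def] using A by measurable
  \<comment> \<open>Sets equal to \<open>UNIV\<close> off \<open>J\<close> let the product run over
    the whole summation range.\<close>
  define B where "B k = (if k \<in> J then A k else UNIV)" for k
  have B [measurable]: "B k \<in> sets borel" for k using A by (simp add: B_def)
  have Gm: "(\<integral>z. exp (w k * z) * indicator (B k) z \<partial>F) = mgf (w k) * measure (G (w k)) (B k)" for k
  proof -
    interpret G: real_distribution "G (w k)" by (rule real_distribution_tilted)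
    have "measure (G (w k)) (B k) = (\<integral>z. indicator (B k) z \<partial>G (w k))" by simp
    also have "\<dots> = (\<integral>z. (exp (w k * z) / mgf (w k)) *\<^sub>R indicator (B k) z \<partial>F)"
      by (rule integral_tilted) simp
    also have "\<dots> = (\<integral>z. exp (w k * z) * indicator (B k) z \<partial>F) / mgf (w k)"
      by (subst integral_divide_zero[symmetric]) simp
    finally show ?thesis using mgf_pos[of "w k"] by simp
  qed
  have iB: "integrable F (\<lambda>z. exp (w k * z) * indicator (B k) z)" for k
    by (rule integrable_real_mult_indicator[OF _ exp_moments]) simp
  have fin: "(\<integral>\<omega>. exp (\<Sum>k\<in>{-int m..int m}. w k * Z k \<omega>) * f \<omega> \<partial>M) =
      (\<integral>\<omega>. exp (\<Sum>k\<in>{-int m..int m}. w k * Z k \<omega>) * 1 \<partial>M) * (\<Prod>k\<in>J. measure (G (w k)) (A k))"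
    if m: "J \<subseteq> {-int m..int m}" for m
  proof -
    have "exp (\<Sum>k\<in>{-int m..int m}. w k * Z k \<omega>) * f \<omega> =
        (\<Prod>k\<in>{-int m..int m}. exp (w k * Z k \<omega>) * indicator (B k) (Z k \<omega>))" for \<omega>
    proof -
      have "f \<omega> = (\<Prod>k\<in>{-int m..int m}. indicator (B k) (Z k \<omega>))"
        unfolding f_def using m by (intro prod.mono_neutral_cong_left) (auto simp: B_def)
      then show ?thesis by (simp add: exp_sum prod.distrib)
    qed
    then have "(\<integral>\<omega>. exp (\<Sum>k\<in>{-int m..int m}. w k * Z k \<omega>) * f \<omega> \<partial>M) =
        (\<Prod>k\<in>{-int m..int m}. \<integral>z. exp (w k * z) * indicator (B k) z \<partial>F)"
      using noise_prod_integral(2)[of "{-int m..int m}" "\<lambda>k z. exp (w k * z) * indicator (B k) z"] iB by simp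
    also have "\<dots> = (\<Prod>k\<in>{-int m..int m}. mgf (w k)) * (\<Prod>k\<in>{-int m..int m}. measure (G (w k)) (B k))"
      unfolding Gm by (simp add: prod.distrib)
    also have "(\<Prod>k\<in>{-int m..int m}. measure (G (w k)) (B k)) = (\<Prod>k\<in>J. measure (G (w k)) (A k))"
    proof (rule prod.mono_neutral_cong_right)
      fix k
      interpret G: real_distribution "G (w k)" by (rule real_distribution_tilted)
      show "k \<in> J \<Longrightarrow> measure (G (w k)) (B k) = measure (G (w k)) (A k)" by (simp add: B_def)
    next
      show "\<forall>k\<in>{-int m..int m} - J. measure (G (w k)) (B k) = 1"
        using prob_space.prob_space[OF real_distribution.axioms(1)[OF real_distribution_tilted]]
          real_distribution.space_eq_univ[OF real_distribution_tilted] by (simp add: B_def)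
    qed (use m in auto)
    also have "(\<Prod>k\<in>{-int m..int m}. mgf (w k)) = (\<integral>\<omega>. exp (\<Sum>k\<in>{-int m..int m}. w k * Z k \<omega>) * 1 \<partial>M)"
      using noise_prod_integral(2)[of "{-int m..int m}" "\<lambda>k z. exp (w k * z)"] exp_moments by (simp add: exp_sum mgf_eq)
    finally show ?thesis .
  qed
  have "(\<lambda>m. (\<integral>\<omega>. exp (\<Sum>k\<in>{-int m..int m}. w k * Z k \<omega>) * 1 \<partial>M) * (\<Prod>k\<in>J. measure (G (w k)) (A k)))
      \<longlonglongrightarrow> norming * (\<Prod>k\<in>J. measure (G (w k)) (A k))"
    using exp_lin_tendsto(2)[of "\<lambda>_. 1"] by (intro tendsto_mult tendsto_const) (simp add: norming_def)
  moreover have "\<forall>\<^sub>F m in sequentially. (\<integral>\<omega>. exp (\<Sum>k\<in>{-int m..int m}. w k * Z k \<omega>) * 1 \<partial>M) * (\<Prod>k\<in>J. measure (G (w k)) (A k)) =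
      (\<integral>\<omega>. exp (\<Sum>k\<in>{-int m..int m}. w k * Z k \<omega>) * f \<omega> \<partial>M)"
  proof -
    have "\<forall>\<^sub>F m in sequentially. \<forall>k\<in>J. k \<in> {-int m..int m}"
    proof (intro eventually_ball_finite J ballI)
      fix k show "\<forall>\<^sub>F m in sequentially. k \<in> {-int m..int m}"
        using eventually_ge_at_top[of "nat \<bar>k\<bar>"] by eventually_elim auto
    qed
    then show ?thesis by eventually_elim (rule fin[symmetric], auto)
  qed
  ultimately have "(\<lambda>m. \<integral>\<omega>. exp (\<Sum>k\<in>{-int m..int m}. w k * Z k \<omega>) * f \<omega> \<partial>M) \<longlonglongrightarrow> norming * (\<Prod>k\<in>J. measure (G (w k)) (A k))"
    by (rule Lim_transform_eventually)
  then have eq: "(\<integral>\<omega>. exp (lin w Z \<omega>) * f \<omega> \<partial>M) = norming * (\<Prod>k\<in>J. measure (G (w k)) (A k))"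
    using exp_lin_tendsto(2)[OF f] f01 by (intro LIMSEQ_unique) auto
  have "measure (tilt_measure M Z w) {\<omega> \<in> space M. \<forall>k\<in>J. Z k \<omega> \<in> A k} =
      (\<integral>\<omega>. indicator {\<omega> \<in> space M. \<forall>k\<in>J. Z k \<omega> \<in> A k} \<omega> \<partial>tilt_measure M Z w)"
    by (simp add: Int_absorb2 Collect_conj_eq)
  also have "\<dots> = (\<integral>\<omega>. f \<omega> \<partial>tilt_measure M Z w)"
    by (intro Bochner_Integration.integral_cong) (auto simp: f01 indicator_def)
  also have "\<dots> = (\<integral>\<omega>. exp (lin w Z \<omega>) * f \<omega> / norming \<partial>M)"
    by (subst integral_tilt_measure) simp_all
  also have "\<dots> = (\<Prod>k\<in>J. measure (G (w k)) (A k))"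
    using norming_pos by (simp add: eq)
  finally show ?thesis .
qed

lemma tilt_measure_law: "distr (tilt_measure M Z w) borel (Z k) = G (w k)"
proof -
  interpret Q: prob_space "tilt_measure M Z w" by (rule prob_space_tilt_measure)
  interpret G: real_distribution "G (w k)" by (rule real_distribution_tilted)
  show ?thesis
  proof (rule measure_eqI)
    fix A assume "A \<in> sets (distr (tilt_measure M Z w) borel (Z k))"
    then have A: "A \<in> sets borel" by simp
    have "emeasure (distr (tilt_measure M Z w) borel (Z k)) A = emeasure (tilt_measure M Z w) {\<omega> \<in> space M. \<forall>k\<in>{k}. Z k \<omega> \<in> A}"
      using A by (subst emeasure_distr) (auto intro!: arg_cong[where f="emeasure _"])
    also have "\<dots> = ennreal (measure (G (w k)) A)"
      using tilt_measure_box[of "{k}" "\<lambda>_. A"] A by (simp add: Q.emeasure_eq_measure)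
    finally show "emeasure (distr (tilt_measure M Z w) borel (Z k)) A = emeasure (G (w k)) A"
      by (simp add: G.emeasure_eq_measure)
  qed simp
qed

lemma tilt_measure_indep: "prob_space.indep_vars (tilt_measure M Z w) (\<lambda>_. borel) Z UNIV"
proof -
  interpret Q: prob_space "tilt_measure M Z w" by (rule prob_space_tilt_measure)
  show ?thesis
    unfolding Q.indep_vars_def2 Q.indep_sets_def
  proof (intro conjI ballI allI impI)
    fix J :: "int set" and E
    assume J: "J \<noteq> {}" "finite J" and E: "E \<in> Pi J (\<lambda>i. {Z i -` A \<inter> space (tilt_measure M Z w) |A. A \<in> sets borel})"
    then have "\<forall>i\<in>J. \<exists>A. A \<in> sets borel \<and> E i = Z i -` A \<inter> space M"
      by (auto simp: Pi_def)
    then obtain A where A: "\<And>i. i \<in> J \<Longrightarrow> A i \<in> sets borel" "\<And>i. i \<in> J \<Longrightarrow> E i = Z i -` A i \<inter> space M"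
      by metis
    have "(\<Inter>j\<in>J. E j) = {\<omega> \<in> space M. \<forall>k\<in>J. Z k \<omega> \<in> A k}" using A(2) J by auto
    then have "Q.prob (\<Inter>j\<in>J. E j) = (\<Prod>k\<in>J. measure (G (w k)) (A k))"
      using tilt_measure_box[OF J(2) A(1)] by simp
    moreover have "Q.prob (E k) = measure (G (w k)) (A k)" if "k \<in> J" for k
    proof -
      have "E k = {\<omega> \<in> space M. \<forall>i\<in>{k}. Z i \<omega> \<in> A i}" using A(2)[OF that] by auto
      then show ?thesis using tilt_measure_box[of "{k}" A] A(1)[OF that] by simp
    qed
    ultimately show "Q.prob (\<Inter>j\<in>J. E j) = (\<Prod>j\<in>J. Q.prob (E j))" by simp
  qed auto
qed

end

declare noise_measurable [measurable del]

end

section \<open>The tilted moving average\<close>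

lemma lipschitz_mult:
  fixes f g :: "real \<Rightarrow> real"
  assumes "\<bar>f x\<bar> \<le> Cf" "\<bar>g y\<bar> \<le> Cg" "\<bar>f x - f y\<bar> \<le> Lf * d" "\<bar>g x - g y\<bar> \<le> Lg * d"
  shows "\<bar>f x * g x - f y * g y\<bar> \<le> (Cf * Lg + Cg * Lf) * d"
proof -
  have "f x * g x - f y * g y = f x * (g x - g y) + g y * (f x - f y)" by (simp add: algebra_simps)
  then have "\<bar>f x * g x - f y * g y\<bar> \<le> \<bar>f x\<bar> * \<bar>g x - g y\<bar> + \<bar>g y\<bar> * \<bar>f x - f y\<bar>"
    by (metis abs_mult abs_triangle_ineq)
  also have "\<dots> \<le> Cf * (Lg * d) + Cg * (Lf * d)"
    using assms by (intro add_mono mult_mono) auto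
  finally show ?thesis by (simp add: algebra_simps)
qed

locale moving_avg = tiltable F for F :: "real measure" +
  fixes a :: "int \<Rightarrow> real" and A \<epsilon> \<tau> :: real and M :: "'w measure" and Z :: "int \<Rightarrow> 'w \<Rightarrow> real"
  assumes M: "prob_space M" and Z_indep: "prob_space.indep_vars M (\<lambda>_. borel) Z UNIV"
    and Z_law: "\<And>n. distr M borel (Z n) = F"
    and a_summable: "(\<lambda>m. \<bar>a m\<bar>) summable_on UNIV"
    and A_eq: "A = infsum a UNIV" and A_pos: "0 < A"
    and \<tau>: "0 < \<tau>" "mean \<tau> = \<epsilon> / A"
begin

section \<open>Mean and variance of the tilted window sum, and the saddle point\<close>

abbreviation b :: "nat \<Rightarrow> int \<Rightarrow> real" where "b \<equiv> bcoef a"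

definition a1 :: real where "a1 = (\<Sum>\<^sub>\<infinity>m. \<bar>a m\<bar>)"
definition \<theta> :: real where "\<theta> = \<tau> / A"
text \<open>The mean of the window sum when each \<open>Z k\<close> is tilted by
  \<open>t * b n k\<close>; \<open>vsum\<close> is the corresponding variance.\<close>

definition msum :: "nat \<Rightarrow> real \<Rightarrow> real" where "msum n t = (\<Sum>\<^sub>\<infinity>k. b n k * mean (t * b n k))"
definition vsum :: "nat \<Rightarrow> real \<Rightarrow> real" where "vsum n t = (\<Sum>\<^sub>\<infinity>k. (b n k)\<^sup>2 * var (t * b n k))"

lemma a1_nonneg: "0 \<le> a1" unfolding a1_def by (rule infsum_nonneg) simp
lemma b_le: "\<bar>b n k\<bar> \<le> a1" unfolding a1_def by (rule bcoef_abs_le[OF a_summable])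
lemma b_summable: "(\<lambda>k. \<bar>b n k\<bar>) summable_on UNIV" by (rule bcoef_abs_summable[OF a_summable])
lemma b_sum: "(\<Sum>\<^sub>\<infinity>k. \<bar>b n k\<bar>) \<le> real n * a1" unfolding a1_def by (rule bcoef_abs_sum_le[OF a_summable])
lemma \<theta>_pos: "0 < \<theta>" using \<tau> A_pos by (simp add: \<theta>_def)
lemma \<theta>_A: "\<theta> * A = \<tau>" using A_pos by (simp add: \<theta>_def)

lemma sb_le: "\<bar>s\<bar> \<le> T \<Longrightarrow> \<bar>x\<bar> \<le> a1 \<Longrightarrow> \<bar>s * x\<bar> \<le> T * a1" for s x :: real
  unfolding abs_mult by (rule mult_mono) auto

text \<open>This makes the summand of \<open>msum\<close> a function to which
  \<open>bcoef_average\<close> applies. The constant is uniform over \<open>|s| <= T\<close> because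
  the tilt will vary with \<open>n\<close>.\<close>

lemma mean_term_lipschitz:
  "\<exists>C\<ge>0. \<forall>s x y. \<bar>s\<bar> \<le> T \<longrightarrow> \<bar>x\<bar> \<le> a1 \<longrightarrow> \<bar>y\<bar> \<le> a1 \<longrightarrow> \<bar>x * mean (s * x) - y * mean (s * y)\<bar> \<le> C * \<bar>x - y\<bar>"
proof -
  obtain L where L: "L \<ge> 0" "\<And>x y. \<bar>x\<bar> \<le> T * a1 \<Longrightarrow> \<bar>y\<bar> \<le> T * a1 \<Longrightarrow> \<bar>mean x - mean y\<bar> \<le> L * \<bar>x - y\<bar>"
    using mean_lipschitz[of "T * a1"] by blast
  obtain C where C: "\<And>x. \<bar>x\<bar> \<le> T * a1 \<Longrightarrow> \<bar>mean x\<bar> \<le> C" using mean_bounded[of "T * a1"] by blast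
  have "\<bar>x * mean (s * x) - y * mean (s * y)\<bar> \<le> (a1 * (L * \<bar>T\<bar>) + \<bar>C\<bar> * 1) * \<bar>x - y\<bar>"
    if s: "\<bar>s\<bar> \<le> T" and x: "\<bar>x\<bar> \<le> a1" and y: "\<bar>y\<bar> \<le> a1" for s x y
  proof (rule lipschitz_mult[where f="\<lambda>x. x" and g="\<lambda>x. mean (s * x)"])
    show "\<bar>mean (s * y)\<bar> \<le> \<bar>C\<bar>" using C[OF sb_le[OF s y]] by linarith
    have "\<bar>mean (s * x) - mean (s * y)\<bar> \<le> L * \<bar>s * x - s * y\<bar>" by (rule L(2)[OF sb_le[OF s x] sb_le[OF s y]])
    also have "\<dots> = L * \<bar>s\<bar> * \<bar>x - y\<bar>" by (simp add: right_diff_distrib[symmetric] abs_mult)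
    also have "\<dots> \<le> L * \<bar>T\<bar> * \<bar>x - y\<bar>" using s L(1) by (intro mult_right_mono mult_left_mono) auto
    finally show "\<bar>mean (s * x) - mean (s * y)\<bar> \<le> L * \<bar>T\<bar> * \<bar>x - y\<bar>" .
  qed (use x in auto)
  moreover have "a1 * (L * \<bar>T\<bar>) + \<bar>C\<bar> * 1 \<ge> 0" using a1_nonneg L(1) by simp
  ultimately show ?thesis by blast
qed

lemma var_term_lipschitz:
  "\<exists>C\<ge>0. \<forall>s x y. \<bar>s\<bar> \<le> T \<longrightarrow> \<bar>x\<bar> \<le> a1 \<longrightarrow> \<bar>y\<bar> \<le> a1 \<longrightarrow> \<bar>x\<^sup>2 * var (s * x) - y\<^sup>2 * var (s * y)\<bar> \<le> C * \<bar>x - y\<bar>"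
proof -
  obtain L where L: "L \<ge> 0" "\<And>x y. \<bar>x\<bar> \<le> T * a1 \<Longrightarrow> \<bar>y\<bar> \<le> T * a1 \<Longrightarrow> \<bar>var x - var y\<bar> \<le> L * \<bar>x - y\<bar>"
    using var_lipschitz[of "T * a1"] by blast
  define C where "C = \<bar>var 0\<bar> + L * (\<bar>T\<bar> * a1)"
  have C: "\<bar>var x\<bar> \<le> C" if "\<bar>x\<bar> \<le> T * a1" for x
  proof -
    have "\<bar>var x - var 0\<bar> \<le> L * \<bar>x - 0\<bar>" using that abs_ge_zero[of x] by (intro L(2)) auto
    also have "\<dots> \<le> L * (\<bar>T\<bar> * a1)"
      using that L(1) a1_nonneg mult_right_mono[OF abs_ge_self[of T] a1_nonneg] by (intro mult_left_mono) auto
    finally show ?thesis by (simp add: C_def)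
  qed
  have C0: "C \<ge> 0" using L(1) a1_nonneg by (simp add: C_def)
  have "\<bar>x\<^sup>2 * var (s * x) - y\<^sup>2 * var (s * y)\<bar> \<le> (a1\<^sup>2 * (L * \<bar>T\<bar>) + C * (2 * a1)) * \<bar>x - y\<bar>"
    if s: "\<bar>s\<bar> \<le> T" and x: "\<bar>x\<bar> \<le> a1" and y: "\<bar>y\<bar> \<le> a1" for s x y
  proof (rule lipschitz_mult[where f="\<lambda>x. x\<^sup>2" and g="\<lambda>x. var (s * x)"])
    show "\<bar>var (s * y)\<bar> \<le> C" using C[OF sb_le[OF s y]] .
    have "\<bar>var (s * x) - var (s * y)\<bar> \<le> L * \<bar>s * x - s * y\<bar>" by (rule L(2)[OF sb_le[OF s x] sb_le[OF s y]])
    also have "\<dots> = L * \<bar>s\<bar> * \<bar>x - y\<bar>" by (simp add: right_diff_distrib[symmetric] abs_mult)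
    also have "\<dots> \<le> L * \<bar>T\<bar> * \<bar>x - y\<bar>" using s L(1) by (intro mult_right_mono mult_left_mono) auto
    finally show "\<bar>var (s * x) - var (s * y)\<bar> \<le> L * \<bar>T\<bar> * \<bar>x - y\<bar>" .
    have "\<bar>x\<bar>\<^sup>2 \<le> a1\<^sup>2" using x by (intro power_mono) auto
    then show "\<bar>x\<^sup>2\<bar> \<le> a1\<^sup>2" by simp
    have "\<bar>x\<^sup>2 - y\<^sup>2\<bar> = \<bar>x + y\<bar> * \<bar>x - y\<bar>" by (simp add: abs_mult[symmetric] power2_eq_square algebra_simps)
    also have "\<dots> \<le> 2 * a1 * \<bar>x - y\<bar>" using x y by (intro mult_right_mono) auto
    finally show "\<bar>x\<^sup>2 - y\<^sup>2\<bar> \<le> 2 * a1 * \<bar>x - y\<bar>" .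
  qed
  then show ?thesis
    using a1_nonneg L(1) C0 by (intro exI[of _ "a1\<^sup>2 * (L * \<bar>T\<bar>) + C * (2 * a1)"]) auto
qed

lemma msum_approx:
  "\<exists>C\<ge>0. \<forall>n s. \<bar>s\<bar> \<le> T \<longrightarrow> (\<lambda>k. \<bar>b n k * mean (s * b n k)\<bar>) summable_on UNIV \<and>
     \<bar>msum n s - real n * (A * mean (s * A))\<bar> \<le> C * (\<Sum>\<^sub>\<infinity>k. \<bar>bdev a n k\<bar>)"
proof -
  obtain C where C: "C \<ge> 0" "\<And>s x y. \<bar>s\<bar> \<le> T \<Longrightarrow> \<bar>x\<bar> \<le> a1 \<Longrightarrow> \<bar>y\<bar> \<le> a1 \<Longrightarrow>
      \<bar>x * mean (s * x) - y * mean (s * y)\<bar> \<le> C * \<bar>x - y\<bar>"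
    using mean_term_lipschitz[of T] by blast
  show ?thesis
    using bcoef_average[OF a_summable, of "\<lambda>x. x * mean (s * x)" C for s] C
    unfolding msum_def A_eq a1_def by (intro exI[of _ C]) auto
qed

lemma vsum_approx:
  "\<exists>C\<ge>0. \<forall>n s. \<bar>s\<bar> \<le> T \<longrightarrow> (\<lambda>k. \<bar>(b n k)\<^sup>2 * var (s * b n k)\<bar>) summable_on UNIV \<and>
     \<bar>vsum n s - real n * (A\<^sup>2 * var (s * A))\<bar> \<le> C * (\<Sum>\<^sub>\<infinity>k. \<bar>bdev a n k\<bar>)"
proof -
  obtain C where C: "C \<ge> 0" "\<And>s x y. \<bar>s\<bar> \<le> T \<Longrightarrow> \<bar>x\<bar> \<le> a1 \<Longrightarrow> \<bar>y\<bar> \<le> a1 \<Longrightarrow>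
      \<bar>x\<^sup>2 * var (s * x) - y\<^sup>2 * var (s * y)\<bar> \<le> C * \<bar>x - y\<bar>"
    using var_term_lipschitz[of T] by blast
  show ?thesis
    using bcoef_average[OF a_summable, of "\<lambda>x. x\<^sup>2 * var (s * x)" C for s] C
    unfolding vsum_def A_eq a1_def by (intro exI[of _ C]) auto
qed

lemma msum_limit: "(\<lambda>n. msum n s / real n) \<longlonglongrightarrow> A * mean (s * A)"
proof -
  obtain C where C: "\<And>n. \<bar>msum n s - real n * (A * mean (s * A))\<bar> \<le> C * (\<Sum>\<^sub>\<infinity>k. \<bar>bdev a n k\<bar>)"
    using msum_approx[of "\<bar>s\<bar>"] by blast
  have "(\<lambda>n. C * ((\<Sum>\<^sub>\<infinity>k. \<bar>bdev a n k\<bar>) / real n)) \<longlonglongrightarrow> C * 0"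
    by (intro tendsto_mult tendsto_const bdev_negligible a_summable)
  then have z: "(\<lambda>n. C * ((\<Sum>\<^sub>\<infinity>k. \<bar>bdev a n k\<bar>) / real n)) \<longlonglongrightarrow> 0" by simp
  have "(\<lambda>n. msum n s / real n - A * mean (s * A)) \<longlonglongrightarrow> 0"
  proof (rule Lim_null_comparison[OF _ z])
    show "\<forall>\<^sub>F n in sequentially. norm (msum n s / real n - A * mean (s * A)) \<le> C * ((\<Sum>\<^sub>\<infinity>k. \<bar>bdev a n k\<bar>) / real n)"
      using eventually_gt_at_top[of 0]
    proof eventually_elim
      case (elim n)
      then have "msum n s / real n - A * mean (s * A) = (msum n s - real n * (A * mean (s * A))) / real n"
        by (simp add: field_simps)
      then show ?case using C[of n] elim by (simp add: abs_divide divide_right_mono)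
    qed
  qed
  then show ?thesis by (rule LIM_zero_cancel)
qed

text \<open>The Lipschitz property of \<open>mean\<close> is summed against the l^1 bound on the
  coefficients. Continuity for fixed \<open>n\<close> is what the intermediate value argument for
  the saddle point uses.\<close>

lemma msum_continuous: "continuous_on {-T..T} (msum n)"
proof -
  obtain L where L: "L \<ge> 0" "\<And>x y. \<bar>x\<bar> \<le> T * a1 \<Longrightarrow> \<bar>y\<bar> \<le> T * a1 \<Longrightarrow> \<bar>mean x - mean y\<bar> \<le> L * \<bar>x - y\<bar>"
    using mean_lipschitz[of "T * a1"] by blast
  obtain C where C: "\<And>s. \<bar>s\<bar> \<le> T \<Longrightarrow> (\<lambda>k. \<bar>b n k * mean (s * b n k)\<bar>) summable_on UNIV"
    using msum_approx[of T] by blast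
  have lip: "\<bar>msum n s - msum n t\<bar> \<le> (L * a1 * (real n * a1)) * \<bar>s - t\<bar>" if s: "\<bar>s\<bar> \<le> T" and t: "\<bar>t\<bar> \<le> T" for s t
  proof -
    have le: "\<bar>b n k * mean (s * b n k) - b n k * mean (t * b n k)\<bar> \<le> L * a1 * \<bar>s - t\<bar> * \<bar>b n k\<bar>" for k
    proof -
      have "\<bar>mean (s * b n k) - mean (t * b n k)\<bar> \<le> L * \<bar>s * b n k - t * b n k\<bar>"
        by (rule L(2)[OF sb_le[OF s b_le] sb_le[OF t b_le]])
      also have "\<dots> = L * (\<bar>s - t\<bar> * \<bar>b n k\<bar>)" by (simp add: left_diff_distrib[symmetric] abs_mult)
      also have "\<dots> \<le> L * (\<bar>s - t\<bar> * a1)" using L(1) b_le by (intro mult_left_mono) auto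
      finally have "\<bar>b n k\<bar> * \<bar>mean (s * b n k) - mean (t * b n k)\<bar> \<le> \<bar>b n k\<bar> * (L * (\<bar>s - t\<bar> * a1))"
        by (rule mult_left_mono) simp
      then show ?thesis by (simp add: abs_mult[symmetric] right_diff_distrib mult.commute mult.left_commute)
    qed
    have sm: "(\<lambda>k. L * a1 * \<bar>s - t\<bar> * \<bar>b n k\<bar>) summable_on UNIV"
      by (intro summable_on_cmult_right b_summable)
    have sd: "(\<lambda>k. \<bar>b n k * mean (s * b n k) - b n k * mean (t * b n k)\<bar>) summable_on UNIV"
      by (rule summable_on_comparison_test[OF sm]) (use le in auto)
    have "msum n s = (\<Sum>\<^sub>\<infinity>k. (b n k * mean (s * b n k) - b n k * mean (t * b n k)) + b n k * mean (t * b n k))"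
      by (simp add: msum_def)
    also have "\<dots> = (\<Sum>\<^sub>\<infinity>k. b n k * mean (s * b n k) - b n k * mean (t * b n k)) + msum n t"
      unfolding msum_def by (rule infsum_add[OF abs_summable_imp_summable[OF sd] abs_summable_imp_summable[OF C[OF t]]])
    finally have "\<bar>msum n s - msum n t\<bar> \<le> (\<Sum>\<^sub>\<infinity>k. \<bar>b n k * mean (s * b n k) - b n k * mean (t * b n k)\<bar>)"
      using infsum_abs_le[OF sd] by simp
    also have "\<dots> \<le> (\<Sum>\<^sub>\<infinity>k. L * a1 * \<bar>s - t\<bar> * \<bar>b n k\<bar>)" by (rule infsum_mono[OF sd sm le])
    also have "\<dots> = L * a1 * \<bar>s - t\<bar> * (\<Sum>\<^sub>\<infinity>k. \<bar>b n k\<bar>)" by (rule infsum_cmult_right')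
    also have "\<dots> \<le> L * a1 * \<bar>s - t\<bar> * (real n * a1)" using L(1) a1_nonneg b_sum by (intro mult_left_mono) auto
    finally show ?thesis by (simp add: mult.commute mult.left_commute)
  qed
  show ?thesis
    unfolding continuous_on_def
  proof
    fix t assume t: "t \<in> {-T..T}"
    have "((\<lambda>s. (L * a1 * (real n * a1)) * \<bar>s - t\<bar>) \<longlongrightarrow> (L * a1 * (real n * a1)) * \<bar>t - t\<bar>) (at t within {-T..T})"
      by (intro tendsto_intros)
    then have z: "((\<lambda>s. (L * a1 * (real n * a1)) * \<bar>s - t\<bar>) \<longlongrightarrow> 0) (at t within {-T..T})" by simp
    have "((\<lambda>s. msum n s - msum n t) \<longlongrightarrow> 0) (at t within {-T..T})"
      by (rule Lim_null_comparison[OF _ z]) (use t lip in \<open>auto simp: eventually_at_filter abs_le_iff\<close>)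
    then show "(msum n \<longlongrightarrow> msum n t) (at t within {-T..T})" by (rule LIM_zero_cancel)
  qed
qed

text \<open>\<open>msum n t / n\<close> tends to \<open>A * mean (t * A)\<close>, which is strictly
  increasing and equals \<open>\<epsilon>\<close> at \<open>\<theta>\<close>. Its values at
  \<open>\<theta> - d\<close> and \<open>\<theta> + d\<close> therefore enclose
  \<open>\<epsilon>\<close> for large \<open>n\<close>.\<close>

lemma saddle_near:
  assumes d: "0 < d" 
  shows "\<forall>\<^sub>F n in sequentially. \<exists>t. \<bar>t - \<theta>\<bar> \<le> d \<and> msum n t = real n * \<epsilon>"
proof -
  have "(\<theta> - d) * A < \<tau>" "\<tau> < (\<theta> + d) * A"
    using d A_pos \<theta>_A by (simp_all add: algebra_simps)
  then have "mean ((\<theta> - d) * A) < mean \<tau>" "mean \<tau> < mean ((\<theta> + d) * A)"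
    by (auto intro: mean_strict_mono)
  then have lt: "A * mean ((\<theta> - d) * A) < \<epsilon>" "\<epsilon> < A * mean ((\<theta> + d) * A)"
    using A_pos \<tau>(2) by (simp_all add: field_simps)
  have "\<forall>\<^sub>F n in sequentially. msum n (\<theta> - d) / real n < \<epsilon> \<and> \<epsilon> < msum n (\<theta> + d) / real n \<and> n > 0"
    by (intro eventually_conj order_tendstoD[OF msum_limit] lt eventually_gt_at_top)
  then show ?thesis
  proof eventually_elim
    case (elim n)
    then have "msum n (\<theta> - d) \<le> real n * \<epsilon>" "real n * \<epsilon> \<le> msum n (\<theta> + d)"
      by (auto simp: divide_less_eq less_divide_eq mult.commute[of _ "real n"] intro: less_imp_le)
    moreover have "continuous_on {\<theta> - d..\<theta> + d} (msum n)"
      by (rule continuous_on_subset[OF msum_continuous[of "\<theta> + d"]]) (use \<theta>_pos d in auto)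
    ultimately obtain t where "\<theta> - d \<le> t" "t \<le> \<theta> + d" "msum n t = real n * \<epsilon>"
      using IVT'[of "msum n" "\<theta> - d" "real n * \<epsilon>" "\<theta> + d"] d by auto
    then show ?case by (intro exI[of _ t]) auto
  qed
qed

text \<open>The threshold in \<open>saddle_near\<close> depends on the distance \<open>d\<close>, so
  one sequence has to be extracted. For each \<open>n\<close> a solution is taken whose distance
  from \<open>\<theta>\<close> is within \<open>1 / (n + 1)\<close> of the smallest possible one;
  the slack avoids having to attain the infimum.\<close>

lemma saddle_exists:
  "\<exists>t. t \<longlonglongrightarrow> \<theta> \<and> (\<forall>\<^sub>F n in sequentially. msum n (t n) = real n * \<epsilon>)"
proof -
  define good where "good n t \<longleftrightarrow> msum n t = real n * \<epsilon> \<and>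
      (\<forall>t'. msum n t' = real n * \<epsilon> \<longrightarrow> \<bar>t - \<theta>\<bar> \<le> \<bar>t' - \<theta>\<bar> + 1 / (real n + 1))" for n t
  have ex: "\<exists>t. good n t" if sol: "\<exists>t. msum n t = real n * \<epsilon>" for n
  proof -
    define D where "D = (\<lambda>t. \<bar>t - \<theta>\<bar>) ` {t. msum n t = real n * \<epsilon>}"
    have D: "D \<noteq> {}" "bdd_below D" using sol by (auto simp: D_def intro!: bdd_belowI2[of _ 0])
    have "Inf D < Inf D + 1 / (real n + 1)" by simp
    then obtain d where "d \<in> D" "d < Inf D + 1 / (real n + 1)"
      using cInf_lessD[OF D(1)] by blast
    then obtain t where t: "msum n t = real n * \<epsilon>" "\<bar>t - \<theta>\<bar> < Inf D + 1 / (real n + 1)" by (auto simp: D_def)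
    have "\<bar>t - \<theta>\<bar> \<le> \<bar>t' - \<theta>\<bar> + 1 / (real n + 1)" if "msum n t' = real n * \<epsilon>" for t'
      using cInf_lower[OF _ D(2), of "\<bar>t' - \<theta>\<bar>"] that t(2) by (force simp: D_def)
    then show ?thesis using t(1) unfolding good_def by blast
  qed
  define t where "t n = (SOME t. good n t)" for n
  have t: "good n (t n)" if "\<exists>t. msum n t = real n * \<epsilon>" for n
    unfolding t_def by (rule someI_ex[OF ex[OF that]])
  have "t \<longlonglongrightarrow> \<theta>"
  proof (rule LIMSEQ_I)
    fix r :: real assume r: "0 < r"
    have "(\<lambda>n. 1 / (real n + 1)) \<longlonglongrightarrow> 0"
      using LIMSEQ_inverse_real_of_nat by (simp add: inverse_eq_divide add.commute)
    then have "\<forall>\<^sub>F n in sequentially. 1 / (real n + 1) < r / 2"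
      by (rule order_tendstoD) (use r in simp)
    moreover have "\<forall>\<^sub>F n in sequentially. \<exists>t. \<bar>t - \<theta>\<bar> \<le> r / 2 \<and> msum n t = real n * \<epsilon>"
      using saddle_near[of "r / 2"] r by simp
    ultimately have "\<forall>\<^sub>F n in sequentially. norm (t n - \<theta>) < r"
    proof eventually_elim
      case (elim n)
      then obtain t' where t': "\<bar>t' - \<theta>\<bar> \<le> r / 2" "msum n t' = real n * \<epsilon>" by blast
      then have "\<bar>t n - \<theta>\<bar> \<le> \<bar>t' - \<theta>\<bar> + 1 / (real n + 1)" using t[of n] unfolding good_def by blast
      then show ?case using t'(1) elim(1) by simp
    qed
    then show "\<exists>no. \<forall>n\<ge>no. norm (t n - \<theta>) < r" by (simp add: eventually_sequentially)
  qed
  moreover have "\<forall>\<^sub>F n in sequentially. msum n (t n) = real n * \<epsilon>"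
    using saddle_near[OF zero_less_one]
  proof eventually_elim
    case (elim n)
    then show ?case using t[of n] unfolding good_def by blast
  qed
  ultimately show ?thesis by blast
qed

text \<open>
  Tilting by \<open>sp n * b n\<close> gives the window sum the exact mean \<open>n * \<epsilon>\<close>. The limiting tilt \<open>\<theta> * b n\<close>
  would leave a centring error that, for merely summable coefficients, need not be \<open>o(sqrt n)\<close>.
\<close>

definition sp :: "nat \<Rightarrow> real" where
  "sp = (SOME t. t \<longlonglongrightarrow> \<theta> \<and> (\<forall>\<^sub>F n in sequentially. msum n (t n) = real n * \<epsilon>))"

lemma sp_tendsto: "sp \<longlonglongrightarrow> \<theta>" and sp_saddle: "\<forall>\<^sub>F n in sequentially. msum n (sp n) = real n * \<epsilon>"
  using someI_ex[OF saddle_exists] unfolding sp_def by auto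

text \<open>A bound for all the tilts: the individual tilts then satisfy
  \<open>|wt n k| <= spT * a1\<close>, which makes the constants below uniform in \<open>n\<close>
  and \<open>k\<close>.\<close>

definition spT :: real where "spT = (SOME T. \<forall>n. \<bar>sp n\<bar> \<le> T)"

lemma sp_le: "\<bar>sp n\<bar> \<le> spT"
proof -
  have "Bseq sp" using sp_tendsto by (intro convergent_imp_Bseq convergentI)
  then have "\<exists>T. \<forall>n. \<bar>sp n\<bar> \<le> T" by (auto simp: Bseq_def)
  from someI_ex[OF this] show ?thesis by (simp add: spT_def)
qed

definition wt :: "nat \<Rightarrow> int \<Rightarrow> real" where "wt n k = sp n * b n k"

lemma wt_le: "\<bar>wt n k\<bar> \<le> spT * a1"
  unfolding wt_def by (rule sb_le[OF sp_le b_le])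

lemma wt_summable: "(\<lambda>k. \<bar>wt n k\<bar>) summable_on UNIV"
  unfolding wt_def abs_mult by (intro summable_on_cmult_right b_summable)

definition Q :: "nat \<Rightarrow> 'w measure" where "Q n = tilt_measure M Z (wt n)"

lemmas tilt_facts = M Z_indep Z_law wt_summable

lemma Q_prob: "prob_space (Q n)" unfolding Q_def by (rule prob_space_tilt_measure[OF tilt_facts])
lemma Q_indep: "prob_space.indep_vars (Q n) (\<lambda>_. borel) Z UNIV" unfolding Q_def by (rule tilt_measure_indep[OF tilt_facts])
lemma Q_law: "distr (Q n) borel (Z k) = G (wt n k)" unfolding Q_def by (rule tilt_measure_law[OF tilt_facts])
lemma sets_Q [simp, measurable_cong]: "sets (Q n) = sets M" by (simp add: Q_def)
lemma Z_measurable [measurable]: "Z k \<in> borel_measurable M" by (rule noise_measurable[OF tilt_facts])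

lemma Q_AE_summable: "(\<lambda>k. \<bar>c k\<bar>) summable_on UNIV \<Longrightarrow> AE \<omega> in Q n. (\<lambda>k. \<bar>c k * Z k \<omega>\<bar>) summable_on UNIV"
  by (rule tilted_lin_AE_summable[OF Q_prob _ Q_law wt_le]) measurable

section \<open>The window sum without a finite block of noise variables\<close>

definition rcoef :: "nat \<Rightarrow> int set \<Rightarrow> int \<Rightarrow> real" where
  "rcoef n B k = (if k \<in> B then 0 else b n k)"

text \<open>Deleting the block \<open>B\<close> makes the remainder independent of the noise in
  \<open>B\<close>; \<open>lin_split\<close> restores the window sum.\<close>

definition rest :: "nat \<Rightarrow> int set \<Rightarrow> 'w \<Rightarrow> real" where
  "rest n B = lin (rcoef n B) Z"

lemma rcoef_le: "\<bar>rcoef n B k\<bar> \<le> \<bar>b n k\<bar>" by (simp add: rcoef_def)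

lemma rcoef_summable: "(\<lambda>k. \<bar>rcoef n B k\<bar>) summable_on UNIV"
  by (rule summable_on_comparison_test[OF b_summable[of n]]) (use rcoef_le in auto)

lemma rest_measurable [measurable]: "rest n B \<in> borel_measurable M"
  unfolding rest_def by (rule lin_measurable) simp

lemma infsum_split_finite:
  fixes f :: "int \<Rightarrow> real"
  assumes f: "f summable_on UNIV" and B: "finite B"
  shows "(\<lambda>k. if k \<in> B then 0 else f k) summable_on UNIV" "infsum f UNIV = sum f B + (\<Sum>\<^sub>\<infinity>k. if k \<in> B then 0 else f k)"
proof -
  have s: "f summable_on (UNIV - B)"
    by (rule summable_on_subset_banach[OF f]) simp
  have e: "(\<Sum>\<^sub>\<infinity>k. if k \<in> B then 0 else f k) = infsum f (UNIV - B)"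
    by (rule infsum_cong_neutral) auto
  show "(\<lambda>k. if k \<in> B then 0 else f k) summable_on UNIV"
    by (rule summable_on_cong_neutral[THEN iffD1, OF _ _ _ s]) auto
  show "infsum f UNIV = sum f B + (\<Sum>\<^sub>\<infinity>k. if k \<in> B then 0 else f k)"
    unfolding e using infsum_Diff[OF f, of B] B by simp
qed

lemma lin_split: "AE \<omega> in Q n. finite B \<longrightarrow> lin (b n) Z \<omega> = (\<Sum>k\<in>B. b n k * Z k \<omega>) + rest n B \<omega>"
  using Q_AE_summable[OF b_summable, of n n]
proof eventually_elim
  case (elim \<omega>)
  have "(\<Sum>\<^sub>\<infinity>k. if k \<in> B then 0 else b n k * Z k \<omega>) = rest n B \<omega>"
    unfolding rest_def lin_def by (rule infsum_cong) (simp add: rcoef_def)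
  then show ?case
    using infsum_split_finite(2)[OF abs_summable_imp_summable[OF elim]] by (simp add: lin_def)
qed

text \<open>Once the l^1 norm of \<open>bdev\<close> is below \<open>n * A / 8\<close>, fewer than
  \<open>n / 4\<close> sites of the window have a coefficient further than \<open>A / 2\<close> from
  \<open>A\<close>. After deleting at most \<open>m <= n / 4\<close> variables, at least
  \<open>n / 2\<close> factors with coefficients between \<open>A / 2\<close> and
  \<open>2 * A\<close> remain, each with the uniform Gaussian decay. Only the size of
  \<open>B\<close> matters, which gives uniformity over blocks.\<close>

lemma rest_decay:
  "\<exists>c>0. \<forall>\<^sub>F n in sequentially. \<forall>B s. finite B \<longrightarrow> card B \<le> m \<longrightarrow> \<bar>s\<bar> \<le> S \<longrightarrow>
     cmod (char (distr (Q n) borel (rest n B)) s) \<le> exp (- (c * real n * s\<^sup>2))"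
proof -
  obtain c0 where c0: "c0 > 0" "\<And>t s. \<bar>t\<bar> \<le> spT * a1 \<Longrightarrow> \<bar>s\<bar> \<le> \<bar>S\<bar> * (2 * A) \<Longrightarrow> cmod (char (G t) s) \<le> exp (- (c0 * s\<^sup>2))"
    using char_tilted_decay[of "spT * a1" "\<bar>S\<bar> * (2 * A)"] by blast
  \<comment> \<open>\<open>A^2 / 4\<close> comes from coefficients of at least \<open>A / 2\<close>,
    the final halving from having \<open>n / 2\<close> usable factors.\<close>
  define c where "c = c0 * (A\<^sup>2 / 4) / 2"
  have "(\<lambda>n. (\<Sum>\<^sub>\<infinity>k. \<bar>bdev a n k\<bar>) / real n) \<longlonglongrightarrow> 0" by (rule bdev_negligible[OF a_summable])
  then have "\<forall>\<^sub>F n in sequentially. (\<Sum>\<^sub>\<infinity>k. \<bar>bdev a n k\<bar>) / real n < A / 8"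
    by (rule order_tendstoD) (use A_pos in simp)
  then have "\<forall>\<^sub>F n in sequentially. \<forall>B s. finite B \<longrightarrow> card B \<le> m \<longrightarrow> \<bar>s\<bar> \<le> S \<longrightarrow>
     cmod (char (distr (Q n) borel (rest n B)) s) \<le> exp (- (c * real n * s\<^sup>2))"
    using eventually_ge_at_top[of "4 * m + 1"]
  proof eventually_elim
    case (elim n)
    then have n: "n > 0" "4 * m \<le> n" by auto
    have dev: "(\<Sum>\<^sub>\<infinity>k. \<bar>bdev a n k\<bar>) < real n * A / 8" using elim(1) n by (simp add: field_simps)
    define good where "good = {k \<in> {0..<int n}. \<bar>b n k - A\<bar> \<le> A / 2}"
    define bad where "bad = {0..<int n} - good"
    have fin: "finite good" "finite bad"
      by (rule finite_subset[of _ "{0..<int n}"]; force simp: good_def bad_def)+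
    have "real (card bad) * (A / 2) = (\<Sum>k\<in>bad. A / 2)" by simp
    also have "\<dots> \<le> (\<Sum>k\<in>bad. \<bar>bdev a n k\<bar>)"
      by (intro sum_mono) (auto simp: bad_def good_def bdev_def bulk_def A_eq)
    also have "\<dots> \<le> (\<Sum>\<^sub>\<infinity>k. \<bar>bdev a n k\<bar>)"
      by (rule finite_sum_le_infsum[OF bdev_abs_summable(1)[OF a_summable] fin(2)]) auto
    also note dev
    finally have "real (card bad) * (A / 2) < (real n / 4) * (A / 2)" by simp
    then have bad: "real (card bad) < real n / 4" using A_pos by (simp only: mult_less_cancel_right_pos)
    have "card bad + card good = n"
    proof -
      have "bad \<union> good = {0..<int n}" "bad \<inter> good = {}" by (auto simp: bad_def good_def)
      then show ?thesis using card_Un_disjoint[OF fin(2) fin(1)] by simp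
    qed
    then have good: "real (card good) > 3 * real n / 4" using bad by linarith
    show ?case
    proof (intro allI impI)
      fix B :: "int set" and s assume B: "finite B" "card B \<le> m" and s: "\<bar>s\<bar> \<le> S"
      interpret Q: prob_space "Q n" by (rule Q_prob)
      have lim: "(\<lambda>m. \<Prod>k\<in>{-int m..int m}. char (G (wt n k)) (s * rcoef n B k)) \<longlonglongrightarrow> char (distr (Q n) borel (rest n B)) s"
        using Q.char_lin_tendsto[OF Q_indep Q_AE_summable[OF rcoef_summable], of s] by (simp add: Q_law rest_def)
      have "real (card (good - B)) \<ge> real (card good) - real (card B)"
        using diff_card_le_card_Diff[OF B(1), of good] by linarith
      then have cg: "real (card (good - B)) \<ge> real n / 2" using good B(2) n(2) by linarith
      have one: "cmod (char (G t) x) \<le> 1" for t x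
        by (rule real_distribution.cmod_char_le_1[OF real_distribution_tilted])
      have each: "cmod (char (G (wt n k)) (s * rcoef n B k)) \<le> exp (- (c0 * (A\<^sup>2 / 4) * s\<^sup>2))" if k: "k \<in> good - B" for k
      proof -
        have "\<bar>b n k - A\<bar> \<le> A / 2" using k unfolding good_def by blast
        then have bk: "A / 2 \<le> b n k" "b n k \<le> 2 * A" using A_pos by linarith+
        have "\<bar>s * b n k\<bar> \<le> \<bar>S\<bar> * (2 * A)"
          unfolding abs_mult using s bk A_pos by (intro mult_mono) auto
        from c0(2)[OF wt_le[of n k] this] have "cmod (char (G (wt n k)) (s * b n k)) \<le> exp (- (c0 * (s * b n k)\<^sup>2))" .
        also have "\<dots> \<le> exp (- (c0 * (A\<^sup>2 / 4) * s\<^sup>2))"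
        proof -
          have "(A / 2)\<^sup>2 \<le> (b n k)\<^sup>2" using bk A_pos by (intro power_mono) auto
          then have "c0 * ((A / 2)\<^sup>2 * s\<^sup>2) \<le> c0 * ((b n k)\<^sup>2 * s\<^sup>2)" using c0(1) by (intro mult_left_mono mult_right_mono) auto
          then show ?thesis by (simp add: power_mult_distrib power_divide mult.commute mult.left_commute)
        qed
        finally show ?thesis using k by (simp add: rcoef_def)
      qed
      have bound: "cmod (\<Prod>k\<in>{-int m..int m}. char (G (wt n k)) (s * rcoef n B k)) \<le> exp (- (c * real n * s\<^sup>2))" if m: "m \<ge> n" for m
      proof -
        have "cmod (\<Prod>k\<in>{-int m..int m}. char (G (wt n k)) (s * rcoef n B k)) =
            (\<Prod>k\<in>{-int m..int m}. cmod (char (G (wt n k)) (s * rcoef n B k)))" by (rule prod_norm[symmetric])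
        also have "\<dots> \<le> (\<Prod>k\<in>{-int m..int m}. if k \<in> good - B then exp (- (c0 * (A\<^sup>2 / 4) * s\<^sup>2)) else 1)"
          using each one by (intro prod_mono) auto
        also have "\<dots> = (\<Prod>k\<in>good - B. exp (- (c0 * (A\<^sup>2 / 4) * s\<^sup>2)))"
          by (rule prod.mono_neutral_cong_right) (use m in \<open>auto simp: good_def\<close>)
        also have "\<dots> = exp (- (real (card (good - B)) * (c0 * (A\<^sup>2 / 4) * s\<^sup>2)))"
          by (simp add: exp_of_nat_mult[symmetric])
        also have "\<dots> \<le> exp (- (real n / 2 * (c0 * (A\<^sup>2 / 4) * s\<^sup>2)))"
          unfolding exp_le_cancel_iff neg_le_iff_le using cg c0(1) by (intro mult_right_mono) auto
        also have "\<dots> = exp (- (c * real n * s\<^sup>2))" by (simp add: c_def mult.commute mult.left_commute)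
        finally show ?thesis .
      qed
      show "cmod (char (distr (Q n) borel (rest n B)) s) \<le> exp (- (c * real n * s\<^sup>2))"
        by (rule Lim_bounded[OF tendsto_norm[OF lim], of n]) (use bound in auto)
    qed
  qed
  moreover have "c > 0" using c0(1) A_pos by (simp add: c_def)
  ultimately show ?thesis by blast
qed

text \<open>The asymptotic standard deviation of the tilted window sum divided by
  \<open>sqrt n\<close>.\<close>

definition \<sigma> :: real where "\<sigma> = A * sqrt (var \<tau>)"

lemma \<sigma>_pos: "0 < \<sigma>" using A_pos var_pos[of \<tau>] by (simp add: \<sigma>_def)

lemma vsum_limit: "(\<lambda>n. vsum n (sp n) / real n) \<longlonglongrightarrow> \<sigma>\<^sup>2"
proof -
  obtain C where C: "\<And>n s. \<bar>s\<bar> \<le> spT \<Longrightarrow> \<bar>vsum n s - real n * (A\<^sup>2 * var (s * A))\<bar> \<le> C * (\<Sum>\<^sub>\<infinity>k. \<bar>bdev a n k\<bar>)"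
    using vsum_approx[of spT] by blast
  have "(\<lambda>n. C * ((\<Sum>\<^sub>\<infinity>k. \<bar>bdev a n k\<bar>) / real n)) \<longlonglongrightarrow> C * 0"
    by (intro tendsto_mult tendsto_const bdev_negligible a_summable)
  then have z: "(\<lambda>n. C * ((\<Sum>\<^sub>\<infinity>k. \<bar>bdev a n k\<bar>) / real n)) \<longlonglongrightarrow> 0" by simp
  have 1: "(\<lambda>n. vsum n (sp n) / real n - A\<^sup>2 * var (sp n * A)) \<longlonglongrightarrow> 0"
  proof (rule Lim_null_comparison[OF _ z])
    show "\<forall>\<^sub>F n in sequentially. norm (vsum n (sp n) / real n - A\<^sup>2 * var (sp n * A)) \<le> C * ((\<Sum>\<^sub>\<infinity>k. \<bar>bdev a n k\<bar>) / real n)"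
      using eventually_gt_at_top[of 0]
    proof eventually_elim
      case (elim n)
      then have "vsum n (sp n) / real n - A\<^sup>2 * var (sp n * A) = (vsum n (sp n) - real n * (A\<^sup>2 * var (sp n * A))) / real n"
        by (simp add: field_simps)
      then show ?case using C[OF sp_le, of n n] elim by (simp add: abs_divide divide_right_mono)
    qed
  qed
  have 2: "(\<lambda>n. A\<^sup>2 * var (sp n * A)) \<longlonglongrightarrow> A\<^sup>2 * var (\<theta> * A)"
    by (intro tendsto_mult tendsto_const isCont_tendsto_compose[OF isCont_var] sp_tendsto)
  have "A\<^sup>2 * var (\<theta> * A) = \<sigma>\<^sup>2"
    using var_pos[of \<tau>] by (simp add: \<theta>_A \<sigma>_def power_mult_distrib less_imp_le)
  then show ?thesis using tendsto_add[OF 1 2] by simp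
qed

text \<open>Three effects are separated: the Gaussian approximation error, of order
  \<open>1 / sqrt n\<close>; the variance, which loses only boundedly many bounded terms; and the
  centring. For the last, the exact saddle-point equation says that the mean of the remainder
  differs from \<open>n * \<epsilon>\<close> by the block terms alone, a bounded quantity.\<close>

lemma rest_clt:
  assumes B: "\<And>n. finite (B n)" "\<And>n. card (B n) \<le> m"
  shows "(\<lambda>n. char (distr (Q n) borel (rest n (B n))) (u / sqrt (real n)) * iexp (- (u / sqrt (real n) * (real n * \<epsilon>))))
    \<longlonglongrightarrow> complex_of_real (exp (- (\<sigma>\<^sup>2 * u\<^sup>2 / 2)))"
proof -
  define s where "s n = u / sqrt (real n)" for n
  define \<mu> where "\<mu> n = (\<Sum>\<^sub>\<infinity>k. rcoef n (B n) k * mean (wt n k))" for n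
  define v where "v n = (\<Sum>\<^sub>\<infinity>k. (rcoef n (B n) k)\<^sup>2 * var (wt n k))" for n
  obtain C where C: "C \<ge> 0" "\<And>t s. \<bar>t\<bar> \<le> spT * a1 \<Longrightarrow> \<bar>s\<bar> \<le> \<bar>u\<bar> * a1 \<Longrightarrow>
      cmod (char (G t) s * iexp (- (s * mean t)) - exp (- (s\<^sup>2 * var t / 2))) \<le> C * \<bar>s\<bar> ^ 3"
    using char_tilted_approx[of "spT * a1" "\<bar>u\<bar> * a1"] by blast
  obtain Cm where Cm: "\<And>t. \<bar>t\<bar> \<le> spT * a1 \<Longrightarrow> \<bar>mean t\<bar> \<le> Cm" using mean_bounded by blast
  have ms: "(\<lambda>k. \<bar>b n k * mean (wt n k)\<bar>) summable_on UNIV" for n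
    using msum_approx[of spT] sp_le unfolding wt_def by blast
  have vs: "(\<lambda>k. \<bar>(b n k)\<^sup>2 * var (wt n k)\<bar>) summable_on UNIV" for n
    using vsum_approx[of spT] sp_le unfolding wt_def by blast
  have r1: "rcoef n (B n) k * mean (wt n k) = (if k \<in> B n then 0 else b n k * mean (wt n k))" for n k
    by (simp add: rcoef_def)
  have r2: "(rcoef n (B n) k)\<^sup>2 * var (wt n k) = (if k \<in> B n then 0 else (b n k)\<^sup>2 * var (wt n k))" for n k
    by (simp add: rcoef_def)
  have \<mu>_split: "(\<lambda>k. rcoef n (B n) k * mean (wt n k)) summable_on UNIV"
    "(\<Sum>\<^sub>\<infinity>k. b n k * mean (wt n k)) = (\<Sum>k\<in>B n. b n k * mean (wt n k)) + \<mu> n" for n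
    using infsum_split_finite[OF abs_summable_imp_summable[OF ms[of n]] B(1)[of n]] by (simp_all only: r1 \<mu>_def)
  have v_split: "(\<lambda>k. (rcoef n (B n) k)\<^sup>2 * var (wt n k)) summable_on UNIV"
    "(\<Sum>\<^sub>\<infinity>k. (b n k)\<^sup>2 * var (wt n k)) = (\<Sum>k\<in>B n. (b n k)\<^sup>2 * var (wt n k)) + v n" for n
    using infsum_split_finite[OF abs_summable_imp_summable[OF vs[of n]] B(1)[of n]] by (simp_all only: r2 v_def)
  have s3: "(\<lambda>k. \<bar>rcoef n (B n) k\<bar> ^ 3) summable_on UNIV" and s3le: "(\<Sum>\<^sub>\<infinity>k. \<bar>rcoef n (B n) k\<bar> ^ 3) \<le> a1\<^sup>2 * (real n * a1)" for n
  proof -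
    have le: "\<bar>rcoef n (B n) k\<bar> ^ 3 \<le> a1\<^sup>2 * \<bar>b n k\<bar>" for k
    proof -
      have "\<bar>rcoef n (B n) k\<bar>\<^sup>2 * \<bar>rcoef n (B n) k\<bar> \<le> a1\<^sup>2 * \<bar>b n k\<bar>"
        using rcoef_le[of n "B n" k] b_le[of n k] by (intro mult_mono power_mono) auto
      then show ?thesis by (simp add: power3_eq_cube power2_eq_square)
    qed
    have sm: "(\<lambda>k. a1\<^sup>2 * \<bar>b n k\<bar>) summable_on UNIV" by (intro summable_on_cmult_right b_summable)
    show s3: "(\<lambda>k. \<bar>rcoef n (B n) k\<bar> ^ 3) summable_on UNIV"
      by (rule summable_on_comparison_test[OF sm]) (use le in auto)
    have "(\<Sum>\<^sub>\<infinity>k. \<bar>rcoef n (B n) k\<bar> ^ 3) \<le> (\<Sum>\<^sub>\<infinity>k. a1\<^sup>2 * \<bar>b n k\<bar>)" by (rule infsum_mono[OF s3 sm le])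
    also have "\<dots> = a1\<^sup>2 * (\<Sum>\<^sub>\<infinity>k. \<bar>b n k\<bar>)" by (rule infsum_cmult_right')
    also have "\<dots> \<le> a1\<^sup>2 * (real n * a1)" by (intro mult_left_mono b_sum) auto
    finally show "(\<Sum>\<^sub>\<infinity>k. \<bar>rcoef n (B n) k\<bar> ^ 3) \<le> a1\<^sup>2 * (real n * a1)" .
  qed
  have sqrt_inv: "(\<lambda>n. 1 / sqrt (real n)) \<longlonglongrightarrow> 0"
    by (intro tendsto_divide_0[OF tendsto_const] filterlim_at_top_imp_at_infinity filterlim_compose[OF sqrt_at_top] filterlim_real_sequentially)
  have gauss: "\<forall>\<^sub>F n in sequentially. norm (char (distr (Q n) borel (rest n (B n))) (s n) * iexp (- (s n * \<mu> n)) -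
      complex_of_real (exp (- ((s n)\<^sup>2 * v n / 2)))) \<le> C * \<bar>u\<bar> ^ 3 * a1 ^ 3 * (1 / sqrt (real n))"
    using eventually_ge_at_top[of 1]
  proof eventually_elim
    case (elim n)
    have sn: "\<bar>s n\<bar> \<le> \<bar>u\<bar>"
    proof -
      have "\<bar>u\<bar> / sqrt (real n) \<le> \<bar>u\<bar> / 1" using elim by (intro divide_left_mono) auto
      then show ?thesis by (simp add: s_def abs_divide)
    qed
    have "cmod (char (distr (Q n) borel (lin (rcoef n (B n)) Z)) (s n) * iexp (- (s n * (\<Sum>\<^sub>\<infinity>k. rcoef n (B n) k * mean (wt n k)))) -
      exp (- ((s n)\<^sup>2 * (\<Sum>\<^sub>\<infinity>k. (rcoef n (B n) k)\<^sup>2 * var (wt n k)) / 2))) \<le> C * \<bar>s n\<bar> ^ 3 * (\<Sum>\<^sub>\<infinity>k. \<bar>rcoef n (B n) k\<bar> ^ 3)"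
    proof (rule lin_char_gauss[OF Q_prob Q_indep Q_law wt_le rcoef_summable _ C(2) _ _ s3 C(1)])
      show "\<bar>s n * rcoef n (B n) k\<bar> \<le> \<bar>u\<bar> * a1" for k
        unfolding abs_mult using sn rcoef_le[of n "B n" k] b_le[of n k] by (intro mult_mono) auto
    qed (use \<mu>_split(1) v_split(1) in auto)
    also have "\<dots> \<le> C * \<bar>s n\<bar> ^ 3 * (a1\<^sup>2 * (real n * a1))"
      using C(1) s3le by (intro mult_left_mono) auto
    \<comment> \<open>The cube of \<open>u / sqrt n\<close> against \<open>n\<close> summands leaves
      one factor \<open>1 / sqrt n\<close>.\<close>
    also have "\<dots> = C * \<bar>u\<bar> ^ 3 * a1 ^ 3 * (1 / sqrt (real n))"
    proof -
      have "\<bar>s n\<bar> ^ 3 * real n = \<bar>u\<bar> ^ 3 * (1 / sqrt (real n))"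
      proof -
        define q where "q = sqrt (real n)"
        have q: "q > 0" "real n = q * q" using elim by (auto simp: q_def)
        show ?thesis unfolding s_def q_def[symmetric] q(2) using q(1)
          by (simp add: abs_divide power_divide power3_eq_cube)
      qed
      then have "C * (\<bar>s n\<bar> ^ 3 * real n) * (a1\<^sup>2 * a1) = C * (\<bar>u\<bar> ^ 3 * (1 / sqrt (real n))) * (a1\<^sup>2 * a1)" by simp
      then show ?thesis by (simp add: power2_eq_square power3_eq_cube ac_simps)
    qed
    finally show ?case unfolding rest_def \<mu>_def v_def .
  qed
  have "(\<lambda>n. C * \<bar>u\<bar> ^ 3 * a1 ^ 3 * (1 / sqrt (real n))) \<longlonglongrightarrow> C * \<bar>u\<bar> ^ 3 * a1 ^ 3 * 0"
    by (intro tendsto_mult tendsto_const sqrt_inv)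
  then have "(\<lambda>n. C * \<bar>u\<bar> ^ 3 * a1 ^ 3 * (1 / sqrt (real n))) \<longlonglongrightarrow> 0" by simp
  from Lim_null_comparison[OF gauss this]
  have L1: "(\<lambda>n. char (distr (Q n) borel (rest n (B n))) (s n) * iexp (- (s n * \<mu> n)) - complex_of_real (exp (- ((s n)\<^sup>2 * v n / 2)))) \<longlonglongrightarrow> 0" .
  have L2: "(\<lambda>n. complex_of_real (exp (- ((s n)\<^sup>2 * v n / 2)))) \<longlonglongrightarrow> complex_of_real (exp (- (\<sigma>\<^sup>2 * u\<^sup>2 / 2)))"
  proof -
    have small: "(\<lambda>n. (\<Sum>k\<in>B n. (b n k)\<^sup>2 * var (wt n k)) / real n) \<longlonglongrightarrow> 0"
    proof -
      obtain D where D: "\<And>t. \<bar>t\<bar> \<le> spT * a1 \<Longrightarrow> \<bar>var t\<bar> \<le> D"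
      proof -
        obtain L where L: "L \<ge> 0" "\<And>x y. \<bar>x\<bar> \<le> spT * a1 \<Longrightarrow> \<bar>y\<bar> \<le> spT * a1 \<Longrightarrow> \<bar>var x - var y\<bar> \<le> L * \<bar>x - y\<bar>"
          using var_lipschitz[of "spT * a1"] by blast
        have "\<bar>var t\<bar> \<le> \<bar>var 0\<bar> + L * (spT * a1)" if t: "\<bar>t\<bar> \<le> spT * a1" for t
          using L(2)[OF t, of 0] t mult_left_mono[OF t L(1)] abs_ge_zero[of t] by simp
        then show ?thesis by (rule that)
      qed
      have Dp: "0 \<le> D" using D[OF wt_le[of 0 0]] by linarith
      have "\<bar>(\<Sum>k\<in>B n. (b n k)\<^sup>2 * var (wt n k))\<bar> \<le> real m * (a1\<^sup>2 * D)" for n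
      proof -
        have "\<bar>(\<Sum>k\<in>B n. (b n k)\<^sup>2 * var (wt n k))\<bar> \<le> (\<Sum>k\<in>B n. a1\<^sup>2 * D)"
        proof (rule order.trans[OF sum_abs], rule sum_mono)
          fix k
          have "\<bar>b n k\<bar>\<^sup>2 \<le> a1\<^sup>2" by (rule power_mono[OF b_le]) simp
          then show "\<bar>(b n k)\<^sup>2 * var (wt n k)\<bar> \<le> a1\<^sup>2 * D"
            unfolding abs_mult using D[OF wt_le[of n k]] by (intro mult_mono) auto
        qed
        also have "\<dots> \<le> real m * (a1\<^sup>2 * D)" using B(2)[of n] Dp by (simp add: mult_right_mono)
        finally show ?thesis .
      qed
      then have "\<forall>\<^sub>F n in sequentially. norm ((\<Sum>k\<in>B n. (b n k)\<^sup>2 * var (wt n k)) / real n) \<le> real m * (a1\<^sup>2 * D) / real n"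
        by (intro always_eventually allI) (simp add: abs_divide divide_right_mono)
      moreover have "(\<lambda>n. real m * (a1\<^sup>2 * D) / real n) \<longlonglongrightarrow> 0" by (rule lim_const_over_n)
      ultimately show ?thesis by (rule Lim_null_comparison)
    qed
    have "v n / real n = vsum n (sp n) / real n - (\<Sum>k\<in>B n. (b n k)\<^sup>2 * var (wt n k)) / real n" for n
      using v_split(2)[of n] unfolding vsum_def wt_def by (simp add: diff_divide_distrib[symmetric])
    then have "(\<lambda>n. v n / real n) \<longlonglongrightarrow> \<sigma>\<^sup>2"
      using tendsto_diff[OF vsum_limit small] by simp
    then have "(\<lambda>n. complex_of_real (exp (- (u\<^sup>2 * (v n / real n) / 2)))) \<longlonglongrightarrow> complex_of_real (exp (- (u\<^sup>2 * \<sigma>\<^sup>2 / 2)))"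
      by (intro tendsto_of_real tendsto_exp tendsto_minus tendsto_divide tendsto_mult tendsto_const) simp_all
    then show ?thesis by (simp add: s_def power_divide mult.commute)
  qed
  \<comment> \<open>The phase left after centring at \<open>n * \<epsilon>\<close> instead of at the
    true mean.\<close>
  have L3: "(\<lambda>n. iexp (s n * (\<mu> n - real n * \<epsilon>))) \<longlonglongrightarrow> iexp 0"
  proof (rule isCont_tendsto_compose[OF isCont_iexp])
    have "\<forall>\<^sub>F n in sequentially. norm (s n * (\<mu> n - real n * \<epsilon>)) \<le> \<bar>u\<bar> * (real m * (a1 * \<bar>Cm\<bar>)) * (1 / sqrt (real n))"
      using sp_saddle
    proof eventually_elim
      case (elim n)
      then have "real n * \<epsilon> = (\<Sum>k\<in>B n. b n k * mean (wt n k)) + \<mu> n"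
        using \<mu>_split(2)[of n] by (simp add: msum_def wt_def)
      then have "\<bar>\<mu> n - real n * \<epsilon>\<bar> = \<bar>\<Sum>k\<in>B n. b n k * mean (wt n k)\<bar>" by simp
      also have "\<dots> \<le> (\<Sum>k\<in>B n. a1 * \<bar>Cm\<bar>)"
      proof (rule order.trans[OF sum_abs], rule sum_mono)
        fix k show "\<bar>b n k * mean (wt n k)\<bar> \<le> a1 * \<bar>Cm\<bar>"
          unfolding abs_mult using b_le[of n k] Cm[OF wt_le[of n k]] by (intro mult_mono) auto
      qed
      also have "\<dots> \<le> real m * (a1 * \<bar>Cm\<bar>)" using B(2)[of n] a1_nonneg by (simp add: mult_right_mono)
      finally have "\<bar>s n\<bar> * \<bar>\<mu> n - real n * \<epsilon>\<bar> \<le> \<bar>s n\<bar> * (real m * (a1 * \<bar>Cm\<bar>))" by (rule mult_left_mono) simp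
      then show ?case by (simp add: s_def abs_mult abs_divide)
    qed
    moreover have "(\<lambda>n. \<bar>u\<bar> * (real m * (a1 * \<bar>Cm\<bar>)) * (1 / sqrt (real n))) \<longlonglongrightarrow> 0"
      by (rule tendsto_mult_right_zero[OF sqrt_inv])
    ultimately show "(\<lambda>n. s n * (\<mu> n - real n * \<epsilon>)) \<longlonglongrightarrow> 0"
      by (rule Lim_null_comparison)
  qed
  have "(\<lambda>n. (char (distr (Q n) borel (rest n (B n))) (s n) * iexp (- (s n * \<mu> n))) * iexp (s n * (\<mu> n - real n * \<epsilon>)))
      \<longlonglongrightarrow> complex_of_real (exp (- (\<sigma>\<^sup>2 * u\<^sup>2 / 2))) * iexp 0"
    using tendsto_mult[OF tendsto_add[OF L1 L2] L3] by (simp only: diff_add_cancel add_0)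
  moreover have "iexp (- (s n * \<mu> n)) * iexp (s n * (\<mu> n - real n * \<epsilon>)) = iexp (- (s n * (real n * \<epsilon>)))" for n
    unfolding exp_add[symmetric] by (rule arg_cong[where f=exp]) (simp add: algebra_simps)
  ultimately show ?thesis by (simp add: mult.assoc s_def)
qed

end

section \<open>The local limit theorem for the window sum, jointly with a noise block\<close>

lemma (in prob_space) char_shift:
  assumes [measurable]: "X \<in> borel_measurable M"
  shows "char (distr M borel (\<lambda>\<omega>. X \<omega> + x)) s = char (distr M borel X) s * iexp (s * x)"
proof -
  have "char (distr M borel (\<lambda>\<omega>. X \<omega> + x)) s = (CLINT \<omega>|M. iexp (s * X \<omega>) * iexp (s * x))"
    unfolding char_def by (subst integral_distr) (auto simp: exp_add[symmetric] distrib_left)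
  also have "\<dots> = (CLINT \<omega>|M. iexp (s * X \<omega>)) * iexp (s * x)" by simp
  also have "(CLINT \<omega>|M. iexp (s * X \<omega>)) = char (distr M borel X) s"
    unfolding char_def by (subst integral_distr) auto
  finally show ?thesis .
qed

context moving_avg
begin

text \<open>A translation changes the characteristic function by a phase only, so
  \<open>kernel_integral_bound\<close> with the decay of \<open>rest_decay\<close> yields one
  constant for all shifts \<open>x\<close> and all blocks of bounded size.\<close>

lemma rest_bound:
  "\<exists>C\<ge>0. \<forall>\<^sub>F n in sequentially. \<forall>B x. finite B \<longrightarrow> card B \<le> m \<longrightarrow>
     sqrt (real n) * (\<integral>\<omega>. kernel (rest n B \<omega> + x) \<partial>Q n) \<le> C"
proof -
  obtain c where c: "c > 0" and ev: "\<forall>\<^sub>F n in sequentially. \<forall>B s. finite B \<longrightarrow> card B \<le> m \<longrightarrow> \<bar>s\<bar> \<le> 1 \<longrightarrow>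
     cmod (char (distr (Q n) borel (rest n B)) s) \<le> exp (- (c * real n * s\<^sup>2))"
    using rest_decay[of m 1] by blast
  have "\<forall>\<^sub>F n in sequentially. \<forall>B x. finite B \<longrightarrow> card B \<le> m \<longrightarrow>
     sqrt (real n) * (\<integral>\<omega>. kernel (rest n B \<omega> + x) \<partial>Q n) \<le> 2 * sqrt (pi / c)"
    using ev eventually_gt_at_top[of 0]
  proof eventually_elim
    case (elim n)
    show ?case
    proof (intro allI impI)
      fix B :: "int set" and x assume B: "finite B" "card B \<le> m"
      interpret Q: prob_space "Q n" by (rule Q_prob)
      have rm [measurable]: "rest n B \<in> borel_measurable (Q n)" by measurable
      interpret D: real_distribution "distr (Q n) borel (\<lambda>\<omega>. rest n B \<omega> + x)"
        by (rule Q.real_distribution_distr) simp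
      have "sqrt (real n) * (\<integral>y. kernel y \<partial>distr (Q n) borel (\<lambda>\<omega>. rest n B \<omega> + x)) \<le> 2 * sqrt (pi / c)"
      proof (rule D.kernel_integral_bound[OF c])
        show "cmod (char (distr (Q n) borel (\<lambda>\<omega>. rest n B \<omega> + x)) s) \<le> exp (- (c * (sqrt (real n))\<^sup>2 * s\<^sup>2))"
          if "\<bar>s\<bar> \<le> 1" for s
          unfolding Q.char_shift[OF rm] using elim(1) B that by (simp add: norm_mult)
      qed (use elim(2) in simp)
      then show "sqrt (real n) * (\<integral>\<omega>. kernel (rest n B \<omega> + x) \<partial>Q n) \<le> 2 * sqrt (pi / c)"
        by (subst (asm) integral_distr) auto
    qed
  qed
  then show ?thesis using c by (intro exI[of _ "2 * sqrt (pi / c)"]) auto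
qed

text \<open>A bounded shift \<open>x n\<close> is invisible on the scale \<open>sqrt n\<close> of
  the central limit theorem, and the limiting Lebesgue measure is translation invariant; so the
  limit does not depend on the shifts.\<close>

lemma rest_local_limit:
  assumes B: "\<And>n. finite (B n)" "\<And>n. card (B n) \<le> m" and x: "\<And>n. \<bar>x n\<bar> \<le> X"
    and g: "g \<in> borel_measurable borel" "\<And>y. \<bar>g y\<bar> \<le> C * kernel y" "AE y in lborel. isCont g y"
  shows "(\<lambda>n. sqrt (real n) * (\<integral>\<omega>. g (rest n (B n) \<omega> + x n - real n * \<epsilon>) \<partial>Q n)) \<longlonglongrightarrow>
     (\<integral>y. g y \<partial>lborel) / (\<sigma> * sqrt (2 * pi))"
proof -
  define \<nu> where "\<nu> n = distr (Q n) borel (\<lambda>\<omega>. rest n (B n) \<omega> + (x n - real n * \<epsilon>))" for n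
  have rm [measurable]: "rest n B \<in> borel_measurable (Q n)" for n B by measurable
  have \<nu>: "real_distribution (\<nu> n)" for n
    unfolding \<nu>_def by (rule prob_space.real_distribution_distr[OF Q_prob]) simp
  have ch: "char (\<nu> n) s = char (distr (Q n) borel (rest n (B n))) s * iexp (s * (x n - real n * \<epsilon>))" for n s
    unfolding \<nu>_def by (rule prob_space.char_shift[OF Q_prob rm])
  have sqrt_inv: "(\<lambda>n. 1 / sqrt (real n)) \<longlonglongrightarrow> 0"
    by (intro tendsto_divide_0[OF tendsto_const] filterlim_at_top_imp_at_infinity filterlim_compose[OF sqrt_at_top] filterlim_real_sequentially)
  have clt: "(\<lambda>n. char (\<nu> n) (u / sqrt (real n))) \<longlonglongrightarrow> complex_of_real (exp (- (\<sigma>\<^sup>2 * u\<^sup>2 / 2)))" for u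
  proof -
    have "(\<lambda>n. u / sqrt (real n) * x n) \<longlonglongrightarrow> 0"
    proof (rule Lim_null_comparison)
      show "(\<lambda>n. \<bar>u\<bar> * X * (1 / sqrt (real n))) \<longlonglongrightarrow> 0" by (rule tendsto_mult_right_zero[OF sqrt_inv])
      have "norm (u / sqrt (real n) * x n) \<le> \<bar>u\<bar> * X * (1 / sqrt (real n))" for n
        using mult_left_mono[OF x[of n], of "\<bar>u\<bar> * (1 / sqrt (real n))"] by (simp add: abs_mult abs_divide mult.commute)
      then show "\<forall>\<^sub>F n in sequentially. norm (u / sqrt (real n) * x n) \<le> \<bar>u\<bar> * X * (1 / sqrt (real n))" by simp
    qed
    then have "(\<lambda>n. iexp (u / sqrt (real n) * x n)) \<longlonglongrightarrow> iexp 0"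
      by (rule isCont_tendsto_compose[OF isCont_iexp])
    from tendsto_mult[OF rest_clt[OF B, where u=u] this]
    have L: "(\<lambda>n. char (distr (Q n) borel (rest n (B n))) (u / sqrt (real n)) * iexp (- (u / sqrt (real n) * (real n * \<epsilon>))) * iexp (u / sqrt (real n) * x n))
      \<longlonglongrightarrow> complex_of_real (exp (- (\<sigma>\<^sup>2 * u\<^sup>2 / 2))) * iexp 0" .
    have eq: "char (distr (Q n) borel (rest n (B n))) s * iexp (- (s * (real n * \<epsilon>))) * iexp (s * x n) = char (\<nu> n) s" for n s
      unfolding ch mult.assoc exp_add[symmetric] by (simp add: algebra_simps)
    show ?thesis using L unfolding eq by simp
  qed
  have bd: "\<exists>c>0. \<forall>\<^sub>F n in sequentially. \<forall>s. \<bar>s\<bar> \<le> S \<longrightarrow> cmod (char (\<nu> n) s) \<le> exp (- (c * (sqrt (real n))\<^sup>2 * s\<^sup>2))" for S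
  proof -
    obtain c where c: "c > 0" and ev: "\<forall>\<^sub>F n in sequentially. \<forall>B s. finite B \<longrightarrow> card B \<le> m \<longrightarrow> \<bar>s\<bar> \<le> S \<longrightarrow>
       cmod (char (distr (Q n) borel (rest n B)) s) \<le> exp (- (c * real n * s\<^sup>2))"
      using rest_decay[of m S] by blast
    from ev have "\<forall>\<^sub>F n in sequentially. \<forall>s. \<bar>s\<bar> \<le> S \<longrightarrow> cmod (char (\<nu> n) s) \<le> exp (- (c * (sqrt (real n))\<^sup>2 * s\<^sup>2))"
      by eventually_elim (use B in \<open>auto simp: ch norm_mult\<close>)
    then show ?thesis using c by blast
  qed
  \<comment> \<open>The index is shifted because \<open>local_limit\<close> asks for positive
    scales, and \<open>sqrt 0 = 0\<close>.\<close>
  have "(\<lambda>n. sqrt (real (Suc n)) * (\<integral>y. g y \<partial>\<nu> (Suc n))) \<longlonglongrightarrow> (\<integral>y. g y \<partial>lborel) / (\<sigma> * sqrt (2 * pi))"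
  proof (rule local_limit[OF \<nu> _ _ \<sigma>_pos _ _ g])
    show "filterlim (\<lambda>n. sqrt (real (Suc n))) at_top sequentially"
      by (rule filterlim_compose[OF sqrt_at_top filterlim_compose[OF filterlim_real_sequentially filterlim_Suc]])
    show "(\<lambda>n. char (\<nu> (Suc n)) (u / sqrt (real (Suc n)))) \<longlonglongrightarrow> complex_of_real (exp (- (\<sigma>\<^sup>2 * u\<^sup>2 / 2)))" for u
      by (rule LIMSEQ_Suc[OF clt])
    show "\<exists>c>0. \<forall>\<^sub>F n in sequentially. \<forall>s. \<bar>s\<bar> \<le> S \<longrightarrow> cmod (char (\<nu> (Suc n)) s) \<le> exp (- (c * (sqrt (real (Suc n)))\<^sup>2 * s\<^sup>2))" for S
      using bd[of S] eventually_sequentially_Suc[of "\<lambda>n. \<forall>s. \<bar>s\<bar> \<le> S \<longrightarrow> cmod (char (\<nu> n) s) \<le> exp (- (_ * (sqrt (real n))\<^sup>2 * s\<^sup>2))"]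
      by blast
  qed simp
  then have "(\<lambda>n. sqrt (real n) * (\<integral>y. g y \<partial>\<nu> n)) \<longlonglongrightarrow> (\<integral>y. g y \<partial>lborel) / (\<sigma> * sqrt (2 * pi))"
    by (rule LIMSEQ_imp_Suc)
  moreover have "(\<integral>y. g y \<partial>\<nu> n) = (\<integral>\<omega>. g (rest n (B n) \<omega> + x n - real n * \<epsilon>) \<partial>Q n)" for n
    unfolding \<nu>_def using g(1) by (subst integral_distr) (auto simp: algebra_simps)
  ultimately show ?thesis by simp
qed

definition S :: "nat \<Rightarrow> 'w \<Rightarrow> real" where "S n = lin (b n) Z"

lemma S_measurable [measurable]: "S n \<in> borel_measurable M"
  unfolding S_def by (rule lin_measurable) simp

lemma distr_block_rest_Q:
  fixes idx :: "'i \<Rightarrow> int"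
  assumes inj: "inj_on idx I" and I: "I \<noteq> {}"
  shows "distr (Q n) (PiM I (\<lambda>_. borel) \<Otimes>\<^sub>M borel) (\<lambda>\<omega>. (\<lambda>p\<in>I. Z (idx p) \<omega>, rest n (idx ` I) \<omega>)) =
      PiM I (\<lambda>p. G (wt n (idx p))) \<Otimes>\<^sub>M distr (Q n) borel (rest n (idx ` I))"
proof -
  have 0: "\<And>k. k \<in> idx ` I \<Longrightarrow> rcoef n (idx ` I) k = 0" by (simp add: rcoef_def)
  show ?thesis
    using prob_space.distr_block_rest[OF Q_prob[of n] Q_indep inj I lin_restrict(2)[OF 0], where Y="rest n (idx ` I)"]
      lin_restrict(1)[OF 0, where Z=Z] by (simp add: rest_def Q_law)
qed

text \<open>Split \<open>Z k\<close> off the window sum. Given its value, the remaining sum is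
  merely translated, so its kernel integral is at most \<open>C / sqrt n\<close> by
  \<open>rest_bound\<close>; what is left is the first absolute moment of a tilted law, bounded
  uniformly. Hence the factor \<open>sqrt n\<close> does no harm.\<close>

lemma weighted_bound:
  "\<exists>C\<ge>0. \<forall>\<^sub>F n in sequentially. \<forall>k.
     (\<integral>\<^sup>+\<omega>. ennreal (sqrt (real n) * kernel (S n \<omega> - real n * \<epsilon>)) * ennreal \<bar>Z k \<omega>\<bar> \<partial>Q n) \<le> ennreal C"
proof -
  obtain C where C: "C \<ge> 0" and ev: "\<forall>\<^sub>F n in sequentially. \<forall>B x. finite B \<longrightarrow> card B \<le> 1 \<longrightarrow>
     sqrt (real n) * (\<integral>\<omega>. kernel (rest n B \<omega> + x) \<partial>Q n) \<le> C"
    using rest_bound[of 1] by blast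
  define D where "D = (\<integral>z. \<bar>z\<bar> * exp (spT * a1 * \<bar>z\<bar>) \<partial>F)"
  have D: "D \<ge> 0" unfolding D_def by (intro Bochner_Integration.integral_nonneg) simp
  from ev have "\<forall>\<^sub>F n in sequentially. \<forall>k.
     (\<integral>\<^sup>+\<omega>. ennreal (sqrt (real n) * kernel (S n \<omega> - real n * \<epsilon>)) * ennreal \<bar>Z k \<omega>\<bar> \<partial>Q n) \<le> ennreal (C * D)"
  proof eventually_elim
    case (elim n)
    show ?case
    proof
      fix k
      interpret Q: prob_space "Q n" by (rule Q_prob)
      have rm [measurable]: "rest n {k} \<in> borel_measurable (Q n)" by measurable
      \<comment> \<open>A one-point block, so that the block decomposition applies to a single
        variable.\<close>
      let ?I = "{()}" and ?idx = "\<lambda>_::unit. k"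
      let ?P = "PiM ?I (\<lambda>p. G (wt n (?idx p)))"
      let ?R = "distr (Q n) borel (rest n {k})"
      define f where "f p = ennreal (sqrt (real n) * kernel (b n k * fst p () + snd p - real n * \<epsilon>)) * ennreal \<bar>fst p ()\<bar>" for p :: "(unit \<Rightarrow> real) \<times> real"
      have fm [measurable]: "f \<in> borel_measurable (PiM ?I (\<lambda>_. borel) \<Otimes>\<^sub>M borel)"
        unfolding f_def[abs_def] by measurable
      interpret R: real_distribution ?R by (rule Q.real_distribution_distr) simp
      interpret P: product_sigma_finite "\<lambda>p::unit. G (wt n (?idx p))"
        using real_distribution_tilted
        by (intro product_sigma_finite.intro prob_space_imp_sigma_finite) (auto simp: real_distribution_def)
      have sP: "sets ?P = sets (PiM ?I (\<lambda>_. borel))" by (intro sets_PiM_cong) auto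
      note [measurable_cong] = sP
      have "(\<integral>\<^sup>+\<omega>. ennreal (sqrt (real n) * kernel (S n \<omega> - real n * \<epsilon>)) * ennreal \<bar>Z k \<omega>\<bar> \<partial>Q n) =
          (\<integral>\<^sup>+\<omega>. f (\<lambda>p\<in>?I. Z (?idx p) \<omega>, rest n {k} \<omega>) \<partial>Q n)"
      proof (rule nn_integral_cong_AE)
        show "AE \<omega> in Q n. ennreal (sqrt (real n) * kernel (S n \<omega> - real n * \<epsilon>)) * ennreal \<bar>Z k \<omega>\<bar> =
            f (\<lambda>p\<in>?I. Z (?idx p) \<omega>, rest n {k} \<omega>)"
          using lin_split[where n=n and B="{k}"] by eventually_elim (simp add: f_def S_def)
      qed
      also have "\<dots> = (\<integral>\<^sup>+p. f p \<partial>distr (Q n) (PiM ?I (\<lambda>_. borel) \<Otimes>\<^sub>M borel) (\<lambda>\<omega>. (\<lambda>p\<in>?I. Z (?idx p) \<omega>, rest n {k} \<omega>)))"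
        by (subst nn_integral_distr) auto
      also have "\<dots> = (\<integral>\<^sup>+p. f p \<partial>(?P \<Otimes>\<^sub>M ?R))"
        using distr_block_rest_Q[of ?idx ?I n] by simp
      also have "\<dots> = (\<integral>\<^sup>+z. \<integral>\<^sup>+y. f (z, y) \<partial>?R \<partial>?P)"
        by (rule R.nn_integral_fst[symmetric]) measurable
      also have "\<dots> \<le> (\<integral>\<^sup>+z. ennreal C * ennreal \<bar>z ()\<bar> \<partial>?P)"
      proof (rule nn_integral_mono)
        fix z :: "unit \<Rightarrow> real"
        have "(\<integral>\<^sup>+y. f (z, y) \<partial>?R) = (\<integral>\<^sup>+y. ennreal (sqrt (real n) * kernel (b n k * z () + y - real n * \<epsilon>)) \<partial>?R) * ennreal \<bar>z ()\<bar>"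
          unfolding f_def by (simp add: nn_integral_multc)
        also have "(\<integral>\<^sup>+y. ennreal (sqrt (real n) * kernel (b n k * z () + y - real n * \<epsilon>)) \<partial>?R) =
            ennreal (\<integral>y. sqrt (real n) * kernel (b n k * z () + y - real n * \<epsilon>) \<partial>?R)"
          by (rule nn_integral_eq_integral)
            (use kernel_pos kernel_le in \<open>auto simp: less_imp_le abs_of_pos intro!: integrable_mult_right R.integrable_const_bound[where B=2]\<close>)
        also have "(\<integral>y. sqrt (real n) * kernel (b n k * z () + y - real n * \<epsilon>) \<partial>?R) =
            sqrt (real n) * (\<integral>\<omega>. kernel (rest n {k} \<omega> + (b n k * z () - real n * \<epsilon>)) \<partial>Q n)"
          by (subst integral_distr) (auto simp: algebra_simps)
        finally have eq: "(\<integral>\<^sup>+y. f (z, y) \<partial>?R) =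
            ennreal (sqrt (real n) * (\<integral>\<omega>. kernel (rest n {k} \<omega> + (b n k * z () - real n * \<epsilon>)) \<partial>Q n)) * ennreal \<bar>z ()\<bar>" .
        show "(\<integral>\<^sup>+y. f (z, y) \<partial>?R) \<le> ennreal C * ennreal \<bar>z ()\<bar>"
          unfolding eq using elim by (intro mult_right_mono ennreal_leI) simp_all
      qed
      also have "\<dots> = ennreal C * (\<integral>\<^sup>+z. ennreal \<bar>z ()\<bar> \<partial>?P)"
        by (rule nn_integral_cmult) measurable
      also have "(\<integral>\<^sup>+z. ennreal \<bar>z ()\<bar> \<partial>?P) = (\<integral>\<^sup>+z. ennreal \<bar>z\<bar> \<partial>G (wt n k))"
        by (rule P.product_nn_integral_singleton) simp
      also have "\<dots> = (\<integral>\<^sup>+\<omega>. ennreal \<bar>Z k \<omega>\<bar> \<partial>Q n)"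
        unfolding Q_law[symmetric] by (subst nn_integral_distr) auto
      also have "ennreal C * \<dots> \<le> ennreal C * ennreal D"
        unfolding D_def by (intro mult_left_mono nn_integral_abs_tilted_le[OF _ Q_law wt_le]) auto
      also have "\<dots> = ennreal (C * D)" using C D by (simp add: ennreal_mult)
      finally show "(\<integral>\<^sup>+\<omega>. ennreal (sqrt (real n) * kernel (S n \<omega> - real n * \<epsilon>)) * ennreal \<bar>Z k \<omega>\<bar> \<partial>Q n) \<le> ennreal (C * D)" .
    qed
  qed
  then show ?thesis using C D by (intro exI[of _ "C * D"]) auto
qed

text \<open>Given the block values \<open>z\<close>, the rest of the window sum obeys the local
  limit theorem with the bounded shift \<open>x n z\<close>, which leaves no trace in the limit.
  Averaging over the block, whose tilted laws converge, yields the product structure. Blocks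
  attached to different ends may overlap for small \<open>n\<close>, hence injectivity of
  \<open>idx n\<close> only eventually.\<close>

lemma block_local_limit:
  fixes I :: "'i set" and idx :: "nat \<Rightarrow> 'i \<Rightarrow> int" and g :: "('i \<Rightarrow> real) \<Rightarrow> real \<Rightarrow> real"
  assumes I: "finite I" "I \<noteq> {}" and inj: "\<forall>\<^sub>F n in sequentially. inj_on (idx n) I"
    and lim: "\<And>p. p \<in> I \<Longrightarrow> (\<lambda>n. b n (idx n p)) \<longlonglongrightarrow> \<beta> p"
    and g [measurable]: "(\<lambda>(z, y). g z y) \<in> borel_measurable (PiM I (\<lambda>_. borel) \<Otimes>\<^sub>M borel)"
    and bound: "\<And>z y. \<bar>g z y\<bar> \<le> C * kernel y"
    and cont: "\<And>z. z \<in> space (PiM I (\<lambda>_. borel)) \<Longrightarrow> AE y in lborel. isCont (g z) y"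
  shows "(\<lambda>n. sqrt (real n) * (\<integral>\<omega>. g (\<lambda>p\<in>I. Z (idx n p) \<omega>) (S n \<omega> - real n * \<epsilon>) \<partial>Q n)) \<longlonglongrightarrow>
    (\<integral>z. (\<integral>y. g z y \<partial>lborel) / (\<sigma> * sqrt (2 * pi)) \<partial>PiM I (\<lambda>p. G (\<theta> * \<beta> p)))"
proof -
  define B where "B n = idx n ` I" for n
  have B: "finite (B n)" "card (B n) \<le> card I" for n
    using I by (auto simp: B_def card_image_le)
  have C: "C \<ge> 0" using bound[of undefined 0] kernel_pos[of 0] abs_ge_zero[of "g undefined 0"]
    by (smt (verit) mult_neg_pos)
  have gz [measurable]: "g z \<in> borel_measurable borel" if "z \<in> space (PiM I (\<lambda>_. borel))" for z
    using measurable_Pair2[OF g that] by simp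
  \<comment> \<open>The contribution of the block to the window sum.\<close>
  define x where "x n z = (\<Sum>p\<in>I. b n (idx n p) * z p)" for n and z :: "'i \<Rightarrow> real"
  have xm [measurable]: "x n \<in> borel_measurable (PiM I (\<lambda>_. borel))" for n
    unfolding x_def[abs_def] by measurable
  define R where "R n = distr (Q n) borel (rest n (B n))" for n
  have rm [measurable]: "rest n B \<in> borel_measurable (Q n)" for n B by measurable
  have R: "real_distribution (R n)" for n
    unfolding R_def by (rule prob_space.real_distribution_distr[OF Q_prob]) simp
  define f where "f n p = g (fst p) (snd p + x n (fst p) - real n * \<epsilon>)" for n and p :: "('i \<Rightarrow> real) \<times> real"
  have fm [measurable]: "f n \<in> borel_measurable (PiM I (\<lambda>_. borel) \<Otimes>\<^sub>M borel)" for n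
  proof -
    have "(\<lambda>p. (\<lambda>(z, y). g z y) (fst p, snd p + x n (fst p) - real n * \<epsilon>)) \<in> borel_measurable (PiM I (\<lambda>_. borel) \<Otimes>\<^sub>M borel)"
      by (rule measurable_compose[OF _ g]) measurable
    then show ?thesis by (simp add: f_def[abs_def])
  qed
  define H where "H n z = sqrt (real n) * (\<integral>y. f n (z, y) \<partial>R n)" for n z
  have Hm: "H n \<in> borel_measurable (PiM I (\<lambda>_. borel))" for n
  proof -
    interpret R: real_distribution "R n" by (rule R)
    show ?thesis unfolding H_def[abs_def] by measurable
  qed
  have H_eq: "H n z = sqrt (real n) * (\<integral>\<omega>. g z (rest n (B n) \<omega> + x n z - real n * \<epsilon>) \<partial>Q n)"
    if z: "z \<in> space (PiM I (\<lambda>_. borel))" for n z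
    unfolding H_def R_def f_def using gz[OF z] by (subst integral_distr) auto
  obtain C' where C': "C' \<ge> 0" and ev: "\<forall>\<^sub>F n in sequentially. \<forall>B x. finite B \<longrightarrow> card B \<le> card I \<longrightarrow>
     sqrt (real n) * (\<integral>\<omega>. kernel (rest n B \<omega> + x) \<partial>Q n) \<le> C'"
    using rest_bound[of "card I"] by blast
  have Hbound: "\<forall>\<^sub>F n in sequentially. \<forall>z\<in>space (PiM I (\<lambda>_. borel)). \<bar>H n z\<bar> \<le> C * C'"
    using ev
  proof eventually_elim
    case (elim n)
    interpret Q: prob_space "Q n" by (rule Q_prob)
    show ?case
    proof
      fix z :: "'i \<Rightarrow> real" assume z: "z \<in> space (PiM I (\<lambda>_. borel))"
      note [measurable] = gz[OF z]
      have ik: "integrable (Q n) (\<lambda>\<omega>. kernel (rest n (B n) \<omega> + (x n z - real n * \<epsilon>)))"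
        by (rule Q.integrable_const_bound[where B=2]) (use kernel_pos kernel_le in \<open>auto simp: abs_of_pos\<close>)
      have "\<bar>\<integral>\<omega>. g z (rest n (B n) \<omega> + x n z - real n * \<epsilon>) \<partial>Q n\<bar> \<le>
          (\<integral>\<omega>. C * kernel (rest n (B n) \<omega> + (x n z - real n * \<epsilon>)) \<partial>Q n)"
      proof -
        have "norm (\<integral>\<omega>. g z (rest n (B n) \<omega> + x n z - real n * \<epsilon>) \<partial>Q n) \<le>
            (\<integral>\<omega>. C * kernel (rest n (B n) \<omega> + (x n z - real n * \<epsilon>)) \<partial>Q n)"
        proof (rule order.trans[OF integral_norm_bound], rule integral_mono)
          show le: "norm (g z (rest n (B n) \<omega> + x n z - real n * \<epsilon>)) \<le> C * kernel (rest n (B n) \<omega> + (x n z - real n * \<epsilon>))" for \<omega>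
            using bound[of z "rest n (B n) \<omega> + x n z - real n * \<epsilon>"] by (simp add: add_diff_eq)
          show i: "integrable (Q n) (\<lambda>\<omega>. C * kernel (rest n (B n) \<omega> + (x n z - real n * \<epsilon>)))"
            by (rule integrable_mult_right[OF ik])
          show "integrable (Q n) (\<lambda>\<omega>. norm (g z (rest n (B n) \<omega> + x n z - real n * \<epsilon>)))"
            by (rule Bochner_Integration.integrable_bound[OF i]) (use le in \<open>auto intro!: AE_I2 order.trans[OF _ abs_ge_self]\<close>)
        qed
        then show ?thesis by simp
      qed
      then have "\<bar>H n z\<bar> \<le> sqrt (real n) * (\<integral>\<omega>. C * kernel (rest n (B n) \<omega> + (x n z - real n * \<epsilon>)) \<partial>Q n)"
        unfolding H_eq[OF z] abs_mult by (simp add: mult_left_mono)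
      also have "\<dots> = C * (sqrt (real n) * (\<integral>\<omega>. kernel (rest n (B n) \<omega> + (x n z - real n * \<epsilon>)) \<partial>Q n))" by simp
      also have "\<dots> \<le> C * C'" using elim B[of n] C by (intro mult_left_mono) auto
      finally show "\<bar>H n z\<bar> \<le> C * C'" .
    qed
  qed
  have Hlim: "(\<lambda>n. H n z) \<longlonglongrightarrow> (\<integral>y. g z y \<partial>lborel) / (\<sigma> * sqrt (2 * pi))"
    if z: "z \<in> space (PiM I (\<lambda>_. borel))" for z
    unfolding H_eq[OF z]
  proof (rule rest_local_limit[OF B _ gz[OF z] bound cont[OF z]])
    show "\<bar>x n z\<bar> \<le> (\<Sum>p\<in>I. a1 * \<bar>z p\<bar>)" for n
      unfolding x_def by (rule order.trans[OF sum_abs], rule sum_mono) (auto simp: abs_mult intro!: mult_right_mono b_le)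
  qed
  have main: "(\<lambda>n. \<integral>z. H n z \<partial>PiM I (\<lambda>p. G (wt n (idx n p)))) \<longlonglongrightarrow>
      (\<integral>z. (\<integral>y. g z y \<partial>lborel) / (\<sigma> * sqrt (2 * pi)) \<partial>PiM I (\<lambda>p. G (\<theta> * \<beta> p)))"
  proof (rule PiM_tilted_tendsto[OF I(1) _ wt_le Hm _ Hbound Hlim])
    show "(\<lambda>n. wt n (idx n p)) \<longlonglongrightarrow> \<theta> * \<beta> p" if "p \<in> I" for p
      unfolding wt_def by (intro tendsto_mult sp_tendsto lim that)
    show "(\<lambda>z. (\<integral>y. g z y \<partial>lborel) / (\<sigma> * sqrt (2 * pi))) \<in> borel_measurable (PiM I (\<lambda>_. borel))"
      by measurable
  qed
  have "\<forall>\<^sub>F n in sequentially. (\<integral>z. H n z \<partial>PiM I (\<lambda>p. G (wt n (idx n p)))) =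
      sqrt (real n) * (\<integral>\<omega>. g (\<lambda>p\<in>I. Z (idx n p) \<omega>) (S n \<omega> - real n * \<epsilon>) \<partial>Q n)"
    using inj
  proof eventually_elim
    case (elim n)
    interpret Q: prob_space "Q n" by (rule Q_prob)
    interpret R: real_distribution "R n" by (rule R)
    let ?P = "PiM I (\<lambda>p. G (wt n (idx n p)))"
    interpret P: prob_space ?P
      by (rule prob_space_PiM) (use real_distribution_tilted in \<open>auto simp: real_distribution_def\<close>)
    interpret PR: pair_prob_space ?P "R n" ..
    have sP: "sets ?P = sets (PiM I (\<lambda>_. borel))" by (intro sets_PiM_cong) auto
    note [measurable_cong] = sP
    have fm' [measurable]: "f n \<in> borel_measurable (?P \<Otimes>\<^sub>M R n)"
      using fm[of n] by (simp cong: measurable_cong_sets sets_pair_measure_cong)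
    have fb: "\<bar>f n p\<bar> \<le> C * 2" for p
      unfolding f_def by (rule order.trans[OF bound]) (intro mult_left_mono kernel_le C)
    have "(\<integral>\<omega>. g (\<lambda>p\<in>I. Z (idx n p) \<omega>) (S n \<omega> - real n * \<epsilon>) \<partial>Q n) =
        (\<integral>\<omega>. f n (\<lambda>p\<in>I. Z (idx n p) \<omega>, rest n (B n) \<omega>) \<partial>Q n)"
    proof (rule integral_cong_AE)
      show "AE \<omega> in Q n. g (\<lambda>p\<in>I. Z (idx n p) \<omega>) (S n \<omega> - real n * \<epsilon>) = f n (\<lambda>p\<in>I. Z (idx n p) \<omega>, rest n (B n) \<omega>)"
        using lin_split[where n=n and B="B n"]
      proof eventually_elim
        case (elim \<omega>)
        have "(\<Sum>k\<in>B n. b n k * Z k \<omega>) = x n (\<lambda>p\<in>I. Z (idx n p) \<omega>)"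
          unfolding B_def x_def using \<open>inj_on (idx n) I\<close> by (subst sum.reindex) auto
        then show ?case using elim B(1)[of n] by (simp add: f_def S_def add.commute)
      qed
      show "(\<lambda>\<omega>. f n (\<lambda>p\<in>I. Z (idx n p) \<omega>, rest n (B n) \<omega>)) \<in> borel_measurable (Q n)"
        by (rule measurable_compose[OF _ fm]) measurable
      have "(\<lambda>\<omega>. (\<lambda>(z, y). g z y) (\<lambda>p\<in>I. Z (idx n p) \<omega>, S n \<omega> - real n * \<epsilon>)) \<in> borel_measurable (Q n)"
        by (rule measurable_compose[OF _ g]) measurable
      then show "(\<lambda>\<omega>. g (\<lambda>p\<in>I. Z (idx n p) \<omega>) (S n \<omega> - real n * \<epsilon>)) \<in> borel_measurable (Q n)" by simp
    qed
    also have "\<dots> = (\<integral>p. f n p \<partial>distr (Q n) (PiM I (\<lambda>_. borel) \<Otimes>\<^sub>M borel) (\<lambda>\<omega>. (\<lambda>p\<in>I. Z (idx n p) \<omega>, rest n (B n) \<omega>)))"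
      by (subst integral_distr) auto
    also have "\<dots> = (\<integral>p. f n p \<partial>(?P \<Otimes>\<^sub>M R n))"
      unfolding B_def R_def using distr_block_rest_Q[OF elim I(2), of n] by simp
    also have "\<dots> = (\<integral>z. \<integral>y. f n (z, y) \<partial>R n \<partial>?P)"
      by (rule PR.integral_fst'[symmetric], rule PR.integrable_const_bound[where B="C * 2"]) (use fb in auto)
    finally show ?case by (simp add: H_def)
  qed
  from Lim_transform_eventually[OF main this] show ?thesis .
qed

end

section \<open>The conditional limit\<close>

text \<open>The kernel is at least \<open>4 / (y + pi)^2\<close>, and
  \<open>x^2 <= 2 * exp x\<close> at \<open>x = c * (y + pi)\<close> compares the exponential with
  it; this explains the factor \<open>exp (c * pi) / (2 * c^2)\<close>.\<close>

lemma exp_le_kernel: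
  assumes c: "0 < c" and y: "0 \<le> y"
  shows "exp (- (c * y)) \<le> exp (c * pi) / (2 * c\<^sup>2) * kernel y"
proof -
  have p: "y + pi > 0" using y pi_gt_zero by linarith
  have "(c * (y + pi))\<^sup>2 \<le> fact 2 * exp (c * (y + pi))"
    using c p by (intro power_le_fact_exp) auto
  then have "c\<^sup>2 * (y + pi)\<^sup>2 \<le> 2 * exp (c * (y + pi))" by (simp add: power_mult_distrib)
  also have "exp (c * (y + pi)) = exp (c * y) * exp (c * pi)" by (simp add: distrib_left exp_add)
  finally have "exp (- (c * y)) * (c\<^sup>2 * (y + pi)\<^sup>2) \<le> exp (- (c * y)) * (2 * (exp (c * y) * exp (c * pi)))"
    by (rule mult_left_mono) simp
  also have "\<dots> = 2 * exp (c * pi)" by (simp add: exp_minus)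
  finally have "exp (- (c * y)) \<le> exp (c * pi) / (2 * c\<^sup>2) * (4 / (y + pi)\<^sup>2)"
    using c p by (simp add: field_simps)
  also have "\<dots> \<le> exp (c * pi) / (2 * c\<^sup>2) * kernel y"
    using kernel_ge[of y] y by (intro mult_left_mono) auto
  finally show ?thesis .
qed

text \<open>Both rates are at least \<open>\<theta> / 2\<close>, so the difference is at most
  \<open>|s - \<theta>| * y * exp (- \<theta> / 2 * y)\<close>. Half of this exponent absorbs the
  factor \<open>y\<close> at the cost of \<open>4 / \<theta>\<close>, the other half is compared
  with the kernel.\<close>

lemma exp_diff_le_kernel:
  assumes \<theta>: "0 < \<theta>" and s: "\<bar>s - \<theta>\<bar> \<le> \<theta> / 2" and y: "0 \<le> y"
  shows "\<bar>exp (- (s * y)) - exp (- (\<theta> * y))\<bar> \<le> \<bar>s - \<theta>\<bar> * (4 / \<theta> * (exp (\<theta> / 4 * pi) / (2 * (\<theta> / 4)\<^sup>2))) * kernel y"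
proof -
  have *: "exp (- (u * y)) - exp (- (v * y)) \<le> (v - u) * y * exp (- (\<theta> / 2 * y))" if "\<theta> / 2 \<le> u" "u \<le> v" for u v
  proof -
    have "exp (- (u * y)) - exp (- (v * y)) = exp (- (u * y)) * (1 - exp (- ((v - u) * y)))"
      by (simp add: right_diff_distrib exp_add[symmetric] algebra_simps)
    also have "\<dots> \<le> exp (- (\<theta> / 2 * y)) * ((v - u) * y)"
    proof (rule mult_mono)
      show "exp (- (u * y)) \<le> exp (- (\<theta> / 2 * y))" using mult_right_mono[OF that(1) y] by simp
      show "1 - exp (- ((v - u) * y)) \<le> (v - u) * y" using exp_ge_add_one_self[of "- ((v - u) * y)"] by linarith
      show "0 \<le> 1 - exp (- ((v - u) * y))" using that y by simp
    qed simp
    finally show ?thesis by (simp add: mult.commute)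
  qed
  have "\<bar>exp (- (s * y)) - exp (- (\<theta> * y))\<bar> \<le> \<bar>s - \<theta>\<bar> * y * exp (- (\<theta> / 2 * y))"
  proof (cases "s \<le> \<theta>")
    case True
    then have "exp (- (\<theta> * y)) \<le> exp (- (s * y))" using y by (simp add: mult_right_mono)
    then show ?thesis using *[of s \<theta>] True s by simp
  next
    case False
    then have "exp (- (s * y)) \<le> exp (- (\<theta> * y))" using y by (simp add: mult_right_mono)
    then show ?thesis using *[of \<theta> s] False \<theta> by simp
  qed
  also have "\<dots> = \<bar>s - \<theta>\<bar> * ((y * exp (- (\<theta> / 4 * y))) * exp (- (\<theta> / 4 * y)))"
    by (simp add: exp_add[symmetric] mult.assoc)
  also have "\<dots> \<le> \<bar>s - \<theta>\<bar> * (4 / \<theta> * (exp (\<theta> / 4 * pi) / (2 * (\<theta> / 4)\<^sup>2) * kernel y))"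
  proof (intro mult_left_mono mult_mono exp_le_kernel)
    have "\<theta> / 4 * y \<le> exp (\<theta> / 4 * y)" using exp_ge_add_one_self[of "\<theta> / 4 * y"] by linarith
    then have "\<theta> / 4 * y * exp (- (\<theta> / 4 * y)) \<le> exp (\<theta> / 4 * y) * exp (- (\<theta> / 4 * y))"
      by (rule mult_right_mono) simp
    then show "y * exp (- (\<theta> / 4 * y)) \<le> 4 / \<theta>" using \<theta> by (simp add: exp_minus field_simps)
  qed (use \<theta> y in auto)
  finally show ?thesis by (simp only: mult.assoc)
qed

lemma abs_integral_le_nn:
  fixes f :: "'a \<Rightarrow> real"
  assumes "(\<integral>\<^sup>+x. ennreal \<bar>f x\<bar> \<partial>M) \<le> ennreal c" "0 \<le> c"
  shows "\<bar>\<integral>x. f x \<partial>M\<bar> \<le> c"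
proof (cases "integrable M f")
  case True
  have "ennreal (norm (\<integral>x. f x \<partial>M)) \<le> (\<integral>\<^sup>+x. norm (f x) \<partial>M)"
    by (rule integral_norm_bound_ennreal[OF True])
  also have "\<dots> \<le> ennreal c" using assms(1) by simp
  finally show ?thesis using assms(2) by (simp add: ennreal_le_iff)
qed (use assms(2) in \<open>simp add: not_integrable_integral_eq\<close>)

lemma ennreal_abs_lin_le: "ennreal \<bar>lin c Z \<omega>\<bar> \<le> (\<integral>\<^sup>+k. ennreal \<bar>c k * Z k \<omega>\<bar> \<partial>count_space UNIV)"
proof (cases "integrable (count_space UNIV) (\<lambda>k. c k * Z k \<omega>)")
  case True
  from integral_norm_bound_ennreal[OF this] show ?thesis
    unfolding lin_def infsum_eq_integral by simp
qed (simp add: lin_def infsum_eq_integral not_integrable_integral_eq)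

lemma UNIV_side: "(UNIV :: side set) = {Minus, Plus}"
  by (auto intro: side.exhaust)

text \<open>Every coordinate in the window is \<open>T\<close> plus sums of \<open>U\<close> over
  subintervals of the window. The factor \<open>m\<close> is the slope in
  \<open>window_dist m\<close>, and \<open>2 * m + 1\<close> is the number of coordinates.\<close>

lemma limit_seq_lipschitz:
  assumes f: "\<And>x y. \<bar>f x - f y\<bar> \<le> window_dist m x y"
  shows "\<bar>f (limit_seq T U \<omega>) - f (limit_seq T' U' \<omega>')\<bar> \<le> real m * real (2 * m + 1) *
     (\<bar>T \<omega> - T' \<omega>'\<bar> + (\<Sum>(u, i)\<in>UNIV \<times> {-int m..int m}. \<bar>U u i \<omega> - U' u i \<omega>'\<bar>))"
proof -
  define D where "D u = (\<Sum>i\<in>{-int m..int m}. \<bar>U u i \<omega> - U' u i \<omega>'\<bar>)" for u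
  have D: "(\<Sum>(u, i)\<in>UNIV \<times> {-int m..int m}. \<bar>U u i \<omega> - U' u i \<omega>'\<bar>) = D Minus + D Plus"
    unfolding D_def by (subst sum.cartesian_product[symmetric]) (simp add: UNIV_side)
  have part: "\<bar>(\<Sum>i\<in>J. U u i \<omega>) - (\<Sum>i\<in>J. U' u i \<omega>')\<bar> \<le> D u" if "J \<subseteq> {-int m..int m}" for J u
  proof -
    have "\<bar>(\<Sum>i\<in>J. U u i \<omega>) - (\<Sum>i\<in>J. U' u i \<omega>')\<bar> \<le> (\<Sum>i\<in>J. \<bar>U u i \<omega> - U' u i \<omega>'\<bar>)"
      unfolding sum_subtractf[symmetric] by (rule sum_abs)
    also have "\<dots> \<le> D u" unfolding D_def using that by (intro sum_mono2) auto
    finally show ?thesis .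
  qed
  have "\<bar>limit_seq T U \<omega> j - limit_seq T' U' \<omega>' j\<bar> \<le> \<bar>T \<omega> - T' \<omega>'\<bar> + (D Minus + D Plus)"
    if j: "j \<in> {-int m..int m}" for j
  proof (cases "j < 0")
    case True
    have "{j..-1} \<subseteq> {-int m..int m}" using j True by auto
    from part[OF this, of Minus] part[OF this, of Plus] True show ?thesis by (simp add: limit_seq_def)
  next
    case False
    have "{0..j-1} \<subseteq> {-int m..int m}" using j False by auto
    from part[OF this, of Minus] part[OF this, of Plus] False show ?thesis by (simp add: limit_seq_def)
  qed
  then have "(\<Sum>j\<in>{-int m..int m}. \<bar>limit_seq T U \<omega> j - limit_seq T' U' \<omega>' j\<bar>) \<le>
      (\<Sum>j\<in>{-int m..int m}. \<bar>T \<omega> - T' \<omega>'\<bar> + (D Minus + D Plus))" by (rule sum_mono)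
  also have "\<dots> = real (2 * m + 1) * (\<bar>T \<omega> - T' \<omega>'\<bar> + (D Minus + D Plus))" by (simp add: nat_add_distrib)
  finally have "window_dist m (limit_seq T U \<omega>) (limit_seq T' U' \<omega>') \<le> real m * (real (2 * m + 1) * (\<bar>T \<omega> - T' \<omega>'\<bar> + (D Minus + D Plus)))"
    unfolding window_dist_def by (rule mult_left_mono) simp
  then show ?thesis
    unfolding D using f[of "limit_seq T U \<omega>" "limit_seq T' U' \<omega>'"] by (simp only: mult.assoc)
qed

text \<open>
  \<open>edge Minus k\<close> and \<open>edge Plus k\<close> are the limits of the coefficients \<open>b n k\<close> and \<open>b n (n + k)\<close> of the
  noise variables near the left and the right end of the window.
\<close>

locale moving_avg_limit = moving_avg F a A \<epsilon> \<tau> M Z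
  for F :: "real measure" and a :: "int \<Rightarrow> real" and A \<epsilon> \<tau> :: real and M :: "'w measure" and Z :: "int \<Rightarrow> 'w \<Rightarrow> real" +
  fixes N :: "'v measure" and W :: "side \<Rightarrow> int \<Rightarrow> 'v \<Rightarrow> real" and T :: "'v \<Rightarrow> real" and edge :: "side \<Rightarrow> int \<Rightarrow> real"
  assumes N: "prob_space N"
    and WT_indep: "prob_space.indep_vars N (\<lambda>_. borel) (\<lambda>k. case k of None \<Rightarrow> T | Some (u, j) \<Rightarrow> W u j) UNIV"
    and edge: "\<And>u k. edge u k = (case u of Minus \<Rightarrow> infsum a {-k..} | Plus \<Rightarrow> infsum a {..-1-k})"
    and W_law: "\<And>u k. distr N borel (W u k) = G (\<theta> * edge u k)"
    and T_law: "distributed N lborel T (exponential_density \<theta>)"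
begin

sublocale N: prob_space N by (rule N)

lemma WT_measurable [measurable]: "T \<in> borel_measurable N" "W u k \<in> borel_measurable N"
proof -
  have rv: "(case k of None \<Rightarrow> T | Some (u, j) \<Rightarrow> W u j) \<in> borel_measurable N" for k
    using WT_indep unfolding N.indep_vars_def by blast
  show "T \<in> borel_measurable N" "W u k \<in> borel_measurable N"
    using rv[of None] rv[of "Some (u, k)"] by simp_all
qed

lemma edge_le: "\<bar>\<theta> * edge u k\<bar> \<le> \<theta> * a1"
proof -
  have "\<bar>infsum a B\<bar> \<le> a1" for B
  proof -
    have s: "(\<lambda>m. \<bar>a m\<bar>) summable_on B" by (rule summable_on_subset_banach[OF a_summable]) simp
    have "\<bar>infsum a B\<bar> \<le> infsum (\<lambda>m. \<bar>a m\<bar>) B" by (rule infsum_abs_le[OF s])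
    also have "\<dots> \<le> a1" unfolding a1_def by (rule infsum_mono_neutral[OF s a_summable]) auto
    finally show ?thesis .
  qed
  then have "\<bar>edge u k\<bar> \<le> a1" by (simp add: edge split: side.split)
  then show ?thesis using \<theta>_pos by (simp add: abs_mult)
qed

lemma a_reflect_summable: "(\<lambda>k. \<bar>a (i - k)\<bar>) summable_on UNIV"
  by (rule summable_reflect(1)[OF a_summable])

text \<open>\<open>Minus\<close> labels the values near the left end of the window,
  \<open>Plus\<close> those near the right end, indexed relative to that end.\<close>

definition XU :: "nat \<Rightarrow> side \<Rightarrow> int \<Rightarrow> 'w \<Rightarrow> real" where
  "XU n u i = (case u of Minus \<Rightarrow> moving_average a Z i | Plus \<Rightarrow> moving_average a Z (int n + i))"

definition pre_seq :: "nat \<Rightarrow> 'w \<Rightarrow> int \<Rightarrow> real" where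
  "pre_seq n \<omega> = (\<lambda>j. (\<Sum>i=j..j + int n - 1. moving_average a Z i \<omega>) - real n * \<epsilon>)"

abbreviation lim_seq :: "'v \<Rightarrow> int \<Rightarrow> real" where
  "lim_seq \<equiv> limit_seq T (\<lambda>u. moving_average a (W u))"

lemma moving_average_measurable [measurable]:
  "moving_average a Z i \<in> borel_measurable M" "moving_average a (W u) i \<in> borel_measurable N"
  unfolding lin_moving_average by (rule lin_measurable; simp)+

lemma XU_measurable [measurable]: "XU n u i \<in> borel_measurable M"
  unfolding XU_def by (cases u) simp_all

lemma pre_seq_measurable [measurable]: "pre_seq n \<in> borel_measurable M"
  unfolding pre_seq_def[abs_def] by (rule measurable_coordinatewise_then_product) measurable

lemma limit_seq_measurable:
  assumes [measurable]: "t \<in> borel_measurable L" "\<And>u i. V u i \<in> borel_measurable L"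
  shows "limit_seq t V \<in> borel_measurable L"
proof (rule measurable_coordinatewise_then_product)
  show "(\<lambda>\<omega>. limit_seq t V \<omega> j) \<in> borel_measurable L" for j
    unfolding limit_seq_def by (cases "j < 0") simp_all
qed

lemma lim_seq_measurable [measurable]: "lim_seq \<in> borel_measurable N"
  by (rule limit_seq_measurable) simp_all

lemma S_eq: "AE \<omega> in Q n. (\<Sum>i=0..int n - 1. moving_average a Z i \<omega>) = S n \<omega>"
proof -
  have "AE \<omega> in Q n. \<forall>i\<in>{0..int n - 1}. (\<lambda>k. \<bar>a (i - k) * Z k \<omega>\<bar>) summable_on UNIV"
    by (intro AE_finite_allI Q_AE_summable a_reflect_summable) simp
  then show ?thesis
  proof eventually_elim
    case (elim \<omega>)
    have "(\<Sum>i=0..int n - 1. moving_average a Z i \<omega>) = (\<Sum>i=0..int n - 1. \<Sum>\<^sub>\<infinity>k. a (i - k) * Z k \<omega>)"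
      by (simp add: lin_moving_average lin_def)
    also have "\<dots> = (\<Sum>\<^sub>\<infinity>k. \<Sum>i=0..int n - 1. a (i - k) * Z k \<omega>)"
      by (rule infsum_finite_sum[symmetric]) (use elim in \<open>auto intro: abs_summable_imp_summable\<close>)
    also have "\<dots> = S n \<omega>"
      unfolding S_def lin_def
    proof (rule infsum_cong)
      fix k
      have "bcoef a n k = (\<Sum>i=0..int n - 1. a (i - k))"
        unfolding bcoef_def by (rule sum.reindex_bij_witness[of _ nat int]) auto
      then show "(\<Sum>i=0..int n - 1. a (i - k) * Z k \<omega>) = b n k * Z k \<omega>" by (simp add: sum_distrib_right)
    qed
    finally show ?case .
  qed
qed

text \<open>Moving the window by \<open>j\<close> removes the summands at one end and adds those at
  the other. Thus the prelimit sequence is the functional \<open>limit_seq\<close> itself, with the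
  overshoot in the place of \<open>T\<close>, and only its arguments have to be compared with those
  of the limit.\<close>

lemma pre_seq_eq: "AE \<omega> in Q n. pre_seq n \<omega> = limit_seq (\<lambda>\<omega>. S n \<omega> - real n * \<epsilon>) (XU n) \<omega>"
  using S_eq[of n]
proof eventually_elim
  case (elim \<omega>)
  let ?X = "\<lambda>i. moving_average a Z i \<omega>"
  have shift: "(\<Sum>i=p..q. ?X (int n + i)) = (\<Sum>i=int n + p..int n + q. ?X i)" for p q
    by (rule sum.reindex_bij_witness[of _ "\<lambda>i. i - int n" "\<lambda>i. int n + i"]) auto
  have split: "(\<Sum>i=p..<q. ?X i) + (\<Sum>i=q..<r. ?X i) = (\<Sum>i=p..<r. ?X i)" if "p \<le> q" "q \<le> r" for p q r
  proof -
    have "{p..<r} = {p..<q} \<union> {q..<r}" using that by auto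
    then show ?thesis by (simp add: sum.union_disjoint ivl_disj_int)
  qed
  have ivl: "{p..q - 1} = {p..<q}" for p q :: int by auto
  have ivl': "{p..-1} = {p..<0}" for p :: int by auto
  have ivl'': "{p..q + r - 1} = {p..<q + r}" for p q r :: int by auto
  show ?case
  proof
    fix j
    show "pre_seq n \<omega> j = limit_seq (\<lambda>\<omega>. S n \<omega> - real n * \<epsilon>) (XU n) \<omega> j"
    proof (cases "j < 0")
      case True
      have s1: "(\<Sum>i=j..<j + int n. ?X i) + (\<Sum>i=j + int n..<int n. ?X i) = (\<Sum>i=j..<int n. ?X i)"
        by (rule split) (use True in auto)
      have s2: "(\<Sum>i=j..<0. ?X i) + (\<Sum>i=0..<int n. ?X i) = (\<Sum>i=j..<int n. ?X i)"
        by (rule split) (use True in auto)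
      have s3: "(\<Sum>i=j..-1. ?X (int n + i)) = (\<Sum>i=j + int n..<int n. ?X i)"
        unfolding shift by (rule sum.cong) auto
      show ?thesis
        using True s1 s2 s3 elim
        unfolding pre_seq_def limit_seq_def XU_def side.case ivl ivl'' by (simp add: ivl' )
    next
      case False
      have s1: "(\<Sum>i=j..<j + int n. ?X i) + (\<Sum>i=0..<j. ?X i) = (\<Sum>i=0..<j + int n. ?X i)"
        using split[of 0 j "j + int n"] False by simp
      have s2: "(\<Sum>i=0..<int n. ?X i) + (\<Sum>i=int n..<j + int n. ?X i) = (\<Sum>i=0..<j + int n. ?X i)"
        by (rule split) (use False in auto)
      have s3: "(\<Sum>i=0..<j. ?X (int n + i)) = (\<Sum>i=int n..<j + int n. ?X i)"
        using shift[of 0 "j - 1"] unfolding ivl by (simp add: add.commute add_diff_eq ivl'' )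
      show ?thesis
        using False s1 s2 s3 elim
        unfolding pre_seq_def limit_seq_def XU_def side.case ivl ivl'' by simp
    qed
  qed
qed

subsection \<open>Truncating the noise to blocks around the two ends of the window\<close>

definition blockI :: "nat \<Rightarrow> (side \<times> int) set" where "blockI K = UNIV \<times> {-int K..int K}"

definition idx :: "nat \<Rightarrow> side \<times> int \<Rightarrow> int" where
  "idx n p = (case fst p of Minus \<Rightarrow> snd p | Plus \<Rightarrow> int n + snd p)"

text \<open>\<open>z (u, k)\<close> stands for the noise at offset \<open>k\<close> from the end
  \<open>u\<close>, so that one formula truncates both the prelimit and the limit moving
  averages.\<close>

definition maK :: "nat \<Rightarrow> (side \<times> int \<Rightarrow> real) \<Rightarrow> side \<Rightarrow> int \<Rightarrow> real" where
  "maK K z u i = (\<Sum>k\<in>{-int K..int K}. a (i - k) * z (u, k))"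

definition blk :: "nat \<Rightarrow> nat \<Rightarrow> 'w \<Rightarrow> side \<times> int \<Rightarrow> real" where
  "blk K n \<omega> = (\<lambda>p\<in>blockI K. Z (idx n p) \<omega>)"

definition tail :: "nat \<Rightarrow> int \<Rightarrow> real" where
  "tail K i = (\<Sum>\<^sub>\<infinity>k. if k \<in> {-int K..int K} then 0 else \<bar>a (i - k)\<bar>)"

lemma finite_blockI: "finite (blockI K)" and blockI_nonempty: "blockI K \<noteq> {}"
  by (auto simp: blockI_def UNIV_side)

lemma tail_nonneg: "0 \<le> tail K i"
  unfolding tail_def by (rule infsum_nonneg) simp

lemma tail_tendsto: "(\<lambda>K. tail K i) \<longlonglongrightarrow> 0"
proof -
  have "tail K i = (\<Sum>\<^sub>\<infinity>k. \<bar>a (i - k)\<bar>) - (\<Sum>k\<in>{-int K..int K}. \<bar>a (i - k)\<bar>)" for K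
    using infsum_split_finite(2)[OF a_reflect_summable[of i], of "{-int K..int K}"] by (simp add: tail_def)
  moreover have "(\<lambda>K. (\<Sum>\<^sub>\<infinity>k. \<bar>a (i - k)\<bar>) - (\<Sum>k\<in>{-int K..int K}. \<bar>a (i - k)\<bar>)) \<longlonglongrightarrow> (\<Sum>\<^sub>\<infinity>k. \<bar>a (i - k)\<bar>) - (\<Sum>\<^sub>\<infinity>k. \<bar>a (i - k)\<bar>)"
    by (intro tendsto_diff tendsto_const infsum_tendsto_int a_reflect_summable)
  ultimately show ?thesis by simp
qed

text \<open>The coefficients of the truncation error \<open>XU - maK\<close>. On the
  \<open>Plus\<close> side they are the \<open>Minus\<close> ones translated by \<open>n\<close>, so
  both have l^1 norm \<open>tail K i\<close>.\<close>

definition tcoef :: "nat \<Rightarrow> nat \<Rightarrow> side \<Rightarrow> int \<Rightarrow> int \<Rightarrow> real" where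
  "tcoef K n u i k = (case u of
     Minus \<Rightarrow> (if k \<in> {-int K..int K} then 0 else a (i - k)) |
     Plus \<Rightarrow> (if k - int n \<in> {-int K..int K} then 0 else a (int n + i - k)))"

lemma tcoef_summable: "(\<lambda>k. \<bar>tcoef K n u i k\<bar>) summable_on UNIV" and tcoef_sum: "(\<Sum>\<^sub>\<infinity>k. \<bar>tcoef K n u i k\<bar>) = tail K i"
proof -
  have s: "(\<lambda>k. \<bar>if k \<in> {-int K..int K} then 0 else a (i - k)\<bar>) summable_on UNIV"
    by (rule summable_on_comparison_test[OF a_reflect_summable[of i]]) auto
  have t: "(\<Sum>\<^sub>\<infinity>k. \<bar>if k \<in> {-int K..int K} then 0 else a (i - k)\<bar>) = tail K i"
    unfolding tail_def by (rule infsum_cong) simp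
  have bij: "bij_betw (\<lambda>k. k - int n) UNIV UNIV"
    by (rule bij_betwI[of _ _ _ "\<lambda>k. k + int n"]) auto
  have p: "tcoef K n Plus i k = (\<lambda>k. if k \<in> {-int K..int K} then 0 else a (i - k)) (k - int n)" for k
    by (simp add: tcoef_def algebra_simps)
  show "(\<lambda>k. \<bar>tcoef K n u i k\<bar>) summable_on UNIV"
  proof (cases u)
    case Plus
    show ?thesis using summable_on_reindex_bij_betw[OF bij, of "\<lambda>k. \<bar>if k \<in> {-int K..int K} then 0 else a (i - k)\<bar>"] s
      unfolding Plus p by simp
  qed (use s in \<open>simp add: tcoef_def\<close>)
  show "(\<Sum>\<^sub>\<infinity>k. \<bar>tcoef K n u i k\<bar>) = tail K i"
  proof (cases u)
    case Plus
    show ?thesis using infsum_reindex_bij_betw[OF bij, of "\<lambda>k. \<bar>if k \<in> {-int K..int K} then 0 else a (i - k)\<bar>"] t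
      unfolding Plus p by simp
  qed (use t in \<open>simp add: tcoef_def\<close>)
qed

lemma trunc_error_eq: "AE \<omega> in Q n. XU n u i \<omega> - maK K (blk K n \<omega>) u i = lin (tcoef K n u i) Z \<omega>"
proof -
  define j where "j = (case u of Minus \<Rightarrow> i | Plus \<Rightarrow> int n + i)"
  define B where "B = (case u of Minus \<Rightarrow> {-int K..int K} | Plus \<Rightarrow> {int n - int K..int n + int K})"
  have "AE \<omega> in Q n. (\<lambda>k. \<bar>a (j - k) * Z k \<omega>\<bar>) summable_on UNIV"
    by (rule Q_AE_summable[OF a_reflect_summable])
  then show ?thesis
  proof eventually_elim
    case (elim \<omega>)
    have X: "XU n u i \<omega> = (\<Sum>\<^sub>\<infinity>k. a (j - k) * Z k \<omega>)"
      by (cases u) (simp_all add: XU_def j_def lin_moving_average lin_def)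
    have "finite B" by (cases u) (simp_all add: B_def)
    from infsum_split_finite(2)[OF abs_summable_imp_summable[OF elim] this]
    have "XU n u i \<omega> = (\<Sum>k\<in>B. a (j - k) * Z k \<omega>) + (\<Sum>\<^sub>\<infinity>k. if k \<in> B then 0 else a (j - k) * Z k \<omega>)"
      unfolding X .
    moreover have "(\<Sum>\<^sub>\<infinity>k. if k \<in> B then 0 else a (j - k) * Z k \<omega>) = lin (tcoef K n u i) Z \<omega>"
      unfolding lin_def by (rule infsum_cong) (cases u; auto simp: B_def j_def tcoef_def)
    moreover have "(\<Sum>k\<in>B. a (j - k) * Z k \<omega>) = maK K (blk K n \<omega>) u i"
    proof (cases u)
      case Minus
      then show ?thesis by (simp add: B_def j_def maK_def blk_def blockI_def idx_def)
    next
      case Plus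
      then show ?thesis unfolding B_def j_def maK_def blk_def blockI_def
        by (intro sum.reindex_bij_witness[of _ "\<lambda>k. int n + k" "\<lambda>k. k - int n"]) (auto simp: idx_def algebra_simps)
    qed
    ultimately show ?case by simp
  qed
qed

text \<open>The truncation error is a linear form with l^1 norm \<open>tail K i\<close>, and
  \<open>weighted_bound\<close> controls each noise variable under the local-limit weight. The
  threshold for \<open>n\<close> does not depend on \<open>K\<close>, which lets \<open>K\<close> be
  chosen before \<open>n\<close>.\<close>

lemma trunc_error_bound:
  "\<exists>C\<ge>0. \<forall>\<^sub>F n in sequentially. \<forall>K u i.
     (\<integral>\<^sup>+\<omega>. ennreal (sqrt (real n) * kernel (S n \<omega> - real n * \<epsilon>)) * ennreal \<bar>XU n u i \<omega> - maK K (blk K n \<omega>) u i\<bar> \<partial>Q n) \<le> ennreal (C * tail K i)"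
proof -
  obtain C where C: "C \<ge> 0" and ev: "\<forall>\<^sub>F n in sequentially. \<forall>k.
     (\<integral>\<^sup>+\<omega>. ennreal (sqrt (real n) * kernel (S n \<omega> - real n * \<epsilon>)) * ennreal \<bar>Z k \<omega>\<bar> \<partial>Q n) \<le> ennreal C"
    using weighted_bound by blast
  from ev have "\<forall>\<^sub>F n in sequentially. \<forall>K u i.
     (\<integral>\<^sup>+\<omega>. ennreal (sqrt (real n) * kernel (S n \<omega> - real n * \<epsilon>)) * ennreal \<bar>XU n u i \<omega> - maK K (blk K n \<omega>) u i\<bar> \<partial>Q n) \<le> ennreal (C * tail K i)"
  proof eventually_elim
    case (elim n)
    show ?case
    proof (intro allI)
      fix K u i
      let ?D = "\<lambda>\<omega>. ennreal (sqrt (real n) * kernel (S n \<omega> - real n * \<epsilon>))"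
      have "(\<integral>\<^sup>+\<omega>. ?D \<omega> * ennreal \<bar>XU n u i \<omega> - maK K (blk K n \<omega>) u i\<bar> \<partial>Q n) \<le>
          (\<integral>\<^sup>+\<omega>. ?D \<omega> * (\<integral>\<^sup>+k. ennreal \<bar>tcoef K n u i k * Z k \<omega>\<bar> \<partial>count_space UNIV) \<partial>Q n)"
      proof (rule nn_integral_mono_AE)
        show "AE \<omega> in Q n. ?D \<omega> * ennreal \<bar>XU n u i \<omega> - maK K (blk K n \<omega>) u i\<bar> \<le>
          ?D \<omega> * (\<integral>\<^sup>+k. ennreal \<bar>tcoef K n u i k * Z k \<omega>\<bar> \<partial>count_space UNIV)"
          using trunc_error_eq[of n u i K] by eventually_elim (auto intro!: mult_left_mono ennreal_abs_lin_le)
      qed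
      also have "\<dots> \<le> ennreal (C * (\<Sum>\<^sub>\<infinity>k. \<bar>tcoef K n u i k\<bar>))"
        by (rule nn_integral_abs_weighted[OF _ _ _ C tcoef_summable]) (use elim in auto)
      finally show "(\<integral>\<^sup>+\<omega>. ?D \<omega> * ennreal \<bar>XU n u i \<omega> - maK K (blk K n \<omega>) u i\<bar> \<partial>Q n) \<le> ennreal (C * tail K i)"
        by (simp add: tcoef_sum)
    qed
  qed
  then show ?thesis using C by blast
qed

lemma lim_trunc_error:
  "\<exists>C\<ge>0. \<forall>K u i. (\<integral>\<^sup>+\<omega>. ennreal \<bar>moving_average a (W u) i \<omega> - maK K (\<lambda>p. W (fst p) (snd p) \<omega>) u i\<bar> \<partial>N) \<le> ennreal (C * tail K i)"
proof -
  define C where "C = (\<integral>z. \<bar>z\<bar> * exp (\<theta> * a1 * \<bar>z\<bar>) \<partial>F)"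
  have C: "C \<ge> 0" unfolding C_def by (intro Bochner_Integration.integral_nonneg) simp
  have WC: "(\<integral>\<^sup>+\<omega>. ennreal \<bar>W u k \<omega>\<bar> \<partial>N) \<le> ennreal C" for u k
    unfolding C_def by (rule nn_integral_abs_tilted_le[OF _ W_law edge_le]) simp
  have "(\<integral>\<^sup>+\<omega>. ennreal \<bar>moving_average a (W u) i \<omega> - maK K (\<lambda>p. W (fst p) (snd p) \<omega>) u i\<bar> \<partial>N) \<le> ennreal (C * tail K i)" for K u i
  proof -
    have "AE \<omega> in N. (\<lambda>k. \<bar>a (i - k) * W u k \<omega>\<bar>) summable_on UNIV"
      by (rule N.AE_lin_summable[OF _ WC C a_reflect_summable]) simp
    \<comment> \<open>Both limiting families are indexed around \<open>0\<close>, so the left-end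
      coefficients with \<open>n = 0\<close> serve for either side. The factor \<open>1\<close> is
      the trivial weight.\<close>
    then have "AE \<omega> in N. ennreal \<bar>moving_average a (W u) i \<omega> - maK K (\<lambda>p. W (fst p) (snd p) \<omega>) u i\<bar> \<le>
        1 * (\<integral>\<^sup>+k. ennreal \<bar>tcoef K 0 Minus i k * W u k \<omega>\<bar> \<partial>count_space UNIV)"
    proof eventually_elim
      case (elim \<omega>)
      have "moving_average a (W u) i \<omega> - maK K (\<lambda>p. W (fst p) (snd p) \<omega>) u i =
          (\<Sum>\<^sub>\<infinity>k. if k \<in> {-int K..int K} then 0 else a (i - k) * W u k \<omega>)"
        using infsum_split_finite(2)[OF abs_summable_imp_summable[OF elim], of "{-int K..int K}"]
        by (simp add: lin_moving_average lin_def maK_def)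
      also have "\<dots> = lin (tcoef K 0 Minus i) (W u) \<omega>"
        unfolding lin_def by (rule infsum_cong) (simp add: tcoef_def)
      finally show ?case using ennreal_abs_lin_le[of "tcoef K 0 Minus i" "W u" \<omega>] by simp
    qed
    then have "(\<integral>\<^sup>+\<omega>. ennreal \<bar>moving_average a (W u) i \<omega> - maK K (\<lambda>p. W (fst p) (snd p) \<omega>) u i\<bar> \<partial>N) \<le>
        (\<integral>\<^sup>+\<omega>. 1 * (\<integral>\<^sup>+k. ennreal \<bar>tcoef K 0 Minus i k * W u k \<omega>\<bar> \<partial>count_space UNIV) \<partial>N)"
      by (rule nn_integral_mono_AE)
    also have "\<dots> \<le> ennreal (C * (\<Sum>\<^sub>\<infinity>k. \<bar>tcoef K 0 Minus i k\<bar>))"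
      by (rule nn_integral_abs_weighted[OF _ _ _ C tcoef_summable]) (use WC in auto)
    finally show ?thesis by (simp add: tcoef_sum)
  qed
  then show ?thesis using C by blast
qed

section \<open>Weighted expectations of a bounded Lipschitz functional\<close>

definition h0 :: "real \<Rightarrow> real" where "h0 y = exp (- (\<theta> * y)) * indicator {0..} y"

lemma h0_measurable [measurable]: "h0 \<in> borel_measurable borel"
  unfolding h0_def[abs_def] by measurable

lemma h0_nonneg: "0 \<le> h0 y" by (simp add: h0_def)

text \<open>The constant of \<open>exp_le_kernel\<close> at the rate
  \<open>\<theta>\<close>.\<close>

definition Ch :: real where "Ch = exp (\<theta> * pi) / (2 * \<theta>\<^sup>2)"

lemma Ch_nonneg: "0 \<le> Ch" by (simp add: Ch_def)

lemma h0_le: "h0 y \<le> Ch * kernel y"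
  using exp_le_kernel[OF \<theta>_pos, of y] kernel_pos[of y] Ch_nonneg by (cases "0 \<le> y") (auto simp: h0_def Ch_def)

text \<open>The limit of \<open>sqrt n\<close> times the expected weight:
  \<open>1 / (\<sigma> * sqrt (2 * pi))\<close> from the local limit theorem times
  \<open>1 / \<theta>\<close>, the integral of \<open>h0\<close>.\<close>

definition c1 :: real where "c1 = 1 / (\<sigma> * sqrt (2 * pi) * \<theta>)"

lemma c1_pos: "0 < c1" using \<sigma>_pos \<theta>_pos by (simp add: c1_def)

definition hn :: "nat \<Rightarrow> real \<Rightarrow> real" where "hn n y = exp (- (sp n * y)) * indicator {0..} y"

lemma T_density: "distr N borel T = density lborel (exponential_density \<theta>)"
  using distributed_distr_eq_density[OF T_law] by (metis distr_cong sets_lborel)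

lemma T_integral:
  fixes \<phi> :: "real \<Rightarrow> real"
  assumes [measurable]: "\<phi> \<in> borel_measurable borel"
  shows "(\<integral>y. \<phi> y * h0 y \<partial>lborel) = (\<integral>y. \<phi> y \<partial>distr N borel T) / \<theta>"
proof -
  have "(\<integral>y. \<phi> y \<partial>distr N borel T) = (\<integral>y. exponential_density \<theta> y *\<^sub>R \<phi> y \<partial>lborel)"
    unfolding T_density using \<theta>_pos by (simp add: integral_density exponential_density_nonneg)
  also have "\<dots> = (\<integral>y. \<theta> * (\<phi> y * h0 y) \<partial>lborel)"
    by (intro Bochner_Integration.integral_cong) (auto simp: exponential_density_def h0_def indicator_def mult.commute)
  finally show ?thesis using \<theta>_pos by simp
qed

context
  fixes f :: "(int \<Rightarrow> real) \<Rightarrow> real" and Cf :: real and m :: nat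
  assumes fb: "\<And>x. \<bar>f x\<bar> \<le> Cf" and fl: "\<And>x y. \<bar>f x - f y\<bar> \<le> window_dist m x y"
begin

lemma f_measurable [measurable]: "f \<in> borel_measurable borel"
  by (rule borel_measurable_window_lipschitz[OF fl])

lemma Cf_nonneg: "0 \<le> Cf" using fb[of undefined] abs_ge_zero[of "f undefined"] by linarith

text \<open>The functional evaluated at deterministic block values \<open>z\<close> and overshoot
  \<open>y\<close>; since \<open>limit_seq\<close> expects an outcome, constant functions and the
  dummy outcome \<open>()\<close> are supplied.\<close>

definition tseq :: "nat \<Rightarrow> (side \<times> int \<Rightarrow> real) \<Rightarrow> real \<Rightarrow> int \<Rightarrow> real" where
  "tseq K z y = limit_seq (\<lambda>_. y) (\<lambda>u i _. maK K z u i) ()"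

lemma tseq_eq: "tseq K z y = limit_seq t V \<omega>" if "t \<omega> = y" "\<And>u i. V u i \<omega> = maK K z u i" for t V \<omega>
  using that by (auto simp: tseq_def limit_seq_def)

lemma ftseq_measurable:
  "(\<lambda>(z, y). f (tseq K z y)) \<in> borel_measurable (PiM (blockI K) (\<lambda>_. borel) \<Otimes>\<^sub>M borel)"
proof -
  have "(\<lambda>p. limit_seq (\<lambda>p. snd p) (\<lambda>u i p. maK K (fst p) u i) p) \<in> borel_measurable (PiM (blockI K) (\<lambda>_. borel) \<Otimes>\<^sub>M borel)"
  proof (rule limit_seq_measurable)
    show "(\<lambda>p. maK K (fst p) u i) \<in> borel_measurable (PiM (blockI K) (\<lambda>_. borel) \<Otimes>\<^sub>M borel)" for u i
      unfolding maK_def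
      by (intro borel_measurable_sum borel_measurable_times borel_measurable_const
          measurable_compose[OF measurable_fst measurable_component_singleton]) (simp add: blockI_def)
  qed simp
  moreover have "tseq K (fst p) (snd p) = limit_seq (\<lambda>p. snd p) (\<lambda>u i p. maK K (fst p) u i) p" for p
    by (rule tseq_eq) auto
  ultimately show ?thesis
    using measurable_compose[OF _ f_measurable] by (simp only: split_beta')
qed

definition trunc_pre :: "nat \<Rightarrow> nat \<Rightarrow> real" where
  "trunc_pre K n = sqrt (real n) * (\<integral>\<omega>. f (tseq K (blk K n \<omega>) (S n \<omega> - real n * \<epsilon>)) * h0 (S n \<omega> - real n * \<epsilon>) \<partial>Q n)"

definition trunc_lim :: "nat \<Rightarrow> real" where
  "trunc_lim K = (\<integral>\<omega>. f (limit_seq T (\<lambda>u i \<omega>. maK K (\<lambda>p. W (fst p) (snd p) \<omega>) u i) \<omega>) \<partial>N)"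

text \<open>For fixed \<open>K\<close> the integrand depends on the block and the overshoot only, so
  \<open>block_local_limit\<close> applies. The iterated integral it produces is then recognised as
  an expectation under the joint law of the \<open>W\<close> block and \<open>T\<close>, with
  \<open>c1\<close> collecting the constants.\<close>

lemma trunc_limit: "trunc_pre K \<longlonglongrightarrow> c1 * trunc_lim K"
proof -
  let ?I = "blockI K"
  let ?P = "PiM ?I (\<lambda>p. G (\<theta> * edge (fst p) (snd p)))"
  note fm [measurable] = ftseq_measurable[of K]
  have "(\<lambda>n. sqrt (real n) * (\<integral>\<omega>. f (tseq K (\<lambda>p\<in>?I. Z (idx n p) \<omega>) (S n \<omega> - real n * \<epsilon>)) * h0 (S n \<omega> - real n * \<epsilon>) \<partial>Q n)) \<longlonglongrightarrow>
      (\<integral>z. (\<integral>y. f (tseq K z y) * h0 y \<partial>lborel) / (\<sigma> * sqrt (2 * pi)) \<partial>?P)"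
  proof (rule block_local_limit[where g="\<lambda>z y. f (tseq K z y) * h0 y" and C="Cf * Ch"])
    show "\<forall>\<^sub>F n in sequentially. inj_on (idx n) ?I"
      \<comment> \<open>For \<open>n > 2 * K\<close> the blocks around \<open>0\<close> and
        \<open>n\<close> are disjoint.\<close>
      using eventually_gt_at_top[of "2 * K"]
      by eventually_elim (auto simp: inj_on_def idx_def blockI_def split: side.splits)
    show "(\<lambda>n. b n (idx n p)) \<longlonglongrightarrow> edge (fst p) (snd p)" for p
      using bcoef_tendsto_left[OF a_summable, of "snd p"] bcoef_tendsto_right[OF a_summable, of "snd p"]
      by (cases "fst p") (simp_all add: idx_def edge)
    have "(\<lambda>q. (\<lambda>(z, y). f (tseq K z y)) q * h0 (snd q)) \<in> borel_measurable (PiM ?I (\<lambda>_. borel) \<Otimes>\<^sub>M borel)"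
      by measurable
    then show "(\<lambda>(z, y). f (tseq K z y) * h0 y) \<in> borel_measurable (PiM ?I (\<lambda>_. borel) \<Otimes>\<^sub>M borel)"
      by (simp add: split_beta')
    show "\<bar>f (tseq K z y) * h0 y\<bar> \<le> Cf * Ch * kernel y" for z y
    proof -
      have "\<bar>f (tseq K z y)\<bar> * \<bar>h0 y\<bar> \<le> Cf * (Ch * kernel y)"
        using fb h0_le[of y] h0_nonneg[of y] Cf_nonneg by (intro mult_mono) auto
      then show ?thesis by (simp add: abs_mult mult.assoc)
    qed
    \<comment> \<open>The only discontinuity comes from the jump of \<open>h0\<close> at
      \<open>0\<close>.\<close>
    show "AE y in lborel. isCont (\<lambda>y. f (tseq K z y) * h0 y) y" for z
      using AE_lborel_singleton[of 0]
    proof eventually_elim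
      case (elim y)
      have "isCont (\<lambda>y. f (tseq K z y)) y"
      proof -
        have l: "norm (f (tseq K z y') - f (tseq K z y)) \<le> real m * real (2 * m + 1) * \<bar>y' - y\<bar>" for y'
          using limit_seq_lipschitz[OF fl, of "\<lambda>_. y'" "\<lambda>u i _. maK K z u i" "()" "\<lambda>_. y" "\<lambda>u i _. maK K z u i" "()"]
          by (simp add: tseq_def)
        have "((\<lambda>y'. real m * real (2 * m + 1) * \<bar>y' - y\<bar>) \<longlongrightarrow> real m * real (2 * m + 1) * \<bar>y - y\<bar>) (at y)"
          by (intro tendsto_intros)
        then have "((\<lambda>y'. real m * real (2 * m + 1) * \<bar>y' - y\<bar>) \<longlongrightarrow> 0) (at y)" by simp
        from Lim_null_comparison[OF always_eventually this, of "\<lambda>y'. f (tseq K z y') - f (tseq K z y)"] l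
        show ?thesis by (simp add: isCont_def LIM_zero_iff)
      qed
      moreover have "isCont h0 y"
      proof (cases "0 < y")
        case True
        have "\<forall>\<^sub>F y in nhds y. h0 y = exp (- (\<theta> * y))"
          using eventually_nhds_in_open[OF open_greaterThan, of y 0] True by (auto elim!: eventually_mono simp: h0_def)
        then show ?thesis by (subst isCont_cong) (auto intro!: continuous_intros)
      next
        case False
        then have "\<forall>\<^sub>F y in nhds y. h0 y = 0"
          using eventually_nhds_in_open[OF open_lessThan, of y 0] elim by (auto elim!: eventually_mono simp: h0_def)
        then show ?thesis by (subst isCont_cong) auto
      qed
      ultimately show ?case by (rule continuous_mult)
    qed
  qed (use finite_blockI blockI_nonempty in auto)
  also have "(\<integral>z. (\<integral>y. f (tseq K z y) * h0 y \<partial>lborel) / (\<sigma> * sqrt (2 * pi)) \<partial>?P) = c1 * trunc_lim K"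
  proof -
    let ?X = "\<lambda>k. case k of None \<Rightarrow> T | Some (u, j) \<Rightarrow> W u j"
    let ?D = "distr N borel T"
    interpret D: real_distribution ?D by (rule N.real_distribution_distr) simp
    interpret P: prob_space ?P
      by (rule prob_space_PiM) (use real_distribution_tilted in \<open>auto simp: real_distribution_def\<close>)
    interpret PD: pair_prob_space ?P ?D ..
    have sP: "sets ?P = sets (PiM ?I (\<lambda>_. borel))" by (intro sets_PiM_cong) auto
    note [measurable_cong] = sP
    have law: "distr N borel (?X (Some p)) = G (\<theta> * edge (fst p) (snd p))" for p
      by (simp add: split_beta W_law)
    \<comment> \<open>The same block decomposition as for the noise, with the index
      \<open>None\<close> of \<open>T\<close> playing the part of the remainder.\<close>
    have "distr N (PiM ?I (\<lambda>_. borel) \<Otimes>\<^sub>M borel) (\<lambda>\<omega>. (\<lambda>p\<in>?I. ?X (Some p) \<omega>, T \<omega>)) =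
        PiM ?I (\<lambda>p. distr N borel (?X (Some p))) \<Otimes>\<^sub>M ?D"
      by (rule N.distr_block_rest[OF WT_indep, where \<phi>="\<lambda>x. x None"])
        (auto simp: blockI_nonempty intro!: measurable_component_singleton)
    then have joint: "distr N (PiM ?I (\<lambda>_. borel) \<Otimes>\<^sub>M borel) (\<lambda>\<omega>. (\<lambda>p\<in>?I. W (fst p) (snd p) \<omega>, T \<omega>)) = ?P \<Otimes>\<^sub>M ?D"
      unfolding law by (simp add: split_beta)
    have fm' [measurable]: "(\<lambda>(z, y). f (tseq K z y)) \<in> borel_measurable (?P \<Otimes>\<^sub>M ?D)"
      using fm by (simp cong: measurable_cong_sets sets_pair_measure_cong)
    have "trunc_lim K = (\<integral>\<omega>. (\<lambda>(z, y). f (tseq K z y)) (\<lambda>p\<in>?I. W (fst p) (snd p) \<omega>, T \<omega>) \<partial>N)"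
      unfolding trunc_lim_def
    proof (intro Bochner_Integration.integral_cong refl)
      fix \<omega>
      have "tseq K (\<lambda>p\<in>?I. W (fst p) (snd p) \<omega>) (T \<omega>) = limit_seq T (\<lambda>u i \<omega>. maK K (\<lambda>p. W (fst p) (snd p) \<omega>) u i) \<omega>"
        by (rule tseq_eq) (auto simp: maK_def blockI_def)
      then show "f (limit_seq T (\<lambda>u i \<omega>. maK K (\<lambda>p. W (fst p) (snd p) \<omega>) u i) \<omega>) =
          (\<lambda>(z, y). f (tseq K z y)) (\<lambda>p\<in>?I. W (fst p) (snd p) \<omega>, T \<omega>)" by simp
    qed
    also have "\<dots> = (\<integral>q. (\<lambda>(z, y). f (tseq K z y)) q \<partial>(?P \<Otimes>\<^sub>M ?D))"
      unfolding joint[symmetric] by (rule integral_distr[symmetric]) measurable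
    also have "\<dots> = (\<integral>z. \<integral>y. f (tseq K z y) \<partial>?D \<partial>?P)"
    proof -
      have "integrable (?P \<Otimes>\<^sub>M ?D) (\<lambda>(z, y). f (tseq K z y))"
        by (rule PD.integrable_const_bound[where B=Cf]) (use fb in auto)
      from PD.integral_fst'[OF this] show ?thesis by simp
    qed
    also have "\<dots> = (\<integral>z. \<theta> * (\<integral>y. f (tseq K z y) * h0 y \<partial>lborel) \<partial>?P)"
    proof (intro Bochner_Integration.integral_cong refl)
      fix z assume "z \<in> space ?P"
      then have "z \<in> space (PiM ?I (\<lambda>_. borel))" using sets_eq_imp_space_eq[OF sP] by simp
      then have "(\<lambda>y. f (tseq K z y)) \<in> borel_measurable borel"
        using measurable_Pair2[OF fm] by simp
      from T_integral[OF this] show "(\<integral>y. f (tseq K z y) \<partial>?D) = \<theta> * (\<integral>y. f (tseq K z y) * h0 y \<partial>lborel)"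
        using \<theta>_pos by simp
    qed
    finally have "trunc_lim K = \<theta> * (\<integral>z. (\<integral>y. f (tseq K z y) * h0 y \<partial>lborel) \<partial>?P)" by simp
    then show ?thesis using \<theta>_pos by (simp add: c1_def)
  qed
  finally show ?thesis unfolding trunc_pre_def[abs_def] blk_def .
qed

definition Cm :: real where "Cm = real m * real (2 * m + 1)"

definition tails :: "nat \<Rightarrow> real" where "tails K = (\<Sum>(u, i)\<in>(UNIV :: side set) \<times> {-int m..int m}. tail K i)"

lemma Cm_nonneg: "0 \<le> Cm" by (simp add: Cm_def)

lemma tails_tendsto: "tails \<longlonglongrightarrow> 0"
proof -
  have "(\<lambda>K. \<Sum>p\<in>(UNIV :: side set) \<times> {-int m..int m}. tail K (snd p)) \<longlonglongrightarrow> (\<Sum>p\<in>(UNIV :: side set) \<times> {-int m..int m}. 0)"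
    by (intro tendsto_sum tail_tendsto)
  then show ?thesis by (simp add: tails_def[abs_def] split_beta)
qed

lemma tails_nonneg: "0 \<le> tails K"
  unfolding tails_def by (intro sum_nonneg) (auto simp: tail_nonneg)

definition pre :: "nat \<Rightarrow> real" where
  "pre n = sqrt (real n) * (\<integral>\<omega>. f (pre_seq n \<omega>) * h0 (S n \<omega> - real n * \<epsilon>) \<partial>Q n)"

lemma h0_le_1: "h0 y \<le> 1"
  using \<theta>_pos by (cases "0 \<le> y") (auto simp: h0_def)

text \<open>The Lipschitz bound estimates the difference of the functionals by truncation errors,
  and \<open>h0 <= Ch * kernel\<close> supplies exactly the weight under which
  \<open>trunc_error_bound\<close> controls them, including the factor
  \<open>sqrt n\<close>.\<close>

lemma pre_trunc:
  "\<exists>C\<ge>0. \<forall>\<^sub>F n in sequentially. \<forall>K. \<bar>pre n - trunc_pre K n\<bar> \<le> C * tails K"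
proof -
  obtain C where C: "C \<ge> 0" and ev: "\<forall>\<^sub>F n in sequentially. \<forall>K u i.
     (\<integral>\<^sup>+\<omega>. ennreal (sqrt (real n) * kernel (S n \<omega> - real n * \<epsilon>)) * ennreal \<bar>XU n u i \<omega> - maK K (blk K n \<omega>) u i\<bar> \<partial>Q n) \<le> ennreal (C * tail K i)"
    using trunc_error_bound by blast
  let ?J = "(UNIV :: side set) \<times> {-int m..int m}"
  have fJ: "finite ?J" by (simp add: UNIV_side)
  from ev have "\<forall>\<^sub>F n in sequentially. \<forall>K. \<bar>pre n - trunc_pre K n\<bar> \<le> (Cm * Ch * C) * tails K"
  proof eventually_elim
    case (elim n)
    show ?case
    proof
      fix K
      interpret Q: prob_space "Q n" by (rule Q_prob)
      let ?y = "\<lambda>\<omega>. S n \<omega> - real n * \<epsilon>"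
      let ?d = "\<lambda>p \<omega>. \<bar>XU n (fst p) (snd p) \<omega> - maK K (blk K n \<omega>) (fst p) (snd p)\<bar>"
      have bm [measurable]: "blk K n \<in> measurable (Q n) (PiM (blockI K) (\<lambda>_. borel))"
        unfolding blk_def by measurable
      have tm [measurable]: "(\<lambda>\<omega>. f (tseq K (blk K n \<omega>) (?y \<omega>))) \<in> borel_measurable (Q n)"
        using measurable_compose[OF _ ftseq_measurable[of K], of "\<lambda>\<omega>. (blk K n \<omega>, ?y \<omega>)" "Q n"] by simp
      have mm [measurable]: "(\<lambda>\<omega>. maK K (blk K n \<omega>) u i) \<in> borel_measurable (Q n)" for u i
        unfolding maK_def
        by (intro borel_measurable_sum borel_measurable_times borel_measurable_const
            measurable_compose[OF bm measurable_component_singleton]) (simp add: blockI_def)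
      have pm [measurable]: "(\<lambda>\<omega>. f (pre_seq n \<omega>)) \<in> borel_measurable (Q n)"
        by (rule measurable_compose[OF _ f_measurable]) simp
      have int: "integrable (Q n) (\<lambda>\<omega>. g \<omega> * h0 (?y \<omega>))" if [measurable]: "g \<in> borel_measurable (Q n)" and g: "\<And>\<omega>. \<bar>g \<omega>\<bar> \<le> Cf" for g
      proof (rule Q.integrable_const_bound[where B=Cf])
        show "AE \<omega> in Q n. norm (g \<omega> * h0 (?y \<omega>)) \<le> Cf"
        proof (rule AE_I2)
          fix \<omega>
          have "\<bar>g \<omega>\<bar> * \<bar>h0 (?y \<omega>)\<bar> \<le> Cf * 1"
            using g[of \<omega>] h0_le_1[of "?y \<omega>"] h0_nonneg[of "?y \<omega>"] Cf_nonneg by (intro mult_mono) auto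
          then show "norm (g \<omega> * h0 (?y \<omega>)) \<le> Cf" by (simp add: abs_mult)
        qed
      qed simp
      have eq: "pre n - trunc_pre K n = (\<integral>\<omega>. sqrt (real n) * ((f (pre_seq n \<omega>) - f (tseq K (blk K n \<omega>) (?y \<omega>))) * h0 (?y \<omega>)) \<partial>Q n)"
        unfolding pre_def trunc_pre_def left_diff_distrib right_diff_distrib[symmetric]
        using int[OF pm fb] int[OF tm fb] by simp
      show "\<bar>pre n - trunc_pre K n\<bar> \<le> (Cm * Ch * C) * tails K"
        unfolding eq
      proof (rule abs_integral_le_nn)
        have "AE \<omega> in Q n. ennreal \<bar>sqrt (real n) * ((f (pre_seq n \<omega>) - f (tseq K (blk K n \<omega>) (?y \<omega>))) * h0 (?y \<omega>))\<bar> \<le>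
            (\<Sum>p\<in>?J. ennreal (Cm * Ch) * (ennreal (sqrt (real n) * kernel (?y \<omega>)) * ennreal (?d p \<omega>)))"
          using pre_seq_eq[of n]
        proof eventually_elim
          case (elim \<omega>)
          have "\<bar>f (pre_seq n \<omega>) - f (tseq K (blk K n \<omega>) (?y \<omega>))\<bar> \<le> Cm * (\<Sum>p\<in>?J. ?d p \<omega>)"
            using limit_seq_lipschitz[OF fl, of ?y "XU n" \<omega> "\<lambda>_. ?y \<omega>" "\<lambda>u i _. maK K (blk K n \<omega>) u i" "()"]
            unfolding elim tseq_def by (simp add: Cm_def split_beta)
          moreover have "\<bar>h0 (?y \<omega>)\<bar> \<le> Ch * kernel (?y \<omega>)" using h0_le[of "?y \<omega>"] h0_nonneg[of "?y \<omega>"] by simp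
          ultimately have "\<bar>f (pre_seq n \<omega>) - f (tseq K (blk K n \<omega>) (?y \<omega>))\<bar> * \<bar>h0 (?y \<omega>)\<bar> \<le> (Cm * (\<Sum>p\<in>?J. ?d p \<omega>)) * (Ch * kernel (?y \<omega>))"
            by (intro mult_mono) (auto intro!: mult_nonneg_nonneg sum_nonneg Cm_nonneg)
          then have "sqrt (real n) * (\<bar>f (pre_seq n \<omega>) - f (tseq K (blk K n \<omega>) (?y \<omega>))\<bar> * \<bar>h0 (?y \<omega>)\<bar>) \<le>
              sqrt (real n) * ((Cm * (\<Sum>p\<in>?J. ?d p \<omega>)) * (Ch * kernel (?y \<omega>)))"
            by (rule mult_left_mono) simp
          also have "\<dots> = (\<Sum>p\<in>?J. (Cm * Ch) * ((sqrt (real n) * kernel (?y \<omega>)) * ?d p \<omega>))"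
            by (simp add: sum_distrib_left sum_distrib_right ac_simps)
          finally have "ennreal \<bar>sqrt (real n) * ((f (pre_seq n \<omega>) - f (tseq K (blk K n \<omega>) (?y \<omega>))) * h0 (?y \<omega>))\<bar> \<le>
              ennreal (\<Sum>p\<in>?J. (Cm * Ch) * ((sqrt (real n) * kernel (?y \<omega>)) * ?d p \<omega>))"
            by (intro ennreal_leI) (simp add: abs_mult)
          also have "\<dots> = (\<Sum>p\<in>?J. ennreal ((Cm * Ch) * ((sqrt (real n) * kernel (?y \<omega>)) * ?d p \<omega>)))"
            using Cm_nonneg Ch_nonneg kernel_pos[of "?y \<omega>"] by (intro sum_ennreal[symmetric] mult_nonneg_nonneg) auto
          also have "\<dots> = (\<Sum>p\<in>?J. ennreal (Cm * Ch) * (ennreal (sqrt (real n) * kernel (?y \<omega>)) * ennreal (?d p \<omega>)))"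
            using Cm_nonneg Ch_nonneg kernel_pos[of "?y \<omega>"]
            by (intro sum.cong refl) (subst ennreal_mult, simp, simp, subst ennreal_mult, auto simp: less_imp_le)
          finally show ?case .
        qed
        then have "(\<integral>\<^sup>+\<omega>. ennreal \<bar>sqrt (real n) * ((f (pre_seq n \<omega>) - f (tseq K (blk K n \<omega>) (?y \<omega>))) * h0 (?y \<omega>))\<bar> \<partial>Q n) \<le>
            (\<integral>\<^sup>+\<omega>. (\<Sum>p\<in>?J. ennreal (Cm * Ch) * (ennreal (sqrt (real n) * kernel (?y \<omega>)) * ennreal (?d p \<omega>))) \<partial>Q n)"
          by (rule nn_integral_mono_AE)
        also have "\<dots> = (\<Sum>p\<in>?J. ennreal (Cm * Ch) * (\<integral>\<^sup>+\<omega>. ennreal (sqrt (real n) * kernel (?y \<omega>)) * ennreal (?d p \<omega>) \<partial>Q n))"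
          by (subst nn_integral_sum) (auto intro!: sum.cong nn_integral_cmult)
        also have "\<dots> \<le> (\<Sum>p\<in>?J. ennreal (Cm * Ch) * ennreal (C * tail K (snd p)))"
          using elim by (intro sum_mono mult_left_mono) auto
        also have "\<dots> = (\<Sum>p\<in>?J. ennreal (Cm * Ch * C * tail K (snd p)))"
          using Cm_nonneg Ch_nonneg C tail_nonneg by (intro sum.cong refl) (simp add: ennreal_mult[symmetric] mult.assoc)
        also have "\<dots> = ennreal (\<Sum>p\<in>?J. Cm * Ch * C * tail K (snd p))"
          using Cm_nonneg Ch_nonneg C tail_nonneg by (intro sum_ennreal mult_nonneg_nonneg) auto
        also have "(\<Sum>p\<in>?J. Cm * Ch * C * tail K (snd p)) = Cm * Ch * C * tails K"
          by (simp add: tails_def split_beta sum_distrib_left)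
        finally show "(\<integral>\<^sup>+\<omega>. ennreal \<bar>sqrt (real n) * ((f (pre_seq n \<omega>) - f (tseq K (blk K n \<omega>) (?y \<omega>))) * h0 (?y \<omega>))\<bar> \<partial>Q n) \<le> ennreal (Cm * Ch * C * tails K)" .
      qed (use Cm_nonneg Ch_nonneg C tails_nonneg in auto)
    qed
  qed
  then show ?thesis using Cm_nonneg Ch_nonneg C by (intro exI[of _ "Cm * Ch * C"]) auto
qed

lemma lim_trunc: "\<exists>C\<ge>0. \<forall>K. \<bar>(\<integral>\<omega>. f (lim_seq \<omega>) \<partial>N) - trunc_lim K\<bar> \<le> C * tails K"
proof -
  obtain C where C: "C \<ge> 0" and err: "\<And>K u i. (\<integral>\<^sup>+\<omega>. ennreal \<bar>moving_average a (W u) i \<omega> - maK K (\<lambda>p. W (fst p) (snd p) \<omega>) u i\<bar> \<partial>N) \<le> ennreal (C * tail K i)"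
    using lim_trunc_error by blast
  let ?J = "(UNIV :: side set) \<times> {-int m..int m}"
  have "\<bar>(\<integral>\<omega>. f (lim_seq \<omega>) \<partial>N) - trunc_lim K\<bar> \<le> (Cm * C) * tails K" for K
  proof -
    let ?t = "limit_seq T (\<lambda>u i \<omega>. maK K (\<lambda>p. W (fst p) (snd p) \<omega>) u i)"
    let ?d = "\<lambda>p \<omega>. \<bar>moving_average a (W (fst p)) (snd p) \<omega> - maK K (\<lambda>p. W (fst p) (snd p) \<omega>) (fst p) (snd p)\<bar>"
    have mm [measurable]: "(\<lambda>\<omega>. maK K (\<lambda>p. W (fst p) (snd p) \<omega>) u i) \<in> borel_measurable N" for u i
      unfolding maK_def by measurable
    have tm [measurable]: "?t \<in> borel_measurable N" by (rule limit_seq_measurable) simp_all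
    have int: "integrable N (\<lambda>\<omega>. f (g \<omega>))" if [measurable]: "g \<in> borel_measurable N" for g
      by (rule N.integrable_const_bound[where B=Cf]) (use fb in \<open>auto intro: measurable_compose[OF that f_measurable]\<close>)
    have eq: "(\<integral>\<omega>. f (lim_seq \<omega>) \<partial>N) - trunc_lim K = (\<integral>\<omega>. f (lim_seq \<omega>) - f (?t \<omega>) \<partial>N)"
      unfolding trunc_lim_def using int[OF lim_seq_measurable] int[OF tm] by simp
    show ?thesis
      unfolding eq
    proof (rule abs_integral_le_nn)
      have "ennreal \<bar>f (lim_seq \<omega>) - f (?t \<omega>)\<bar> \<le> (\<Sum>p\<in>?J. ennreal Cm * ennreal (?d p \<omega>))" for \<omega>
      proof -
        have "\<bar>f (lim_seq \<omega>) - f (?t \<omega>)\<bar> \<le> (\<Sum>p\<in>?J. Cm * ?d p \<omega>)"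
          using limit_seq_lipschitz[OF fl, of T "\<lambda>u. moving_average a (W u)" \<omega> T "\<lambda>u i \<omega>. maK K (\<lambda>p. W (fst p) (snd p) \<omega>) u i" \<omega>]
          by (simp add: Cm_def split_beta sum_distrib_left)
        then have "ennreal \<bar>f (lim_seq \<omega>) - f (?t \<omega>)\<bar> \<le> ennreal (\<Sum>p\<in>?J. Cm * ?d p \<omega>)" by (rule ennreal_leI)
        also have "\<dots> = (\<Sum>p\<in>?J. ennreal (Cm * ?d p \<omega>))" using Cm_nonneg by (intro sum_ennreal[symmetric]) auto
        finally show ?thesis using Cm_nonneg by (simp add: ennreal_mult)
      qed
      then have "(\<integral>\<^sup>+\<omega>. ennreal \<bar>f (lim_seq \<omega>) - f (?t \<omega>)\<bar> \<partial>N) \<le> (\<integral>\<^sup>+\<omega>. (\<Sum>p\<in>?J. ennreal Cm * ennreal (?d p \<omega>)) \<partial>N)"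
        by (intro nn_integral_mono) auto
      also have "\<dots> = (\<Sum>p\<in>?J. ennreal Cm * (\<integral>\<^sup>+\<omega>. ennreal (?d p \<omega>) \<partial>N))"
        by (subst nn_integral_sum) (auto intro!: sum.cong nn_integral_cmult)
      also have "\<dots> \<le> (\<Sum>p\<in>?J. ennreal Cm * ennreal (C * tail K (snd p)))"
        by (intro sum_mono mult_left_mono err) auto
      also have "\<dots> = (\<Sum>p\<in>?J. ennreal (Cm * C * tail K (snd p)))"
        using Cm_nonneg C tail_nonneg by (intro sum.cong refl) (simp add: ennreal_mult[symmetric] mult.assoc)
      also have "\<dots> = ennreal (\<Sum>p\<in>?J. Cm * C * tail K (snd p))"
        using Cm_nonneg C tail_nonneg by (intro sum_ennreal mult_nonneg_nonneg) auto
      also have "(\<Sum>p\<in>?J. Cm * C * tail K (snd p)) = Cm * C * tails K"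
        by (simp add: tails_def split_beta sum_distrib_left)
      finally show "(\<integral>\<^sup>+\<omega>. ennreal \<bar>f (lim_seq \<omega>) - f (?t \<omega>)\<bar> \<partial>N) \<le> ennreal (Cm * C * tails K)" .
    qed (use Cm_nonneg C tails_nonneg in auto)
  qed
  then show ?thesis using Cm_nonneg C by (intro exI[of _ "Cm * C"]) auto
qed

text \<open>The truncation errors before and after the limit are bounded by multiples of
  \<open>tails K\<close>, the former for all \<open>K\<close> at once when \<open>n\<close> is
  large. So \<open>K\<close> is fixed first, and then \<open>n\<close> tends to infinity.\<close>

lemma pre_limit: "pre \<longlonglongrightarrow> c1 * (\<integral>\<omega>. f (lim_seq \<omega>) \<partial>N)"
proof (rule tendstoI)
  fix r :: real assume r: "0 < r"
  obtain C where C: "C \<ge> 0" and ev: "\<forall>\<^sub>F n in sequentially. \<forall>K. \<bar>pre n - trunc_pre K n\<bar> \<le> C * tails K"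
    using pre_trunc by blast
  obtain D where D: "D \<ge> 0" "\<And>K. \<bar>(\<integral>\<omega>. f (lim_seq \<omega>) \<partial>N) - trunc_lim K\<bar> \<le> D * tails K"
    using lim_trunc by blast
  have "(\<lambda>K. (C + c1 * D) * tails K) \<longlonglongrightarrow> 0"
    by (rule tendsto_mult_right_zero[OF tails_tendsto])
  then have "\<forall>\<^sub>F K in sequentially. (C + c1 * D) * tails K < r / 2"
    by (rule order_tendstoD) (use r in simp)
  then obtain K where K: "(C + c1 * D) * tails K < r / 2"
    using eventually_happens'[OF sequentially_bot] by blast
  have "\<forall>\<^sub>F n in sequentially. dist (trunc_pre K n) (c1 * trunc_lim K) < r / 2"
    by (rule tendstoD[OF trunc_limit]) (use r in simp)
  with ev show "\<forall>\<^sub>F n in sequentially. dist (pre n) (c1 * (\<integral>\<omega>. f (lim_seq \<omega>) \<partial>N)) < r"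
  proof eventually_elim
    case (elim n)
    let ?l = "\<integral>\<omega>. f (lim_seq \<omega>) \<partial>N"
    have "\<bar>c1 * ?l - c1 * trunc_lim K\<bar> \<le> c1 * (D * tails K)"
      using mult_left_mono[OF D(2)[of K], of c1] c1_pos by (simp add: abs_mult right_diff_distrib[symmetric])
    moreover have "\<bar>pre n - trunc_pre K n\<bar> \<le> C * tails K" using elim by blast
    moreover have "(C + c1 * D) * tails K = C * tails K + c1 * (D * tails K)" by (simp add: distrib_right)
    ultimately show ?case using elim(2) K unfolding dist_real_def by linarith
  qed
qed

text \<open>Replacing the rate \<open>\<theta>\<close> by the actual saddle point costs at most a
  multiple of \<open>|sp n - \<theta>| * kernel\<close>, and the kernel integral times
  \<open>sqrt n\<close> is bounded.\<close>

lemma hn_limit: "(\<lambda>n. sqrt (real n) * (\<integral>\<omega>. f (pre_seq n \<omega>) * hn n (S n \<omega> - real n * \<epsilon>) \<partial>Q n)) \<longlonglongrightarrow> c1 * (\<integral>\<omega>. f (lim_seq \<omega>) \<partial>N)"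
proof -
  obtain C where C: "C \<ge> 0" and ev: "\<forall>\<^sub>F n in sequentially. \<forall>B x. finite B \<longrightarrow> card B \<le> 0 \<longrightarrow>
     sqrt (real n) * (\<integral>\<omega>. kernel (rest n B \<omega> + x) \<partial>Q n) \<le> C"
    using rest_bound[of 0] by blast
  define D where "D = 4 / \<theta> * (exp (\<theta> / 4 * pi) / (2 * (\<theta> / 4)\<^sup>2))"
  have D: "D \<ge> 0" using \<theta>_pos by (simp add: D_def)
  have "\<forall>\<^sub>F n in sequentially. dist (sp n) \<theta> < \<theta> / 2"
    by (rule tendstoD[OF sp_tendsto]) (use \<theta>_pos in simp)
  with ev have near: "\<forall>\<^sub>F n in sequentially.
      norm (sqrt (real n) * (\<integral>\<omega>. f (pre_seq n \<omega>) * hn n (S n \<omega> - real n * \<epsilon>) \<partial>Q n) - pre n) \<le> Cf * D * C * \<bar>sp n - \<theta>\<bar>"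
  proof eventually_elim
    case (elim n)
    interpret Q: prob_space "Q n" by (rule Q_prob)
    let ?y = "\<lambda>\<omega>. S n \<omega> - real n * \<epsilon>"
    have s: "\<bar>sp n - \<theta>\<bar> \<le> \<theta> / 2" using elim(2) by (simp add: dist_real_def)
    have d: "\<bar>hn n y - h0 y\<bar> \<le> \<bar>sp n - \<theta>\<bar> * D * kernel y" for y
    proof (cases "0 \<le> y")
      case True
      then show ?thesis using exp_diff_le_kernel[OF \<theta>_pos s, of y] by (simp add: hn_def h0_def D_def)
    next
      case False
      then show ?thesis using kernel_pos[of y] D by (simp add: hn_def h0_def less_imp_le)
    qed
    have hnb: "\<bar>hn n y\<bar> \<le> 1" for y
    proof (cases "0 \<le> y")
      case True
      have "sp n \<ge> 0" using s \<theta>_pos by linarith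
      then show ?thesis using True by (simp add: hn_def)
    qed (simp add: hn_def)
    have hm [measurable]: "hn n \<in> borel_measurable borel" unfolding hn_def[abs_def] by measurable
    have pm [measurable]: "(\<lambda>\<omega>. f (pre_seq n \<omega>)) \<in> borel_measurable (Q n)"
      by (rule measurable_compose[OF _ f_measurable]) simp
    have i: "integrable (Q n) (\<lambda>\<omega>. f (pre_seq n \<omega>) * g (?y \<omega>))"
      if [measurable]: "g \<in> borel_measurable borel" and g: "\<And>y. \<bar>g y\<bar> \<le> 1" for g
    proof (rule Q.integrable_const_bound[where B=Cf])
      have "\<bar>f (pre_seq n \<omega>)\<bar> * \<bar>g (?y \<omega>)\<bar> \<le> Cf * 1" for \<omega>
        using fb g Cf_nonneg by (intro mult_mono) auto
      then show "AE \<omega> in Q n. norm (f (pre_seq n \<omega>) * g (?y \<omega>)) \<le> Cf" by (simp add: abs_mult)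
    qed simp
    have i2: "integrable (Q n) (\<lambda>\<omega>. f (pre_seq n \<omega>) * h0 (?y \<omega>))"
      by (rule i) (use h0_le_1 h0_nonneg in auto)
    have ik: "integrable (Q n) (\<lambda>\<omega>. kernel (?y \<omega>))"
      by (rule Q.integrable_const_bound[where B=2]) (use kernel_pos kernel_le in \<open>auto simp: abs_of_pos\<close>)
    \<comment> \<open>For the empty block, \<open>rest_bound\<close> speaks of the window sum
      itself.\<close>
    have "rcoef n {} = b n" by (simp add: rcoef_def fun_eq_iff)
    then have rS: "rest n {} = S n" by (simp add: rest_def S_def)
    have eq: "(\<integral>\<omega>. f (pre_seq n \<omega>) * hn n (?y \<omega>) \<partial>Q n) - (\<integral>\<omega>. f (pre_seq n \<omega>) * h0 (?y \<omega>) \<partial>Q n) =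
        (\<integral>\<omega>. f (pre_seq n \<omega>) * (hn n (?y \<omega>) - h0 (?y \<omega>)) \<partial>Q n)"
      using i[OF hm hnb] i2 by (simp add: right_diff_distrib)
    have "norm (\<integral>\<omega>. f (pre_seq n \<omega>) * (hn n (?y \<omega>) - h0 (?y \<omega>)) \<partial>Q n) \<le> (\<integral>\<omega>. Cf * D * \<bar>sp n - \<theta>\<bar> * kernel (?y \<omega>) \<partial>Q n)"
    proof (rule order.trans[OF integral_norm_bound], rule integral_mono)
      show "integrable (Q n) (\<lambda>\<omega>. norm (f (pre_seq n \<omega>) * (hn n (?y \<omega>) - h0 (?y \<omega>))))"
        using i[OF hm hnb] i2 by (simp add: right_diff_distrib)
      show "integrable (Q n) (\<lambda>\<omega>. Cf * D * \<bar>sp n - \<theta>\<bar> * kernel (?y \<omega>))"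
        by (rule integrable_mult_right[OF ik])
      fix \<omega>
      have "\<bar>f (pre_seq n \<omega>)\<bar> * \<bar>hn n (?y \<omega>) - h0 (?y \<omega>)\<bar> \<le> Cf * (\<bar>sp n - \<theta>\<bar> * D * kernel (?y \<omega>))"
        by (intro mult_mono fb d Cf_nonneg) simp
      then show "norm (f (pre_seq n \<omega>) * (hn n (?y \<omega>) - h0 (?y \<omega>))) \<le> Cf * D * \<bar>sp n - \<theta>\<bar> * kernel (?y \<omega>)"
        by (simp add: abs_mult mult.commute mult.left_commute)
    qed
    then have "sqrt (real n) * \<bar>(\<integral>\<omega>. f (pre_seq n \<omega>) * hn n (?y \<omega>) \<partial>Q n) - (\<integral>\<omega>. f (pre_seq n \<omega>) * h0 (?y \<omega>) \<partial>Q n)\<bar>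
        \<le> sqrt (real n) * (Cf * D * \<bar>sp n - \<theta>\<bar> * (\<integral>\<omega>. kernel (?y \<omega>) \<partial>Q n))"
      unfolding eq by (intro mult_left_mono) simp_all
    also have "\<dots> = Cf * D * \<bar>sp n - \<theta>\<bar> * (sqrt (real n) * (\<integral>\<omega>. kernel (?y \<omega>) \<partial>Q n))" by simp
    also have "\<dots> \<le> Cf * D * \<bar>sp n - \<theta>\<bar> * C"
      using elim(1)[rule_format, of "{}" "- (real n * \<epsilon>)"] D Cf_nonneg by (intro mult_left_mono) (auto simp: rS)
    finally show ?case unfolding pre_def right_diff_distrib[symmetric] by (simp add: abs_mult mult.commute mult.left_commute)
  qed
  have "(\<lambda>n. \<bar>sp n - \<theta>\<bar>) \<longlonglongrightarrow> 0"
    using sp_tendsto by (intro tendsto_rabs_zero) (simp add: LIM_zero)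
  from Lim_null_comparison[OF near tendsto_mult_right_zero[OF this]]
  have "(\<lambda>n. (sqrt (real n) * (\<integral>\<omega>. f (pre_seq n \<omega>) * hn n (S n \<omega> - real n * \<epsilon>) \<partial>Q n) - pre n) + pre n) \<longlonglongrightarrow> 0 + c1 * (\<integral>\<omega>. f (lim_seq \<omega>) \<partial>N)"
    by (rule tendsto_add[OF _ pre_limit])
  then show ?thesis by simp
qed

end

end

text \<open>Lets Borel measurability of maps into \<open>int => bool\<close> be checked
  coordinatewise.\<close>

instance bool :: second_countable_topology
proof
  show "\<exists>B :: bool set set. countable B \<and> open = generate_topology B"
  proof (intro exI conjI)
    show "open = generate_topology (UNIV :: bool set set)"
    proof
      fix B :: "bool set"
      have "generate_topology UNIV B" by (rule generate_topology.Basis) simp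
      then show "open B = generate_topology UNIV B" by (simp add: discrete_topology_class.open_discrete)
    qed
  qed (rule countableI_type)
qed

section \<open>From the tilted measures back to the conditional laws\<close>

context moving_avg_limit
begin

text \<open>The density of \<open>Q n\<close> is positive everywhere, so almost sure statements pass
  from \<open>Q n\<close> back to \<open>M\<close>.\<close>

lemma S_eq_M: "AE \<omega> in M. (\<Sum>i=0..int n - 1. moving_average a Z i \<omega>) = S n \<omega>"
proof -
  have "AE \<omega> in M. 0 < ennreal (exp (lin (wt n) Z \<omega>) / norming TYPE('w) M Z (wt n)) \<longrightarrow>
      (\<Sum>i=0..int n - 1. moving_average a Z i \<omega>) = S n \<omega>"
    using S_eq[of n] unfolding Q_def tilt_measure_eq[OF tilt_facts] by (subst (asm) AE_density) simp_all
  then show ?thesis using norming_pos[OF tilt_facts, of n] by simp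
qed

definition E :: "nat \<Rightarrow> 'w set" where "E n = window_event M (moving_average a Z) n \<epsilon> 0"

text \<open>At \<open>n = 0\<close> the two sides disagree: the average is \<open>0\<close>, which
  is less than \<open>\<epsilon>\<close>, while \<open>pre_seq\<close> is \<open>0\<close> and
  passes the test.\<close>

lemma window_event_pre_seq: "0 < n \<Longrightarrow> window_event M (moving_average a Z) n \<epsilon> j = {\<omega> \<in> space M. 0 \<le> pre_seq n \<omega> j}"
  unfolding window_event_def pre_seq_def
  by (intro Collect_cong conj_cong refl) (simp add: field_simps add.commute)

lemma window_event_sets [measurable]: "window_event M (moving_average a Z) n \<epsilon> j \<in> sets M"
  unfolding window_event_def by measurable

lemma E_sets [measurable]: "E n \<in> sets M"
  unfolding E_def by measurable

text \<open>On the event, the weight \<open>hn n\<close> cancels the random part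
  \<open>exp (sp n * S n)\<close> of the tilting density; what remains is a deterministic factor
  that disappears in quotients.\<close>

lemma integral_E:
  assumes n: "0 < n" and [measurable]: "\<phi> \<in> borel_measurable M"
  shows "(\<integral>\<omega>. \<phi> \<omega> * hn n (S n \<omega> - real n * \<epsilon>) \<partial>Q n) =
     exp (sp n * (real n * \<epsilon>)) / norming TYPE('w) M Z (wt n) * (\<integral>\<omega>. indicator (E n) \<omega> * \<phi> \<omega> \<partial>M)"
proof -
  have [measurable]: "hn n \<in> borel_measurable borel" unfolding hn_def[abs_def] by measurable
  have [measurable]: "S n \<in> borel_measurable M" unfolding S_def by measurable
  have w: "lin (wt n) Z \<omega> = sp n * S n \<omega>" for \<omega>
    unfolding lin_def S_def wt_def by (simp add: mult.assoc infsum_cmult_right')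
  have "(\<integral>\<omega>. \<phi> \<omega> * hn n (S n \<omega> - real n * \<epsilon>) \<partial>Q n) =
      (\<integral>\<omega>. exp (lin (wt n) Z \<omega>) / norming TYPE('w) M Z (wt n) * (\<phi> \<omega> * hn n (S n \<omega> - real n * \<epsilon>)) \<partial>M)"
    unfolding Q_def by (rule integral_tilt_measure[OF tilt_facts]) measurable
  also have "\<dots> = (\<integral>\<omega>. exp (sp n * (real n * \<epsilon>)) / norming TYPE('w) M Z (wt n) * (indicator (E n) \<omega> * \<phi> \<omega>) \<partial>M)"
  proof (rule integral_cong_AE)
    show "AE \<omega> in M. exp (lin (wt n) Z \<omega>) / norming TYPE('w) M Z (wt n) * (\<phi> \<omega> * hn n (S n \<omega> - real n * \<epsilon>)) =
        exp (sp n * (real n * \<epsilon>)) / norming TYPE('w) M Z (wt n) * (indicator (E n) \<omega> * \<phi> \<omega>)"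
      using S_eq_M[of n] AE_space
    proof eventually_elim
      case (elim \<omega>)
      have "\<omega> \<in> E n \<longleftrightarrow> 0 \<le> S n \<omega> - real n * \<epsilon>"
        unfolding E_def window_event_pre_seq[OF n] using elim by (simp add: pre_seq_def)
      moreover have "exp (sp n * S n \<omega>) * exp (- (sp n * (S n \<omega> - real n * \<epsilon>))) = exp (sp n * (real n * \<epsilon>))"
        by (simp add: exp_add[symmetric] algebra_simps)
      ultimately show ?case by (simp add: w hn_def indicator_def)
    qed
  qed (auto simp: w)
  also have "\<dots> = exp (sp n * (real n * \<epsilon>)) / norming TYPE('w) M Z (wt n) * (\<integral>\<omega>. indicator (E n) \<omega> * \<phi> \<omega> \<partial>M)"
    by (rule integral_mult_right_zero)
  finally show ?thesis .
qed

text \<open>\<open>hn_limit\<close> for the constant function \<open>1\<close> has the positive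
  limit \<open>c1\<close>, whereas a null event would make the left-hand side vanish by
  \<open>integral_E\<close>.\<close>

lemma E_pos: "\<forall>\<^sub>F n in sequentially. 0 < measure M (E n)"
proof -
  interpret M: prob_space M by (rule M)
  have "(\<lambda>n. sqrt (real n) * (\<integral>\<omega>. 1 * hn n (S n \<omega> - real n * \<epsilon>) \<partial>Q n)) \<longlonglongrightarrow> c1 * (\<integral>\<omega>. 1 \<partial>N)"
    by (rule hn_limit[where f="\<lambda>_. 1" and Cf=1 and m=0]) (auto simp: window_dist_def)
  then have "\<forall>\<^sub>F n in sequentially. 0 < sqrt (real n) * (\<integral>\<omega>. 1 * hn n (S n \<omega> - real n * \<epsilon>) \<partial>Q n)"
    by (rule order_tendstoD) (use c1_pos N.prob_space in simp)
  then show ?thesis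
    using eventually_gt_at_top[of 0]
  proof eventually_elim
    case (elim n)
    have "measure M (E n) \<noteq> 0"
    proof
      assume "measure M (E n) = 0"
      then show False using elim by (subst (asm) integral_E) auto
    qed
    then show ?case using measure_nonneg[of M "E n"] by linarith
  qed
qed

lemma integral_cond:
  fixes \<phi> :: "'w \<Rightarrow> real"
  assumes "0 < measure M (E n)" and [measurable]: "\<phi> \<in> borel_measurable M"
  shows "(\<integral>\<omega>. \<phi> \<omega> \<partial>uniform_measure M (E n)) = (\<integral>\<omega>. indicator (E n) \<omega> * \<phi> \<omega> \<partial>M) / measure M (E n)"
proof -
  interpret M: prob_space M by (rule M)
  have "(indicator (E n) \<omega> :: ennreal) / emeasure M (E n) = ennreal (indicator (E n) \<omega> / measure M (E n))" for \<omega>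
    unfolding M.emeasure_eq_measure using assms(1) by (simp add: divide_ennreal ennreal_indicator[symmetric])
  then have "uniform_measure M (E n) = density M (\<lambda>\<omega>. ennreal (indicator (E n) \<omega> / measure M (E n)))"
    by (simp add: uniform_measure_def)
  then have "(\<integral>\<omega>. \<phi> \<omega> \<partial>uniform_measure M (E n)) = (\<integral>\<omega>. (indicator (E n) \<omega> / measure M (E n)) *\<^sub>R \<phi> \<omega> \<partial>M)"
    using assms(1) by (simp add: integral_density)
  also have "\<dots> = (\<integral>\<omega>. indicator (E n) \<omega> * \<phi> \<omega> / measure M (E n) \<partial>M)" by simp
  also have "\<dots> = (\<integral>\<omega>. indicator (E n) \<omega> * \<phi> \<omega> \<partial>M) / measure M (E n)" by (rule integral_divide_zero)
  finally show ?thesis .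
qed

lemma cond_lipschitz_limit:
  assumes fb: "\<And>x. \<bar>f x\<bar> \<le> Cf" and fl: "\<And>x y. \<bar>f x - f y\<bar> \<le> window_dist m x y"
  shows "(\<lambda>n. \<integral>\<omega>. f (pre_seq n \<omega>) \<partial>uniform_measure M (E n)) \<longlonglongrightarrow> (\<integral>\<omega>. f (lim_seq \<omega>) \<partial>N)"
proof -
  note [measurable] = borel_measurable_window_lipschitz[OF fl]
  define u v where "u n = sqrt (real n) * (\<integral>\<omega>. f (pre_seq n \<omega>) * hn n (S n \<omega> - real n * \<epsilon>) \<partial>Q n)"
    and "v n = sqrt (real n) * (\<integral>\<omega>. 1 * hn n (S n \<omega> - real n * \<epsilon>) \<partial>Q n)" for n
  have u: "u \<longlonglongrightarrow> c1 * (\<integral>\<omega>. f (lim_seq \<omega>) \<partial>N)"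
    unfolding u_def[abs_def] by (rule hn_limit[OF fb fl])
  have "v \<longlonglongrightarrow> c1 * (\<integral>\<omega>. 1 \<partial>N)"
    unfolding v_def[abs_def] by (rule hn_limit[where f="\<lambda>_. 1" and Cf=1 and m=0]) (auto simp: window_dist_def)
  then have v: "v \<longlonglongrightarrow> c1" using N.prob_space by simp
  have "(\<lambda>n. u n / v n) \<longlonglongrightarrow> c1 * (\<integral>\<omega>. f (lim_seq \<omega>) \<partial>N) / c1"
    by (rule tendsto_divide[OF u v]) (use c1_pos in simp)
  then have "(\<lambda>n. u n / v n) \<longlonglongrightarrow> (\<integral>\<omega>. f (lim_seq \<omega>) \<partial>N)" using c1_pos by simp
  moreover have "\<forall>\<^sub>F n in sequentially. u n / v n = (\<integral>\<omega>. f (pre_seq n \<omega>) \<partial>uniform_measure M (E n))"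
    using E_pos eventually_gt_at_top[of 0]
  proof eventually_elim
    case (elim n)
    \<comment> \<open>The deterministic factor shared by numerator and denominator.\<close>
    define c where "c = exp (sp n * (real n * \<epsilon>)) / norming TYPE('w) M Z (wt n)"
    have c: "c > 0" unfolding c_def using norming_pos[OF tilt_facts, of n] by simp
    have "u n = sqrt (real n) * (c * (\<integral>\<omega>. indicator (E n) \<omega> * f (pre_seq n \<omega>) \<partial>M))"
      unfolding u_def c_def by (subst integral_E) (use elim in auto)
    moreover have "v n = sqrt (real n) * (c * measure M (E n))"
      unfolding v_def c_def by (subst integral_E) (use elim in auto)
    ultimately show ?case
      using elim c by (simp add: integral_cond)
  qed
  ultimately show ?thesis by (rule Lim_transform_eventually)
qed

text \<open>Continuity is asked for only almost surely at the limit sequence. This generality is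
  what the discontinuous passage from sequences to indicators requires.\<close>

lemma cond_limit:
  fixes f :: "(int \<Rightarrow> real) \<Rightarrow> real"
  assumes f [measurable]: "f \<in> borel_measurable borel" and fb: "\<And>x. \<bar>f x\<bar> \<le> C"
    and cont: "AE \<omega> in N. isCont f (lim_seq \<omega>)"
  shows "(\<lambda>n. \<integral>\<omega>. f (pre_seq n \<omega>) \<partial>uniform_measure M (E n)) \<longlonglongrightarrow> (\<integral>\<omega>. f (lim_seq \<omega>) \<partial>N)"
proof -
  interpret M: prob_space M by (rule M)
  interpret L: prob_space "distr N borel lim_seq" by (rule N.prob_space_distr) simp
  have "(\<lambda>n. \<integral>x. f x \<partial>cond_law M (E n) (pre_seq n)) \<longlonglongrightarrow> (\<integral>x. f x \<partial>distr N borel lim_seq)"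
  proof (rule integral_tendsto_if_window_lipschitz[OF _ _ L.prob_space_axioms])
    show "\<forall>\<^sub>F n in sequentially. finite_measure (cond_law M (E n) (pre_seq n))"
      using E_pos
    proof eventually_elim
      case (elim n)
      interpret U: prob_space "uniform_measure M (E n)"
        by (rule prob_space_uniform_measure) (use elim in \<open>simp_all add: M.emeasure_eq_measure\<close>)
      show ?case unfolding cond_law_def by (rule U.finite_measure_distr) simp
    qed
    show "AE x in distr N borel lim_seq. isCont f x"
      by (rule AE_distr_iff[THEN iffD2]) (use cont in simp_all)
  next
    fix g :: "(int \<Rightarrow> real) \<Rightarrow> real" and m C
    assume g: "\<And>x. \<bar>g x\<bar> \<le> C" "\<And>x y. \<bar>g x - g y\<bar> \<le> window_dist m x y"
    note [measurable] = borel_measurable_window_lipschitz[OF g(2)]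
    show "(\<lambda>n. \<integral>x. g x \<partial>cond_law M (E n) (pre_seq n)) \<longlonglongrightarrow> (\<integral>x. g x \<partial>distr N borel lim_seq)"
      using cond_lipschitz_limit[OF g] by (simp add: cond_law_def integral_distr)
  qed (use fb in \<open>auto simp: cond_law_def\<close>)
  then show ?thesis by (simp add: cond_law_def integral_distr)
qed

end

section \<open>The indicators of the shifted events\<close>

lemma measurable_bool_borel: "Measurable.pred M P \<Longrightarrow> P \<in> borel_measurable M"
  by (rule measurable_compose[where N="count_space UNIV" and g="\<lambda>b. b"]) auto

text \<open>Each sign is locally constant away from zero, and a basic open set of sign patterns
  restricts finitely many coordinates.\<close>

lemma isCont_sign_pattern:
  fixes x :: "int \<Rightarrow> real"
  assumes x: "\<And>j. x j \<noteq> 0"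
  shows "isCont (\<lambda>y j. 0 \<le> y j) x"
  unfolding isCont_def
proof (rule topological_tendstoI)
  fix S assume S: "open S" "(\<lambda>j. 0 \<le> x j) \<in> S"
  obtain X where X: "(\<lambda>j. 0 \<le> x j) \<in> (\<Pi>\<^sub>E i\<in>UNIV. X i)" "finite {i. X i \<noteq> UNIV}" "(\<Pi>\<^sub>E i\<in>UNIV. X i) \<subseteq> S"
    using product_topology_open_contains_basis[of "\<lambda>_. euclidean" UNIV S "\<lambda>j. 0 \<le> x j"] S
    by (auto simp: open_fun_def)
  have "\<forall>\<^sub>F y in at x. (0 \<le> y i) = (0 \<le> x i)" for i
  proof -
    have c: "((\<lambda>y. y i) \<longlongrightarrow> x i) (at x)"
      using continuous_on_product_coordinates[of i] by (auto simp: continuous_on_def)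
    show ?thesis
    proof (cases "0 < x i")
      case True
      from order_tendstoD(1)[OF c this] show ?thesis by eventually_elim (use True in auto)
    next
      case False
      then have "x i < 0" using x[of i] by simp
      from order_tendstoD(2)[OF c this] show ?thesis by eventually_elim (use \<open>x i < 0\<close> in auto)
    qed
  qed
  then have "\<forall>\<^sub>F y in at x. \<forall>i\<in>{i. X i \<noteq> UNIV}. (0 \<le> y i) = (0 \<le> x i)"
    by (intro eventually_ball_finite X) auto
  then show "\<forall>\<^sub>F y in at x. (\<lambda>j. 0 \<le> y j) \<in> S"
  proof eventually_elim
    case (elim y)
    have "(0 \<le> y i) \<in> X i" for i
      using elim X(1) by (cases "X i = UNIV") (auto simp: PiE_def Pi_def)
    then have "(\<lambda>j. 0 \<le> y j) \<in> (\<Pi>\<^sub>E i\<in>UNIV. X i)" by auto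
    then show ?case using X(3) by blast
  qed
qed

lemma continuous_on_window_sum: "continuous_on UNIV (\<lambda>x :: int \<Rightarrow> bool. \<Sum>j\<in>J. of_bool (x j) :: nat)"
proof -
  have "continuous_on UNIV (\<lambda>x :: int \<Rightarrow> bool. of_bool (x j) :: nat)" for j
    by (rule continuous_on_compose2[OF Topological_Spaces.continuous_on_discrete continuous_on_product_coordinates]) auto
  then show ?thesis by (intro continuous_on_sum) auto
qed

context moving_avg_limit
begin

abbreviation ind_seq :: "nat \<Rightarrow> 'w \<Rightarrow> int \<Rightarrow> bool" where
  "ind_seq n \<omega> \<equiv> (\<lambda>j. \<omega> \<in> window_event M (moving_average a Z) n \<epsilon> j)"

abbreviation lim_ind :: "'v \<Rightarrow> int \<Rightarrow> bool" where
  "lim_ind \<equiv> limit_indicator T (\<lambda>u. moving_average a (W u))"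

lemma ind_seq_measurable [measurable]: "ind_seq n \<in> borel_measurable M"
  by (intro measurable_coordinatewise_then_product measurable_bool_borel) measurable

lemma lim_ind_measurable [measurable]: "lim_ind \<in> borel_measurable N"
proof (intro measurable_coordinatewise_then_product measurable_bool_borel)
  show "Measurable.pred N (\<lambda>\<omega>. lim_ind \<omega> j)" for j
    unfolding limit_indicator_def by (cases "1 \<le> j"; cases "j < 0") simp_all
qed

lemma T_nonneg: "AE \<omega> in N. 0 \<le> T \<omega>"
proof (rule AE_distrD[of T N borel])
  show "AE t in distr N borel T. 0 \<le> t"
    unfolding T_density by (subst AE_density) (auto simp: exponential_density_def)
qed simp

lemma lim_seq_nonzero: "AE \<omega> in N. \<forall>j. lim_seq \<omega> j \<noteq> 0"
proof (subst AE_all_countable, intro allI)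
  fix j
  define X where "X = (\<lambda>k. case k of None \<Rightarrow> T | Some (u, j) \<Rightarrow> W u j)"
  \<comment> \<open>The drift: the limit sequence with the overshoot set to \<open>0\<close>, hence
    a function of the \<open>W\<close> variables only.\<close>
  define Y where "Y = (\<lambda>\<omega>. limit_seq (\<lambda>_. 0) (\<lambda>u. moving_average a (W u)) \<omega> j)"
  define \<phi> where "\<phi> = (\<lambda>x :: (side \<times> int) option \<Rightarrow> real. limit_seq (\<lambda>_. 0) (\<lambda>u. moving_average a (\<lambda>k x. x (Some (u, k)))) x j)"
  have "(\<lambda>x. x (Some (u, k))) \<in> borel_measurable (PiM (- {None}) (\<lambda>_. borel :: real measure))" for u :: side and k :: int
    by (rule measurable_component_singleton) simp
  then have \<phi>: "\<phi> \<in> borel_measurable (PiM (- (\<lambda>_. None) ` {()}) (\<lambda>_. borel))"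
    unfolding \<phi>_def limit_seq_def lin_moving_average
    by (cases "j < 0") (auto intro!: borel_measurable_add borel_measurable_diff borel_measurable_sum lin_measurable)
  have Y [measurable]: "Y \<in> borel_measurable N"
    unfolding Y_def limit_seq_def by (cases "j < 0") simp_all
  \<comment> \<open>\<open>T\<close> is taken as a one-point block and the drift as the
    remainder.\<close>
  have joint: "distr N (PiM {()} (\<lambda>_. borel) \<Otimes>\<^sub>M borel) (\<lambda>\<omega>. (\<lambda>p\<in>{()}. X ((\<lambda>_. None) p) \<omega>, Y \<omega>)) =
      PiM {()} (\<lambda>p. distr N borel (X ((\<lambda>_. None) p))) \<Otimes>\<^sub>M distr N borel Y"
  proof (rule N.distr_block_rest[OF _ _ _ \<phi>])
    show "N.indep_vars (\<lambda>_. borel) X UNIV" unfolding X_def by (rule WT_indep)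
    show "Y \<omega> = \<phi> (restrict (\<lambda>k. X k \<omega>) (- (\<lambda>_. None) ` {()}))" for \<omega>
      by (simp add: Y_def \<phi>_def X_def limit_seq_def moving_average_def)
  qed auto
  have XN: "X None = T" by (simp add: X_def)
  interpret DT: prob_space "distr N borel T" by (rule N.prob_space_distr) simp
  interpret DY: prob_space "distr N borel Y" by (rule N.prob_space_distr) simp
  interpret P: product_prob_space "\<lambda>_ :: unit. distr N borel T" "{()}" by standard
  interpret PP: pair_prob_space "PiM {()} (\<lambda>_ :: unit. distr N borel T)" "distr N borel Y" by standard
  have c: "(\<lambda>x. x ()) \<in> borel_measurable (PiM {()} (\<lambda>_ :: unit. distr N borel T))"
    using measurable_component_singleton[of "()" "{()}" "\<lambda>_. distr N borel T"] by simp
  have "(\<lambda>p. fst p () + snd p) \<in> borel_measurable (PiM {()} (\<lambda>_ :: unit. distr N borel T) \<Otimes>\<^sub>M distr N borel Y)"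
    by (intro borel_measurable_add measurable_compose[OF measurable_fst c] measurable_compose[OF measurable_snd]) simp
  then have pm: "{p \<in> space (PiM {()} (\<lambda>_ :: unit. distr N borel T) \<Otimes>\<^sub>M distr N borel Y). fst p () + snd p \<noteq> 0} \<in>
      sets (PiM {()} (\<lambda>_ :: unit. distr N borel T) \<Otimes>\<^sub>M distr N borel Y)"
    using borel_measurable_neq[OF _ borel_measurable_const] by blast
  have "AE t in distr N borel T. t \<noteq> - y" for y
    unfolding T_density using AE_lborel_singleton[of "- y"] by (subst AE_density) auto
  then have "AE x in PiM {()} (\<lambda>_ :: unit. distr N borel T). x () \<noteq> - y" for y
    by (intro AE_PiM_component) (auto intro: DT.prob_space_axioms)
  then have "AE x in PiM {()} (\<lambda>_ :: unit. distr N borel T). x () + y \<noteq> 0" for y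
    by (simp add: add_eq_0_iff2)
  then have "AE y in distr N borel Y. AE x in PiM {()} (\<lambda>_ :: unit. distr N borel T). x () + y \<noteq> 0" by simp
  \<comment> \<open>The absence of atoms of \<open>T\<close> gives the statement for fixed drift;
    the quantifiers are exchanged to have the first component outermost, as the product measure
    demands.\<close>
  then have "AE x in PiM {()} (\<lambda>_ :: unit. distr N borel T). AE y in distr N borel Y. x () + y \<noteq> 0"
    by (rule PP.AE_commute[THEN iffD2, rotated]) (rule pm)
  then have "AE p in PiM {()} (\<lambda>_ :: unit. distr N borel T) \<Otimes>\<^sub>M distr N borel Y. fst p () + snd p \<noteq> 0"
    by (intro PP.AE_pair_measure pm) simp
  then have ae: "AE p in distr N (PiM {()} (\<lambda>_. borel) \<Otimes>\<^sub>M borel) (\<lambda>\<omega>. (\<lambda>p\<in>{()}. T \<omega>, Y \<omega>)). fst p () + snd p \<noteq> 0"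
    unfolding joint[unfolded XN] .
  have m: "(\<lambda>\<omega>. (\<lambda>p\<in>{()}. T \<omega>, Y \<omega>)) \<in> N \<rightarrow>\<^sub>M PiM {()} (\<lambda>_. borel) \<Otimes>\<^sub>M borel"
    by (intro measurable_Pair measurable_restrict Y WT_measurable)
  from AE_distrD[OF m ae] show "AE \<omega> in N. lim_seq \<omega> j \<noteq> 0"
    by eventually_elim (auto simp: Y_def limit_seq_def)
qed

text \<open>For \<open>j = 0\<close> the indicator is true by definition, while the sequence takes
  the value \<open>T\<close>; nonnegativity of \<open>T\<close> is needed there. For other
  \<open>j\<close> the inequalities are rearrangements of each other.\<close>

lemma lim_ind_eq: "AE \<omega> in N. lim_ind \<omega> = (\<lambda>j. 0 \<le> lim_seq \<omega> j)"
  using T_nonneg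
proof eventually_elim
  case (elim \<omega>)
  show ?case
  proof
    fix j :: int
    consider "j = 0" | "j \<ge> 1" | "j < 0" by linarith
    then show "lim_ind \<omega> j = (0 \<le> lim_seq \<omega> j)"
      by cases (use elim in \<open>auto simp: limit_indicator_def limit_seq_def sum_subtractf\<close>)
  qed
qed

text \<open>The continuous mapping theorem for the sign pattern \<open>h\<close>, which is
  continuous at almost every limit sequence because no coordinate vanishes.\<close>

lemma ind_limit:
  fixes f :: "(int \<Rightarrow> bool) \<Rightarrow> real"
  assumes f: "continuous_on UNIV f" "bounded (range f)"
  shows "(\<lambda>n. \<integral>\<omega>. f (ind_seq n \<omega>) \<partial>uniform_measure M (E n)) \<longlonglongrightarrow> (\<integral>\<omega>. f (lim_ind \<omega>) \<partial>N)"
proof -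
  define h where "h = (\<lambda>(x :: int \<Rightarrow> real) j. 0 \<le> x j)"
  have hm [measurable]: "h \<in> borel_measurable borel"
    unfolding h_def by (intro measurable_coordinatewise_then_product measurable_bool_borel) measurable
  have fm [measurable]: "f \<in> borel_measurable borel" by (rule borel_measurable_continuous_onI[OF f(1)])
  obtain C where C: "\<And>x. \<bar>f x\<bar> \<le> C" using f(2) by (auto simp: bounded_iff)
  have "(\<lambda>n. \<integral>\<omega>. f (h (pre_seq n \<omega>)) \<partial>uniform_measure M (E n)) \<longlonglongrightarrow> (\<integral>\<omega>. f (h (lim_seq \<omega>)) \<partial>N)"
  proof (rule cond_limit)
    show "AE \<omega> in N. isCont (\<lambda>x. f (h x)) (lim_seq \<omega>)"
      using lim_seq_nonzero
    proof eventually_elim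
      case (elim \<omega>)
      have "isCont h (lim_seq \<omega>)" unfolding h_def by (rule isCont_sign_pattern) (use elim in auto)
      then show ?case unfolding isCont_def by (intro continuous_on_tendsto_compose[OF f(1)]) auto
    qed
  qed (use C in auto)
  moreover have "\<forall>\<^sub>F n in sequentially. (\<integral>\<omega>. f (h (pre_seq n \<omega>)) \<partial>uniform_measure M (E n)) = (\<integral>\<omega>. f (ind_seq n \<omega>) \<partial>uniform_measure M (E n))"
    using eventually_gt_at_top[of 0]
  proof eventually_elim
    case (elim n)
    show ?case
      by (intro Bochner_Integration.integral_cong refl arg_cong[where f=f])
        (auto simp: h_def window_event_pre_seq[OF elim])
  qed
  moreover have "(\<integral>\<omega>. f (h (lim_seq \<omega>)) \<partial>N) = (\<integral>\<omega>. f (lim_ind \<omega>) \<partial>N)"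
  proof (rule integral_cong_AE)
    show "AE \<omega> in N. f (h (lim_seq \<omega>)) = f (lim_ind \<omega>)"
      using lim_ind_eq by eventually_elim (simp add: h_def)
  qed measurable
  ultimately show ?thesis using Lim_transform_eventually by force
qed

lemma weak_conv_cond_law:
  fixes Y :: "nat \<Rightarrow> 'w \<Rightarrow> 'b::topological_space"
  assumes "\<And>n. Y n \<in> borel_measurable M" "Y' \<in> borel_measurable N"
    and lim: "\<And>f :: 'b \<Rightarrow> real. continuous_on UNIV f \<Longrightarrow> bounded (range f) \<Longrightarrow>
      (\<lambda>n. \<integral>\<omega>. f (Y n \<omega>) \<partial>uniform_measure M (E n)) \<longlonglongrightarrow> (\<integral>\<omega>. f (Y' \<omega>) \<partial>N)"
  shows "weak_conv_measure (\<lambda>n. cond_law M (window_event M (moving_average a Z) n \<epsilon> 0) (Y n)) (distr N borel Y')"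
  unfolding weak_conv_measure_def cond_law_def E_def[symmetric]
proof (intro allI impI)
  fix f :: "'b \<Rightarrow> real" assume f: "continuous_on UNIV f" "bounded (range f)"
  have fm: "f \<in> borel_measurable borel" by (rule borel_measurable_continuous_onI[OF f(1)])
  have "Y n \<in> borel_measurable (uniform_measure M (E n))" for n
    using assms(1)[of n] by (simp cong: measurable_cong_sets)
  then show "(\<lambda>n. \<integral>x. f x \<partial>distr (uniform_measure M (E n)) borel (Y n)) \<longlonglongrightarrow> (\<integral>x. f x \<partial>distr N borel Y')"
    using lim[OF f] by (simp add: integral_distr fm assms(2))
qed

theorem conditional_limits:
  "weak_conv_measure (\<lambda>n. cond_law M (window_event M (moving_average a Z) n \<epsilon> 0) (pre_seq n)) (distr N borel lim_seq)"
  "weak_conv_measure (\<lambda>n. cond_law M (window_event M (moving_average a Z) n \<epsilon> 0) (ind_seq n)) (distr N borel lim_ind)"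
  "weak_conv_measure
     (\<lambda>n. cond_law M (window_event M (moving_average a Z) n \<epsilon> 0)
        (\<lambda>\<omega>. (\<Sum>j\<in>J. of_bool (ind_seq n \<omega> j) :: nat, \<Sum>j\<in>J'. of_bool (ind_seq n \<omega> j) :: nat)))
     (distr N borel (\<lambda>\<omega>. (\<Sum>j\<in>J. of_bool (lim_ind \<omega> j) :: nat, \<Sum>j\<in>J'. of_bool (lim_ind \<omega> j) :: nat)))"
proof -
  show "weak_conv_measure (\<lambda>n. cond_law M (window_event M (moving_average a Z) n \<epsilon> 0) (pre_seq n)) (distr N borel lim_seq)"
  proof (rule weak_conv_cond_law)
    fix f :: "(int \<Rightarrow> real) \<Rightarrow> real" assume f: "continuous_on UNIV f" "bounded (range f)"
    obtain C where C: "\<And>x. \<bar>f x\<bar> \<le> C" using f(2) by (auto simp: bounded_iff)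
    show "(\<lambda>n. \<integral>\<omega>. f (pre_seq n \<omega>) \<partial>uniform_measure M (E n)) \<longlonglongrightarrow> (\<integral>\<omega>. f (lim_seq \<omega>) \<partial>N)"
      by (rule cond_limit[OF borel_measurable_continuous_onI[OF f(1)] C]) (use f(1) in \<open>simp add: continuous_on_eq_continuous_at\<close>)
  qed measurable
  show "weak_conv_measure (\<lambda>n. cond_law M (window_event M (moving_average a Z) n \<epsilon> 0) (ind_seq n)) (distr N borel lim_ind)"
    by (rule weak_conv_cond_law[OF ind_seq_measurable lim_ind_measurable ind_limit])
  \<comment> \<open>The pair of counts is a continuous image of the indicator sequence, so the third
    claim also reduces to \<open>ind_limit\<close>.\<close>
  define \<psi> where "\<psi> = (\<lambda>x :: int \<Rightarrow> bool. (\<Sum>j\<in>J. of_bool (x j) :: nat, \<Sum>j\<in>J'. of_bool (x j) :: nat))"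
  have c: "continuous_on UNIV \<psi>"
    unfolding \<psi>_def by (intro continuous_on_Pair continuous_on_window_sum)
  have [measurable]: "\<psi> \<in> borel_measurable borel" by (rule borel_measurable_continuous_onI[OF c])
  have "weak_conv_measure (\<lambda>n. cond_law M (window_event M (moving_average a Z) n \<epsilon> 0) (\<lambda>\<omega>. \<psi> (ind_seq n \<omega>))) (distr N borel (\<lambda>\<omega>. \<psi> (lim_ind \<omega>)))"
  proof (rule weak_conv_cond_law)
    fix f :: "nat \<times> nat \<Rightarrow> real" assume f: "continuous_on UNIV f" "bounded (range f)"
    show "(\<lambda>n. \<integral>\<omega>. f (\<psi> (ind_seq n \<omega>)) \<partial>uniform_measure M (E n)) \<longlonglongrightarrow> (\<integral>\<omega>. f (\<psi> (lim_ind \<omega>)) \<partial>N)"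
    proof (rule ind_limit)
      show "continuous_on UNIV (\<lambda>x. f (\<psi> x))" by (rule continuous_on_compose2[OF f(1) c]) simp
      show "bounded (range (\<lambda>x. f (\<psi> x)))" by (rule bounded_subset[OF f(2)]) auto
    qed
  qed measurable
  then show "weak_conv_measure
     (\<lambda>n. cond_law M (window_event M (moving_average a Z) n \<epsilon> 0)
        (\<lambda>\<omega>. (\<Sum>j\<in>J. of_bool (ind_seq n \<omega> j) :: nat, \<Sum>j\<in>J'. of_bool (ind_seq n \<omega> j) :: nat)))
     (distr N borel (\<lambda>\<omega>. (\<Sum>j\<in>J. of_bool (lim_ind \<omega> j) :: nat, \<Sum>j\<in>J'. of_bool (lim_ind \<omega> j) :: nat)))"
    unfolding \<psi>_def .
qed

end

section \<open>Identification of the limiting tilts\<close>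

lemma infsum_Un_finite:
  fixes a :: "int \<Rightarrow> real"
  assumes a: "(\<lambda>n. \<bar>a n\<bar>) summable_on UNIV" and J: "finite J" "J \<inter> B = {}"
  shows "infsum a (J \<union> B) = sum a J + infsum a B"
proof -
  have "a summable_on B" for B
    by (rule abs_summable_imp_summable[OF summable_on_subset_banach[OF a]]) simp
  then show ?thesis using infsum_Un_disjoint[of a J B] J by simp
qed

text \<open>The four tilts of the limiting families are half-line sums of the coefficients, each
  obtained by moving a finite stretch across \<open>0\<close>. The condition \<open>1 <= j\<close>
  protects the natural number subtraction \<open>j - 1\<close>.\<close>

lemma edge_sums:
  assumes a: "(\<lambda>n. \<bar>a n\<bar>) summable_on UNIV"
  shows "1 \<le> j \<Longrightarrow> coef_sum_nonneg a - coef_partial_nonneg a (j - 1) = infsum a {int j..}"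
    and "coef_sum_nonneg a + coef_partial_neg a j = infsum a {- int j..}"
    and "1 \<le> j \<Longrightarrow> coef_partial_nonneg a (j - 1) + coef_sum_neg a = infsum a {..int j - 1}"
    and "coef_sum_neg a - coef_partial_neg a j = infsum a {..-1 - int j}"
proof -
  have pos: "coef_partial_nonneg a (j - 1) = sum a {0..int j - 1}" if "1 \<le> j"
    unfolding coef_partial_nonneg_def
    by (rule sum.reindex_bij_witness[of _ nat int]) (use that in auto)
  have neg: "coef_partial_neg a j = sum a {- int j..-1}"
    unfolding coef_partial_neg_def
    by (rule sum.reindex_bij_witness[of _ "\<lambda>i. nat (- i)" "\<lambda>i. - int i"]) auto
  {
    assume j: "1 \<le> j"
    have "{0..} = {0..int j - 1} \<union> {int j..}" "{..int j - 1} = {0..int j - 1} \<union> {..-1}" using j by auto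
    then show "coef_sum_nonneg a - coef_partial_nonneg a (j - 1) = infsum a {int j..}"
      and "coef_partial_nonneg a (j - 1) + coef_sum_neg a = infsum a {..int j - 1}"
      unfolding pos[OF j] coef_sum_nonneg_def coef_sum_neg_def
      using infsum_Un_finite[OF a, of "{0..int j - 1}" "{int j..}"] infsum_Un_finite[OF a, of "{0..int j - 1}" "{..-1}"] by auto
  }
  have "{- int j..} = {- int j..-1} \<union> {0..}" "{..-1} = {- int j..-1} \<union> {..-1 - int j}" by auto
  then show "coef_sum_nonneg a + coef_partial_neg a j = infsum a {- int j..}"
    and "coef_sum_neg a - coef_partial_neg a j = infsum a {..-1 - int j}"
    unfolding neg coef_sum_nonneg_def coef_sum_neg_def
    using infsum_Un_finite[OF a, of "{- int j..-1}" "{0..}"] infsum_Un_finite[OF a, of "{- int j..-1}" "{..-1 - int j}"] by auto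
qed

theorem theorem1:
  fixes F :: "real measure" and a :: "int \<Rightarrow> real" and \<epsilon> \<tau> A :: real
    and M :: "'w measure" and Z :: "int \<Rightarrow> 'w \<Rightarrow> real"
    and N :: "'v measure" and W :: "side \<Rightarrow> int \<Rightarrow> 'v \<Rightarrow> real" and T :: "'v \<Rightarrow> real"
  assumes F: "real_distribution F"
    and F_nondegenerate: "\<not> (\<exists>c. AE z in F. z = c)"
    and F_exp_moments: "\<And>t. integrable F (\<lambda>z. exp (t * z))"
    and F_mean: "(\<integral>z. z \<partial>F) = 0"
    and F_char: "\<And>t. t \<noteq> 0 \<Longrightarrow> cmod (char F t) < 1"
    and M: "prob_space M"
    and Z_indep: "prob_space.indep_vars M (\<lambda>_. borel) Z UNIV"
    and Z_law: "\<And>n. distr M borel (Z n) = F"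
    and a_square_summable: "(\<lambda>n. (a n)\<^sup>2) summable_on UNIV"
    and a_short_memory: "short_memory a"
    and A_def: "A = coef_sum a"
    and A_pos: "A > 0"
    and \<epsilon>: "0 < \<epsilon> / A" "ereal (\<epsilon> / A) < right_endpoint F"
    and \<tau>_def: "\<tau> = tilt_param F (\<epsilon> / A)"
    and N: "prob_space N"
    and W_T_indep: "prob_space.indep_vars N (\<lambda>_. borel)
          (\<lambda>k. case k of None \<Rightarrow> T | Some (u, j) \<Rightarrow> W u j) UNIV"
    and W_Minus_neg: "\<And>j::nat. j \<ge> 1 \<Longrightarrow> distr N borel (W Minus (- int j)) =
          tilted_law F (\<tau> * (coef_sum_nonneg a - coef_partial_nonneg a (j - 1)) / A)"
    and W_Minus_nonneg: "\<And>j::nat. distr N borel (W Minus (int j)) =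
          tilted_law F (\<tau> * (coef_sum_nonneg a + coef_partial_neg a j) / A)"
    and W_Plus_neg: "\<And>j::nat. j \<ge> 1 \<Longrightarrow> distr N borel (W Plus (- int j)) =
          tilted_law F (\<tau> * (coef_partial_nonneg a (j - 1) + coef_sum_neg a) / A)"
    and W_Plus_nonneg: "\<And>j::nat. distr N borel (W Plus (int j)) =
          tilted_law F (\<tau> * (coef_sum_neg a - coef_partial_neg a j) / A)"
    and T_law: "distributed N lborel T (exponential_density (\<tau> / A))"
  shows
    "weak_conv_measure
       (\<lambda>n. cond_law M (window_event M (moving_average a Z) n \<epsilon> 0)
          (\<lambda>\<omega> j. (\<Sum>i=j..j + int n - 1. moving_average a Z i \<omega>) - real n * \<epsilon>))
       (distr N borel (limit_seq T (\<lambda>u. moving_average a (W u))))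
     \<and>
     weak_conv_measure
       (\<lambda>n. cond_law M (window_event M (moving_average a Z) n \<epsilon> 0)
          (\<lambda>\<omega> j. \<omega> \<in> window_event M (moving_average a Z) n \<epsilon> j))
       (distr N borel (limit_indicator T (\<lambda>u. moving_average a (W u))))
     \<and>
     (\<forall>Km Kp :: int. Km \<ge> 1 \<longrightarrow> Kp \<ge> 1 \<longrightarrow>
       weak_conv_measure
         (\<lambda>n. cond_law M (window_event M (moving_average a Z) n \<epsilon> 0)
            (\<lambda>\<omega>. (\<Sum>j=-Km..-1. of_bool (\<omega> \<in> window_event M (moving_average a Z) n \<epsilon> j) :: nat,
                  \<Sum>j=1..Kp. of_bool (\<omega> \<in> window_event M (moving_average a Z) n \<epsilon> j) :: nat)))
         (distr N borel
            (\<lambda>\<omega>. (\<Sum>j=-Km..-1. of_bool (limit_indicator T (\<lambda>u. moving_average a (W u)) \<omega> j) :: nat,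
                  \<Sum>j=1..Kp. of_bool (limit_indicator T (\<lambda>u. moving_average a (W u)) \<omega> j) :: nat))))"
proof -
  interpret F: real_distribution F by (rule F)
  interpret tiltable F
    by unfold_locales (use F_exp_moments F_mean F_nondegenerate F_char in auto)
  have a: "(\<lambda>m. \<bar>a m\<bar>) summable_on UNIV" using a_short_memory by (simp add: short_memory_def)
  define edge where "edge u k = (case u of Minus \<Rightarrow> infsum a {-k..} | Plus \<Rightarrow> infsum a {..-1-k})" for u and k :: int
  \<comment> \<open>Written as half-line sums, the laws for negative and nonnegative positions
    follow a single formula on each side.\<close>
  have W_law: "distr N borel (W u k) = G (\<tau> / A * edge u k)" for u k
  proof (cases "0 \<le> k")
    case True
    define j where "j = nat k"
    then have k: "k = int j" using True by simp
    show ?thesis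
      unfolding k using W_Minus_nonneg[of j] W_Plus_nonneg[of j] by (cases u) (simp_all add: edge_def edge_sums[OF a])
  next
    case False
    define j where "j = nat (- k)"
    then have k: "k = - int j" "1 \<le> j" using False by simp_all
    show ?thesis
      unfolding k(1) using W_Minus_neg[OF k(2), unfolded edge_sums(1)[OF a k(2)]] W_Plus_neg[OF k(2), unfolded edge_sums(3)[OF a k(2)]]
      by (cases u) (simp_all add: edge_def)
  qed
  have \<tau>: "0 < \<tau>" "mean \<tau> = \<epsilon> / A" using tilt_param[OF \<epsilon>] unfolding \<tau>_def by auto
  interpret moving_avg F a A \<epsilon> \<tau> M Z
    by (intro moving_avg.intro moving_avg_axioms.intro tiltable_axioms M Z_indep Z_law a A_def[unfolded coef_sum_def] A_pos \<tau>)
  interpret moving_avg_limit F a A \<epsilon> \<tau> M Z N W T edge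
    by (intro moving_avg_limit.intro moving_avg_limit_axioms.intro moving_avg_axioms N W_T_indep edge_def
      W_law[folded \<theta>_def] T_law[folded \<theta>_def])
  show ?thesis
    by (intro conjI allI impI conditional_limits(1)[unfolded pre_seq_def[abs_def]] conditional_limits(2,3))
qed

end
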